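(* Let $\mu$ be a stochastic measure on the Borel $\sigma$-algebra $\mathcal{B}((0,1])$, let $a>0$, and assume: (A1) $u_0(y)=u_0(y,\omega):\mathbb{R}\times\Omega\to\mathbb{R}$ and $v_0(y)=v_0(y,\omega):\mathbb{R}\times\Omega\to\mathbb{R}$ are measurable, and are bounded (in $y$) for every fixed $\omega\in\Omega$; (A2) $f(s,y,v):[0,1]\times\mathbb{R}\times\mathbb{R}\to\mathbb{R}$ is measurable and bounded; (A3) there is a constant $L_f$ such that $|f(s,y_1,v_1)-f(s,y_2,v_2)|\le L_f(|y_1-y_2|+|v_1-v_2|)$ for all $s\in[0,1]$, $y_1,y_2,v_1,v_2\in\mathbb{R}$; (A4) $\sigma(s,y):[0,1]\times\mathbb{R}\to\mathbb{R}$ is measurable and bounded; (A5) there are constants $L_\sigma$ and $\beta(\sigma)$ with $1/2<\beta(\sigma)\le 1$ such that $|\sigma(s_1,y_1)-\sigma(s_2,y_2)|\le L_\sigma\big(|s_1-s_2|^{\beta(\sigma)}+|y_1-y_2|^{\beta(\sigma)}\big)$ for all $s_1,s_2\in[0,1]$, $y_1,y_2\in\mathbb{R}$; (A6) for some finite random constant $C_\mu(\omega)$, $|\mu((0,t])|\le C_\mu(\omega)$ for all $t\in(0,1]$. Assume moreover that every $h\in L_2((0,1])$ is integrable with respect to $\mu$, and that $$\text{if }\int_{(0,1]}|h_j(x)|^2\,dx\to 0,\ j\to\infty,\quad\text{then}\quad \int_{(0,1]}h_j(x)\,d\mu(x)\to 0\ \text{ in probability},\ j\to\infty .$$ Let $u$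 be the solution of $$u(t,x)=\frac12\big(u_0(x+at)+u_0(x-at)\big)+\frac1{2a}\int_{x-at}^{x+at}v_0(y)\,dy+\frac1{2a}\int_0^t ds\int_{x-a(t-s)}^{x+a(t-s)}f(s,y,u(s,y))\,dy+\frac1{2a}\int_{(0,t]}d\mu(s)\int_{x-a(t-s)}^{x+a(t-s)}\sigma(s,y)\,dy,$$ and, for $j\in\mathbb{Z}_+$, let $u_j$ be the solution of $$u_j(t,x)=\frac12\big(u_0(x+at)+u_0(x-at)\big)+\frac1{2a}\int_{x-at}^{x+at}v_0(y)\,dy+\frac1{2a}\int_0^t ds\int_{x-a(t-s)}^{x+a(t-s)}f(s,y,u_j(s,y))\,dy+\frac1{2a}\int_{(0,t]}S_j(s)\,ds\int_{x-a(t-s)}^{x+a(t-s)}\sigma(s,y)\,dy,$$ where $(t,x)\in[0,1]\times\mathbb{R}$ and $S_j$ is the $j$-th partial sum of the Fourier series of $\mu$. Then $u$ and $u_j$ have versions such that for every $0<\delta<1$ $$\sup_{x\in\mathbb{R},\,t\in[0,1-\delta]}|u_j(t,x)-u(t,x)|\to 0\quad\text{in probability},\quad j\to\infty .$$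
   Context: $(\Omega,\mathcal{F},\mathsf{P})$ is a complete probability space and $\mathsf{L}_0=\mathsf{L}_0(\Omega,\mathcal{F},\mathsf{P})$ is the set of (equivalence classes of) real random variables, with convergence in probability. A stochastic measure on a $\sigma$-algebra $\mathcal{B}$ is a $\sigma$-additive mapping $\mu:\mathcal{B}\to\mathsf{L}_0$ (for disjoint $A_n\in\mathcal{B}$, $\mu(\bigcup_n A_n)=\sum_n\mu(A_n)$ with convergence in probability); neither positivity nor existence of moments is assumed. Integral: for a simple deterministic function $g=\sum_k c_k\mathbf{1}_{A_k}$ (finite sum), $\int_A g\,d\mu=\sum_k c_k\mu(A\cap A_k)$. A deterministic measurable function $g$ is integrable with respect to $\mu$ if there are simple functions $g_n\to g$ pointwise such that for each $A\in\mathcal{B}$ the sequence $\int_A g_n\,d\mu$ converges in probability; the limit is $\int_A g\,d\mu$. Every bounded measurable function is integrable with respect to any stochastic measure. In (A6), representatives of the random variables $\mu((0,t])$, $t\in(0,1]$, are fixed so that the bound holds for all $t$ simultaneously. Fourier series of $\mu$: for $k\in\mathbb{Z}$ put $\xi_k=\int_{(0,1]}\exp\{-2\pi ikt\}\,d\mu(t):=\int_{(0,1]}\cos(2\pi kt)\,d\mu(t)-i\int_{(0,1]}\sin(2\pi kt)\,d\mu(t)$. The partial sums are $S_j(t)=\sum_{|k|\le j}\xi_k\exp\{2\pi ikt\}$, $j\in\mathbb{Z}_+$, $t\in[0,1]$. The equation for $u$ is the mild form of the Cauchy problem $\partial_t^2u=a^2\partial_x^2u+f(t,x,u)+\sigma(t,x)\dot\mu(t)$,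 $u(0,x)=u_0(x)$, $\partial_tu(0,x)=v_0(x)$. A solution is a measurable random function $u(t,x)=u(t,x,\omega)$ satisfying the equation a.s. for each $(t,x)\in[0,1]\times\mathbb{R}$. Integrals of random functions with respect to $dx,dy,ds$ are taken for each fixed $\omega$. Under (A1)–(A5) the equation for $u$ has a unique solution (up to versions), by a known result; in the equation for $u_j$ all integrals are pathwise Lebesgue integrals. A version of a random function $w(t,x)$ is a random function $\tilde w(t,x)$ with $\mathsf{P}(\tilde w(t,x)=w(t,x))=1$ for each $(t,x)$. *)

theory Defs
  imports "HOL-Probability.Probability"
begin

text \<open>
  Elements of \<open>L\<^sub>0\<close> are represented by measurable functions on \<open>\<Omega>\<close>, and equality in \<open>L\<^sub>0\<close>
  by almost sure equality.

  \<^const>\<open>measure\<close> is \<open>0\<close> on non-measurable sets, so convergence in probability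
  includes the measurability of the functions involved. Values in \<^typ>\<open>ennreal\<close> are needed
  because the supremum of a random function over an unbounded region may be infinite.
\<close>

definition null_in_prob :: "'w measure \<Rightarrow> (nat \<Rightarrow> 'w \<Rightarrow> ennreal) \<Rightarrow> bool" where
  "null_in_prob M X \<longleftrightarrow>
     (\<forall>n. X n \<in> borel_measurable M) \<and>
     (\<forall>\<epsilon>>0. (\<lambda>n. measure M {\<omega> \<in> space M. ennreal \<epsilon> < X n \<omega>}) \<longlonglongrightarrow> 0)"

definition tendsto_in_prob :: "'w measure \<Rightarrow> (nat \<Rightarrow> 'w \<Rightarrow> real) \<Rightarrow> ('w \<Rightarrow> real) \<Rightarrow> bool" where
  "tendsto_in_prob M X Y \<longleftrightarrow>
     (\<forall>n. X n \<in> borel_measurable M) \<and> Y \<in> borel_measurable M \<and>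
     null_in_prob M (\<lambda>n \<omega>. ennreal \<bar>X n \<omega> - Y \<omega>\<bar>)"

text \<open>Of the measure space \<open>N\<close> below only the underlying \<open>\<sigma>\<close>-algebra is used.\<close>

definition stochastic_measure :: "'w measure \<Rightarrow> 'a measure \<Rightarrow> ('a set \<Rightarrow> 'w \<Rightarrow> real) \<Rightarrow> bool" where
  "stochastic_measure M N \<mu> \<longleftrightarrow>
     (\<forall>A\<in>sets N. \<mu> A \<in> borel_measurable M) \<and>
     (\<forall>A :: nat \<Rightarrow> 'a set. range A \<subseteq> sets N \<longrightarrow> disjoint_family A \<longrightarrow>
        tendsto_in_prob M (\<lambda>n \<omega>. \<Sum>i<n. \<mu> (A i) \<omega>) (\<mu> (\<Union>i. A i)))"

definition sm_simple_integral ::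
    "'a measure \<Rightarrow> ('a set \<Rightarrow> 'w \<Rightarrow> real) \<Rightarrow> 'a set \<Rightarrow> ('a \<Rightarrow> real) \<Rightarrow> 'w \<Rightarrow> real" where
  "sm_simple_integral N \<mu> A g \<omega> =
     (\<Sum>c \<in> g ` space N. c * \<mu> (A \<inter> (g -` {c} \<inter> space N)) \<omega>)"

definition sm_approx ::
    "'w measure \<Rightarrow> 'a measure \<Rightarrow> ('a set \<Rightarrow> 'w \<Rightarrow> real) \<Rightarrow> ('a \<Rightarrow> real) \<Rightarrow> (nat \<Rightarrow> 'a \<Rightarrow> real) \<Rightarrow> bool" where
  "sm_approx M N \<mu> g G \<longleftrightarrow>
     (\<forall>n. simple_function N (G n)) \<and>
     (\<forall>x\<in>space N. (\<lambda>n. G n x) \<longlonglongrightarrow> g x) \<and>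
     (\<forall>A\<in>sets N. \<exists>Y. tendsto_in_prob M (\<lambda>n. sm_simple_integral N \<mu> A (G n)) Y)"

definition sm_integrable ::
    "'w measure \<Rightarrow> 'a measure \<Rightarrow> ('a set \<Rightarrow> 'w \<Rightarrow> real) \<Rightarrow> ('a \<Rightarrow> real) \<Rightarrow> bool" where
  "sm_integrable M N \<mu> g \<longleftrightarrow> g \<in> borel_measurable N \<and> (\<exists>G. sm_approx M N \<mu> g G)"

text \<open>
  The limit does not depend, up to almost sure equality, on the approximating sequence, so
  the choice below only selects a representative of an element of \<open>L\<^sub>0\<close>.
\<close>

definition sm_integral ::
    "'w measure \<Rightarrow> 'a measure \<Rightarrow> ('a set \<Rightarrow> 'w \<Rightarrow> real) \<Rightarrow> 'a set \<Rightarrow> ('a \<Rightarrow> real) \<Rightarrow> 'w \<Rightarrow> real" where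
  "sm_integral M N \<mu> A g =
     (SOME Y. \<exists>G. sm_approx M N \<mu> g G \<and>
        tendsto_in_prob M (\<lambda>n. sm_simple_integral N \<mu> A (G n)) Y)"

abbreviation unit_borel :: "real measure" where
  "unit_borel \<equiv> restrict_space borel {0<..1}"

definition square_integrable_unit :: "(real \<Rightarrow> real) \<Rightarrow> bool" where
  "square_integrable_unit h \<longleftrightarrow>
     h \<in> borel_measurable unit_borel \<and> set_integrable lborel {0<..1} (\<lambda>x. \<bar>h x\<bar>\<^sup>2)"

definition fourier_coeff :: "'w measure \<Rightarrow> (real set \<Rightarrow> 'w \<Rightarrow> real) \<Rightarrow> int \<Rightarrow> 'w \<Rightarrow> complex" where
  "fourier_coeff M \<mu> k \<omega> =
     complex_of_real (sm_integral M unit_borel \<mu> {0<..1} (\<lambda>t. cos (2 * pi * of_int k * t)) \<omega>)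
     - \<i> * complex_of_real (sm_integral M unit_borel \<mu> {0<..1} (\<lambda>t. sin (2 * pi * of_int k * t)) \<omega>)"

definition fourier_partial_sum ::
    "'w measure \<Rightarrow> (real set \<Rightarrow> 'w \<Rightarrow> real) \<Rightarrow> nat \<Rightarrow> real \<Rightarrow> 'w \<Rightarrow> complex" where
  "fourier_partial_sum M \<mu> j t \<omega> =
     (\<Sum>k\<in>{- int j..int j}. fourier_coeff M \<mu> k \<omega> *
        exp (2 * complex_of_real pi * \<i> * of_int k * complex_of_real t))"

text \<open>
  Mild form of the wave equation; \<open>Z t x\<close> is the term coming from the noise. In the set
  integrals below the intervals have left end point at most the right one, as \<open>a > 0\<close> and
  \<open>0 \<le> s \<le> t\<close>.
\<close>

definition mild_solution ::
    "'w measure \<Rightarrow> real \<Rightarrow> (real \<Rightarrow> 'w \<Rightarrow> real) \<Rightarrow> (real \<Rightarrow> 'w \<Rightarrow> real) \<Rightarrow> (real \<Rightarrow> real \<Rightarrow> real \<Rightarrow> real) \<Rightarrow>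
     (real \<Rightarrow> real \<Rightarrow> 'w \<Rightarrow> real) \<Rightarrow> (real \<Rightarrow> real \<Rightarrow> 'w \<Rightarrow> real) \<Rightarrow> bool" where
  "mild_solution M a u0 v0 f Z u \<longleftrightarrow>
     (\<lambda>((t, x), \<omega>). u t x \<omega>) \<in> borel_measurable (restrict_space borel ({0..1} \<times> UNIV) \<Otimes>\<^sub>M M) \<and>
     (\<forall>t\<in>{0..1}. \<forall>x. AE \<omega> in M.
        u t x \<omega> =
          1 / 2 * (u0 (x + a * t) \<omega> + u0 (x - a * t) \<omega>)
          + 1 / (2 * a) * (LINT y:{x - a * t..x + a * t}|lborel. v0 y \<omega>)
          + 1 / (2 * a) * (LINT s:{0..t}|lborel.
              (LINT y:{x - a * (t - s)..x + a * (t - s)}|lborel. f s y (u s y \<omega>)))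
          + 1 / (2 * a) * Z t x \<omega>)"

text \<open>
  In the integrand of \<open>noise_term\<close> the interval is empty for \<open>s > t\<close>, where the values are
  irrelevant since the integral is over \<open>(0,t]\<close>.
\<close>

definition noise_term ::
    "'w measure \<Rightarrow> real \<Rightarrow> (real set \<Rightarrow> 'w \<Rightarrow> real) \<Rightarrow> (real \<Rightarrow> real \<Rightarrow> real) \<Rightarrow>
     real \<Rightarrow> real \<Rightarrow> 'w \<Rightarrow> real" where
  "noise_term M a \<mu> \<sigma> t x =
     sm_integral M unit_borel \<mu> {0<..t}
       (\<lambda>s. LINT y:{x - a * (t - s)..x + a * (t - s)}|lborel. \<sigma> s y)"

text \<open>
  The Fourier coefficients with indices \<open>k\<close> and \<open>- k\<close> are almost surely conjugate, so the
  partial sums are almost surely real; \<^const>\<open>Re\<close> only takes them to type \<^typ>\<open>real\<close>.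
\<close>

definition fourier_noise_term ::
    "'w measure \<Rightarrow> real \<Rightarrow> (real set \<Rightarrow> 'w \<Rightarrow> real) \<Rightarrow> (real \<Rightarrow> real \<Rightarrow> real) \<Rightarrow> nat \<Rightarrow>
     real \<Rightarrow> real \<Rightarrow> 'w \<Rightarrow> real" where
  "fourier_noise_term M a \<mu> \<sigma> j t x \<omega> =
     (LINT s:{0<..t}|lborel. Re (fourier_partial_sum M \<mu> j s \<omega>) *
        (LINT y:{x - a * (t - s)..x + a * (t - s)}|lborel. \<sigma> s y))"

definition is_version :: "'w measure \<Rightarrow> (real \<Rightarrow> real \<Rightarrow> 'w \<Rightarrow> real) \<Rightarrow> (real \<Rightarrow> real \<Rightarrow> 'w \<Rightarrow> real) \<Rightarrow> bool" where
  "is_version M w' w \<longleftrightarrow>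
     (\<forall>t\<in>{0..1}. \<forall>x. w' t x \<in> borel_measurable M \<and> (AE \<omega> in M. w' t x \<omega> = w t x \<omega>))"

end

theory Submission
  imports Defs
begin

text \<open>
  Write \<open>g\<^bsub>t,x\<^esub>(s)\<close> for the integral of \<open>\<sigma>(s,y)\<close> over \<open>\<bar>y - x\<bar> \<le> a(t - s)\<close>, which is \<open>0\<close> for \<open>s \<ge> t\<close>.
  The noise enters \<open>u\<close> through \<open>\<integral> g\<^bsub>t,x\<^esub> d\<mu>\<close>. Let \<open>\<zeta>\<^sub>k\<close> be the integrals of an orthonormal trigonometric
  system with respect to \<open>\<mu>\<close>, and \<open>c\<^sub>k(g)\<close> the Fourier coefficients of a function. The noise enters \<open>u\<^sub>j\<close>
  through the sum of \<open>c\<^sub>k(g\<^bsub>t,x\<^esub>) \<zeta>\<^sub>k\<close> over \<open>\<bar>k\<bar> \<le> j\<close>. The theorem says that these partial sums converge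
  uniformly in \<open>(t,x)\<close>, and that the equation passes this on to the solutions. Three ideas are used.

  \<^item> The Fourier coefficients of the kernel are small. For functions vanishing at both end points
    and Hoelder continuous with exponent \<open>\<beta>\<close>, the sums of \<open>\<bar>k\<bar>\<^sup>r c\<^sub>k\<^sup>2\<close> are bounded for \<open>r < 2\<beta>\<close>
    (\<open>hoelder_coefficients_weighted\<close>, by Bernstein's argument with symmetric differences). As
    \<open>\<beta> > 1/2\<close>, some \<open>r > 1\<close> is possible. The kernel vanishes at \<open>1\<close> but not at \<open>0\<close>, so \<open>g\<^bsub>t,x\<^esub>(0)(1 - s)\<close>
    is subtracted first. The Fourier sums of the fixed function \<open>1 - s\<close> converge in mean square, and
    their integrals converge in probability by the continuity of the integral.

  \<^item> The random coefficients are not large. Continuity in mean square makes the signed sums of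
    \<open>\<bar>k\<bar>\<^bsup>-r/2\<^esup> \<zeta>\<^sub>k\<close> bounded in probability, for all choices of signs at once, because they are integrals
    of functions with bounded mean square. Averaging over the signs (a Paley-Zygmund argument, as
    the \<open>\<zeta>\<^sub>k\<close> need not have moments) bounds the sum of \<open>\<bar>k\<bar>\<^bsup>-r\<^esup> \<zeta>\<^sub>k\<^sup>2\<close> (\<open>weighted_squares_bounded\<close>), so that
    this series converges almost surely. By the Cauchy-Schwarz inequality the tails of the series of
    \<open>c\<^sub>k \<zeta>\<^sub>k\<close> are bounded by one random sequence that tends to \<open>0\<close> and does not depend on \<open>(t,x)\<close>
    (\<open>pseries_tendsto\<close>, \<open>noise_error_bound\<close>).

  \<^item> For fixed \<open>\<omega>\<close>, Gronwall's argument bounds \<open>u\<^sub>j - u\<close> by a constant times the supremum of the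
    noise error (\<open>perturbation_bound\<close>). The equations hold only almost surely for each \<open>(t,x)\<close>, but by
    Fubini's theorem almost every \<open>\<omega>\<close> satisfies them for almost all \<open>(t,x)\<close>, and the integrals of \<open>f\<close>
    see nothing else. Hence the versions: \<open>u\<close> is kept, and \<open>u\<^sub>j\<close> is replaced by \<open>u\<close> plus the difference
    of the right-hand sides, which is continuous in \<open>(t,x)\<close>.

  All this presupposes a linear integral. The limit defining it has to be independent of the
  approximating functions, which comes down to two facts on measures with values in \<open>L\<^sub>0\<close>: the range is
  bounded in probability (\<open>mu_range_bounded\<close>), and simple functions that tend to \<open>0\<close> pointwise have
  integrals that tend to \<open>0\<close> once they converge on every set (\<open>simp_int_limit_unique\<close>). Since \<open>L\<^sub>0\<close> is
  not locally convex, the first one is again proved by averaging, over random subsets of a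
  partition.
\<close>

section \<open>Averages over random subsets of a finite set\<close>

text \<open>
  The expectation of \<open>F T\<close> for a random subset \<open>T\<close> of \<open>I\<close> that contains each \<open>i\<close> independently with
  probability \<open>q i\<close>. A finite sum avoids an auxiliary probability space; \<open>bern_avg_prob\<close> below plays
  the role of Fubini's theorem.
\<close>

definition bern_avg :: "('i \<Rightarrow> real) \<Rightarrow> 'i set \<Rightarrow> ('i set \<Rightarrow> real) \<Rightarrow> real" where
  "bern_avg q I F = (\<Sum>T\<in>Pow I. (\<Prod>i\<in>T. q i) * (\<Prod>i\<in>I - T. 1 - q i) * F T)"

lemma bern_avg_empty [simp]: "bern_avg q {} F = F {}"
  by (simp add: bern_avg_def)

text \<open>
  Conditioning on whether \<open>i\<close> is chosen. The facts below follow from it by induction.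
\<close>

lemma bern_avg_insert:
  assumes "finite I" "i \<notin> I"
  shows "bern_avg q (insert i I) F =
    q i * bern_avg q I (\<lambda>T. F (insert i T)) + (1 - q i) * bern_avg q I F"
proof -
  have disj: "Pow I \<inter> insert i ` Pow I = {}" using assms by auto
  have inj: "inj_on (insert i) (Pow I)" using assms by (auto simp: inj_on_def)
  let ?w = "\<lambda>I T. (\<Prod>i\<in>T. q i) * (\<Prod>i\<in>I - T. 1 - q i)"
  have 1: "?w (insert i I) T = (1 - q i) * ?w I T" if "T \<in> Pow I" for T
  proof -
    have "insert i I - T = insert i (I - T)" "finite (I - T)" "i \<notin> I - T" using that assms by auto
    then show ?thesis by simp
  qed
  have 2: "?w (insert i I) (insert i T) = q i * ?w I T" if "T \<in> Pow I" for T
  proof -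
    have "insert i I - insert i T = I - T" "finite T" "i \<notin> T"
      using that assms finite_subset by auto
    then show ?thesis by simp
  qed
  have "bern_avg q (insert i I) F = (\<Sum>T\<in>Pow I. ?w (insert i I) T * F T) +
      (\<Sum>T\<in>Pow I. ?w (insert i I) (insert i T) * F (insert i T))"
    unfolding bern_avg_def Pow_insert using assms disj inj
    by (subst sum.union_disjoint) (simp_all only: sum.reindex finite_Pow_iff finite_imageI o_def)
  also have "\<dots> = (\<Sum>T\<in>Pow I. (1 - q i) * (?w I T * F T)) + (\<Sum>T\<in>Pow I. q i * (?w I T * F (insert i T)))"
    by (intro arg_cong2[where f="(+)"] sum.cong refl) (simp_all only: 1 2 mult.assoc)
  finally show ?thesis by (simp add: bern_avg_def sum_distrib_left)
qed

lemma bern_avg_mono: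
  assumes "\<And>i. i \<in> I \<Longrightarrow> 0 \<le> q i \<and> q i \<le> 1" "\<And>T. T \<subseteq> I \<Longrightarrow> F T \<le> G T"
  shows "bern_avg q I F \<le> bern_avg q I G"
  unfolding bern_avg_def using assms
  by (intro sum_mono mult_left_mono mult_nonneg_nonneg prod_nonneg) auto

lemma bern_avg_add: "bern_avg q I (\<lambda>T. F T + G T) = bern_avg q I F + bern_avg q I G"
  by (simp add: bern_avg_def algebra_simps sum.distrib)

lemma bern_avg_cmult: "bern_avg q I (\<lambda>T. c * F T) = c * bern_avg q I F"
  by (simp add: bern_avg_def sum_distrib_left algebra_simps)

lemma bern_avg_const [simp]: "finite I \<Longrightarrow> bern_avg q I (\<lambda>T. c) = c"
  by (induction I rule: finite_induct) (simp_all add: bern_avg_insert algebra_simps)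

lemma bern_avg_union:
  assumes "finite I" "finite J" "I \<inter> J = {}"
  shows "bern_avg q (I \<union> J) F = bern_avg q J (\<lambda>S. bern_avg q I (\<lambda>T. F (T \<union> S)))"
  using assms(2,1,3)
  by (induction J arbitrary: F rule: finite_induct) (simp_all add: bern_avg_insert Un_insert_right)

lemma bern_avg_notin:
  assumes "finite I" "i \<in> I"
  shows "bern_avg q I (\<lambda>T. of_bool (i \<notin> T)) = 1 - q i"
proof -
  have "bern_avg q (insert i (I - {i})) (\<lambda>T. of_bool (i \<notin> T)) =
     (1 - q i) * bern_avg q (I - {i}) (\<lambda>T. of_bool (i \<notin> T))"
    using assms by (subst bern_avg_insert) (auto simp: bern_avg_def)
  also have "bern_avg q (I - {i}) (\<lambda>T. of_bool (i \<notin> T)) = bern_avg q (I - {i}) (\<lambda>T. 1)"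
    unfolding bern_avg_def by (intro sum.cong) auto
  finally show ?thesis using assms by (simp add: insert_absorb)
qed

text \<open>
  Choose \<open>m\<close> indices with \<open>\<bar>x i\<bar> > 2 * K\<close> and fix the choice outside of them. With probability at
  least \<open>1/2\<close> none of the \<open>m\<close> indices is chosen, and with probability at least \<open>1/4\<close> exactly one.
  If the sum outside is at most \<open>K\<close> in absolute value, then the second event makes the total exceed
  \<open>K\<close>, otherwise the first one does. It matters that subsets as sparse as \<open>1 / (2 * m)\<close> suffice when
  many terms are large: the complement of the random subset is then almost everything.
\<close>

lemma bern_avg_large_partial_sum:
  fixes x :: "'i \<Rightarrow> real"
  assumes I: "finite I" and m: "m \<ge> 1" "card {i\<in>I. \<bar>x i\<bar> > 2 * K} \<ge> m" and "K \<ge> 0"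
  shows "bern_avg (\<lambda>_. 1 / (2 * real m)) I (\<lambda>T. of_bool (\<bar>\<Sum>i\<in>T. x i\<bar> > K)) \<ge> 1 / 4"
proof -
  define q :: "'i \<Rightarrow> real" where "q = (\<lambda>_. 1 / (2 * real m))"
  define r where "r = 1 / (2 * real m)"
  have r: "0 \<le> r" "r \<le> 1" using m by (auto simp: r_def field_simps)
  obtain J where J: "J \<subseteq> {i\<in>I. \<bar>x i\<bar> > 2 * K}" "card J = m"
    using obtain_subset_with_card_n[OF m(2)] by auto
  have JI: "J \<subseteq> I" using J by auto
  have fJ: "finite J" using JI I finite_subset by blast
  have pow: "(1 - r) ^ m \<ge> 1 / 2"
  proof -
    have "1 + real m * (- r) \<le> (1 + (- r)) ^ m" using r by (intro Bernoulli_inequality) auto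
    then show ?thesis using m by (simp add: r_def)
  qed
  have pow': "(1 - r) ^ (m - 1) \<ge> (1 - r) ^ m"
    using r by (intro power_decreasing) auto
  have inner: "bern_avg q J (\<lambda>T. of_bool (\<bar>\<Sum>i\<in>T \<union> S. x i\<bar> > K)) \<ge> 1 / 4"
    if S: "S \<subseteq> I - J" for S
  proof -
    let ?G = "\<lambda>T. of_bool (\<bar>\<Sum>i\<in>T \<union> S. x i\<bar> > K) :: real"
    let ?w = "\<lambda>T. (\<Prod>i\<in>T. q i) * (\<Prod>i\<in>J - T. 1 - q i)"
    define s where "s = sum x S"
    have fS: "finite S" using S I by (meson finite_Diff finite_subset)
    have sub: "insert {} ((\<lambda>j. {j}) ` J) \<subseteq> Pow J" by auto
    \<comment> \<open>only the empty set and the singletons are counted\<close>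
    have "(\<Sum>T\<in>insert {} ((\<lambda>j. {j}) ` J). ?w T * ?G T) \<le> bern_avg q J ?G"
      unfolding bern_avg_def using fJ r
      by (intro sum_mono2 sub) (auto intro!: mult_nonneg_nonneg prod_nonneg simp: q_def r_def)
    moreover have "(\<Sum>T\<in>insert {} ((\<lambda>j. {j}) ` J). ?w T * ?G T) =
       (1 - r) ^ m * ?G {} + (\<Sum>j\<in>J. r * (1 - r) ^ (m - 1) * ?G {j})"
    proof -
      have "?w {} * ?G {} = (1 - r) ^ m * ?G {}" using fJ J(2) by (simp add: q_def r_def)
      moreover have "(\<Sum>T\<in>(\<lambda>j. {j}) ` J. ?w T * ?G T) = (\<Sum>j\<in>J. ?w {j} * ?G {j})"
        by (subst sum.reindex) (auto simp: inj_on_def)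
      moreover have "?w {j} * ?G {j} = r * (1 - r) ^ (m - 1) * ?G {j}" if "j \<in> J" for j
        using that fJ J(2) by (simp add: q_def r_def)
      ultimately show ?thesis using fJ by (subst sum.insert) auto
    qed
    moreover have "\<dots> \<ge> 1 / 4"
    proof (cases "\<bar>s\<bar> > K")
      case True
      then have "?G {} = 1" by (simp add: s_def)
      moreover have "(\<Sum>j\<in>J. r * (1 - r) ^ (m - 1) * ?G {j}) \<ge> 0" using r by (intro sum_nonneg) auto
      ultimately show ?thesis using pow by simp
    next
      case False
      have "?G {j} = 1" if "j \<in> J" for j
      proof -
        have "sum x ({j} \<union> S) = x j + s" using that S fS by (subst sum.union_disjoint) (auto simp: s_def)
        moreover have "\<bar>x j\<bar> > 2 * K" using that J by auto
        ultimately show ?thesis using False by auto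
      qed
      then have "(\<Sum>j\<in>J. r * (1 - r) ^ (m - 1) * ?G {j}) = (\<Sum>j\<in>J. r * (1 - r) ^ (m - 1))"
        by (intro sum.cong) auto
      also have "\<dots> = (real m * r) * (1 - r) ^ (m - 1)" using J by simp
      also have "real m * r = 1 / 2" using m by (simp add: r_def)
      finally show ?thesis using pow pow' r by (simp add: field_simps)
    qed
    ultimately show ?thesis by linarith
  qed
  have IJ: "I = J \<union> (I - J)" using JI by auto
  have "1 / 4 = bern_avg q (I - J) (\<lambda>S. 1 / 4)" using I by simp
  also have "\<dots> \<le> bern_avg q (I - J) (\<lambda>S. bern_avg q J (\<lambda>T. of_bool (\<bar>\<Sum>i\<in>T \<union> S. x i\<bar> > K)))"
    using inner r by (intro bern_avg_mono) (auto simp: q_def r_def)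
  also have "\<dots> = bern_avg q (J \<union> (I - J)) (\<lambda>T. of_bool (\<bar>\<Sum>i\<in>T. x i\<bar> > K))"
    using fJ I by (subst bern_avg_union) auto
  finally show ?thesis unfolding q_def using IJ by simp
qed

text \<open>
  The sum with signs \<open>+1\<close> on \<open>T\<close> and \<open>-1\<close> off \<open>T\<close>; random subsets become random signs.
\<close>

definition sgn_sum :: "('i \<Rightarrow> real) \<Rightarrow> 'i set \<Rightarrow> 'i set \<Rightarrow> real" where
  "sgn_sum x I T = sum x T - sum x (I - T)"

lemma sgn_sum_empty [simp]: "sgn_sum x {} {} = 0" by (simp add: sgn_sum_def)

lemma sgn_sum_insert:
  assumes "finite I" "i \<notin> I" "T \<subseteq> I"
  shows "sgn_sum x (insert i I) (insert i T) = x i + sgn_sum x I T"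
    "sgn_sum x (insert i I) T = sgn_sum x I T - x i"
proof -
  have "finite T" "i \<notin> T" "insert i I - insert i T = I - T" using assms finite_subset by auto
  then show "sgn_sum x (insert i I) (insert i T) = x i + sgn_sum x I T" by (simp add: sgn_sum_def)
  have "insert i I - T = insert i (I - T)" "finite (I - T)" "i \<notin> I - T" using assms by auto
  then show "sgn_sum x (insert i I) T = sgn_sum x I T - x i" by (simp add: sgn_sum_def)
qed

lemma bern_avg_cong: "(\<And>T. T \<subseteq> I \<Longrightarrow> F T = G T) \<Longrightarrow> bern_avg q I F = bern_avg q I G"
  unfolding bern_avg_def by (intro sum.cong) auto

lemma bern_avg_insert_sgn:
  fixes h :: "real \<Rightarrow> real"
  assumes "finite I" "i \<notin> I"
  shows "bern_avg q (insert i I) (\<lambda>T. h (s + sgn_sum x (insert i I) T)) =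
     q i * bern_avg q I (\<lambda>T. h ((s + x i) + sgn_sum x I T)) +
     (1 - q i) * bern_avg q I (\<lambda>T. h ((s - x i) + sgn_sum x I T))"
  unfolding bern_avg_insert[OF assms]
  by (intro arg_cong2[where f="(+)"] arg_cong2[where f="(*)"] refl bern_avg_cong)
     (simp_all add: sgn_sum_insert[OF assms] algebra_simps)

text \<open>
  For independent signs with means \<open>a i\<close>, the second moment is the squared mean plus the sum of the
  variances \<open>(1 - (a i)\<^sup>2) * (x i)\<^sup>2\<close>. The shift \<open>s\<close> makes the induction work.
\<close>

lemma bern_avg_sgn_sum_square:
  assumes "finite I"
  shows "bern_avg (\<lambda>i. (1 + a i) / 2) I (\<lambda>T. (s + sgn_sum x I T)\<^sup>2) =
    (s + (\<Sum>i\<in>I. a i * x i))\<^sup>2 + (\<Sum>i\<in>I. (1 - (a i)\<^sup>2) * (x i)\<^sup>2)"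
  using assms
proof (induction I arbitrary: s rule: finite_induct)
  case (insert i I)
  show ?case
    unfolding bern_avg_insert_sgn[OF insert(1,2), where h="\<lambda>x. x\<^sup>2"] insert.IH
    using insert(1,2) by (simp add: power2_eq_square field_simps)
qed simp

text \<open>
  The case of exponent \<open>4\<close> of Khinchin's inequality.
\<close>

lemma bern_avg_sgn_sum_fourth_power:
  assumes "finite I"
  shows "bern_avg (\<lambda>i. 1 / 2) I (\<lambda>T. (s + sgn_sum x I T) ^ 4) \<le>
    s ^ 4 + 6 * s\<^sup>2 * (\<Sum>i\<in>I. (x i)\<^sup>2) + 3 * (\<Sum>i\<in>I. (x i)\<^sup>2)\<^sup>2"
  using assms
proof (induction I arbitrary: s rule: finite_induct)
  case (insert i I)
  define Q where "Q = (\<Sum>i\<in>I. (x i)\<^sup>2)"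
  define y where "y = x i"
  have "1 / 2 * bern_avg (\<lambda>i. 1 / 2) I (\<lambda>T. ((s + x i) + sgn_sum x I T) ^ 4) +
        (1 - 1 / 2) * bern_avg (\<lambda>i. 1 / 2) I (\<lambda>T. ((s - x i) + sgn_sum x I T) ^ 4) \<le>
     1 / 2 * ((s + y) ^ 4 + 6 * (s + y)\<^sup>2 * Q + 3 * Q\<^sup>2) + 1 / 2 * ((s - y) ^ 4 + 6 * (s - y)\<^sup>2 * Q + 3 * Q\<^sup>2)"
  proof -
    have "1 / 2 * A + (1 - 1 / 2) * B \<le> 1 / 2 * A' + 1 / 2 * B'" if "A \<le> A'" "B \<le> B'" for A B A' B' :: real
      using that by simp
    then show ?thesis unfolding Q_def y_def using insert.IH[of "s + x i"] insert.IH[of "s - x i"] by blast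
  qed
  also have "\<dots> = s ^ 4 + 6 * s\<^sup>2 * (y\<^sup>2 + Q) + 3 * (y\<^sup>2 + Q)\<^sup>2 - 2 * y ^ 4"
    by (simp add: power4_eq_xxxx power2_eq_square algebra_simps)
  also have "\<dots> \<le> s ^ 4 + 6 * s\<^sup>2 * (y\<^sup>2 + Q) + 3 * (y\<^sup>2 + Q)\<^sup>2" by simp
  finally show ?case
    unfolding bern_avg_insert_sgn[OF insert(1,2), where h="\<lambda>x. x ^ 4"]
    using insert(1,2) by (simp add: Q_def y_def)
qed simp

text \<open>
  Paley-Zygmund inequality. The indicator is bounded from below by a quadratic polynomial in the
  square of the sum, so that the second and the fourth moment suffice.
\<close>

lemma bern_avg_sgn_sum_large:
  assumes "finite I" and Q: "(\<Sum>i\<in>I. (x i)\<^sup>2) > 2 * K\<^sup>2" and K: "K \<ge> 0"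
  shows "bern_avg (\<lambda>i. 1 / 2) I (\<lambda>T. of_bool (\<bar>sgn_sum x I T\<bar> > K)) \<ge> 1 / 10"
proof -
  define Q where "Q = (\<Sum>i\<in>I. (x i)\<^sup>2)"
  let ?S = "sgn_sum x I"
  have Qpos: "Q > 0" using Q by (smt (verit) Q_def zero_le_power2)
  \<comment> \<open>in terms of \<open>y = s\<^sup>2 / Q\<close> the polynomial is \<open>(y - 1/2) * (9 - y) / 20\<close>, not positive for \<open>y \<le> 1/2\<close>
    and at most \<open>1\<close> everywhere; the moments give \<open>19/40 - 3/20 - 9/40 = 1/10\<close>\<close>
  have ptw: "of_bool (\<bar>s\<bar> > K) \<ge> (- 1 / (20 * Q\<^sup>2)) * s ^ 4 + 19 / (40 * Q) * s\<^sup>2 + (- 9 / 40)" for s :: real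
  proof -
    define y where "y = s\<^sup>2 / Q"
    have eq: "(- 1 / (20 * Q\<^sup>2)) * s ^ 4 + 19 / (40 * Q) * s\<^sup>2 + (- 9 / 40) = - (y\<^sup>2) / 20 + 19 / 40 * y - 9 / 40"
      by (simp add: y_def power_divide flip: power_mult)
    show ?thesis
    proof (cases "\<bar>s\<bar> > K")
      case True
      have "- (y\<^sup>2) / 20 + 19 / 40 * y - 9 / 40 \<le> 1"
        using zero_le_power2[of "y - 19/4"] by (simp add: power2_eq_square algebra_simps)
      then show ?thesis using True eq by simp
    next
      case False
      then have "s\<^sup>2 \<le> K\<^sup>2" using K by (simp add: abs_le_square_iff[symmetric])
      then have "s\<^sup>2 \<le> Q / 2" using Q by (simp add: Q_def)
      then have "y \<le> 1 / 2" using Qpos by (simp add: y_def field_simps)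
      then have "(y - 1 / 2) * (9 - y) \<le> 0" by (intro mult_nonpos_nonneg) auto
      moreover have "(y - 1 / 2) * (9 - y) = - (y\<^sup>2) + 19 / 2 * y - 9 / 2"
        by (simp add: power2_eq_square algebra_simps)
      ultimately show ?thesis unfolding eq using False by simp
    qed
  qed
  have s2: "bern_avg (\<lambda>i. 1 / 2) I (\<lambda>T. (?S T)\<^sup>2) = Q"
    using bern_avg_sgn_sum_square[OF assms(1), of "\<lambda>_. 0" 0 x] by (simp add: Q_def)
  have s4: "bern_avg (\<lambda>i. 1 / 2) I (\<lambda>T. (?S T) ^ 4) \<le> 3 * Q\<^sup>2"
    using bern_avg_sgn_sum_fourth_power[OF assms(1), of 0 x] by (simp add: Q_def)
  have "bern_avg (\<lambda>i. 1 / 2) I (\<lambda>T. (- 1 / (20 * Q\<^sup>2)) * (?S T) ^ 4 + 19 / (40 * Q) * (?S T)\<^sup>2 + (- 9 / 40))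
     \<le> bern_avg (\<lambda>i. 1 / 2) I (\<lambda>T. of_bool (\<bar>?S T\<bar> > K))"
    using ptw by (intro bern_avg_mono) auto
  moreover have "bern_avg (\<lambda>i. 1 / 2) I (\<lambda>T. (- 1 / (20 * Q\<^sup>2)) * (?S T) ^ 4 + 19 / (40 * Q) * (?S T)\<^sup>2 + (- 9 / 40))
     = (- 1 / (20 * Q\<^sup>2)) * bern_avg (\<lambda>i. 1 / 2) I (\<lambda>T. (?S T) ^ 4) + 19 / (40 * Q) * Q - 9 / 40"
    using assms(1) by (simp only: bern_avg_add bern_avg_cmult s2 bern_avg_const)
  moreover have "1 / (20 * Q\<^sup>2) * bern_avg (\<lambda>i. 1 / 2) I (\<lambda>T. (?S T) ^ 4) \<le> 1 / (20 * Q\<^sup>2) * (3 * Q\<^sup>2)"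
    using s4 by (intro mult_left_mono) auto
  moreover have "1 / (20 * Q\<^sup>2) * (3 * Q\<^sup>2) = 3 / 20" "19 / (40 * Q) * Q = 19 / 40"
    using Qpos by (simp_all add: field_simps)
  ultimately show ?thesis by simp
qed

section \<open>Convergence in probability\<close>

text \<open>
  The quasi-norm that metrizes convergence in probability. It is subadditive but not homogeneous;
  \<open>prob_norm_cmult\<close> replaces homogeneity.
\<close>

definition prob_norm :: "'w measure \<Rightarrow> ('w \<Rightarrow> real) \<Rightarrow> real" where
  "prob_norm M X = (\<integral>\<omega>. min 1 \<bar>X \<omega>\<bar> \<partial>M)"

context prob_space
begin

lemma integrable_min_1_abs [simp]:
  "X \<in> borel_measurable M \<Longrightarrow> integrable M (\<lambda>\<omega>. min 1 \<bar>X \<omega> :: real\<bar>)"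
  by (rule integrable_const_bound[where B=1]) auto

lemma prob_norm_nonneg: "prob_norm M X \<ge> 0"
  unfolding prob_norm_def by simp

lemma prob_norm_squeeze:
  assumes "h \<longlonglongrightarrow> 0" "\<And>n. prob_norm M (X n) \<le> h n"
  shows "(\<lambda>n. prob_norm M (X n)) \<longlonglongrightarrow> 0"
  by (rule tendsto_sandwich[OF _ _ tendsto_const assms(1)])
     (intro always_eventually allI prob_norm_nonneg assms(2))+

lemma prob_norm_add:
  assumes [measurable]: "X \<in> borel_measurable M" "Y \<in> borel_measurable M"
  shows "prob_norm M (\<lambda>\<omega>. X \<omega> + Y \<omega>) \<le> prob_norm M X + prob_norm M Y"
proof -
  have "prob_norm M (\<lambda>\<omega>. X \<omega> + Y \<omega>) \<le> (\<integral>\<omega>. min 1 \<bar>X \<omega>\<bar> + min 1 \<bar>Y \<omega>\<bar> \<partial>M)"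
    unfolding prob_norm_def by (intro integral_mono) auto
  then show ?thesis by (simp add: prob_norm_def)
qed

lemma prob_norm_minus [simp]: "prob_norm M (\<lambda>\<omega>. - X \<omega>) = prob_norm M X"
  by (simp add: prob_norm_def)

lemma prob_norm_diff:
  assumes [measurable]: "X \<in> borel_measurable M" "Y \<in> borel_measurable M"
  shows "prob_norm M (\<lambda>\<omega>. X \<omega> - Y \<omega>) \<le> prob_norm M X + prob_norm M Y"
  using prob_norm_add[of X "\<lambda>\<omega>. - Y \<omega>"] by simp

lemma prob_norm_diff_commute: "prob_norm M (\<lambda>\<omega>. X \<omega> - Y \<omega>) = prob_norm M (\<lambda>\<omega>. Y \<omega> - X \<omega>)"
  by (simp add: prob_norm_def abs_minus_commute)

lemma prob_norm_triangle_sub: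
  assumes [measurable]: "X \<in> borel_measurable M" "Y \<in> borel_measurable M"
  shows "prob_norm M X \<le> prob_norm M Y + prob_norm M (\<lambda>\<omega>. X \<omega> - Y \<omega>)"
  using prob_norm_add[of Y "\<lambda>\<omega>. X \<omega> - Y \<omega>"] by simp

lemma prob_norm_cong_AE:
  assumes [measurable]: "X \<in> borel_measurable M" "Y \<in> borel_measurable M"
    and "AE \<omega> in M. X \<omega> = Y \<omega>"
  shows "prob_norm M X = prob_norm M Y"
  unfolding prob_norm_def using assms(3) by (intro integral_cong_AE) auto

lemma prob_norm_cmult:
  assumes [measurable]: "X \<in> borel_measurable M"
  shows "prob_norm M (\<lambda>\<omega>. c * X \<omega>) \<le> max 1 \<bar>c\<bar> * prob_norm M X"
proof -
  have "min 1 \<bar>c * x\<bar> \<le> max 1 \<bar>c\<bar> * min 1 \<bar>x\<bar>" for x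
  proof (cases "\<bar>x\<bar> \<le> 1")
    case True
    then have "\<bar>c * x\<bar> \<le> max 1 \<bar>c\<bar> * \<bar>x\<bar>" unfolding abs_mult by (intro mult_right_mono) auto
    then show ?thesis using True by (simp add: min_def)
  qed auto
  then have "prob_norm M (\<lambda>\<omega>. c * X \<omega>) \<le> (\<integral>\<omega>. max 1 \<bar>c\<bar> * min 1 \<bar>X \<omega>\<bar> \<partial>M)"
    unfolding prob_norm_def by (intro integral_mono) auto
  then show ?thesis by (simp add: prob_norm_def)
qed

lemma prob_norm_eq_0_iff:
  assumes [measurable]: "X \<in> borel_measurable M"
  shows "prob_norm M X = 0 \<longleftrightarrow> (AE \<omega> in M. X \<omega> = 0)"
proof -
  have "prob_norm M X = 0 \<longleftrightarrow> (AE \<omega> in M. min 1 \<bar>X \<omega>\<bar> = 0)"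
    unfolding prob_norm_def by (intro integral_nonneg_eq_0_iff_AE) auto
  also have "\<dots> \<longleftrightarrow> (AE \<omega> in M. X \<omega> = 0)" by (intro AE_cong) (auto simp: min_def)
  finally show ?thesis .
qed

lemma prob_gt_le_prob_norm:
  assumes [measurable]: "X \<in> borel_measurable M" and e: "0 < e" "e \<le> 1"
  shows "e * prob {\<omega>\<in>space M. e < \<bar>X \<omega>\<bar>} \<le> prob_norm M X"
proof -
  have "e * prob {\<omega>\<in>space M. e < \<bar>X \<omega>\<bar>} = (\<integral>\<omega>. e * indicator {\<omega>\<in>space M. e < \<bar>X \<omega>\<bar>} \<omega> \<partial>M)"
    by simp
  also have "\<dots> \<le> prob_norm M X"
    unfolding prob_norm_def using e
    by (intro integral_mono integrable_mult_right integrable_real_indicator) (auto simp: indicator_def emeasure_eq_measure)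
  finally show ?thesis .
qed

lemma prob_norm_le_prob_gt:
  assumes [measurable]: "X \<in> borel_measurable M" and "e \<ge> 0"
  shows "prob_norm M X \<le> e + prob {\<omega>\<in>space M. e < \<bar>X \<omega>\<bar>}"
proof -
  have "prob_norm M X \<le> (\<integral>\<omega>. e + indicator {\<omega>\<in>space M. e < \<bar>X \<omega>\<bar>} \<omega> \<partial>M)"
    unfolding prob_norm_def using assms(2)
    by (intro integral_mono Bochner_Integration.integrable_add integrable_real_indicator)
       (auto simp: indicator_def emeasure_eq_measure)
  also have "\<dots> = e + prob {\<omega>\<in>space M. e < \<bar>X \<omega>\<bar>}"
    by (subst Bochner_Integration.integral_add)
       (auto simp: prob_space emeasure_eq_measure intro!: integrable_real_indicator)
  finally show ?thesis .
qed

lemma prob_gt_tendsto_0_iff: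
  assumes [measurable]: "\<And>n. X n \<in> borel_measurable M"
  shows "(\<forall>\<epsilon>>0. (\<lambda>n. prob {\<omega>\<in>space M. \<epsilon> < \<bar>X n \<omega>\<bar>}) \<longlonglongrightarrow> 0) \<longleftrightarrow> (\<lambda>n. prob_norm M (X n)) \<longlonglongrightarrow> 0"
proof
  assume L: "\<forall>\<epsilon>>0. (\<lambda>n. prob {\<omega>\<in>space M. \<epsilon> < \<bar>X n \<omega>\<bar>}) \<longlonglongrightarrow> 0"
  show "(\<lambda>n. prob_norm M (X n)) \<longlonglongrightarrow> 0"
  proof (rule LIMSEQ_I)
    fix r :: real assume r: "r > 0"
    then have "(\<lambda>n. prob {\<omega>\<in>space M. r / 2 < \<bar>X n \<omega>\<bar>}) \<longlonglongrightarrow> 0" by (intro L[rule_format]) simp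
    then obtain n0 where n0: "\<forall>n\<ge>n0. norm (prob {\<omega>\<in>space M. r / 2 < \<bar>X n \<omega>\<bar>} - 0) < r / 2"
      using LIMSEQ_D[of "\<lambda>n. prob {\<omega>\<in>space M. r / 2 < \<bar>X n \<omega>\<bar>}" 0 "r / 2"] half_gt_zero[OF r] by blast
    have "norm (prob_norm M (X n) - 0) < r" if "n \<ge> n0" for n
      using n0[rule_format, OF that] prob_norm_le_prob_gt[of "X n" "r / 2"] r prob_norm_nonneg[of "X n"] by auto
    then show "\<exists>no. \<forall>n\<ge>no. norm (prob_norm M (X n) - 0) < r" by blast
  qed
next
  assume R: "(\<lambda>n. prob_norm M (X n)) \<longlonglongrightarrow> 0"
  show "\<forall>\<epsilon>>0. (\<lambda>n. prob {\<omega>\<in>space M. \<epsilon> < \<bar>X n \<omega>\<bar>}) \<longlonglongrightarrow> 0"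
  proof (intro allI impI)
    fix e :: real assume e: "e > 0"
    define d where "d = min 1 e"
    have d: "0 < d" "d \<le> 1" "d \<le> e" using e by (auto simp: d_def)
    have le: "prob {\<omega>\<in>space M. e < \<bar>X n \<omega>\<bar>} \<le> prob_norm M (X n) / d" for n
    proof -
      have "prob {\<omega>\<in>space M. e < \<bar>X n \<omega>\<bar>} \<le> prob {\<omega>\<in>space M. d < \<bar>X n \<omega>\<bar>}"
        using d by (intro finite_measure_mono) auto
      also have "\<dots> \<le> prob_norm M (X n) / d"
        using prob_gt_le_prob_norm[of "X n" d] d by (simp add: field_simps)
      finally show ?thesis .
    qed
    have "(\<lambda>n. prob_norm M (X n) / d) \<longlonglongrightarrow> 0" using tendsto_divide[OF R tendsto_const, of d] d by simp
    then show "(\<lambda>n. prob {\<omega>\<in>space M. e < \<bar>X n \<omega>\<bar>}) \<longlonglongrightarrow> 0"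
      by (rule tendsto_sandwich[OF _ _ tendsto_const, rotated 2]) (use le in auto)
  qed
qed

lemma tendsto_in_prob_iff:
  "tendsto_in_prob M X Y \<longleftrightarrow> (\<forall>n. X n \<in> borel_measurable M) \<and> Y \<in> borel_measurable M \<and>
     (\<lambda>n. prob_norm M (\<lambda>\<omega>. X n \<omega> - Y \<omega>)) \<longlonglongrightarrow> 0"
proof (cases "(\<forall>n. X n \<in> borel_measurable M) \<and> Y \<in> borel_measurable M")
  case True
  then have [measurable]: "\<And>n. X n \<in> borel_measurable M" "Y \<in> borel_measurable M" by auto
  have eq: "{\<omega>\<in>space M. ennreal \<epsilon> < ennreal \<bar>X n \<omega> - Y \<omega>\<bar>} = {\<omega>\<in>space M. \<epsilon> < \<bar>X n \<omega> - Y \<omega>\<bar>}"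
    if "\<epsilon> > 0" for \<epsilon> n using that by (auto simp: ennreal_less_iff)
  have "tendsto_in_prob M X Y \<longleftrightarrow> (\<forall>\<epsilon>>0. (\<lambda>n. prob {\<omega>\<in>space M. \<epsilon> < \<bar>X n \<omega> - Y \<omega>\<bar>}) \<longlonglongrightarrow> 0)"
  proof -
    have "(\<forall>\<epsilon>>0. (\<lambda>n. prob {\<omega>\<in>space M. ennreal \<epsilon> < ennreal \<bar>X n \<omega> - Y \<omega>\<bar>}) \<longlonglongrightarrow> 0) \<longleftrightarrow>
        (\<forall>\<epsilon>>0. (\<lambda>n. prob {\<omega>\<in>space M. \<epsilon> < \<bar>X n \<omega> - Y \<omega>\<bar>}) \<longlonglongrightarrow> 0)"
      by (intro all_cong1 imp_cong refl) (simp only: eq)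
    then show ?thesis
      unfolding tendsto_in_prob_def null_in_prob_def by simp
  qed
  then show ?thesis using True prob_gt_tendsto_0_iff[of "\<lambda>n \<omega>. X n \<omega> - Y \<omega>"] by simp
qed (auto simp: tendsto_in_prob_def)

lemma tendsto_in_prob_unique:
  assumes "tendsto_in_prob M X Y" "tendsto_in_prob M X' Z" "\<And>n. AE \<omega> in M. X n \<omega> = X' n \<omega>"
  shows "AE \<omega> in M. Y \<omega> = Z \<omega>"
proof -
  have [measurable]: "\<And>n. X n \<in> borel_measurable M" "\<And>n. X' n \<in> borel_measurable M"
    "Y \<in> borel_measurable M" "Z \<in> borel_measurable M"
    using assms by (auto simp: tendsto_in_prob_iff)
  have "prob_norm M (\<lambda>\<omega>. Y \<omega> - Z \<omega>) \<le>
      prob_norm M (\<lambda>\<omega>. X n \<omega> - Y \<omega>) + prob_norm M (\<lambda>\<omega>. X' n \<omega> - Z \<omega>)" for n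
  proof -
    have "prob_norm M (\<lambda>\<omega>. Y \<omega> - Z \<omega>) = prob_norm M (\<lambda>\<omega>. (X' n \<omega> - Z \<omega>) - (X n \<omega> - Y \<omega>))"
      using assms(3)[of n] by (intro prob_norm_cong_AE) auto
    also have "\<dots> \<le> prob_norm M (\<lambda>\<omega>. X' n \<omega> - Z \<omega>) + prob_norm M (\<lambda>\<omega>. X n \<omega> - Y \<omega>)"
      by (rule prob_norm_diff) auto
    finally show ?thesis by simp
  qed
  moreover have "(\<lambda>n. prob_norm M (\<lambda>\<omega>. X n \<omega> - Y \<omega>) + prob_norm M (\<lambda>\<omega>. X' n \<omega> - Z \<omega>)) \<longlonglongrightarrow> 0 + 0"
    using assms by (intro tendsto_add) (auto simp: tendsto_in_prob_iff)
  ultimately have "prob_norm M (\<lambda>\<omega>. Y \<omega> - Z \<omega>) \<le> 0"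
    by (intro LIMSEQ_le_const[of _ 0]) auto
  then have "prob_norm M (\<lambda>\<omega>. Y \<omega> - Z \<omega>) = 0" using prob_norm_nonneg by (metis antisym)
  then show ?thesis by (subst (asm) prob_norm_eq_0_iff) auto
qed

lemma tendsto_in_prob_add:
  assumes "tendsto_in_prob M X Y" "tendsto_in_prob M X' Z"
  shows "tendsto_in_prob M (\<lambda>n \<omega>. X n \<omega> + X' n \<omega>) (\<lambda>\<omega>. Y \<omega> + Z \<omega>)"
proof -
  have [measurable]: "\<And>n. X n \<in> borel_measurable M" "\<And>n. X' n \<in> borel_measurable M"
    "Y \<in> borel_measurable M" "Z \<in> borel_measurable M"
    using assms by (auto simp: tendsto_in_prob_iff)
  have le: "prob_norm M (\<lambda>\<omega>. X n \<omega> + X' n \<omega> - (Y \<omega> + Z \<omega>)) \<le>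
     prob_norm M (\<lambda>\<omega>. X n \<omega> - Y \<omega>) + prob_norm M (\<lambda>\<omega>. X' n \<omega> - Z \<omega>)" for n
    using prob_norm_add[of "\<lambda>\<omega>. X n \<omega> - Y \<omega>" "\<lambda>\<omega>. X' n \<omega> - Z \<omega>"] by (simp add: algebra_simps)
  have "(\<lambda>n. prob_norm M (\<lambda>\<omega>. X n \<omega> - Y \<omega>) + prob_norm M (\<lambda>\<omega>. X' n \<omega> - Z \<omega>)) \<longlonglongrightarrow> 0 + 0"
    using assms by (intro tendsto_add) (auto simp: tendsto_in_prob_iff)
  from this[simplified] have "(\<lambda>n. prob_norm M (\<lambda>\<omega>. X n \<omega> + X' n \<omega> - (Y \<omega> + Z \<omega>))) \<longlonglongrightarrow> 0"
    using le by (intro prob_norm_squeeze) simp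
  then show ?thesis by (auto simp: tendsto_in_prob_iff)
qed

lemma tendsto_in_prob_cmult:
  assumes "tendsto_in_prob M X Y"
  shows "tendsto_in_prob M (\<lambda>n \<omega>. c * X n \<omega>) (\<lambda>\<omega>. c * Y \<omega>)"
proof -
  have [measurable]: "\<And>n. X n \<in> borel_measurable M" "Y \<in> borel_measurable M"
    using assms by (auto simp: tendsto_in_prob_iff)
  have le: "prob_norm M (\<lambda>\<omega>. c * X n \<omega> - c * Y \<omega>) \<le> max 1 \<bar>c\<bar> * prob_norm M (\<lambda>\<omega>. X n \<omega> - Y \<omega>)" for n
    using prob_norm_cmult[of "\<lambda>\<omega>. X n \<omega> - Y \<omega>" c] by (simp add: algebra_simps)
  have "(\<lambda>n. max 1 \<bar>c\<bar> * prob_norm M (\<lambda>\<omega>. X n \<omega> - Y \<omega>)) \<longlonglongrightarrow> max 1 \<bar>c\<bar> * 0"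
    using assms by (intro tendsto_mult_left) (auto simp: tendsto_in_prob_iff)
  then have "(\<lambda>n. max 1 \<bar>c\<bar> * prob_norm M (\<lambda>\<omega>. X n \<omega> - Y \<omega>)) \<longlonglongrightarrow> 0" by (simp only: mult_zero_right)
  then have "(\<lambda>n. prob_norm M (\<lambda>\<omega>. c * X n \<omega> - c * Y \<omega>)) \<longlonglongrightarrow> 0"
    by (rule prob_norm_squeeze) (rule le)
  then show ?thesis by (auto simp: tendsto_in_prob_iff)
qed

lemma tendsto_in_prob_cong:
  assumes "tendsto_in_prob M X Y" "\<And>n. X' n \<in> borel_measurable M" "Z \<in> borel_measurable M"
    "\<And>n. AE \<omega> in M. X n \<omega> = X' n \<omega>" "AE \<omega> in M. Y \<omega> = Z \<omega>"
  shows "tendsto_in_prob M X' Z"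
proof -
  have [measurable]: "\<And>n. X n \<in> borel_measurable M" "Y \<in> borel_measurable M"
    using assms by (auto simp: tendsto_in_prob_iff)
  have "prob_norm M (\<lambda>\<omega>. X' n \<omega> - Z \<omega>) = prob_norm M (\<lambda>\<omega>. X n \<omega> - Y \<omega>)" for n
  proof (rule prob_norm_cong_AE)
    show "AE \<omega> in M. X' n \<omega> - Z \<omega> = X n \<omega> - Y \<omega>"
      using assms(4)[of n] assms(5) by eventually_elim simp
  qed (use assms(2,3) in auto)
  then show ?thesis using assms by (simp add: tendsto_in_prob_iff)
qed

end

section \<open>Stochastic measures\<close>

locale stoch_measure = prob_space M for M :: "'w measure" +
  fixes N :: "'a measure" and \<mu> :: "'a set \<Rightarrow> 'w \<Rightarrow> real"
  assumes stochastic_measure: "stochastic_measure M N \<mu>"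
begin

lemma mu_measurable [measurable, simp]: "A \<in> sets N \<Longrightarrow> \<mu> A \<in> borel_measurable M"
  using stochastic_measure by (simp add: stochastic_measure_def)

lemma mu_sums:
  assumes "\<And>i::nat. A i \<in> sets N" "disjoint_family A"
  shows "tendsto_in_prob M (\<lambda>n \<omega>. \<Sum>i<n. \<mu> (A i) \<omega>) (\<mu> (\<Union>i. A i))"
  using stochastic_measure assms by (auto simp: stochastic_measure_def)

text \<open>
  The values are the differences of consecutive partial sums of a convergent series.
\<close>

lemma mu_disjoint_tendsto:
  assumes A: "\<And>i::nat. A i \<in> sets N" "disjoint_family A"
  shows "(\<lambda>n. prob_norm M (\<mu> (A n))) \<longlonglongrightarrow> 0"
proof -
  note S = mu_sums[OF A]
  have [measurable]: "\<mu> (\<Union>i. A i) \<in> borel_measurable M" using S by (auto simp: tendsto_in_prob_iff)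
  let ?D = "\<lambda>n. prob_norm M (\<lambda>\<omega>. (\<Sum>i<n. \<mu> (A i) \<omega>) - \<mu> (\<Union>i. A i) \<omega>)"
  have "?D \<longlonglongrightarrow> 0" using S by (auto simp: tendsto_in_prob_iff)
  then have lim: "(\<lambda>n. ?D (Suc n) + ?D n) \<longlonglongrightarrow> 0 + 0" by (intro tendsto_add LIMSEQ_Suc)
  have le: "prob_norm M (\<mu> (A n)) \<le> ?D (Suc n) + ?D n" for n
    using prob_norm_diff[of "\<lambda>\<omega>. (\<Sum>i<Suc n. \<mu> (A i) \<omega>) - \<mu> (\<Union>i. A i) \<omega>" "\<lambda>\<omega>. (\<Sum>i<n. \<mu> (A i) \<omega>) - \<mu> (\<Union>i. A i) \<omega>"]
      A by simp
  show ?thesis by (rule prob_norm_squeeze[OF lim[unfolded add_0_left]]) (rule le)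
qed

lemma mu_empty: "AE \<omega> in M. \<mu> {} \<omega> = 0"
proof -
  have "(\<lambda>n::nat. prob_norm M (\<mu> {})) \<longlonglongrightarrow> 0"
    by (rule mu_disjoint_tendsto) (auto simp: disjoint_family_on_def)
  then have "prob_norm M (\<mu> {}) = 0" by (simp add: LIMSEQ_const_iff)
  then show ?thesis by (subst (asm) prob_norm_eq_0_iff) auto
qed

lemma mu_finite_Union_lessThan:
  fixes n :: nat
  assumes A: "\<And>i. i < n \<Longrightarrow> A i \<in> sets N" "disjoint_family_on A {..<n}"
  shows "AE \<omega> in M. \<mu> (\<Union>i<n. A i) \<omega> = (\<Sum>i<n. \<mu> (A i) \<omega>)"
proof -
  define B where "B = (\<lambda>i. if i < n then A i else {})"
  have B: "\<And>i. B i \<in> sets N" "disjoint_family B"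
    using A by (auto simp: B_def disjoint_family_on_def)
  have UB: "(\<Union>i. B i) = (\<Union>i<n. A i)" by (auto simp: B_def split: if_splits)
  have sB: "AE \<omega> in M. (\<Sum>i<k. \<mu> (B i) \<omega>) = (\<Sum>i<n. \<mu> (A i) \<omega>)" if "k \<ge> n" for k
  proof -
    have eq: "(\<Sum>i<k. \<mu> (B i) \<omega>) = (\<Sum>i<n. \<mu> (A i) \<omega>)" if z: "\<mu> {} \<omega> = 0" for \<omega>
    proof -
      have "(\<Sum>i<k. \<mu> (B i) \<omega>) = (\<Sum>i<n. \<mu> (B i) \<omega>)"
        using \<open>k \<ge> n\<close> z by (intro sum.mono_neutral_right) (auto simp: B_def)
      then show ?thesis by (simp add: B_def)
    qed
    show ?thesis using mu_empty by eventually_elim (rule eq)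
  qed
  have 1: "tendsto_in_prob M (\<lambda>k \<omega>. \<Sum>i<k + n. \<mu> (B i) \<omega>) (\<mu> (\<Union>i. B i))"
    using mu_sums[OF B] by (auto simp: tendsto_in_prob_iff intro: LIMSEQ_ignore_initial_segment)
  have 2: "tendsto_in_prob M (\<lambda>k \<omega>. \<Sum>i<n. \<mu> (A i) \<omega>) (\<lambda>\<omega>. \<Sum>i<n. \<mu> (A i) \<omega>)"
    using A(1) by (auto simp: tendsto_in_prob_iff prob_norm_def intro!: borel_measurable_sum)
  show ?thesis using tendsto_in_prob_unique[OF 1 2 sB] by (simp add: UB)
qed

lemma mu_finite_Union:
  assumes "finite I" "\<And>i. i \<in> I \<Longrightarrow> A i \<in> sets N" "disjoint_family_on A I"
  shows "AE \<omega> in M. \<mu> (\<Union>i\<in>I. A i) \<omega> = (\<Sum>i\<in>I. \<mu> (A i) \<omega>)"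
proof -
  obtain h where "bij_betw h {0..<card I} I" using \<open>finite I\<close> ex_bij_betw_nat_finite by blast
  then have h: "bij_betw h {..<card I} I" by (simp add: lessThan_atLeast0)
  have "disjoint_family_on (\<lambda>i. A (h i)) {..<card I}"
    unfolding disjoint_family_on_def
  proof (intro ballI impI)
    fix m n assume mn: "m \<in> {..<card I}" "n \<in> {..<card I}" "m \<noteq> n"
    then have "h m \<in> I" "h n \<in> I" "h m \<noteq> h n"
      using h by (auto simp: bij_betw_def dest: inj_onD)
    then show "A (h m) \<inter> A (h n) = {}" using assms(3) by (auto simp: disjoint_family_on_def)
  qed
  then have "AE \<omega> in M. \<mu> (\<Union>i<card I. A (h i)) \<omega> = (\<Sum>i<card I. \<mu> (A (h i)) \<omega>)"
    using h assms(2) by (intro mu_finite_Union_lessThan) (auto simp: bij_betw_def)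
  moreover have "(\<Union>i<card I. A (h i)) = (\<Union>i\<in>I. A i)"
  proof -
    have "(\<Union>i\<in>h ` {..<card I}. A i) = (\<Union>i\<in>I. A i)" using h by (simp add: bij_betw_def)
    then show ?thesis by (simp only: image_image)
  qed
  moreover have "(\<Sum>i<card I. \<mu> (A (h i)) \<omega>) = (\<Sum>i\<in>I. \<mu> (A i) \<omega>)" for \<omega>
    using sum.reindex_bij_betw[OF h, of "\<lambda>i. \<mu> (A i) \<omega>"] by simp
  ultimately show ?thesis by simp
qed

lemma mu_Un:
  assumes "A \<in> sets N" "B \<in> sets N" "A \<inter> B = {}"
  shows "AE \<omega> in M. \<mu> (A \<union> B) \<omega> = \<mu> A \<omega> + \<mu> B \<omega>"
proof -
  have "AE \<omega> in M. \<mu> (\<Union>b\<in>{True, False}. if b then A else B) \<omega> =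
      (\<Sum>b\<in>{True, False}. \<mu> (if b then A else B) \<omega>)"
    using assms by (intro mu_finite_Union) (auto simp: disjoint_family_on_def)
  moreover have "(\<Union>b\<in>{True, False}. if b then A else B) = A \<union> B" by auto
  ultimately show ?thesis by simp
qed

lemma mu_Int_Diff:
  assumes "A \<in> sets N" "B \<in> sets N"
  shows "AE \<omega> in M. \<mu> A \<omega> = \<mu> (A \<inter> B) \<omega> + \<mu> (A - B) \<omega>"
proof -
  have "A \<inter> B \<union> (A - B) = A" "(A \<inter> B) \<inter> (A - B) = {}" by auto
  then show ?thesis using mu_Un[of "A \<inter> B" "A - B"] assms by auto
qed

text \<open>
  The sets \<open>C n - C (Suc n)\<close> partition \<open>C 0\<close>, and \<open>\<mu> (C n)\<close> is the remainder of the corresponding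
  series.
\<close>

lemma mu_decseq_tendsto:
  assumes C: "\<And>n. C n \<in> sets N" "decseq C" "(\<Inter>n. C n) = {}"
  shows "(\<lambda>n. prob_norm M (\<mu> (C n))) \<longlonglongrightarrow> 0"
proof -
  define R where "R = (\<lambda>n. C n - C (Suc n))"
  have R: "\<And>i. R i \<in> sets N" using C by (auto simp: R_def)
  have Rn: "R m \<inter> R n = {}" if "m < n" for m n
    using decseqD[OF C(2), of "Suc m" n] that by (auto simp: R_def)
  have disj: "disjoint_family R"
    unfolding disjoint_family_on_def using Rn by (metis Int_commute linorder_neqE_nat)
  have part: "(\<Union>i<n. R i) = C 0 - C n" for n
  proof (induction n)
    case (Suc n)
    have "(\<Union>i<Suc n. R i) = (C 0 - C n) \<union> R n" using Suc by (auto simp: lessThan_Suc)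
    also have "\<dots> = C 0 - C (Suc n)"
      using decseqD[OF C(2), of n "Suc n"] decseqD[OF C(2), of 0 n] by (auto simp: R_def)
    finally show ?case .
  qed auto
  have un: "(\<Union>i. R i) = C 0"
  proof -
    have "(\<Union>i. R i) = (\<Union>n. \<Union>i<n. R i)" by auto
    also have "\<dots> = (\<Union>n. C 0 - C n)" unfolding part ..
    also have "\<dots> = C 0" using C(3) by auto
    finally show ?thesis .
  qed
  have "prob_norm M (\<lambda>\<omega>. (\<Sum>i<n. \<mu> (R i) \<omega>) - \<mu> (C 0) \<omega>) = prob_norm M (\<mu> (C n))" for n
  proof -
    have 1: "AE \<omega> in M. \<mu> (C 0 - C n) \<omega> = (\<Sum>i<n. \<mu> (R i) \<omega>)"
      unfolding part[symmetric]
      using R disj by (intro mu_finite_Union_lessThan) (auto simp: disjoint_family_on_def)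
    have 2: "AE \<omega> in M. \<mu> (C 0) \<omega> = \<mu> (C 0 \<inter> C n) \<omega> + \<mu> (C 0 - C n) \<omega>"
      using C by (intro mu_Int_Diff) auto
    have 3: "C 0 \<inter> C n = C n" using decseqD[OF C(2), of 0 n] by auto
    have "prob_norm M (\<lambda>\<omega>. (\<Sum>i<n. \<mu> (R i) \<omega>) - \<mu> (C 0) \<omega>) = prob_norm M (\<lambda>\<omega>. - \<mu> (C n) \<omega>)"
    proof (rule prob_norm_cong_AE)
      show "AE \<omega> in M. (\<Sum>i<n. \<mu> (R i) \<omega>) - \<mu> (C 0) \<omega> = - \<mu> (C n) \<omega>"
        using 1 2 unfolding 3 by eventually_elim simp
    qed (use R C in auto)
    then show ?thesis by simp
  qed
  moreover have "(\<lambda>n. prob_norm M (\<lambda>\<omega>. (\<Sum>i<n. \<mu> (R i) \<omega>) - \<mu> (C 0) \<omega>)) \<longlonglongrightarrow> 0"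
    using mu_sums[OF R disj] unfolding un tendsto_in_prob_iff by blast
  ultimately show ?thesis by simp
qed

end

subsection \<open>Boundedness of the range\<close>

text \<open>
  The probabilistic method: some subset does at least as well as the average.
\<close>

lemma bern_avg_le_value:
  assumes "finite I" "\<And>i. i \<in> I \<Longrightarrow> 0 \<le> q i \<and> q i \<le> 1"
  obtains T where "T \<subseteq> I" "bern_avg q I F \<le> F T"
proof -
  have "Max (F ` Pow I) \<in> F ` Pow I" using assms(1) by (intro Max_in) auto
  then obtain T where "T \<in> Pow I" "Max (F ` Pow I) = F T" by (rule imageE)
  then have T: "T \<subseteq> I" "Max (F ` Pow I) = F T" by simp_all
  have le: "F S \<le> F T" if S: "S \<subseteq> I" for S
  proof -
    have "F S \<in> F ` Pow I" using S by (intro imageI PowI)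
    moreover have "finite (F ` Pow I)" using assms(1) by (intro finite_imageI) simp
    ultimately have "F S \<le> Max (F ` Pow I)" by (intro Max_ge)
    then show ?thesis using T(2) by simp
  qed
  have "bern_avg q I F \<le> bern_avg q I (\<lambda>_. F T)"
    by (intro bern_avg_mono assms(2) le) simp_all
  then show ?thesis using that[OF T(1)] bern_avg_const[OF assms(1)] by simp
qed

lemma sum_lessThan_double:
  fixes k :: nat and f :: "nat \<Rightarrow> real"
  shows "sum f {..<k + k} = (\<Sum>i<k. f i + f (k + i))"
proof -
  have "sum f {0..<k + k} = sum f {0..<k} + sum f {0 + k..<k + k}"
    by (simp only: add_0 sum.atLeastLessThan_concat le_add1 le0)
  also have "sum f {0 + k..<k + k} = (\<Sum>i\<in>{0..<k}. f (k + i))"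
    by (subst sum.shift_bounds_nat_ivl) (simp only: add.commute)
  finally show ?thesis by (simp only: lessThan_atLeast0 sum.distrib)
qed

context prob_space
begin

text \<open>
  Fubini's theorem for the random subset and \<open>\<omega>\<close>.
\<close>

lemma bern_avg_prob:
  assumes I: "finite I" and q: "\<And>i. i \<in> I \<Longrightarrow> 0 \<le> q i \<and> q i \<le> 1"
    and \<phi>: "\<And>T. T \<subseteq> I \<Longrightarrow> {\<omega>\<in>space M. \<phi> T \<omega>} \<in> events" and E: "E \<in> events"
    and c: "AE \<omega> in M. \<omega> \<in> E \<longrightarrow> c \<le> bern_avg q I (\<lambda>T. of_bool (\<phi> T \<omega>))"
  shows "c * prob E \<le> bern_avg q I (\<lambda>T. prob {\<omega>\<in>space M. \<phi> T \<omega>})"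
proof -
  let ?w = "\<lambda>T. (\<Prod>i\<in>T. q i) * (\<Prod>i\<in>I - T. 1 - q i)"
  let ?i = "\<lambda>T. indicator {\<omega>\<in>space M. \<phi> T \<omega>} :: 'a \<Rightarrow> real"
  have int: "integrable M (?i T)" if "T \<subseteq> I" for T
    using \<phi>[OF that] by (intro integrable_real_indicator) (auto simp: emeasure_eq_measure)
  have int': "integrable M (\<lambda>\<omega>. bern_avg q I (\<lambda>T. ?i T \<omega>))"
    unfolding bern_avg_def using int by (intro Bochner_Integration.integrable_sum integrable_mult_right) auto
  have "c * prob E = (\<integral>\<omega>. c * indicator E \<omega> \<partial>M)" using E by simp
  also have "\<dots> \<le> (\<integral>\<omega>. bern_avg q I (\<lambda>T. ?i T \<omega>) \<partial>M)"
  proof (rule integral_mono_AE)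
    show "integrable M (\<lambda>\<omega>. c * indicator E \<omega>)" using E by (intro integrable_mult_right integrable_real_indicator) (auto simp: emeasure_eq_measure)
    show "AE \<omega> in M. c * indicator E \<omega> \<le> bern_avg q I (\<lambda>T. ?i T \<omega>)"
      using c AE_space
    proof eventually_elim
      case (elim \<omega>)
      have "bern_avg q I (\<lambda>T. ?i T \<omega>) = bern_avg q I (\<lambda>T. of_bool (\<phi> T \<omega>))"
        using elim by (intro bern_avg_cong) (auto simp: indicator_def)
      moreover have "0 \<le> bern_avg q I (\<lambda>T. of_bool (\<phi> T \<omega>))"
        using bern_avg_mono[of I q "\<lambda>_. 0" "\<lambda>T. of_bool (\<phi> T \<omega>)"] q I by simp
      ultimately show ?case using elim by (auto simp: indicator_def)
    qed
  qed (rule int')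
  also have "\<dots> = (\<Sum>T\<in>Pow I. \<integral>\<omega>. ?w T * ?i T \<omega> \<partial>M)"
    unfolding bern_avg_def using int by (intro Bochner_Integration.integral_sum integrable_mult_right) auto
  also have "\<dots> = bern_avg q I (\<lambda>T. prob {\<omega>\<in>space M. \<phi> T \<omega>})"
    unfolding bern_avg_def using \<phi> by (intro sum.cong refl) simp
  finally show ?thesis .
qed

lemma integrable_min_const:
  assumes [measurable]: "X \<in> borel_measurable M" and "\<And>\<omega>. 0 \<le> X \<omega>" "0 \<le> (c::real)"
  shows "integrable M (\<lambda>\<omega>. min c (X \<omega>))"
  using assms(2,3) by (intro integrable_const_bound[where B=c] AE_I2) auto

lemma exists_prob_gt_le:
  assumes [measurable]: "X \<in> borel_measurable M" and "e > 0"
  obtains K where "K \<ge> K0" "prob {\<omega>\<in>space M. K < \<bar>X \<omega> :: real\<bar>} \<le> e"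
proof -
  have "(\<lambda>n. prob {\<omega>\<in>space M. real n < \<bar>X \<omega>\<bar>}) \<longlonglongrightarrow> prob (\<Inter>n. {\<omega>\<in>space M. real n < \<bar>X \<omega>\<bar>})"
    by (intro finite_Lim_measure_decseq) (auto simp: decseq_def)
  also have "(\<Inter>n. {\<omega>\<in>space M. real n < \<bar>X \<omega>\<bar>}) = {}"
  proof -
    have "\<exists>n. \<not> real n < \<bar>X \<omega>\<bar>" for \<omega> using reals_Archimedean2[of "\<bar>X \<omega>\<bar>"] by (auto simp: not_less intro: less_imp_le)
    then show ?thesis by blast
  qed
  finally have "(\<lambda>n. prob {\<omega>\<in>space M. real n < \<bar>X \<omega>\<bar>}) \<longlonglongrightarrow> 0" by simp
  from LIMSEQ_D[OF this \<open>e > 0\<close>] obtain n where n: "prob {\<omega>\<in>space M. real n < \<bar>X \<omega>\<bar>} < e" by auto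
  have "prob {\<omega>\<in>space M. max K0 (real n) < \<bar>X \<omega>\<bar>} \<le> prob {\<omega>\<in>space M. real n < \<bar>X \<omega>\<bar>}"
    by (intro finite_measure_mono) auto
  then show ?thesis using that[of "max K0 (real n)"] n by simp
qed

end

context stoch_measure
begin

text \<open>
  Unboundedness of the values on subsets of \<open>A\<close>, with level \<open>p\<close>. Finite families of disjoint sets
  instead of single sets are allowed because the level then survives a passage to smaller sets:
  cutting the members of a family by a finite partition gives a family of the same kind, whose
  largest value is smaller at most by a constant factor. By \<open>unbounded_on_single\<close> a single set attains the
  level \<open>p / 4\<close>.
\<close>

definition unbounded_on :: "real \<Rightarrow> 'a set \<Rightarrow> bool" where
  "unbounded_on p A \<longleftrightarrow> (\<forall>K. \<exists>\<B>. finite \<B> \<and> \<B> \<subseteq> sets N \<and> disjoint \<B> \<and> (\<forall>B\<in>\<B>. B \<subseteq> A) \<and>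
     p \<le> prob {\<omega>\<in>space M. \<exists>B\<in>\<B>. K < \<bar>\<mu> B \<omega>\<bar>})"

lemma unbounded_onE:
  assumes "unbounded_on p A"
  obtains \<B> where "finite \<B>" "\<And>B. B \<in> \<B> \<Longrightarrow> B \<in> sets N" "disjoint \<B>" "\<And>B. B \<in> \<B> \<Longrightarrow> B \<subseteq> A"
    "p \<le> prob {\<omega>\<in>space M. \<exists>B\<in>\<B>. K < \<bar>\<mu> B \<omega>\<bar>}"
proof -
  from assms[unfolded unbounded_on_def, THEN spec[of _ K]] obtain \<B> where
    B: "finite \<B> \<and> \<B> \<subseteq> sets N \<and> disjoint \<B> \<and> (\<forall>B\<in>\<B>. B \<subseteq> A) \<and>
     p \<le> prob {\<omega>\<in>space M. \<exists>B\<in>\<B>. K < \<bar>\<mu> B \<omega>\<bar>}" ..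
  show ?thesis by (rule that[of \<B>]) (use B in blast)+
qed

text \<open>
  A random union of members of the family is as large as the largest member, up to the factor \<open>2\<close>,
  with conditional probability at least \<open>1/4\<close>.
\<close>

lemma unbounded_on_single:
  assumes "unbounded_on p A"
  obtains D where "D \<in> sets N" "D \<subseteq> A" "p / 4 \<le> prob {\<omega>\<in>space M. K < \<bar>\<mu> D \<omega>\<bar>}"
proof -
  define L where "L = max K 0"
  obtain \<B> where \<B>: "finite \<B>" "\<And>B. B \<in> \<B> \<Longrightarrow> B \<in> sets N" "disjoint \<B>" "\<And>B. B \<in> \<B> \<Longrightarrow> B \<subseteq> A"
    "p \<le> prob {\<omega>\<in>space M. \<exists>B\<in>\<B>. 2 * L < \<bar>\<mu> B \<omega>\<bar>}"
    by (rule unbounded_onE[OF assms, of "2 * L"]) blast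
  define E where "E = {\<omega>\<in>space M. \<exists>B\<in>\<B>. 2 * L < \<bar>\<mu> B \<omega>\<bar>}"
  let ?q = "\<lambda>_ :: 'a set. 1 / 2 :: real"
  have UT: "\<Union>T \<in> sets N" if "T \<subseteq> \<B>" for T
    using finite_subset[OF that \<B>(1)] \<B>(2) that by (intro sets.finite_Union subsetI) blast+
  have add: "AE \<omega> in M. \<forall>T\<in>Pow \<B>. \<mu> (\<Union>T) \<omega> = (\<Sum>B\<in>T. \<mu> B \<omega>)"
  proof (rule AE_finite_allI)
    fix T assume T: "T \<in> Pow \<B>"
    then have "T \<subseteq> \<B>" by simp
    then have "disjoint_family_on (\<lambda>B. B) T"
      using \<B>(3) unfolding disjoint_family_on_def disjoint_def by blast
    moreover have "finite T" using finite_subset[OF \<open>T \<subseteq> \<B>\<close> \<B>(1)] .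
    ultimately have "AE \<omega> in M. \<mu> (\<Union>B\<in>T. B) \<omega> = (\<Sum>B\<in>T. \<mu> B \<omega>)"
      using \<open>T \<subseteq> \<B>\<close> by (intro mu_finite_Union) (blast intro: \<B>(2))+
    then show "AE \<omega> in M. \<mu> (\<Union>T) \<omega> = (\<Sum>B\<in>T. \<mu> B \<omega>)" by simp
  qed (use \<B> in auto)
  have [measurable]: "E \<in> events"
    unfolding E_def by (intro sets.sets_Collect_finite_Ex \<B>(1)) (use \<B>(2) in measurable)
  have "1 / 4 * prob E \<le> bern_avg ?q \<B> (\<lambda>T. prob {\<omega>\<in>space M. L < \<bar>\<mu> (\<Union>T) \<omega>\<bar>})"
  proof (rule bern_avg_prob)
    show "AE \<omega> in M. \<omega> \<in> E \<longrightarrow> 1 / 4 \<le> bern_avg ?q \<B> (\<lambda>T. of_bool (L < \<bar>\<mu> (\<Union>T) \<omega>\<bar>))"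
      using add
    proof eventually_elim
      case (elim \<omega>)
      show ?case
      proof
        assume "\<omega> \<in> E"
        then have "{B\<in>\<B>. 2 * L < \<bar>\<mu> B \<omega>\<bar>} \<noteq> {}" by (auto simp: E_def)
        then have "1 \<le> card {B\<in>\<B>. 2 * L < \<bar>\<mu> B \<omega>\<bar>}" using \<B>(1) by (simp add: Suc_le_eq card_gt_0_iff)
        then have "1 / 4 \<le> bern_avg (\<lambda>_. 1 / (2 * real 1)) \<B> (\<lambda>T. of_bool (L < \<bar>\<Sum>B\<in>T. \<mu> B \<omega>\<bar>))"
          using \<B>(1) by (intro bern_avg_large_partial_sum) (auto simp: L_def)
        also have "\<dots> = bern_avg ?q \<B> (\<lambda>T. of_bool (L < \<bar>\<mu> (\<Union>T) \<omega>\<bar>))"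
          using elim by (simp, intro bern_avg_cong) auto
        finally show "1 / 4 \<le> bern_avg ?q \<B> (\<lambda>T. of_bool (L < \<bar>\<mu> (\<Union>T) \<omega>\<bar>))" .
      qed
    qed
  next
    fix T assume "T \<subseteq> \<B>"
    then have [measurable]: "\<Union>T \<in> sets N" by (rule UT)
    show "{\<omega>\<in>space M. L < \<bar>\<mu> (\<Union>T) \<omega>\<bar>} \<in> events" by measurable
  qed (use \<B>(1) \<open>E \<in> events\<close> in auto)
  moreover obtain T where T: "T \<subseteq> \<B>" "bern_avg ?q \<B> (\<lambda>T. prob {\<omega>\<in>space M. L < \<bar>\<mu> (\<Union>T) \<omega>\<bar>}) \<le> prob {\<omega>\<in>space M. L < \<bar>\<mu> (\<Union>T) \<omega>\<bar>}"
    using bern_avg_le_value[OF \<B>(1), of ?q "\<lambda>T. prob {\<omega>\<in>space M. L < \<bar>\<mu> (\<Union>T) \<omega>\<bar>}"] by auto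
  moreover have "prob {\<omega>\<in>space M. L < \<bar>\<mu> (\<Union>T) \<omega>\<bar>} \<le> prob {\<omega>\<in>space M. K < \<bar>\<mu> (\<Union>T) \<omega>\<bar>}"
    using UT[OF T(1)] by (intro finite_measure_mono) (auto simp: L_def)
  ultimately have "p / 4 \<le> prob {\<omega>\<in>space M. K < \<bar>\<mu> (\<Union>T) \<omega>\<bar>}" using \<B>(5) unfolding E_def by linarith
  then show ?thesis using that[of "\<Union>T"] UT[OF T(1)] T(1) \<B>(4) by blast
qed

text \<open>
  A partition is refined by a set \<open>D\<close> on which \<open>\<mu>\<close> is huge compared with its values on the cells.
  Every cell with a value above \<open>2 * K\<close> keeps a part with a value above \<open>K\<close>. In addition, where \<open>\<mu> D\<close>
  is huge, some cell is cut by \<open>D\<close> into two huge parts that almost cancel, which yields one more large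
  cell. So the truncated expected number of large cells grows by a fixed amount with every step.
\<close>

lemma unbounded_on_many_large_expectation:
  assumes unb: "unbounded_on p A" and A: "A \<in> sets N" and p: "p > 0" and "K \<ge> 0"
  shows "\<exists>k B. (\<forall>i<k. B i \<in> sets N) \<and> disjoint_family_on B {..<k} \<and> (\<Union>i<k. B i) = A \<and>
    real n * (p / 8) \<le> expectation (\<lambda>\<omega>. min (real n) (\<Sum>i<k::nat. of_bool (K < \<bar>\<mu> (B i) \<omega>\<bar>)))"
  using \<open>K \<ge> 0\<close>
proof (induction n arbitrary: K)
  case 0
  show ?case
    by (rule exI[of _ 1], rule exI[of _ "\<lambda>_. A"])
       (simp add: A disjoint_family_on_def min_def sum_nonneg lessThan_Suc)
next
  case (Suc n)
  have K2nn: "0 \<le> 2 * K" using Suc.prems by simp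
  obtain k :: nat and B where kB: "(\<forall>i<k. B i \<in> sets N) \<and> disjoint_family_on B {..<k} \<and> (\<Union>i<k. B i) = A \<and>
    real n * (p / 8) \<le> expectation (\<lambda>\<omega>. min (real n) (\<Sum>i<k::nat. of_bool (2 * K < \<bar>\<mu> (B i) \<omega>\<bar>)))"
    using Suc.IH[OF K2nn] by (elim exE) (rule that)
  have Bs: "B i \<in> sets N" if "i < k" for i using kB that by simp
  note B2 = kB[THEN conjunct2, THEN conjunct1] and B3 = kB[THEN conjunct2, THEN conjunct2, THEN conjunct1]
  note IH = kB[THEN conjunct2, THEN conjunct2, THEN conjunct2]
  have [measurable]: "\<And>i. i < k \<Longrightarrow> \<mu> (B i) \<in> borel_measurable M" using Bs by simp
  define Y where "Y = (\<lambda>\<omega>. \<Sum>i<k. \<bar>\<mu> (B i) \<omega>\<bar>)"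
  have [measurable]: "Y \<in> borel_measurable M" unfolding Y_def by measurable
  \<comment> \<open>\<open>K2\<close> bounds all values on cells outside an event of probability \<open>p / 8\<close>\<close>
  obtain K2 where K2: "K2 \<ge> K" "prob {\<omega>\<in>space M. K2 < \<bar>Y \<omega>\<bar>} \<le> p / 8"
    using exists_prob_gt_le[of Y "p / 8" K] p by auto
  obtain D where D: "D \<in> sets N" "D \<subseteq> A" "p / 4 \<le> prob {\<omega>\<in>space M. real k * (2 * K2) < \<bar>\<mu> D \<omega>\<bar>}"
    by (rule unbounded_on_single[OF unb]) blast
  have [measurable]: "\<And>i. i < k \<Longrightarrow> \<mu> (B i \<inter> D) \<in> borel_measurable M" "\<And>i. i < k \<Longrightarrow> \<mu> (B i - D) \<in> borel_measurable M"
    "\<mu> D \<in> borel_measurable M" using Bs D(1) by simp_all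
  define S where "S = {\<omega>\<in>space M. real k * (2 * K2) < \<bar>\<mu> D \<omega>\<bar>} - {\<omega>\<in>space M. K2 < \<bar>Y \<omega>\<bar>}"
  have [measurable]: "S \<in> events" unfolding S_def by measurable
  have pS: "p / 8 \<le> prob S"
  proof -
    have "prob {\<omega>\<in>space M. real k * (2 * K2) < \<bar>\<mu> D \<omega>\<bar>} \<le> prob (S \<union> {\<omega>\<in>space M. K2 < \<bar>Y \<omega>\<bar>})"
      by (intro finite_measure_mono) (auto simp: S_def)
    also have "\<dots> \<le> prob S + prob {\<omega>\<in>space M. K2 < \<bar>Y \<omega>\<bar>}" by (intro measure_Un_le) auto
    finally show ?thesis using D K2 by linarith
  qed
  define B' where "B' = (\<lambda>i. if i < k then B i \<inter> D else B (i - k) - D)"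
  have B'1: "B' i \<in> sets N" if "i < k + k" for i
    using that Bs[of i] Bs[of "i - k"] D(1) by (auto simp: B'_def)
  have B'2: "disjoint_family_on B' {..<k + k}"
    unfolding disjoint_family_on_def
  proof (intro ballI impI)
    fix i j assume ij: "i \<in> {..<k + k}" "j \<in> {..<k + k}" "i \<noteq> j"
    have dB: "B a \<inter> B b = {}" if "a < k" "b < k" "a \<noteq> b" for a b
      using B2 that by (auto simp: disjoint_family_on_def)
    show "B' i \<inter> B' j = {}"
    proof (cases "i < k \<longleftrightarrow> j < k")
      case True
      have "B (if i < k then i else i - k) \<inter> B (if j < k then j else j - k) = {}"
        using ij True by (intro dB) (auto split: if_splits)
      then show ?thesis using True by (auto simp: B'_def split: if_splits)
    qed (auto simp: B'_def split: if_splits)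
  qed
  have B'3: "(\<Union>i<k + k. B' i) = A"
  proof
    show "(\<Union>i<k + k. B' i) \<subseteq> A"
    proof (rule UN_least)
      fix i assume "i \<in> {..<k + k}"
      then have "B' i \<subseteq> (\<Union>i<k. B i)" by (cases "i < k") (force simp: B'_def)+
      then show "B' i \<subseteq> A" unfolding B3 .
    qed
    show "A \<subseteq> (\<Union>i<k + k. B' i)"
    proof
      fix x assume "x \<in> A"
      then obtain i where i: "i < k" "x \<in> B i" using B3[symmetric] by blast
      then have "x \<in> B' i \<or> x \<in> B' (k + i)" by (auto simp: B'_def)
      moreover have "i \<in> {..<k + k}" "k + i \<in> {..<k + k}" using i by auto
      ultimately show "x \<in> (\<Union>i<k + k. B' i)" by blast
    qed
  qed
  have split: "AE \<omega> in M. \<forall>i\<in>{..<k}. \<mu> (B i) \<omega> = \<mu> (B i \<inter> D) \<omega> + \<mu> (B i - D) \<omega>"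
    using Bs D(1) by (intro AE_finite_allI mu_Int_Diff) auto
  have muD: "AE \<omega> in M. \<mu> D \<omega> = (\<Sum>i<k. \<mu> (B i \<inter> D) \<omega>)"
  proof -
    have "AE \<omega> in M. \<mu> (\<Union>i<k. B i \<inter> D) \<omega> = (\<Sum>i<k. \<mu> (B i \<inter> D) \<omega>)"
    proof (rule mu_finite_Union)
      show "disjoint_family_on (\<lambda>i. B i \<inter> D) {..<k}" using B2 unfolding disjoint_family_on_def by blast
    qed (use Bs D(1) in auto)
    moreover have "(\<Union>i<k. B i \<inter> D) = D" using B3 D(2) by blast
    ultimately show ?thesis by simp
  qed
  let ?X = "\<lambda>\<omega>. \<Sum>i<k. of_bool (2 * K < \<bar>\<mu> (B i) \<omega>\<bar>) :: real"
  let ?X' = "\<lambda>\<omega>. \<Sum>i<k + k. of_bool (K < \<bar>\<mu> (B' i) \<omega>\<bar>) :: real"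
  have X': "?X' \<omega> = (\<Sum>i<k. of_bool (K < \<bar>\<mu> (B i \<inter> D) \<omega>\<bar>) + of_bool (K < \<bar>\<mu> (B i - D) \<omega>\<bar>))" for \<omega>
    unfolding sum_lessThan_double by (intro sum.cong) (auto simp: B'_def)
  have [measurable]: "?X \<in> borel_measurable M" "?X' \<in> borel_measurable M"
    unfolding X' by measurable
  have key: "AE \<omega> in M. min (real n) (?X \<omega>) + indicator S \<omega> \<le> min (real (Suc n)) (?X' \<omega>)"
    using split muD
  proof eventually_elim
    case (elim \<omega>)
    have tm: "of_bool (2 * K < \<bar>\<mu> (B i) \<omega>\<bar>) \<le>
       (of_bool (K < \<bar>\<mu> (B i \<inter> D) \<omega>\<bar>) + of_bool (K < \<bar>\<mu> (B i - D) \<omega>\<bar>) :: real)" if "i < k" for i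
      using elim(1) that by auto
    have "?X \<omega> + indicator S \<omega> \<le> ?X' \<omega>"
    proof (cases "\<omega> \<in> S")
      case False
      have "?X \<omega> \<le> ?X' \<omega>" unfolding X' by (intro sum_mono tm) simp
      then show ?thesis using False by simp
    next
      case True
      have "\<exists>i<k. 2 * K2 < \<bar>\<mu> (B i \<inter> D) \<omega>\<bar>"
      proof (rule ccontr)
        assume "\<not> ?thesis"
        then have "\<bar>\<mu> (B i \<inter> D) \<omega>\<bar> \<le> 2 * K2" if "i < k" for i using that not_less by blast
        then have "(\<Sum>i<k. \<bar>\<mu> (B i \<inter> D) \<omega>\<bar>) \<le> (\<Sum>i<k. 2 * K2)" by (intro sum_mono) simp
        then have "\<bar>\<mu> D \<omega>\<bar> \<le> real k * (2 * K2)"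
          unfolding elim(2) using order_trans[OF sum_abs[of "\<lambda>i. \<mu> (B i \<inter> D) \<omega>" "{..<k}"]] by simp
        then show False using True by (simp add: S_def)
      qed
      \<comment> \<open>the cell \<open>B j\<close> is the one that is cut into two large parts\<close>
      then obtain j where j: "j < k" "2 * K2 < \<bar>\<mu> (B j \<inter> D) \<omega>\<bar>" by blast
      have "\<bar>\<mu> (B j) \<omega>\<bar> \<le> Y \<omega>" unfolding Y_def using j by (intro member_le_sum) auto
      then have "\<bar>\<mu> (B j) \<omega>\<bar> \<le> K2" using True by (auto simp: S_def)
      then have jb: "K < \<bar>\<mu> (B j \<inter> D) \<omega>\<bar>" "K < \<bar>\<mu> (B j - D) \<omega>\<bar>"
        using elim(1) j K2(1) Suc.prems by auto
      have "?X \<omega> + 1 = (\<Sum>i\<in>{..<k} - {j}. of_bool (2 * K < \<bar>\<mu> (B i) \<omega>\<bar>)) + (of_bool (2 * K < \<bar>\<mu> (B j) \<omega>\<bar>) + 1)"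
        using j by (subst sum.remove[of _ j]) auto
      also have "\<dots> \<le> (\<Sum>i\<in>{..<k} - {j}. of_bool (K < \<bar>\<mu> (B i \<inter> D) \<omega>\<bar>) + of_bool (K < \<bar>\<mu> (B i - D) \<omega>\<bar>))
           + (of_bool (K < \<bar>\<mu> (B j \<inter> D) \<omega>\<bar>) + of_bool (K < \<bar>\<mu> (B j - D) \<omega>\<bar>))"
        using tm jb by (intro add_mono sum_mono) auto
      also have "\<dots> = ?X' \<omega>" unfolding X' using j by (subst (2) sum.remove[of _ j]) auto
      finally show ?thesis using True by simp
    qed
    then show ?case by (auto simp: indicator_def min_def split: if_splits)
  qed
  have int: "integrable M (\<lambda>\<omega>. min (real n) (?X \<omega>))" "integrable M (\<lambda>\<omega>. min (real (Suc n)) (?X' \<omega>))"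
    by (rule integrable_min_const; measurable; simp add: sum_nonneg)+
  have "real (Suc n) * (p / 8) \<le> expectation (\<lambda>\<omega>. min (real n) (?X \<omega>)) + prob S"
    using IH pS by (simp add: algebra_simps)
  also have "\<dots> = expectation (\<lambda>\<omega>. min (real n) (?X \<omega>) + indicator S \<omega>)"
    using int(1) by (subst Bochner_Integration.integral_add) (auto simp: emeasure_eq_measure intro!: integrable_real_indicator)
  also have "\<dots> \<le> expectation (\<lambda>\<omega>. min (real (Suc n)) (?X' \<omega>))"
    using int key by (intro integral_mono_AE Bochner_Integration.integrable_add integrable_real_indicator) (auto simp: emeasure_eq_measure)
  finally have fin: "real (Suc n) * (p / 8) \<le> expectation (\<lambda>\<omega>. min (real (Suc n)) (?X' \<omega>))" .
  show ?case
    by (rule exI[of _ "k + k"], rule exI[of _ B'], intro conjI allI impI B'1 B'2 B'3 fin)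
qed

text \<open>
  The number of large cells, truncated at \<open>n\<close>, has expectation at least \<open>n * (p / 8)\<close>. Less than \<open>m\<close> cells
  contribute at most \<open>n * (p / 16)\<close> if \<open>n\<close> is large, and the rest comes from the event that there are \<open>m\<close>
  of them. The level \<open>p / 16\<close> does not depend on \<open>m\<close>.
\<close>

lemma unbounded_on_many_large:
  assumes unb: "unbounded_on p A" and A: "A \<in> sets N" and p: "p > 0" and "K \<ge> 0"
  obtains k B where "\<And>i. i < k \<Longrightarrow> B i \<in> sets N" "disjoint_family_on B {..<k}" "(\<Union>i<k. B i) = A"
    "p / 16 \<le> prob {\<omega>\<in>space M. m \<le> card {i\<in>{..<k::nat}. K < \<bar>\<mu> (B i) \<omega>\<bar>}}"
proof -
  obtain n0 :: nat where "real m * 16 / p < real n0" using reals_Archimedean2 by blast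
  define n where "n = Suc n0"
  have n: "real m \<le> real n * (p / 16)" "n > 0"
    using \<open>real m * 16 / p < real n0\<close> p by (auto simp: n_def field_simps)
  obtain k :: nat and B where kB: "(\<forall>i<k. B i \<in> sets N) \<and> disjoint_family_on B {..<k} \<and> (\<Union>i<k. B i) = A \<and>
    real n * (p / 8) \<le> expectation (\<lambda>\<omega>. min (real n) (\<Sum>i<k::nat. of_bool (K < \<bar>\<mu> (B i) \<omega>\<bar>)))"
    using unbounded_on_many_large_expectation[OF assms, of n] by (elim exE) (rule that)
  have B: "B i \<in> sets N" if "i < k" for i using kB that by simp
  note B' = kB[THEN conjunct2, THEN conjunct1] kB[THEN conjunct2, THEN conjunct2, THEN conjunct1]
  note E = kB[THEN conjunct2, THEN conjunct2, THEN conjunct2]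
  have [measurable]: "\<And>i. i < k \<Longrightarrow> \<mu> (B i) \<in> borel_measurable M" using B by auto
  let ?X = "\<lambda>\<omega>. \<Sum>i<k. of_bool (K < \<bar>\<mu> (B i) \<omega>\<bar>) :: real"
  have Xm [measurable]: "?X \<in> borel_measurable M" by measurable
  have X: "?X \<omega> = real (card {i\<in>{..<k}. K < \<bar>\<mu> (B i) \<omega>\<bar>})" for \<omega>
    by (simp add: Collect_conj_eq Int_commute lessThan_def)
  define S where "S = {\<omega>\<in>space M. real m \<le> ?X \<omega>}"
  have [measurable, simp]: "S \<in> events" unfolding S_def by measurable
  have "expectation (\<lambda>\<omega>. min (real n) (?X \<omega>)) \<le> expectation (\<lambda>\<omega>. real n * (p / 16) + real n * indicator S \<omega>)"
  proof (rule integral_mono)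
    show "integrable M (\<lambda>\<omega>. min (real n) (?X \<omega>))"
      by (intro integrable_min_const Xm sum_nonneg) simp_all
    show "integrable M (\<lambda>\<omega>. real n * (p / 16) + real n * indicator S \<omega>)"
      by (intro Bochner_Integration.integrable_add integrable_mult_right integrable_real_indicator) (auto simp: emeasure_eq_measure)
    fix \<omega> assume "\<omega> \<in> space M"
    show "min (real n) (?X \<omega>) \<le> real n * (p / 16) + real n * indicator S \<omega>"
    proof (cases "\<omega> \<in> S")
      case True
      have "min (real n) (?X \<omega>) \<le> real n" "0 \<le> real n * (p / 16)" using p by auto
      then show ?thesis using True by simp
    next
      case False
      then have "?X \<omega> < real m" using \<open>\<omega> \<in> space M\<close> unfolding S_def by auto
      then have "min (real n) (?X \<omega>) \<le> real n * (p / 16)" using n(1) min.cobounded2[of "real n" "?X \<omega>"] by linarith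
      then show ?thesis using False by simp
    qed
  qed
  also have "\<dots> = real n * (p / 16) + real n * prob S"
    by (subst Bochner_Integration.integral_add)
       (auto simp: prob_space emeasure_eq_measure intro!: integrable_mult_right integrable_real_indicator)
  finally have "real n * (p / 8) \<le> real n * (p / 16 + prob S)" using E by (simp add: algebra_simps)
  then have "p / 8 \<le> p / 16 + prob S" using n(2) by (simp only: mult_le_cancel_left_pos of_nat_0_less_iff)
  then have "p / 16 \<le> prob S" by simp
  then have pm: "p / 16 \<le> prob {\<omega>\<in>space M. m \<le> card {i\<in>{..<k}. K < \<bar>\<mu> (B i) \<omega>\<bar>}}" unfolding S_def X by simp
  show ?thesis by (rule that[OF _ B' pm]) (rule B)
qed

end

context stoch_measure
begin

lemma exists_large_event:
  assumes "finite \<B>" "\<And>b. b \<in> \<B> \<Longrightarrow> b \<in> sets N"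
  shows "{\<omega>\<in>space M. \<exists>b\<in>\<B>. K < \<bar>\<mu> b \<omega>\<bar>} \<in> events"
proof (rule sets.sets_Collect_finite_Ex[OF _ assms(1)])
  fix b assume "b \<in> \<B>"
  then have [measurable]: "b \<in> sets N" by (rule assms(2))
  show "{\<omega>\<in>space M. K < \<bar>\<mu> b \<omega>\<bar>} \<in> events" by measurable
qed

text \<open>
  A set \<open>D\<close> with a value that is not small can be removed at a loss of level as small as desired.
  Take a partition of \<open>A\<close> with \<open>m\<close> large cells and a random union of cells, each taken with
  probability \<open>q = 1 / (2 * m)\<close>. The union has a large value with probability bounded from below
  independently of \<open>m\<close>. A member of a family witnessing unboundedness that is huge has a large trace on some
  cell, and this cell is missed by the union with probability \<open>1 - q\<close>. Since \<open>q\<close> is small compared with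
  the first probability, some union has both properties, if \<open>m\<close> is large.
\<close>

lemma unbounded_on_step:
  assumes unb: "unbounded_on p A" and A: "A \<in> sets N" and r: "0 < r" "r < p"
  obtains D where "D \<in> sets N" "D \<subseteq> A" "p / 128 \<le> prob {\<omega>\<in>space M. 1 < \<bar>\<mu> D \<omega>\<bar>}" "unbounded_on r (A - D)"
proof -
  define c where "c = p / 64"
  have c: "c > 0" and p: "p > 0" using r by (auto simp: c_def)
  obtain m0 :: nat where m0: "2 / (c * (1 - r / p)) < real m0" using reals_Archimedean2 by blast
  define m where "m = Suc m0"
  define q where "q = 1 / (2 * real m)"
  have q: "0 < q" "q \<le> 1" by (auto simp: q_def m_def)
  have rq: "r \<le> p * (1 - 4 * q / c)"
  proof -
    have pos: "c * (1 - r / p) > 0" using c r p by simp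
    have "2 / (c * (1 - r / p)) \<le> real m" using m0 by (simp add: m_def)
    then have "2 \<le> real m * (c * (1 - r / p))" using pos by (simp add: pos_divide_le_eq)
    moreover have "real m > 0" by (simp add: m_def)
    ultimately have "4 * q \<le> c * (1 - r / p)" by (simp add: q_def field_simps)
    then have "4 * q / c \<le> 1 - r / p" using c by (simp add: pos_divide_le_eq mult.commute)
    then have "r / p \<le> 1 - 4 * q / c" by simp
    then show ?thesis using p by (simp add: pos_divide_le_eq mult.commute)
  qed
  obtain k :: nat and B where Bs: "\<And>i. i < k \<Longrightarrow> B i \<in> sets N" and B2: "disjoint_family_on B {..<k}" and B3: "(\<Union>i<k. B i) = A"
    and E: "p / 16 \<le> prob {\<omega>\<in>space M. m \<le> card {i\<in>{..<k}. 2 < \<bar>\<mu> (B i) \<omega>\<bar>}}"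
    by (rule unbounded_on_many_large[OF unb A p zero_le_numeral, where m=m]) blast
  have [measurable]: "\<And>i. i < k \<Longrightarrow> \<mu> (B i) \<in> borel_measurable M" using Bs by simp
  define U where "U = (\<lambda>T. \<Union>i\<in>T. B i)"
  have Us: "U T \<in> sets N" if "T \<subseteq> {..<k}" for T
    unfolding U_def using that Bs finite_subset[OF that] by (intro sets.finite_UN) auto
  have UA: "U T \<subseteq> A" if "T \<subseteq> {..<k}" for T
    using that B3 unfolding U_def by blast
  have addU: "AE \<omega> in M. \<forall>T\<in>Pow {..<k}. \<mu> (U T) \<omega> = (\<Sum>i\<in>T. \<mu> (B i) \<omega>)"
  proof (rule AE_finite_allI)
    fix T assume "T \<in> Pow {..<k}"
    then have T: "T \<subseteq> {..<k}" by simp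
    show "AE \<omega> in M. \<mu> (U T) \<omega> = (\<Sum>i\<in>T. \<mu> (B i) \<omega>)"
      unfolding U_def
    proof (rule mu_finite_Union)
      show "finite T" using finite_subset[OF T] by simp
      show "disjoint_family_on B T" using B2 T unfolding disjoint_family_on_def by blast
      show "B i \<in> sets N" if "i \<in> T" for i using that T Bs by auto
    qed
  qed simp
  let ?q = "\<lambda>_ :: nat. q"
  \<comment> \<open>the subsets of cells whose union has a large value; their probability is bounded from below\<close>
  define H where "H = {T. T \<subseteq> {..<k} \<and> c / 2 \<le> prob {\<omega>\<in>space M. 1 < \<bar>\<mu> (U T) \<omega>\<bar>}}"
  have finH: "finite H" by (rule finite_subset[of _ "Pow {..<k}"]) (auto simp: H_def)
  have wH: "c / 2 \<le> bern_avg ?q {..<k} (\<lambda>T. of_bool (T \<in> H))"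
  proof -
    define F where "F = {\<omega>\<in>space M. m \<le> card {i\<in>{..<k}. 2 < \<bar>\<mu> (B i) \<omega>\<bar>}}"
    have "F = {\<omega>\<in>space M. real m \<le> (\<Sum>i<k. of_bool (2 < \<bar>\<mu> (B i) \<omega>\<bar>))}"
      by (simp add: F_def Collect_conj_eq Int_commute lessThan_def)
    moreover have "{\<omega>\<in>space M. real m \<le> (\<Sum>i<k. of_bool (2 < \<bar>\<mu> (B i) \<omega>\<bar>))} \<in> events" by measurable
    ultimately have [measurable]: "F \<in> events" by (simp only:)
    have "1 / 4 * prob F \<le> bern_avg ?q {..<k} (\<lambda>T. prob {\<omega>\<in>space M. 1 < \<bar>\<mu> (U T) \<omega>\<bar>})"
    proof (rule bern_avg_prob)
      show "AE \<omega> in M. \<omega> \<in> F \<longrightarrow> 1 / 4 \<le> bern_avg ?q {..<k} (\<lambda>T. of_bool (1 < \<bar>\<mu> (U T) \<omega>\<bar>))"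
        using addU
      proof eventually_elim
        case (elim \<omega>)
        show ?case
        proof
          assume "\<omega> \<in> F"
          then have "m \<le> card {i\<in>{..<k}. 2 * 1 < \<bar>\<mu> (B i) \<omega>\<bar>}" by (simp add: F_def)
          then have "1 / 4 \<le> bern_avg ?q {..<k} (\<lambda>T. of_bool (1 < \<bar>\<Sum>i\<in>T. \<mu> (B i) \<omega>\<bar>))"
            unfolding q_def by (intro bern_avg_large_partial_sum) (simp_all add: m_def)
          also have "\<dots> = bern_avg ?q {..<k} (\<lambda>T. of_bool (1 < \<bar>\<mu> (U T) \<omega>\<bar>))"
            by (rule bern_avg_cong) (simp add: elim)
          finally show "1 / 4 \<le> bern_avg ?q {..<k} (\<lambda>T. of_bool (1 < \<bar>\<mu> (U T) \<omega>\<bar>))" .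
        qed
      qed
      fix T assume "T \<subseteq> {..<k}"
      then have [measurable]: "U T \<in> sets N" by (rule Us)
      show "{\<omega>\<in>space M. 1 < \<bar>\<mu> (U T) \<omega>\<bar>} \<in> events" by measurable
    qed (use q in auto)
    moreover have "bern_avg ?q {..<k} (\<lambda>T. prob {\<omega>\<in>space M. 1 < \<bar>\<mu> (U T) \<omega>\<bar>}) \<le>
        bern_avg ?q {..<k} (\<lambda>T. c / 2 + of_bool (T \<in> H))"
    proof (rule bern_avg_mono)
      fix T assume T: "T \<subseteq> {..<k}"
      show "prob {\<omega>\<in>space M. 1 < \<bar>\<mu> (U T) \<omega>\<bar>} \<le> c / 2 + of_bool (T \<in> H)"
      proof (cases "T \<in> H")
        case True
        then show ?thesis using c by (intro order_trans[OF prob_le_1]) simp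
      next
        case False
        then show ?thesis using T by (simp add: H_def)
      qed
    qed (use q in auto)
    moreover have "bern_avg ?q {..<k} (\<lambda>T. c / 2 + of_bool (T \<in> H)) = c / 2 + bern_avg ?q {..<k} (\<lambda>T. of_bool (T \<in> H))"
      unfolding bern_avg_add by simp
    moreover have "c \<le> 1 / 4 * prob F" using E unfolding F_def c_def by simp
    ultimately show ?thesis by linarith
  qed
  \<comment> \<open>\<open>good K T\<close>: outside of the union \<open>U T\<close>, the level \<open>r\<close> of unboundedness is witnessed for the bound \<open>K\<close>\<close>
  define good where "good = (\<lambda>K T. \<exists>\<B>. finite \<B> \<and> \<B> \<subseteq> sets N \<and> disjoint \<B> \<and> (\<forall>b\<in>\<B>. b \<subseteq> A - U T) \<and>
     r \<le> prob {\<omega>\<in>space M. \<exists>b\<in>\<B>. K < \<bar>\<mu> b \<omega>\<bar>})"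
  have ex: "\<exists>T\<in>H. good K T" if K: "K \<ge> 0" for K :: real
  proof -
    obtain \<B> where \<B>: "finite \<B>" "\<And>b. b \<in> \<B> \<Longrightarrow> b \<in> sets N" "disjoint \<B>" "\<And>b. b \<in> \<B> \<Longrightarrow> b \<subseteq> A"
      "p \<le> prob {\<omega>\<in>space M. \<exists>b\<in>\<B>. real k * K < \<bar>\<mu> b \<omega>\<bar>}"
      by (rule unbounded_onE[OF unb, of "real k * K"]) blast
    define G where "G = {\<omega>\<in>space M. \<exists>b\<in>\<B>. real k * K < \<bar>\<mu> b \<omega>\<bar>}"
    have [measurable]: "G \<in> events"
      unfolding G_def by (intro sets.sets_Collect_finite_Ex \<B>(1)) (use \<B>(2) in measurable)
    have pG: "p \<le> prob G" using \<B>(5) by (simp add: G_def)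
    \<comment> \<open>the traces of the family on the cells that are not taken\<close>
    define \<C> where "\<C> = (\<lambda>T. (\<lambda>(b, i). b \<inter> B i) ` (\<B> \<times> ({..<k} - T)))"
    have fC: "finite (\<C> T)" for T using \<B>(1) by (simp add: \<C>_def)
    have sC: "\<C> T \<subseteq> sets N" for T
      unfolding \<C>_def by (clarsimp) (blast intro: sets.Int \<B>(2) Bs)
    have CA: "\<forall>b\<in>\<C> T. b \<subseteq> A - U T" if T: "T \<subseteq> {..<k}" for T
    proof
      fix b assume "b \<in> \<C> T"
      then obtain b' i where bi: "b' \<in> \<B>" "i \<in> {..<k} - T" "b = b' \<inter> B i" by (auto simp: \<C>_def)
      have "B i \<inter> B j = {}" if "j \<in> T" for j
      proof (rule disjoint_family_onD[OF B2])
        show "j \<in> {..<k}" "i \<in> {..<k}" "i \<noteq> j" using that T bi(2) by auto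
      qed
      then have "B i \<inter> U T = {}" unfolding U_def by blast
      moreover have "b' \<subseteq> A" by (rule \<B>(4)[OF bi(1)])
      ultimately show "b \<subseteq> A - U T" unfolding bi(3) by blast
    qed
    have dC: "disjoint (\<C> T)" for T
      unfolding disjoint_def
    proof (intro ballI impI)
      fix x y assume x: "x \<in> \<C> T" and y: "y \<in> \<C> T" and "x \<noteq> y"
      obtain b i where bi: "b \<in> \<B>" "i < k" "x = b \<inter> B i" using x by (auto simp: \<C>_def)
      obtain b' i' where bi': "b' \<in> \<B>" "i' < k" "y = b' \<inter> B i'" using y by (auto simp: \<C>_def)
      consider "b \<noteq> b'" | "i \<noteq> i'" using \<open>x \<noteq> y\<close> unfolding bi(3) bi'(3) by blast
      then show "x \<inter> y = {}"
      proof cases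
        case 1
        then have "b \<inter> b' = {}" using \<B>(3) bi(1) bi'(1) by (simp add: disjoint_def)
        then show ?thesis unfolding bi(3) bi'(3) by blast
      next
        case 2
        then have "B i \<inter> B i' = {}" using bi(2) bi'(2) by (intro disjoint_family_onD[OF B2]) auto
        then show ?thesis unfolding bi(3) bi'(3) by blast
      qed
    qed
    define \<phi> where "\<phi> = (\<lambda>T \<omega>. \<omega> \<in> G \<and> (\<exists>b\<in>\<C> T. K < \<bar>\<mu> b \<omega>\<bar>))"
    have Cev: "{\<omega>\<in>space M. \<exists>b\<in>\<C> T. K < \<bar>\<mu> b \<omega>\<bar>} \<in> events" for T
      using sC by (intro exists_large_event fC) blast
    have \<phi>_alt: "{\<omega>\<in>space M. \<phi> T \<omega>} = G \<inter> {\<omega>\<in>space M. \<exists>b\<in>\<C> T. K < \<bar>\<mu> b \<omega>\<bar>}" for T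
      by (auto simp: \<phi>_def)
    have \<phi>ev: "{\<omega>\<in>space M. \<phi> T \<omega>} \<in> events" for T
      unfolding \<phi>_alt using Cev by simp
    have addB: "AE \<omega> in M. \<forall>b\<in>\<B>. \<mu> b \<omega> = (\<Sum>i<k. \<mu> (b \<inter> B i) \<omega>)"
    proof (rule AE_finite_allI[OF \<B>(1)])
      fix b assume b: "b \<in> \<B>"
      have "AE \<omega> in M. \<mu> (\<Union>i<k. b \<inter> B i) \<omega> = (\<Sum>i<k. \<mu> (b \<inter> B i) \<omega>)"
      proof (rule mu_finite_Union)
        show "disjoint_family_on (\<lambda>i. b \<inter> B i) {..<k}" using B2 unfolding disjoint_family_on_def by blast
      qed (use Bs \<B>(2)[OF b] in auto)
      moreover have "(\<Union>i<k. b \<inter> B i) = b" using \<B>(4)[OF b] B3 by blast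
      ultimately show "AE \<omega> in M. \<mu> b \<omega> = (\<Sum>i<k. \<mu> (b \<inter> B i) \<omega>)" by simp
    qed
    have avg: "(1 - q) * prob G \<le> bern_avg ?q {..<k} (\<lambda>T. prob {\<omega>\<in>space M. \<phi> T \<omega>})"
    proof (rule bern_avg_prob)
      show "AE \<omega> in M. \<omega> \<in> G \<longrightarrow> 1 - q \<le> bern_avg ?q {..<k} (\<lambda>T. of_bool (\<phi> T \<omega>))"
        using addB
      proof eventually_elim
        case (elim \<omega>)
        show ?case
        proof
          assume G: "\<omega> \<in> G"
          then obtain b where b: "b \<in> \<B>" "real k * K < \<bar>\<mu> b \<omega>\<bar>" by (auto simp: G_def)
          have "\<exists>i<k. K < \<bar>\<mu> (b \<inter> B i) \<omega>\<bar>"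
          proof (rule ccontr)
            assume "\<not> ?thesis"
            then have "\<bar>\<mu> (b \<inter> B i) \<omega>\<bar> \<le> K" if "i < k" for i using that not_less by blast
            then have "(\<Sum>i<k. \<bar>\<mu> (b \<inter> B i) \<omega>\<bar>) \<le> (\<Sum>i<k. K)" by (intro sum_mono) simp
            then have "\<bar>\<mu> b \<omega>\<bar> \<le> real k * K"
              unfolding elim[rule_format, OF b(1)] using order_trans[OF sum_abs[of "\<lambda>i. \<mu> (b \<inter> B i) \<omega>" "{..<k}"]] by simp
            then show False using b by simp
          qed
          then obtain i where i: "i < k" "K < \<bar>\<mu> (b \<inter> B i) \<omega>\<bar>" by blast
          have "1 - q = bern_avg ?q {..<k} (\<lambda>T. of_bool (i \<notin> T))"
            using i by (subst bern_avg_notin) auto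
          also have "\<dots> \<le> bern_avg ?q {..<k} (\<lambda>T. of_bool (\<phi> T \<omega>))"
          proof (rule bern_avg_mono)
            fix T :: "nat set"
            have "\<phi> T \<omega>" if "i \<notin> T"
            proof -
              have "b \<inter> B i \<in> \<C> T"
                unfolding \<C>_def using b(1) i(1) that by (intro image_eqI[of _ _ "(b, i)"]) auto
              then show ?thesis using G i(2) unfolding \<phi>_def by blast
            qed
            then show "of_bool (i \<notin> T) \<le> (of_bool (\<phi> T \<omega>) :: real)" by simp
          qed (use q in auto)
          finally show "1 - q \<le> bern_avg ?q {..<k} (\<lambda>T. of_bool (\<phi> T \<omega>))" .
        qed
      qed
    qed (use q \<phi>ev in auto)
    have "\<exists>T\<in>H. r \<le> prob {\<omega>\<in>space M. \<phi> T \<omega>}"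
    proof (rule ccontr)
      assume "\<not> ?thesis"
      then have no: "prob {\<omega>\<in>space M. \<phi> T \<omega>} < r" if "T \<in> H" for T using that by auto
      have "p * (1 - 4 * q / c) \<le> prob G * (1 - 4 * q / c)"
      proof (rule mult_right_mono[OF pG])
        have "0 < p * (1 - 4 * q / c)" using rq r by linarith
        then show "0 \<le> 1 - 4 * q / c" using p by (simp add: zero_less_mult_iff)
      qed
      then have rG: "r \<le> prob G * (1 - 4 * q / c)" using rq by simp
      have "bern_avg ?q {..<k} (\<lambda>T. prob {\<omega>\<in>space M. \<phi> T \<omega>}) \<le>
         bern_avg ?q {..<k} (\<lambda>T. prob G + (- (prob G * (4 * q / c))) * of_bool (T \<in> H))"
      proof (rule bern_avg_mono)
        fix T :: "nat set" assume "T \<subseteq> {..<k}"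
        show "prob {\<omega>\<in>space M. \<phi> T \<omega>} \<le> prob G + (- (prob G * (4 * q / c))) * of_bool (T \<in> H)"
        proof (cases "T \<in> H")
          case True
          then show ?thesis using no[OF True] rG by (simp add: algebra_simps)
        next
          case False
          then show ?thesis by (auto simp: \<phi>_def intro!: finite_measure_mono)
        qed
      qed (use q in auto)
      also have "\<dots> = prob G + (- (prob G * (4 * q / c))) * bern_avg ?q {..<k} (\<lambda>T. of_bool (T \<in> H))"
        unfolding bern_avg_add bern_avg_cmult by simp
      also have "\<dots> \<le> prob G + (- (prob G * (4 * q / c))) * (c / 2)"
        using wH c q by (intro add_left_mono mult_left_mono_neg) auto
      also have "\<dots> = prob G * (1 - 2 * q)" using c by (simp add: field_simps)
      finally have "(1 - q) * prob G \<le> (1 - 2 * q) * prob G" using avg by (simp add: mult.commute)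
      moreover have "prob G > 0" using pG p by simp
      ultimately show False using q by simp
    qed
    then obtain T where T: "T \<in> H" "r \<le> prob {\<omega>\<in>space M. \<phi> T \<omega>}" by blast
    have "prob {\<omega>\<in>space M. \<phi> T \<omega>} \<le> prob {\<omega>\<in>space M. \<exists>b\<in>\<C> T. K < \<bar>\<mu> b \<omega>\<bar>}"
      by (intro finite_measure_mono Cev) (auto simp: \<phi>_def)
    moreover have "T \<subseteq> {..<k}" using T(1) by (simp add: H_def)
    ultimately have le: "r \<le> prob {\<omega>\<in>space M. \<exists>b\<in>\<C> T. K < \<bar>\<mu> b \<omega>\<bar>}" and Tk: "T \<subseteq> {..<k}"
      using T(2) by linarith+
    have "good K T"
      unfolding good_def by (intro exI[of _ "\<C> T"] conjI fC sC dC CA[OF Tk] le)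
    then show ?thesis using T(1) by blast
  qed
  have good_anti: "good K T" if gd: "good K' T" and le: "K \<le> K'" for K K' T
  proof -
    obtain \<B> where B: "finite \<B>" "\<B> \<subseteq> sets N" "disjoint \<B>" "\<forall>b\<in>\<B>. b \<subseteq> A - U T"
      "r \<le> prob {\<omega>\<in>space M. \<exists>b\<in>\<B>. K' < \<bar>\<mu> b \<omega>\<bar>}" using gd unfolding good_def by (elim exE conjE) (rule that)
    have "prob {\<omega>\<in>space M. \<exists>b\<in>\<B>. K' < \<bar>\<mu> b \<omega>\<bar>} \<le> prob {\<omega>\<in>space M. \<exists>b\<in>\<B>. K < \<bar>\<mu> b \<omega>\<bar>}"
    proof (rule finite_measure_mono)
      show "{\<omega>\<in>space M. \<exists>b\<in>\<B>. K < \<bar>\<mu> b \<omega>\<bar>} \<in> events"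
        using B(2) by (intro exists_large_event B(1)) blast
    qed (use le in force)
    then have "r \<le> prob {\<omega>\<in>space M. \<exists>b\<in>\<B>. K < \<bar>\<mu> b \<omega>\<bar>}" using B(5) by linarith
    then show ?thesis unfolding good_def by (intro exI[of _ \<B>] conjI B(1-4))
  qed
  \<comment> \<open>there are finitely many \<open>T\<close>, so one of them works for arbitrarily large bounds\<close>
  have "\<exists>T\<in>H. \<forall>K. good K T"
  proof (rule ccontr)
    assume "\<not> ?thesis"
    then have "\<forall>T\<in>H. \<exists>K. \<not> good K T" by blast
    then obtain KK where KK: "\<And>T. T \<in> H \<Longrightarrow> \<not> good (KK T) T" by metis
    define L where "L = (\<Sum>T\<in>H. \<bar>KK T\<bar>)"
    have "L \<ge> 0" unfolding L_def by (intro sum_nonneg) simp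
    then obtain T where T: "T \<in> H" "good L T" using ex by blast
    have "\<bar>KK T\<bar> \<le> L" unfolding L_def using T(1) finH by (intro member_le_sum) auto
    then have "good (KK T) T" using good_anti[OF T(2), of "KK T"] by linarith
    then show False using KK T(1) by blast
  qed
  then obtain T where T: "T \<in> H" "\<And>K. good K T" by blast
  have Tk: "T \<subseteq> {..<k}" "c / 2 \<le> prob {\<omega>\<in>space M. 1 < \<bar>\<mu> (U T) \<omega>\<bar>}" using T(1) by (auto simp: H_def)
  have "unbounded_on r (A - U T)" unfolding unbounded_on_def by (rule allI) (rule T(2)[unfolded good_def])
  then show ?thesis using that[OF Us[OF Tk(1)] UA[OF Tk(1)]] Tk(2) by (simp add: c_def)
qed

text \<open>
  If the range were unbounded at level \<open>p\<close>, then \<open>unbounded_on_step\<close> would produce infinitely many disjoint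
  sets whose values stay away from \<open>0\<close> in probability, while the level decreases from \<open>p\<close> towards
  \<open>p / 2\<close>. This contradicts \<open>\<sigma>\<close>-additivity.
\<close>

lemma mu_range_bounded:
  assumes p: "p > 0"
  obtains K where "\<And>A. A \<in> sets N \<Longrightarrow> prob {\<omega>\<in>space M. K < \<bar>\<mu> A \<omega>\<bar>} < p"
proof (rule ccontr)
  assume neg: "\<not> thesis"
  have unb: "unbounded_on p (space N)"
    unfolding unbounded_on_def
  proof
    fix K
    have "\<not> (\<forall>A\<in>sets N. prob {\<omega>\<in>space M. K < \<bar>\<mu> A \<omega>\<bar>} < p)" using neg that by blast
    then obtain A where A: "A \<in> sets N" "p \<le> prob {\<omega>\<in>space M. K < \<bar>\<mu> A \<omega>\<bar>}"
      by (auto simp: not_less)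
    show "\<exists>\<B>. finite \<B> \<and> \<B> \<subseteq> sets N \<and> disjoint \<B> \<and> (\<forall>B\<in>\<B>. B \<subseteq> space N) \<and>
       p \<le> prob {\<omega>\<in>space M. \<exists>B\<in>\<B>. K < \<bar>\<mu> B \<omega>\<bar>}"
      using A sets.sets_into_space[OF A(1)] by (intro exI[of _ "{A}"]) simp
  qed
  define P where "P = (\<lambda>n::nat. p / 2 * (1 + (1 / 2) ^ n))"
  have P: "P (Suc n) < P n" "p / 2 < P n" for n using p by (auto simp: P_def)
  have "\<exists>f. \<forall>n. (f n \<in> sets N \<and> unbounded_on (P n) (f n)) \<and>
     (\<exists>D. D \<in> sets N \<and> D \<subseteq> f n \<and> p / 256 \<le> prob {\<omega>\<in>space M. 1 < \<bar>\<mu> D \<omega>\<bar>} \<and> f (Suc n) = f n - D)"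
  proof (rule dependent_nat_choice)
    show "\<exists>x. x \<in> sets N \<and> unbounded_on (P 0) x" using unb by (intro exI[of _ "space N"]) (simp add: P_def)
    fix A n assume A: "A \<in> sets N \<and> unbounded_on (P n) A"
    have "0 < P (Suc n)" using P(2)[of "Suc n"] p by linarith
    then obtain D where D: "D \<in> sets N" "D \<subseteq> A" "P n / 128 \<le> prob {\<omega>\<in>space M. 1 < \<bar>\<mu> D \<omega>\<bar>}" "unbounded_on (P (Suc n)) (A - D)"
      using unbounded_on_step[of "P n" A "P (Suc n)"] A P(1)[of n] by blast
    moreover have "p / 256 \<le> P n / 128" using P(2)[of n] by simp
    ultimately show "\<exists>y. (y \<in> sets N \<and> unbounded_on (P (Suc n)) y) \<and>
       (\<exists>D. D \<in> sets N \<and> D \<subseteq> A \<and> p / 256 \<le> prob {\<omega>\<in>space M. 1 < \<bar>\<mu> D \<omega>\<bar>} \<and> y = A - D)"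
      using A by (intro exI[of _ "A - D"] conjI exI[of _ D] sets.Diff) (auto)
  qed
  then obtain f where "\<forall>n. \<exists>D. D \<in> sets N \<and> D \<subseteq> f n \<and>
      p / 256 \<le> prob {\<omega>\<in>space M. 1 < \<bar>\<mu> D \<omega>\<bar>} \<and> f (Suc n) = f n - D" by blast
  then have "\<exists>D. \<forall>n. D n \<in> sets N \<and> D n \<subseteq> f n \<and>
      p / 256 \<le> prob {\<omega>\<in>space M. 1 < \<bar>\<mu> (D n) \<omega>\<bar>} \<and> f (Suc n) = f n - D n" by (rule choice)
  then obtain D where f: "\<And>n. D n \<in> sets N" "\<And>n. D n \<subseteq> f n"
    "\<And>n. p / 256 \<le> prob {\<omega>\<in>space M. 1 < \<bar>\<mu> (D n) \<omega>\<bar>}" "\<And>n. f (Suc n) = f n - D n"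
    by blast
  have dec: "f n \<subseteq> f m" if "m \<le> n" for m n
    using that by (induction n rule: dec_induct) (auto simp: f(4))
  have dj: "D m \<inter> D n = {}" if "m < n" for m n
    using dec[of "Suc m" n] that f(2)[of n] f(4)[of m] by auto
  have "disjoint_family D"
    unfolding disjoint_family_on_def
  proof (intro ballI impI)
    fix m n :: nat assume "m \<noteq> n"
    then show "D m \<inter> D n = {}" using dj[of m n] dj[of n m] by (cases "m < n") auto
  qed
  then have "(\<lambda>n. prob_norm M (\<mu> (D n))) \<longlonglongrightarrow> 0" using f(1) by (intro mu_disjoint_tendsto)
  moreover have "p / 256 \<le> prob_norm M (\<mu> (D n))" for n
    using prob_gt_le_prob_norm[of "\<mu> (D n)" 1] f(1,3)[of n] by simp
  ultimately have "p / 256 \<le> 0" by (intro LIMSEQ_le_const) auto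
  then show False using p by simp
qed

end

subsection \<open>Boundedness of linear combinations\<close>

context prob_space
begin

lemma prob_norm_sum:
  assumes "finite J" "\<And>j. j \<in> J \<Longrightarrow> X j \<in> borel_measurable M"
  shows "prob_norm M (\<lambda>\<omega>. \<Sum>j\<in>J. X j \<omega>) \<le> (\<Sum>j\<in>J. prob_norm M (X j))"
  using assms
proof (induction J rule: finite_induct)
  case empty
  then show ?case by (simp add: prob_norm_def)
next
  case (insert j J)
  have "prob_norm M (\<lambda>\<omega>. X j \<omega> + (\<Sum>j\<in>J. X j \<omega>)) \<le> prob_norm M (X j) + prob_norm M (\<lambda>\<omega>. \<Sum>j\<in>J. X j \<omega>)"
    using insert.prems by (intro prob_norm_add borel_measurable_sum) auto
  then show ?case using insert by simp
qed

lemma prob_norm_sum_tendsto_0: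
  assumes "finite J" "\<And>j n. j \<in> J \<Longrightarrow> X j n \<in> borel_measurable M"
    "\<And>j. j \<in> J \<Longrightarrow> (\<lambda>n. prob_norm M (X j n)) \<longlonglongrightarrow> 0"
  shows "(\<lambda>n. prob_norm M (\<lambda>\<omega>. \<Sum>j\<in>J. c j * X j n \<omega>)) \<longlonglongrightarrow> 0"
proof (rule prob_norm_squeeze)
  have "(\<lambda>n. \<Sum>j\<in>J. max 1 \<bar>c j\<bar> * prob_norm M (X j n)) \<longlonglongrightarrow> (\<Sum>j\<in>J. max 1 \<bar>c j\<bar> * 0)"
    by (intro tendsto_sum tendsto_mult_left assms(3))
  then show "(\<lambda>n. \<Sum>j\<in>J. max 1 \<bar>c j\<bar> * prob_norm M (X j n)) \<longlonglongrightarrow> 0" by simp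
  show "prob_norm M (\<lambda>\<omega>. \<Sum>j\<in>J. c j * X j n \<omega>) \<le> (\<Sum>j\<in>J. max 1 \<bar>c j\<bar> * prob_norm M (X j n))" for n
  proof -
    have "prob_norm M (\<lambda>\<omega>. \<Sum>j\<in>J. c j * X j n \<omega>) \<le> (\<Sum>j\<in>J. prob_norm M (\<lambda>\<omega>. c j * X j n \<omega>))"
      using assms(1,2) by (intro prob_norm_sum borel_measurable_times) auto
    also have "\<dots> \<le> (\<Sum>j\<in>J. max 1 \<bar>c j\<bar> * prob_norm M (X j n))"
      using assms(2) by (intro sum_mono prob_norm_cmult) auto
    finally show ?thesis .
  qed
qed

text \<open>
  Random signs: wherever the sum of squares is large, a tenth of all sign patterns give a large
  signed sum.
\<close>

lemma prob_sum_squares_le: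
  fixes X :: "'i \<Rightarrow> 'a \<Rightarrow> real"
  assumes I: "finite I" and X: "\<And>i. i \<in> I \<Longrightarrow> X i \<in> borel_measurable M" and L: "L \<ge> 0"
    and S: "\<And>T. T \<subseteq> I \<Longrightarrow> prob {\<omega>\<in>space M. L < \<bar>sgn_sum (\<lambda>i. X i \<omega>) I T\<bar>} \<le> p"
  shows "prob {\<omega>\<in>space M. 2 * L\<^sup>2 < (\<Sum>i\<in>I. (X i \<omega>)\<^sup>2)} \<le> 10 * p"
proof -
  have m: "(\<lambda>\<omega>. sgn_sum (\<lambda>i. X i \<omega>) I T) \<in> borel_measurable M" if "T \<subseteq> I" for T
    unfolding sgn_sum_def using that X by (intro borel_measurable_diff borel_measurable_sum) auto
  have mQ: "(\<lambda>\<omega>. \<Sum>i\<in>I. (X i \<omega>)\<^sup>2) \<in> borel_measurable M"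
    using X by (intro borel_measurable_sum borel_measurable_power)
  have "1 / 10 * prob {\<omega>\<in>space M. 2 * L\<^sup>2 < (\<Sum>i\<in>I. (X i \<omega>)\<^sup>2)} \<le>
     bern_avg (\<lambda>_. 1 / 2) I (\<lambda>T. prob {\<omega>\<in>space M. L < \<bar>sgn_sum (\<lambda>i. X i \<omega>) I T\<bar>})"
  proof (rule bern_avg_prob)
    show "AE \<omega> in M. \<omega> \<in> {\<omega>\<in>space M. 2 * L\<^sup>2 < (\<Sum>i\<in>I. (X i \<omega>)\<^sup>2)} \<longrightarrow>
       1 / 10 \<le> bern_avg (\<lambda>_. 1 / 2) I (\<lambda>T. of_bool (L < \<bar>sgn_sum (\<lambda>i. X i \<omega>) I T\<bar>))"
    proof (intro AE_I2 impI)
      fix \<omega> assume "\<omega> \<in> {\<omega>\<in>space M. 2 * L\<^sup>2 < (\<Sum>i\<in>I. (X i \<omega>)\<^sup>2)}"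
      then show "1 / 10 \<le> bern_avg (\<lambda>_. 1 / 2) I (\<lambda>T. of_bool (L < \<bar>sgn_sum (\<lambda>i. X i \<omega>) I T\<bar>))"
        by (intro bern_avg_sgn_sum_large[OF I _ L]) simp
    qed
    show "{\<omega>\<in>space M. L < \<bar>sgn_sum (\<lambda>i. X i \<omega>) I T\<bar>} \<in> events" if "T \<subseteq> I" for T
      using m[OF that] by measurable
    show "{\<omega>\<in>space M. 2 * L\<^sup>2 < (\<Sum>i\<in>I. (X i \<omega>)\<^sup>2)} \<in> events" using mQ by measurable
  qed (use I in auto)
  also have "\<dots> \<le> bern_avg (\<lambda>_. 1 / 2) I (\<lambda>T. p)" using S by (intro bern_avg_mono) auto
  finally show ?thesis using I by simp
qed

end

context stoch_measure
begin

text \<open>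
  Boundedness does not pass from signed sums to their convex combinations for free, as \<open>L\<^sub>0\<close> is not locally
  convex. The combination with coefficients \<open>c i\<close> is the mean of signed sums with independent signs of
  means \<open>c i\<close>. Signed sums are differences of two values of \<open>\<mu>\<close>, hence bounded in probability. Their
  variance is at most the sum of the squares \<open>(\<mu> (B i))\<^sup>2\<close>, which is bounded in probability by
  \<open>prob_sum_squares_le\<close>; so by Chebyshev's inequality they are not far from their mean.
\<close>

lemma mu_combinations_bounded:
  assumes p: "p > 0"
  obtains K where "K > 0" "\<And>(I :: 'i set) B c. finite I \<Longrightarrow> (\<And>i. i \<in> I \<Longrightarrow> B i \<in> sets N) \<Longrightarrow>
     disjoint_family_on B I \<Longrightarrow> (\<And>i. i \<in> I \<Longrightarrow> \<bar>c i\<bar> \<le> 1) \<Longrightarrow>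
     prob {\<omega>\<in>space M. K < \<bar>\<Sum>i\<in>I. c i * \<mu> (B i) \<omega>\<bar>} \<le> p"
proof -
  define r where "r = p / 24"
  have "r > 0" using p by (simp add: r_def)
  then obtain K0 where K0: "\<And>A. A \<in> sets N \<Longrightarrow> prob {\<omega>\<in>space M. K0 < \<bar>\<mu> A \<omega>\<bar>} < r"
    using mu_range_bounded by blast
  define L where "L = max K0 1"
  have L: "L > 0" "L \<ge> K0" by (auto simp: L_def)
  have PL: "prob {\<omega>\<in>space M. L < \<bar>\<mu> A \<omega>\<bar>} \<le> r" if A[measurable]: "A \<in> sets N" for A
  proof -
    have "prob {\<omega>\<in>space M. L < \<bar>\<mu> A \<omega>\<bar>} \<le> prob {\<omega>\<in>space M. K0 < \<bar>\<mu> A \<omega>\<bar>}"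
      using L by (intro finite_measure_mono) auto
    then show ?thesis using K0[OF A] by simp
  qed
  show ?thesis
  proof (rule that[of "6 * L"])
    show "6 * L > 0" using L by simp
    fix I :: "'i set" and B and c :: "'i \<Rightarrow> real"
    assume I: "finite I" and B: "\<And>i. i \<in> I \<Longrightarrow> B i \<in> sets N" and d: "disjoint_family_on B I"
      and c: "\<And>i. i \<in> I \<Longrightarrow> \<bar>c i\<bar> \<le> 1"
    have X: "\<mu> (B i) \<in> borel_measurable M" if "i \<in> I" for i using B[OF that] by simp
    let ?x = "\<lambda>\<omega> i. \<mu> (B i) \<omega>"
    have mS: "(\<lambda>\<omega>. sgn_sum (?x \<omega>) I T) \<in> borel_measurable M" if "T \<subseteq> I" for T
      unfolding sgn_sum_def using that X by (intro borel_measurable_diff borel_measurable_sum) auto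
    have PS: "prob {\<omega>\<in>space M. 2 * L < \<bar>sgn_sum (?x \<omega>) I T\<bar>} \<le> 2 * r" if T: "T \<subseteq> I" for T
    proof -
      have add: "AE \<omega> in M. \<mu> (\<Union>i\<in>S. B i) \<omega> = (\<Sum>i\<in>S. \<mu> (B i) \<omega>)" and sU: "(\<Union>i\<in>S. B i) \<in> sets N" if S: "S \<subseteq> I" for S
      proof -
        have f: "finite S" using I S by (rule rev_finite_subset)
        show "AE \<omega> in M. \<mu> (\<Union>i\<in>S. B i) \<omega> = (\<Sum>i\<in>S. \<mu> (B i) \<omega>)"
          using B S by (intro mu_finite_Union f disjoint_family_on_mono[OF S d]) auto
        show "(\<Union>i\<in>S. B i) \<in> sets N" using f S B by (intro sets.finite_UN) auto
      qed
      define U V where "U = (\<Union>i\<in>T. B i)" and "V = (\<Union>i\<in>I - T. B i)"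
      have [measurable]: "U \<in> sets N" "V \<in> sets N" unfolding U_def V_def using sU T by auto
      have "prob {\<omega>\<in>space M. 2 * L < \<bar>sgn_sum (?x \<omega>) I T\<bar>} \<le>
         prob ({\<omega>\<in>space M. L < \<bar>\<mu> U \<omega>\<bar>} \<union> {\<omega>\<in>space M. L < \<bar>\<mu> V \<omega>\<bar>})"
      proof (rule finite_measure_mono_AE)
        show "AE \<omega> in M. \<omega> \<in> {\<omega>\<in>space M. 2 * L < \<bar>sgn_sum (?x \<omega>) I T\<bar>} \<longrightarrow>
           \<omega> \<in> {\<omega>\<in>space M. L < \<bar>\<mu> U \<omega>\<bar>} \<union> {\<omega>\<in>space M. L < \<bar>\<mu> V \<omega>\<bar>}"
          using add[OF T] add[of "I - T", OF Diff_subset]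
          by eventually_elim (auto simp: sgn_sum_def U_def V_def)
      qed simp
      also have "\<dots> \<le> prob {\<omega>\<in>space M. L < \<bar>\<mu> U \<omega>\<bar>} + prob {\<omega>\<in>space M. L < \<bar>\<mu> V \<omega>\<bar>}"
        by (intro measure_Un_le) auto
      also have "\<dots> \<le> r + r" by (intro add_mono PL) auto
      finally show ?thesis by simp
    qed
    define Q where "Q = (\<lambda>\<omega>. \<Sum>i\<in>I. (\<mu> (B i) \<omega>)\<^sup>2)"
    have [measurable]: "Q \<in> borel_measurable M" unfolding Q_def using X by (intro borel_measurable_sum borel_measurable_power)
    define m where "m = (\<lambda>\<omega>. \<Sum>i\<in>I. c i * \<mu> (B i) \<omega>)"
    have [measurable]: "m \<in> borel_measurable M" unfolding m_def using X by (intro borel_measurable_sum borel_measurable_times) auto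
    have PQ: "prob {\<omega>\<in>space M. 8 * L\<^sup>2 < Q \<omega>} \<le> 20 * r"
      using prob_sum_squares_le[where X="\<lambda>i. \<mu> (B i)" and L="2 * L" and p="2 * r", OF I X] L PS
      by (simp add: Q_def power_mult_distrib)
    define E where "E = {\<omega>\<in>space M. 6 * L < \<bar>m \<omega>\<bar> \<and> Q \<omega> \<le> 8 * L\<^sup>2}"
    have [measurable]: "E \<in> events" unfolding E_def by measurable
    let ?q = "\<lambda>i. (1 + c i) / 2"
    have q: "0 \<le> ?q i \<and> ?q i \<le> 1" if "i \<in> I" for i using c[OF that] by auto
    have "1 / 2 * prob E \<le> bern_avg ?q I (\<lambda>T. prob {\<omega>\<in>space M. 2 * L < \<bar>sgn_sum (?x \<omega>) I T\<bar>})"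
    proof (rule bern_avg_prob[OF I q])
      show "{\<omega>\<in>space M. 2 * L < \<bar>sgn_sum (?x \<omega>) I T\<bar>} \<in> events" if "T \<subseteq> I" for T
        using mS[OF that] by measurable
      show "AE \<omega> in M. \<omega> \<in> E \<longrightarrow> 1 / 2 \<le> bern_avg ?q I (\<lambda>T. of_bool (2 * L < \<bar>sgn_sum (?x \<omega>) I T\<bar>))"
      proof (intro AE_I2 impI)
        fix \<omega> assume "\<omega> \<in> E"
        then have w: "6 * L < \<bar>m \<omega>\<bar>" "Q \<omega> \<le> 8 * L\<^sup>2" by (auto simp: E_def)
        let ?S = "sgn_sum (?x \<omega>) I"
        define a where "a = 1 / (16 * L\<^sup>2)"
        \<comment> \<open>Chebyshev: a signed sum that is not large deviates from its mean by at least \<open>4 * L\<close>\<close>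
        have ptw: "1 + (- a) * (- m \<omega> + s)\<^sup>2 \<le> of_bool (2 * L < \<bar>s\<bar>)" for s
        proof (cases "2 * L < \<bar>s\<bar>")
          case True
          then show ?thesis by (simp add: a_def)
        next
          case False
          then have "\<bar>4 * L\<bar> \<le> \<bar>- m \<omega> + s\<bar>" using w(1) L by linarith
          then have "(4 * L)\<^sup>2 \<le> (- m \<omega> + s)\<^sup>2" by (simp add: abs_le_square_iff)
          then have "16 * L\<^sup>2 \<le> (- m \<omega> + s)\<^sup>2" by (simp add: power_mult_distrib)
          then have "1 \<le> a * (- m \<omega> + s)\<^sup>2" using L by (simp add: a_def pos_le_divide_eq)
          then show ?thesis using False by simp
        qed
        have "1 / 2 \<le> 1 - a * Q \<omega>" using w(2) L by (simp add: a_def pos_divide_le_eq)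
        also have "\<dots> \<le> 1 + (- a) * bern_avg ?q I (\<lambda>T. (- m \<omega> + ?S T)\<^sup>2)"
        proof -
          have "bern_avg ?q I (\<lambda>T. (- m \<omega> + ?S T)\<^sup>2) = (\<Sum>i\<in>I. (1 - (c i)\<^sup>2) * (\<mu> (B i) \<omega>)\<^sup>2)"
            unfolding bern_avg_sgn_sum_square[OF I] by (simp add: m_def)
          also have "\<dots> \<le> (\<Sum>i\<in>I. 1 * (\<mu> (B i) \<omega>)\<^sup>2)" by (intro sum_mono mult_right_mono) auto
          finally have "bern_avg ?q I (\<lambda>T. (- m \<omega> + ?S T)\<^sup>2) \<le> Q \<omega>" by (simp add: Q_def)
          then have "a * bern_avg ?q I (\<lambda>T. (- m \<omega> + ?S T)\<^sup>2) \<le> a * Q \<omega>" by (intro mult_left_mono) (auto simp: a_def)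
          then show ?thesis by simp
        qed
        also have "\<dots> = bern_avg ?q I (\<lambda>T. 1 + (- a) * (- m \<omega> + ?S T)\<^sup>2)"
          unfolding bern_avg_add bern_avg_cmult using I by simp
        also have "\<dots> \<le> bern_avg ?q I (\<lambda>T. of_bool (2 * L < \<bar>?S T\<bar>))"
          by (intro bern_avg_mono q ptw)
        finally show "1 / 2 \<le> bern_avg ?q I (\<lambda>T. of_bool (2 * L < \<bar>?S T\<bar>))" .
      qed
    qed simp_all
    also have "\<dots> \<le> bern_avg ?q I (\<lambda>T. 2 * r)" using PS q by (intro bern_avg_mono)
    finally have PE: "prob E \<le> 4 * r" using I by simp
    have "prob {\<omega>\<in>space M. 6 * L < \<bar>m \<omega>\<bar>} \<le> prob ({\<omega>\<in>space M. 8 * L\<^sup>2 < Q \<omega>} \<union> E)"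
      by (intro finite_measure_mono) (auto simp: E_def)
    also have "\<dots> \<le> prob {\<omega>\<in>space M. 8 * L\<^sup>2 < Q \<omega>} + prob E" by (intro measure_Un_le) auto
    also have "\<dots> \<le> p" using PQ PE by (simp add: r_def)
    finally show "prob {\<omega>\<in>space M. 6 * L < \<bar>\<Sum>i\<in>I. c i * \<mu> (B i) \<omega>\<bar>} \<le> p" unfolding m_def .
  qed
qed

subsection \<open>Integrals of simple functions\<close>

abbreviation simp_int where "simp_int \<equiv> sm_simple_integral N \<mu>"

lemma vimage_sets: "simple_function N g \<Longrightarrow> g -` {c} \<inter> space N \<in> sets N"
  by (rule simple_functionD(2))

lemma simp_int_measurable [measurable]:
  assumes "simple_function N g" "A \<in> sets N"
  shows "simp_int A g \<in> borel_measurable M"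
proof -
  have "(\<lambda>\<omega>. \<Sum>c\<in>g ` space N. c * \<mu> (A \<inter> (g -` {c} \<inter> space N)) \<omega>) \<in> borel_measurable M"
    by (intro borel_measurable_sum borel_measurable_times mu_measurable sets.Int assms(2)
        vimage_sets[OF assms(1)] borel_measurable_const)
  then show ?thesis by (simp add: sm_simple_integral_def[abs_def])
qed

text \<open>
  The integral of a simple function is defined by the partition into level sets. It can be computed
  from any finite partition on whose members the function is constant.
\<close>

lemma simp_int_repr:
  assumes g: "simple_function N g" and A: "A \<in> sets N" and J: "finite J"
    and B: "\<And>j. j \<in> J \<Longrightarrow> B j \<in> sets N" "disjoint_family_on B J" "A \<subseteq> (\<Union>j\<in>J. B j)"
    and c: "\<And>j x. j \<in> J \<Longrightarrow> x \<in> A \<inter> B j \<Longrightarrow> g x = c j"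
  shows "AE \<omega> in M. simp_int A g \<omega> = (\<Sum>j\<in>J. c j * \<mu> (A \<inter> B j) \<omega>)"
proof -
  define V where "V = (\<lambda>v. g -` {v} \<inter> space N)"
  have V: "V v \<in> sets N" for v using vimage_sets[OF g] by (simp add: V_def)
  have fin: "finite (g ` space N)" using g by (rule simple_functionD(1))
  have AN: "A \<subseteq> space N" using A by (rule sets.sets_into_space)
  have 1: "AE \<omega> in M. \<forall>v\<in>g ` space N. \<mu> (A \<inter> V v) \<omega> = (\<Sum>j\<in>J. \<mu> (A \<inter> V v \<inter> B j) \<omega>)"
  proof (rule AE_finite_allI[OF fin])
    fix v
    have "AE \<omega> in M. \<mu> (\<Union>j\<in>J. A \<inter> V v \<inter> B j) \<omega> = (\<Sum>j\<in>J. \<mu> (A \<inter> V v \<inter> B j) \<omega>)"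
    proof (rule mu_finite_Union[OF J])
      show "disjoint_family_on (\<lambda>j. A \<inter> V v \<inter> B j) J"
        using B(2) unfolding disjoint_family_on_def by blast
    qed (use A V B in auto)
    moreover have "(\<Union>j\<in>J. A \<inter> V v \<inter> B j) = A \<inter> V v" using B(3) by blast
    ultimately show "AE \<omega> in M. \<mu> (A \<inter> V v) \<omega> = (\<Sum>j\<in>J. \<mu> (A \<inter> V v \<inter> B j) \<omega>)" by simp
  qed
  have 2: "AE \<omega> in M. \<forall>j\<in>J. \<mu> (A \<inter> B j) \<omega> = (\<Sum>v\<in>g ` space N. \<mu> (A \<inter> V v \<inter> B j) \<omega>)"
  proof (rule AE_finite_allI[OF J])
    fix j assume j: "j \<in> J"
    have "AE \<omega> in M. \<mu> (\<Union>v\<in>g ` space N. A \<inter> V v \<inter> B j) \<omega> = (\<Sum>v\<in>g ` space N. \<mu> (A \<inter> V v \<inter> B j) \<omega>)"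
    proof (rule mu_finite_Union[OF fin])
      show "disjoint_family_on (\<lambda>v. A \<inter> V v \<inter> B j) (g ` space N)"
        unfolding disjoint_family_on_def V_def by blast
    qed (use A V B j in auto)
    moreover have "(\<Union>v\<in>g ` space N. A \<inter> V v \<inter> B j) = A \<inter> B j" using AN unfolding V_def by blast
    ultimately show "AE \<omega> in M. \<mu> (A \<inter> B j) \<omega> = (\<Sum>v\<in>g ` space N. \<mu> (A \<inter> V v \<inter> B j) \<omega>)" by simp
  qed
  show ?thesis
    using 1 2 mu_empty
  proof eventually_elim
    case (elim \<omega>)
    have "simp_int A g \<omega> = (\<Sum>v\<in>g ` space N. v * \<mu> (A \<inter> V v) \<omega>)"
      unfolding sm_simple_integral_def V_def ..
    also have "\<dots> = (\<Sum>v\<in>g ` space N. v * (\<Sum>j\<in>J. \<mu> (A \<inter> V v \<inter> B j) \<omega>))"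
      by (intro sum.cong refl) (simp only: bspec[OF elim(1)])
    also have "\<dots> = (\<Sum>j\<in>J. \<Sum>v\<in>g ` space N. v * \<mu> (A \<inter> V v \<inter> B j) \<omega>)"
      unfolding sum_distrib_left by (rule sum.swap)
    also have "\<dots> = (\<Sum>j\<in>J. \<Sum>v\<in>g ` space N. c j * \<mu> (A \<inter> V v \<inter> B j) \<omega>)"
    proof (intro sum.cong refl)
      fix j v assume j: "j \<in> J"
      show "v * \<mu> (A \<inter> V v \<inter> B j) \<omega> = c j * \<mu> (A \<inter> V v \<inter> B j) \<omega>"
      proof (cases "A \<inter> V v \<inter> B j = {}")
        case True
        then show ?thesis using elim(3) by simp
      next
        case False
        then obtain x where "x \<in> A" "x \<in> V v" "x \<in> B j" by blast
        then have "v = c j" using c[OF j, of x] by (simp add: V_def)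
        then show ?thesis by simp
      qed
    qed
    also have "\<dots> = (\<Sum>j\<in>J. c j * \<mu> (A \<inter> B j) \<omega>)"
      unfolding sum_distrib_left[symmetric] by (intro sum.cong refl) (simp only: bspec[OF elim(2)])
    finally show ?case .
  qed
qed

lemma simp_int_linear:
  assumes g: "simple_function N g" and h: "simple_function N h" and A: "A \<in> sets N"
  shows "AE \<omega> in M. simp_int A (\<lambda>x. a * g x + b * h x) \<omega> = a * simp_int A g \<omega> + b * simp_int A h \<omega>"
proof -
  define J where "J = (g ` space N) \<times> (h ` space N)"
  define B where "B = (\<lambda>(c, d). (g -` {c} \<inter> space N) \<inter> (h -` {d} \<inter> space N))"
  have J: "finite J" unfolding J_def using simple_functionD(1)[OF g] simple_functionD(1)[OF h] by blast
  have B1: "\<And>j. j \<in> J \<Longrightarrow> B j \<in> sets N" unfolding B_def using vimage_sets[OF g] vimage_sets[OF h] by (auto split: prod.split)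
  have B2: "disjoint_family_on B J" unfolding disjoint_family_on_def B_def by auto
  have B3: "A \<subseteq> (\<Union>j\<in>J. B j)"
  proof
    fix x assume "x \<in> A"
    then have "x \<in> space N" using sets.sets_into_space[OF A] by blast
    then have "x \<in> B (g x, h x)" "(g x, h x) \<in> J" by (auto simp: B_def J_def)
    then show "x \<in> (\<Union>j\<in>J. B j)" by blast
  qed
  have gh: "simple_function N (\<lambda>x. a * g x + b * h x)"
    using g h by (intro simple_function_add simple_function_mult simple_function_const)
  have e1: "AE \<omega> in M. simp_int A g \<omega> = (\<Sum>j\<in>J. fst j * \<mu> (A \<inter> B j) \<omega>)"
    by (rule simp_int_repr[OF g A J B1 B2 B3]) (auto simp: B_def)
  have e2: "AE \<omega> in M. simp_int A h \<omega> = (\<Sum>j\<in>J. snd j * \<mu> (A \<inter> B j) \<omega>)"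
    by (rule simp_int_repr[OF h A J B1 B2 B3]) (auto simp: B_def)
  have e3: "AE \<omega> in M. simp_int A (\<lambda>x. a * g x + b * h x) \<omega> = (\<Sum>j\<in>J. (a * fst j + b * snd j) * \<mu> (A \<inter> B j) \<omega>)"
    by (rule simp_int_repr[OF gh A J B1 B2 B3]) (auto simp: B_def)
  show ?thesis using e1 e2 e3
    by eventually_elim (simp add: sum_distrib_left sum.distrib[symmetric] algebra_simps)
qed

lemma simp_int_indicator:
  assumes g: "simple_function N g" and A: "A \<in> sets N" and D: "D \<in> sets N"
  shows "AE \<omega> in M. simp_int D (\<lambda>x. g x * indicator A x) \<omega> = simp_int (A \<inter> D) g \<omega>"
proof -
  define J where "J = (g ` space N) \<times> (UNIV :: bool set)"
  define B where "B = (\<lambda>(c, b). (g -` {c} \<inter> space N) \<inter> (if b then A else space N - A))"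
  have J: "finite J" unfolding J_def using simple_functionD(1)[OF g] by simp
  have B1: "\<And>j. j \<in> J \<Longrightarrow> B j \<in> sets N" unfolding B_def using vimage_sets[OF g] A by (auto split: prod.split)
  have B2: "disjoint_family_on B J" unfolding disjoint_family_on_def B_def by (auto split: if_splits)
  have B3: "D \<subseteq> (\<Union>j\<in>J. B j)"
  proof
    fix x assume "x \<in> D"
    then have "x \<in> space N" using sets.sets_into_space[OF D] by blast
    then have "x \<in> B (g x, x \<in> A)" "(g x, x \<in> A) \<in> J" by (auto simp: B_def J_def)
    then show "x \<in> (\<Union>j\<in>J. B j)" by blast
  qed
  have gA: "simple_function N (\<lambda>x. g x * indicator A x)"
    using g A by (intro simple_function_mult simple_function_indicator)
  have e: "AE \<omega> in M. simp_int D (\<lambda>x. g x * indicator A x) \<omega> =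
      (\<Sum>j\<in>J. (if snd j then fst j else 0) * \<mu> (D \<inter> B j) \<omega>)"
    by (rule simp_int_repr[OF gA D J B1 B2 B3]) (auto simp: B_def split: if_splits)
  have "(\<Sum>j\<in>J. (if snd j then fst j else 0) * \<mu> (D \<inter> B j) \<omega>) = simp_int (A \<inter> D) g \<omega>" for \<omega>
  proof -
    have "D \<inter> B (c, True) = A \<inter> D \<inter> (g -` {c} \<inter> space N)" for c by (auto simp: B_def)
    moreover have "(\<Sum>j\<in>J. F j) = (\<Sum>c\<in>g ` space N. \<Sum>b\<in>UNIV. F (c, b))" for F :: "real \<times> bool \<Rightarrow> real"
      unfolding J_def by (subst sum.cartesian_product) (simp add: case_prod_beta')
    ultimately show ?thesis
      by (simp add: sm_simple_integral_def UNIV_bool)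
  qed
  then show ?thesis using e by simp
qed

lemma simp_int_Int_Diff:
  assumes g: "simple_function N g" and A: "A \<in> sets N" and D: "D \<in> sets N"
  shows "AE \<omega> in M. simp_int A g \<omega> = simp_int (A \<inter> D) g \<omega> + simp_int (A - D) g \<omega>"
proof -
  let ?V = "\<lambda>c. g -` {c} \<inter> space N"
  have "AE \<omega> in M. \<forall>c\<in>g ` space N. \<mu> (A \<inter> ?V c) \<omega> = \<mu> (A \<inter> D \<inter> ?V c) \<omega> + \<mu> ((A - D) \<inter> ?V c) \<omega>"
  proof (rule AE_finite_allI[OF simple_functionD(1)[OF g]])
    fix c
    have "A \<inter> ?V c \<inter> D = A \<inter> D \<inter> ?V c" "A \<inter> ?V c - D = (A - D) \<inter> ?V c" by auto
    then show "AE \<omega> in M. \<mu> (A \<inter> ?V c) \<omega> = \<mu> (A \<inter> D \<inter> ?V c) \<omega> + \<mu> ((A - D) \<inter> ?V c) \<omega>"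
      using mu_Int_Diff[of "A \<inter> ?V c" D] vimage_sets[OF g] A D by auto
  qed
  then show ?thesis
  proof eventually_elim
    case (elim \<omega>)
    have "simp_int A g \<omega> = (\<Sum>c\<in>g ` space N. c * (\<mu> (A \<inter> D \<inter> ?V c) \<omega> + \<mu> ((A - D) \<inter> ?V c) \<omega>))"
      unfolding sm_simple_integral_def by (intro sum.cong refl) (simp only: bspec[OF elim])
    then show ?case by (simp add: sm_simple_integral_def sum.distrib distrib_left)
  qed
qed

text \<open>
  The boundedness of linear combinations, rescaled: small simple functions have small integrals.
\<close>

lemma simp_int_small:
  assumes "\<eta> > 0"
  obtains \<epsilon> where "\<epsilon> > 0" "\<And>g A. simple_function N g \<Longrightarrow> A \<in> sets N \<Longrightarrow> (\<And>x. x \<in> A \<Longrightarrow> \<bar>g x\<bar> \<le> \<epsilon>) \<Longrightarrow>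
    prob_norm M (simp_int A g) \<le> \<eta>"
proof -
  obtain K where K: "K > 0" "\<And>(I :: real set) B c. finite I \<Longrightarrow> (\<And>i. i \<in> I \<Longrightarrow> B i \<in> sets N) \<Longrightarrow>
     disjoint_family_on B I \<Longrightarrow> (\<And>i. i \<in> I \<Longrightarrow> \<bar>c i\<bar> \<le> 1) \<Longrightarrow>
     prob {\<omega>\<in>space M. K < \<bar>\<Sum>i\<in>I. c i * \<mu> (B i) \<omega>\<bar>} \<le> \<eta> / 2"
    by (rule mu_combinations_bounded[of "\<eta> / 2", where ?'i=real]) (use assms in auto)
  define \<epsilon> where "\<epsilon> = \<eta> / (2 * K)"
  have \<epsilon>: "\<epsilon> > 0" "\<epsilon> * K = \<eta> / 2" using K(1) assms by (auto simp: \<epsilon>_def)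
  show ?thesis
  proof (rule that[OF \<epsilon>(1)])
    fix g A assume g: "simple_function N g" and A: "A \<in> sets N" and le: "\<And>x. x \<in> A \<Longrightarrow> \<bar>g x\<bar> \<le> \<epsilon>"
    let ?V = "\<lambda>c. g -` {c} \<inter> space N"
    \<comment> \<open>level sets that do not meet \<open>A\<close> may have large values of \<open>g\<close>; their coefficient is set to \<open>0\<close>\<close>
    define c where "c = (\<lambda>v. if A \<inter> ?V v = {} then 0 else v)"
    have fin: "finite (g ` space N)" using g by (rule simple_functionD(1))
    have AN: "A \<subseteq> space N" using A by (rule sets.sets_into_space)
    have c1: "\<bar>c v / \<epsilon>\<bar> \<le> 1" for v
    proof (cases "A \<inter> ?V v = {}")
      case False
      then obtain x where "x \<in> A" "g x = v" by blast
      then have "\<bar>v\<bar> \<le> \<epsilon>" using le by blast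
      then show ?thesis using False \<epsilon> by (simp add: c_def)
    qed (simp add: c_def)
    have s: "A \<inter> ?V v \<in> sets N" for v using A vimage_sets[OF g] by auto
    have d: "disjoint_family_on (\<lambda>v. A \<inter> ?V v) (g ` space N)" unfolding disjoint_family_on_def by blast
    have m: "(\<lambda>\<omega>. \<Sum>v\<in>g ` space N. c v / \<epsilon> * \<mu> (A \<inter> ?V v) \<omega>) \<in> borel_measurable M"
      using s by (intro borel_measurable_sum borel_measurable_times) auto
    have eq: "AE \<omega> in M. simp_int A g \<omega> = \<epsilon> * (\<Sum>v\<in>g ` space N. c v / \<epsilon> * \<mu> (A \<inter> ?V v) \<omega>)"
      using mu_empty
    proof eventually_elim
      case (elim \<omega>)
      have "v * \<mu> (A \<inter> ?V v) \<omega> = \<epsilon> * (c v / \<epsilon> * \<mu> (A \<inter> ?V v) \<omega>)" for v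
        using elim \<epsilon>(1) by (auto simp: c_def)
      then show ?case unfolding sm_simple_integral_def sum_distrib_left by (intro sum.cong refl)
    qed
    have "prob_norm M (simp_int A g) = prob_norm M (\<lambda>\<omega>. \<epsilon> * (\<Sum>v\<in>g ` space N. c v / \<epsilon> * \<mu> (A \<inter> ?V v) \<omega>))"
      using eq m by (intro prob_norm_cong_AE simp_int_measurable g A borel_measurable_times) auto
    also have "\<dots> \<le> \<eta> / 2 + prob {\<omega>\<in>space M. \<eta> / 2 < \<bar>\<epsilon> * (\<Sum>v\<in>g ` space N. c v / \<epsilon> * \<mu> (A \<inter> ?V v) \<omega>)\<bar>}"
      using m assms by (intro prob_norm_le_prob_gt borel_measurable_times) auto
    also have "{\<omega>\<in>space M. \<eta> / 2 < \<bar>\<epsilon> * (\<Sum>v\<in>g ` space N. c v / \<epsilon> * \<mu> (A \<inter> ?V v) \<omega>)\<bar>} =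
        {\<omega>\<in>space M. K < \<bar>\<Sum>v\<in>g ` space N. c v / \<epsilon> * \<mu> (A \<inter> ?V v) \<omega>\<bar>}"
      unfolding abs_mult \<epsilon>(2)[symmetric] using \<epsilon>(1) by (simp only: abs_of_pos mult_less_cancel_left_pos)
    also have "prob \<dots> \<le> \<eta> / 2"
      by (intro K(2) fin s d c1)
    finally show "prob_norm M (simp_int A g) \<le> \<eta>" by simp
  qed
qed

lemma simp_int_tendsto_0:
  assumes g: "simple_function N g" and E: "\<And>n. E n \<in> sets N"
    and lim: "\<And>F. F \<in> sets N \<Longrightarrow> (\<lambda>n. prob_norm M (\<mu> (E n \<inter> F))) \<longlonglongrightarrow> 0"
  shows "(\<lambda>n. prob_norm M (simp_int (E n) g)) \<longlonglongrightarrow> 0"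
  unfolding sm_simple_integral_def[abs_def]
  by (intro prob_norm_sum_tendsto_0 simple_functionD(1)[OF g] lim mu_measurable sets.Int E vimage_sets[OF g])

text \<open>
  Otherwise there are sets \<open>E m \<subseteq> C m\<close> with integrals that are not small. Cutting off a set \<open>C n\<close> with
  \<open>n\<close> large changes the integral over \<open>E m\<close> by little, so disjoint sets with this property can be
  chosen, in contradiction to \<open>mu_disjoint_tendsto\<close>.
\<close>

lemma simp_int_abs_continuous:
  assumes g: "simple_function N g" and C: "\<And>n. C n \<in> sets N" "decseq C" "(\<Inter>n. C n) = {}" and \<eta>: "\<eta> > 0"
  obtains m where "\<And>E. E \<in> sets N \<Longrightarrow> E \<subseteq> C m \<Longrightarrow> prob_norm M (simp_int E g) \<le> \<eta>"
proof (rule ccontr)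
  assume neg: "\<not> thesis"
  have "\<exists>E. E \<in> sets N \<and> E \<subseteq> C m \<and> \<eta> < prob_norm M (simp_int E g)" for m
    using neg that[of m] by (meson not_less)
  then obtain E where E: "\<And>m. E m \<in> sets N" "\<And>m. E m \<subseteq> C m" "\<And>m. \<eta> < prob_norm M (simp_int (E m) g)"
    by metis
  have "\<exists>n>m. prob_norm M (simp_int (E m \<inter> C n) g) < \<eta> / 2" for m
  proof -
    have "(\<lambda>n. prob_norm M (simp_int (E m \<inter> C n) g)) \<longlonglongrightarrow> 0"
    proof (rule simp_int_tendsto_0[OF g])
      fix F assume F: "F \<in> sets N"
      show "(\<lambda>n. prob_norm M (\<mu> (E m \<inter> C n \<inter> F))) \<longlonglongrightarrow> 0"
      proof (rule mu_decseq_tendsto)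
        show "decseq (\<lambda>n. E m \<inter> C n \<inter> F)" using C(2) unfolding decseq_def by blast
        show "(\<Inter>n. E m \<inter> C n \<inter> F) = {}" using C(3) by blast
      qed (use E C F in auto)
    qed (use E C in auto)
    then have "eventually (\<lambda>n. prob_norm M (simp_int (E m \<inter> C n) g) < \<eta> / 2) sequentially"
      using \<eta> by (intro order_tendstoD(2)) auto
    then have "eventually (\<lambda>n. n > m \<and> prob_norm M (simp_int (E m \<inter> C n) g) < \<eta> / 2) sequentially"
      by (intro eventually_conj eventually_gt_at_top)
    then show ?thesis by (rule eventually_happens'[OF sequentially_bot])
  qed
  then obtain nx where nx: "\<And>m. nx m > m" "\<And>m. prob_norm M (simp_int (E m \<inter> C (nx m)) g) < \<eta> / 2"
    by metis
  define k where "k = (\<lambda>i. (nx ^^ i) 0)"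
  have kS: "k (Suc i) = nx (k i)" for i by (simp add: k_def)
  have "strict_mono k" by (rule strict_mono_Suc_iff[THEN iffD2]) (simp add: kS nx)
  define D where "D = (\<lambda>i. E (k i) - C (k (Suc i)))"
  have Ds: "D i \<in> sets N" for i using E C by (auto simp: D_def)
  have Dj: "D i \<inter> D j = {}" if "i < j" for i j
  proof -
    have "k (Suc i) \<le> k j" using \<open>strict_mono k\<close> that by (simp add: strict_mono_less_eq Suc_le_eq)
    then have "C (k j) \<subseteq> C (k (Suc i))" using C(2) by (simp add: decseqD)
    then show ?thesis using E(2)[of "k j"] by (auto simp: D_def)
  qed
  have dj: "disjoint_family D"
    unfolding disjoint_family_on_def
  proof (intro ballI impI)
    fix i j :: nat assume "i \<noteq> j"
    then show "D i \<inter> D j = {}" using Dj[of i j] Dj[of j i] by (cases "i < j") auto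
  qed
  have "(\<lambda>n. prob_norm M (simp_int (D n) g)) \<longlonglongrightarrow> 0"
  proof (rule simp_int_tendsto_0[OF g Ds])
    fix F assume "F \<in> sets N"
    then show "(\<lambda>n. prob_norm M (\<mu> (D n \<inter> F))) \<longlonglongrightarrow> 0"
      using dj Ds by (intro mu_disjoint_tendsto) (auto simp: disjoint_family_on_def)
  qed
  moreover have "\<eta> / 2 \<le> prob_norm M (simp_int (D n) g)" for n
  proof -
    have s: "E (k n) \<in> sets N" "C (k (Suc n)) \<in> sets N" using E C by auto
    have "prob_norm M (simp_int (E (k n)) g) =
        prob_norm M (\<lambda>\<omega>. simp_int (E (k n) \<inter> C (k (Suc n))) g \<omega> + simp_int (D n) g \<omega>)"
      using simp_int_Int_Diff[OF g s] s Ds unfolding D_def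
      by (intro prob_norm_cong_AE borel_measurable_add simp_int_measurable g) auto
    also have "\<dots> \<le> prob_norm M (simp_int (E (k n) \<inter> C (k (Suc n))) g) + prob_norm M (simp_int (D n) g)"
      using s Ds by (intro prob_norm_add simp_int_measurable g) auto
    finally show ?thesis using E(3)[of "k n"] nx(2)[of "k n"] by (simp add: kS)
  qed
  ultimately have "\<eta> / 2 \<le> 0" by (intro LIMSEQ_le_const) auto
  then show False using \<eta> by simp
qed

end

subsection \<open>Uniqueness of the limit of integrals\<close>

context stoch_measure
begin

text \<open>
  Gliding hump. Let \<open>C m\<close> be the set where some \<open>G n\<close> with \<open>n \<ge> m\<close> exceeds \<open>\<epsilon>\<close> in absolute value; these sets decrease to the
  empty set. Along a subsequence \<open>k\<close>, the integral of \<open>G (k i)\<close> is up to a small error carried by the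
  ring \<open>R i\<close> between \<open>C (k i)\<close> and \<open>C (k (Suc i))\<close>: outside \<open>C (k i)\<close> the function is small, and \<open>C (k (Suc i))\<close> is so
  small that it does not count. Let \<open>D\<close> be the union of the rings with even index, within \<open>A\<close>.
  The integrals over \<open>D\<close> converge, and their limit is small because of the odd indices. Along the
  even indices the integrals over \<open>D\<close> and over \<open>A\<close> agree up to a small error, so that the limit \<open>Y\<close> is
  small, too.
\<close>

lemma simp_int_limit_unique:
  assumes ap: "sm_approx M N \<mu> (\<lambda>_. 0) G" and A: "A \<in> sets N"
    and Y: "tendsto_in_prob M (\<lambda>n. simp_int A (G n)) Y"
  shows "AE \<omega> in M. Y \<omega> = 0"
proof -
  have G: "simple_function N (G n)" for n using ap by (simp add: sm_approx_def)
  have G0: "(\<lambda>n. G n x) \<longlonglongrightarrow> 0" if "x \<in> space N" for x using ap that by (simp add: sm_approx_def)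
  have conv: "\<exists>Y. tendsto_in_prob M (\<lambda>n. simp_int D (G n)) Y" if "D \<in> sets N" for D
    using ap that by (simp add: sm_approx_def)
  have Ym [measurable]: "Y \<in> borel_measurable M" using Y by (simp add: tendsto_in_prob_iff)
  have "prob_norm M Y \<le> 6 * \<eta>" if \<eta>: "\<eta> > 0" for \<eta>
  proof -
    obtain \<epsilon> where \<epsilon>: "\<epsilon> > 0" "\<And>g D. simple_function N g \<Longrightarrow> D \<in> sets N \<Longrightarrow> (\<And>x. x \<in> D \<Longrightarrow> \<bar>g x\<bar> \<le> \<epsilon>) \<Longrightarrow>
        prob_norm M (simp_int D g) \<le> \<eta>"
      by (rule simp_int_small[OF \<eta>]) blast
    define C where "C = (\<lambda>m. {x\<in>space N. \<exists>n\<ge>m. \<epsilon> < \<bar>G n x\<bar>})"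
    have Gm [measurable]: "G n \<in> borel_measurable N" for n using G by (rule borel_measurable_simple_function)
    have Cs: "C m \<in> sets N" for m unfolding C_def by measurable
    have Cd: "decseq C" unfolding decseq_def C_def by (auto intro: order_trans)
    have C0: "(\<Inter>m. C m) = {}"
    proof -
      have "x \<notin> (\<Inter>m. C m)" for x
      proof
        assume x: "x \<in> (\<Inter>m. C m)"
        then have "x \<in> space N" by (auto simp: C_def)
        from LIMSEQ_D[OF G0[OF this] \<epsilon>(1)] obtain m where "\<forall>n\<ge>m. \<bar>G n x\<bar> < \<epsilon>" by auto
        moreover from x have "x \<in> C m" by blast
        ultimately show False by (auto simp: C_def)
      qed
      then show ?thesis by blast
    qed
    have "\<forall>n. \<exists>m. m > n \<and> (\<forall>E\<in>sets N. E \<subseteq> C m \<longrightarrow> prob_norm M (simp_int E (G n)) \<le> \<eta>)"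
    proof
      fix n
      obtain m where m: "\<And>E. E \<in> sets N \<Longrightarrow> E \<subseteq> C m \<Longrightarrow> prob_norm M (simp_int E (G n)) \<le> \<eta>"
        using simp_int_abs_continuous[OF G Cs Cd C0 \<eta>, of n] by blast
      have "C (max m (Suc n)) \<subseteq> C m" by (rule decseqD[OF Cd]) simp
      then have "\<forall>E\<in>sets N. E \<subseteq> C (max m (Suc n)) \<longrightarrow> prob_norm M (simp_int E (G n)) \<le> \<eta>" using m by blast
      then show "\<exists>m. m > n \<and> (\<forall>E\<in>sets N. E \<subseteq> C m \<longrightarrow> prob_norm M (simp_int E (G n)) \<le> \<eta>)"
        by (intro exI[of _ "max m (Suc n)"] conjI) simp_all
    qed
    from choice[OF this] obtain nx where nxx: "\<forall>n. nx n > n \<and> (\<forall>E\<in>sets N. E \<subseteq> C (nx n) \<longrightarrow> prob_norm M (simp_int E (G n)) \<le> \<eta>)" ..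
    have nx: "nx n > n" "\<And>E. E \<in> sets N \<Longrightarrow> E \<subseteq> C (nx n) \<Longrightarrow> prob_norm M (simp_int E (G n)) \<le> \<eta>" for n
      using spec[OF nxx, of n] by blast+
    define k where "k = (\<lambda>i. (nx ^^ i) 0)"
    have kS: "k (Suc i) = nx (k i)" for i by (simp add: k_def)
    have km: "strict_mono k" by (rule strict_mono_Suc_iff[THEN iffD2]) (simp add: kS nx)
    define R where "R = (\<lambda>i. C (k i) - C (k (Suc i)))"
    have Rs: "R i \<in> sets N" for i using Cs by (auto simp: R_def)
    have Rj: "R i \<inter> R j = {}" if "i \<noteq> j" for i j
    proof -
      have *: "R i \<inter> R j = {}" if "i < j" for i j
      proof -
        have "k (Suc i) \<le> k j" using km that by (simp add: strict_mono_less_eq Suc_le_eq)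
        then have "C (k j) \<subseteq> C (k (Suc i))" using Cd by (simp add: decseqD)
        then show ?thesis by (auto simp: R_def)
      qed
      show ?thesis using *[of i j] *[of j i] that by (cases "i < j") auto
    qed
    \<comment> \<open>the integral of \<open>G (k i)\<close> is carried by \<open>R i\<close>\<close>
    have ring: "prob_norm M (\<lambda>\<omega>. simp_int D (G (k i)) \<omega> - simp_int (D \<inter> R i) (G (k i)) \<omega>) \<le> 2 * \<eta>"
      if D: "D \<in> sets N" for D i
    proof -
      let ?G = "G (k i)"
      let ?C = "C (k i)" and ?C' = "C (k (Suc i))"
      have s: "?C \<in> sets N" "?C' \<in> sets N" "D \<inter> ?C \<in> sets N" "D - ?C \<in> sets N" "D \<inter> ?C \<inter> ?C' \<in> sets N" "D \<inter> R i \<in> sets N"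
        using Cs D Rs by auto
      have R: "D \<inter> ?C - ?C' = D \<inter> R i" by (auto simp: R_def)
      have small: "prob_norm M (simp_int (D - ?C) ?G) \<le> \<eta>"
      proof (rule \<epsilon>(2)[OF G s(4)])
        fix x assume "x \<in> D - ?C"
        then have "x \<in> space N" "x \<notin> ?C" using sets.sets_into_space[OF D] by auto
        then show "\<bar>?G x\<bar> \<le> \<epsilon>" by (auto simp: C_def not_less)
      qed
      have small': "prob_norm M (simp_int (D \<inter> ?C \<inter> ?C') ?G) \<le> \<eta>"
        using s by (intro nx(2)) (auto simp: kS)
      have "prob_norm M (\<lambda>\<omega>. simp_int D ?G \<omega> - simp_int (D \<inter> R i) ?G \<omega>) =
          prob_norm M (\<lambda>\<omega>. simp_int (D \<inter> ?C \<inter> ?C') ?G \<omega> + simp_int (D - ?C) ?G \<omega>)"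
      proof (rule prob_norm_cong_AE)
        show "AE \<omega> in M. simp_int D ?G \<omega> - simp_int (D \<inter> R i) ?G \<omega> =
            simp_int (D \<inter> ?C \<inter> ?C') ?G \<omega> + simp_int (D - ?C) ?G \<omega>"
          using simp_int_Int_Diff[OF G[of "k i"] D s(1)] simp_int_Int_Diff[OF G[of "k i"] s(3) s(2)]
          unfolding R by eventually_elim simp
      qed (use s D in \<open>auto intro!: borel_measurable_diff borel_measurable_add simp_int_measurable G\<close>)
      also have "\<dots> \<le> prob_norm M (simp_int (D \<inter> ?C \<inter> ?C') ?G) + prob_norm M (simp_int (D - ?C) ?G)"
        using s by (intro prob_norm_add simp_int_measurable G)
      finally show ?thesis using small small' by simp
    qed
    define D where "D = A \<inter> (\<Union>i. R (2 * i))"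
    have D: "D \<in> sets N" unfolding D_def using A Rs by auto
    obtain Z where Z: "tendsto_in_prob M (\<lambda>n. simp_int D (G n)) Z" using conv[OF D] by blast
    have [measurable]: "Z \<in> borel_measurable M" using Z by (simp add: tendsto_in_prob_iff)
    have mA [measurable]: "simp_int A (G n) \<in> borel_measurable M" "simp_int D (G n) \<in> borel_measurable M"
      "simp_int (A \<inter> R i) (G n) \<in> borel_measurable M" for n i
      using A D Rs by (auto intro!: simp_int_measurable G)
    have limA: "(\<lambda>n. prob_norm M (\<lambda>\<omega>. simp_int A (G n) \<omega> - Y \<omega>)) \<longlonglongrightarrow> 0"
      and limD: "(\<lambda>n. prob_norm M (\<lambda>\<omega>. simp_int D (G n) \<omega> - Z \<omega>)) \<longlonglongrightarrow> 0"
      using Y Z by (simp_all add: tendsto_in_prob_iff)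
    have sub: "strict_mono (\<lambda>i. k (2 * i))" "strict_mono (\<lambda>i. k (2 * i + 1))"
      using km by (auto simp: strict_mono_def)
    \<comment> \<open>odd indices: \<open>D\<close> does not meet the ring that carries the integral\<close>
    have Zodd: "prob_norm M Z \<le> 2 * \<eta> + prob_norm M (\<lambda>\<omega>. simp_int D (G (k (2 * i + 1))) \<omega> - Z \<omega>)" for i
    proof -
      have "R (2 * j) \<inter> R (2 * i + 1) = {}" for j by (rule Rj) presburger
      then have e: "D \<inter> R (2 * i + 1) = {}" unfolding D_def by blast
      have "prob_norm M (simp_int D (G (k (2 * i + 1)))) =
          prob_norm M (\<lambda>\<omega>. simp_int D (G (k (2 * i + 1))) \<omega> - simp_int {} (G (k (2 * i + 1))) \<omega>)"
      proof (rule prob_norm_cong_AE)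
        show "AE \<omega> in M. simp_int D (G (k (2 * i + 1))) \<omega> =
           simp_int D (G (k (2 * i + 1))) \<omega> - simp_int {} (G (k (2 * i + 1))) \<omega>"
          using mu_empty by eventually_elim (simp add: sm_simple_integral_def)
      qed (auto intro!: borel_measurable_diff simp_int_measurable G D)
      also have "\<dots> \<le> 2 * \<eta>" using ring[OF D, of "2 * i + 1"] unfolding e .
      finally have 1: "prob_norm M (simp_int D (G (k (2 * i + 1)))) \<le> 2 * \<eta>" .
      have "prob_norm M Z \<le> prob_norm M (simp_int D (G (k (2 * i + 1)))) + prob_norm M (\<lambda>\<omega>. Z \<omega> - simp_int D (G (k (2 * i + 1))) \<omega>)"
        by (rule prob_norm_triangle_sub) auto
      then show ?thesis using 1 prob_norm_diff_commute[of Z "simp_int D (G (k (2 * i + 1)))"] by linarith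
    qed
    have "(\<lambda>i. 2 * \<eta> + prob_norm M (\<lambda>\<omega>. simp_int D (G (k (2 * i + 1))) \<omega> - Z \<omega>)) \<longlonglongrightarrow> 2 * \<eta> + 0"
      using LIMSEQ_subseq_LIMSEQ[OF limD sub(2)] by (intro tendsto_add tendsto_const) (simp add: o_def)
    then have Zle: "prob_norm M Z \<le> 2 * \<eta>" using Zodd by (intro LIMSEQ_le_const[of _ "2 * \<eta>"]) auto
    \<comment> \<open>even indices: \<open>D\<close> and \<open>A\<close> have the same trace on the ring that carries the integral\<close>
    have even: "prob_norm M Y \<le> prob_norm M Z + 4 * \<eta> +
        (prob_norm M (\<lambda>\<omega>. simp_int A (G (k (2 * i))) \<omega> - Y \<omega>) + prob_norm M (\<lambda>\<omega>. simp_int D (G (k (2 * i))) \<omega> - Z \<omega>))" for i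
    proof -
      let ?G = "G (k (2 * i))"
      let ?a = "\<lambda>\<omega>. simp_int A ?G \<omega> - simp_int (A \<inter> R (2 * i)) ?G \<omega>"
      let ?d = "\<lambda>\<omega>. simp_int D ?G \<omega> - simp_int (A \<inter> R (2 * i)) ?G \<omega>"
      let ?y = "\<lambda>\<omega>. simp_int A ?G \<omega> - Y \<omega>" and ?z = "\<lambda>\<omega>. simp_int D ?G \<omega> - Z \<omega>"
      have e: "D \<inter> R (2 * i) = A \<inter> R (2 * i)" unfolding D_def by blast
      have 1: "prob_norm M ?a \<le> 2 * \<eta>" using ring[OF A, of "2 * i"] .
      have 2: "prob_norm M ?d \<le> 2 * \<eta>" using ring[OF D, of "2 * i"] unfolding e .
      have "prob_norm M Y = prob_norm M (\<lambda>\<omega>. (Z \<omega> + (?a \<omega> - ?d \<omega>)) + (?z \<omega> - ?y \<omega>))" by simp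
      also have "\<dots> \<le> prob_norm M (\<lambda>\<omega>. Z \<omega> + (?a \<omega> - ?d \<omega>)) + prob_norm M (\<lambda>\<omega>. ?z \<omega> - ?y \<omega>)"
        by (rule prob_norm_add) measurable
      also have "\<dots> \<le> (prob_norm M Z + prob_norm M (\<lambda>\<omega>. ?a \<omega> - ?d \<omega>)) + (prob_norm M ?z + prob_norm M ?y)"
        by (intro add_mono prob_norm_add prob_norm_diff) measurable
      also have "prob_norm M (\<lambda>\<omega>. ?a \<omega> - ?d \<omega>) \<le> prob_norm M ?a + prob_norm M ?d"
        by (rule prob_norm_diff) measurable
      finally show ?thesis using 1 2 by linarith
    qed
    have "(\<lambda>i. prob_norm M Z + 4 * \<eta> +
        (prob_norm M (\<lambda>\<omega>. simp_int A (G (k (2 * i))) \<omega> - Y \<omega>) + prob_norm M (\<lambda>\<omega>. simp_int D (G (k (2 * i))) \<omega> - Z \<omega>)))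
        \<longlonglongrightarrow> prob_norm M Z + 4 * \<eta> + (0 + 0)"
      using LIMSEQ_subseq_LIMSEQ[OF limD sub(1)] LIMSEQ_subseq_LIMSEQ[OF limA sub(1)]
      by (intro tendsto_add tendsto_const) (simp_all add: o_def)
    then have "prob_norm M Y \<le> prob_norm M Z + 4 * \<eta> + (0 + 0)" using even by (intro LIMSEQ_le_const) auto
    then show ?thesis using Zle by simp
  qed
  from this[of "e / 6" for e] have "prob_norm M Y \<le> 0 + e" if "e > 0" for e using that by simp
  then have "prob_norm M Y \<le> 0" by (rule field_le_epsilon)
  then have "prob_norm M Y = 0" using prob_norm_nonneg[of Y] by linarith
  then show ?thesis by (subst (asm) prob_norm_eq_0_iff) auto
qed

subsection \<open>The stochastic integral\<close>

abbreviation sint where "sint \<equiv> sm_integral M N \<mu>"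

lemma sm_approx_linear:
  assumes g: "sm_approx M N \<mu> g G" and h: "sm_approx M N \<mu> h H"
  shows "sm_approx M N \<mu> (\<lambda>x. a * g x + b * h x) (\<lambda>n x. a * G n x + b * H n x)"
  unfolding sm_approx_def
proof (intro conjI allI ballI)
  have G: "\<And>n. simple_function N (G n)" and H: "\<And>n. simple_function N (H n)"
    using g h by (simp_all add: sm_approx_def)
  show GH: "simple_function N (\<lambda>x. a * G n x + b * H n x)" for n
    using G H by (intro simple_function_add simple_function_mult simple_function_const)
  show "(\<lambda>n. a * G n x + b * H n x) \<longlonglongrightarrow> a * g x + b * h x" if "x \<in> space N" for x
    using g h that by (intro tendsto_add tendsto_mult_left) (simp_all add: sm_approx_def)
  fix A assume A: "A \<in> sets N"
  obtain Y Z where Y: "tendsto_in_prob M (\<lambda>n. simp_int A (G n)) Y" and Z: "tendsto_in_prob M (\<lambda>n. simp_int A (H n)) Z"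
    using g h A unfolding sm_approx_def by blast
  have "tendsto_in_prob M (\<lambda>n \<omega>. a * simp_int A (G n) \<omega> + b * simp_int A (H n) \<omega>) (\<lambda>\<omega>. a * Y \<omega> + b * Z \<omega>)"
    by (intro tendsto_in_prob_add tendsto_in_prob_cmult Y Z)
  then have "tendsto_in_prob M (\<lambda>n. simp_int A (\<lambda>x. a * G n x + b * H n x)) (\<lambda>\<omega>. a * Y \<omega> + b * Z \<omega>)"
  proof (rule tendsto_in_prob_cong)
    show "AE \<omega> in M. a * simp_int A (G n) \<omega> + b * simp_int A (H n) \<omega> = simp_int A (\<lambda>x. a * G n x + b * H n x) \<omega>" for n
      using simp_int_linear[OF G H A, of a n b n] by eventually_elim simp
    show "(\<lambda>\<omega>. a * Y \<omega> + b * Z \<omega>) \<in> borel_measurable M"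
      using Y Z by (auto simp: tendsto_in_prob_iff)
  qed (auto intro: simp_int_measurable GH A)
  then show "\<exists>Y. tendsto_in_prob M (\<lambda>n. simp_int A (\<lambda>x. a * G n x + b * H n x)) Y" by blast
qed

text \<open>
  The integral is the limit for every approximating sequence: two of them differ by a sequence that
  approximates the zero function.
\<close>

lemma sint_tendsto:
  assumes g: "sm_approx M N \<mu> g G" and A: "A \<in> sets N"
  shows "tendsto_in_prob M (\<lambda>n. simp_int A (G n)) (sint A g)"
proof -
  have G: "\<And>n. simple_function N (G n)" using g by (simp add: sm_approx_def)
  obtain Z where Z: "tendsto_in_prob M (\<lambda>n. simp_int A (G n)) Z"
    using g A unfolding sm_approx_def by blast
  have "\<exists>Y. \<exists>G. sm_approx M N \<mu> g G \<and> tendsto_in_prob M (\<lambda>n. simp_int A (G n)) Y"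
    using g Z by blast
  from someI_ex[OF this] obtain H where H: "sm_approx M N \<mu> g H"
    "tendsto_in_prob M (\<lambda>n. simp_int A (H n)) (sint A g)"
    unfolding sm_integral_def[symmetric] by blast
  have Hs: "\<And>n. simple_function N (H n)" using H by (simp add: sm_approx_def)
  have d: "sm_approx M N \<mu> (\<lambda>_. 0) (\<lambda>n x. 1 * H n x + (- 1) * G n x)"
    using sm_approx_linear[OF H(1) g, of 1 "-1"] by simp
  have "tendsto_in_prob M (\<lambda>n \<omega>. 1 * simp_int A (H n) \<omega> + (- 1) * simp_int A (G n) \<omega>) (\<lambda>\<omega>. 1 * sint A g \<omega> + (- 1) * Z \<omega>)"
    by (intro tendsto_in_prob_add tendsto_in_prob_cmult H(2) Z)
  then have "tendsto_in_prob M (\<lambda>n. simp_int A (\<lambda>x. 1 * H n x + (- 1) * G n x)) (\<lambda>\<omega>. 1 * sint A g \<omega> + (- 1) * Z \<omega>)"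
  proof (rule tendsto_in_prob_cong)
    show "AE \<omega> in M. 1 * simp_int A (H n) \<omega> + (- 1) * simp_int A (G n) \<omega> = simp_int A (\<lambda>x. 1 * H n x + (- 1) * G n x) \<omega>" for n
      using simp_int_linear[OF Hs G A, of 1 n "-1" n] by eventually_elim simp
    show "(\<lambda>\<omega>. 1 * sint A g \<omega> + (- 1) * Z \<omega>) \<in> borel_measurable M"
      using H(2) Z by (auto simp: tendsto_in_prob_iff)
    show "simp_int A (\<lambda>x. 1 * H n x + (- 1) * G n x) \<in> borel_measurable M" for n
      by (intro simp_int_measurable A simple_function_add simple_function_mult simple_function_const Hs G)
  qed auto
  from simp_int_limit_unique[OF d A this] have "AE \<omega> in M. Z \<omega> = sint A g \<omega>" by eventually_elim simp
  then show ?thesis using H(2)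
    by (intro tendsto_in_prob_cong[OF Z]) (auto simp: tendsto_in_prob_iff intro: simp_int_measurable G A)
qed

lemma sint_measurable:
  assumes "sm_integrable M N \<mu> g" "A \<in> sets N"
  shows "sint A g \<in> borel_measurable M"
proof -
  obtain G where "sm_approx M N \<mu> g G" using assms(1) by (auto simp: sm_integrable_def)
  from sint_tendsto[OF this assms(2)] show ?thesis by (simp add: tendsto_in_prob_iff)
qed

lemma sm_integrable_linear:
  assumes "sm_integrable M N \<mu> g" "sm_integrable M N \<mu> h"
  shows "sm_integrable M N \<mu> (\<lambda>x. a * g x + b * h x)"
proof -
  obtain G H where "sm_approx M N \<mu> g G" "sm_approx M N \<mu> h H"
    using assms by (auto simp: sm_integrable_def)
  from sm_approx_linear[OF this, of a b] show ?thesis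
    using assms by (auto simp: sm_integrable_def)
qed

lemma sint_linear:
  assumes "sm_integrable M N \<mu> g" "sm_integrable M N \<mu> h" and A: "A \<in> sets N"
  shows "AE \<omega> in M. sint A (\<lambda>x. a * g x + b * h x) \<omega> = a * sint A g \<omega> + b * sint A h \<omega>"
proof -
  obtain G H where g: "sm_approx M N \<mu> g G" and h: "sm_approx M N \<mu> h H"
    using assms by (auto simp: sm_integrable_def)
  have G: "\<And>n. simple_function N (G n)" and H: "\<And>n. simple_function N (H n)"
    using g h by (simp_all add: sm_approx_def)
  have 1: "tendsto_in_prob M (\<lambda>n \<omega>. a * simp_int A (G n) \<omega> + b * simp_int A (H n) \<omega>) (\<lambda>\<omega>. a * sint A g \<omega> + b * sint A h \<omega>)"
    by (intro tendsto_in_prob_add tendsto_in_prob_cmult sint_tendsto g h A)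
  have 2: "tendsto_in_prob M (\<lambda>n. simp_int A (\<lambda>x. a * G n x + b * H n x)) (sint A (\<lambda>x. a * g x + b * h x))"
    by (rule sint_tendsto[OF sm_approx_linear[OF g h] A])
  show ?thesis
    by (rule tendsto_in_prob_unique[OF 2 1]) (rule simp_int_linear[OF G H A])
qed

lemma sm_approx_zero: "sm_approx M N \<mu> (\<lambda>_. 0) (\<lambda>_ _. 0)"
proof -
  have "tendsto_in_prob M (\<lambda>n. simp_int A (\<lambda>_. 0)) (simp_int A (\<lambda>_. 0))" if "A \<in> sets N" for A
    using that by (auto simp: tendsto_in_prob_iff prob_norm_def intro: simp_int_measurable)
  then show ?thesis by (auto simp: sm_approx_def)
qed

lemma sint_sum:
  assumes J: "finite J" and g: "\<And>j. j \<in> J \<Longrightarrow> sm_integrable M N \<mu> (g j)" and A: "A \<in> sets N"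
  shows "sm_integrable M N \<mu> (\<lambda>x. \<Sum>j\<in>J. c j * g j x) \<and>
    (AE \<omega> in M. sint A (\<lambda>x. \<Sum>j\<in>J. c j * g j x) \<omega> = (\<Sum>j\<in>J. c j * sint A (g j) \<omega>))"
  using J g
proof (induction J rule: finite_induct)
  case empty
  have "tendsto_in_prob M (\<lambda>n. simp_int A (\<lambda>_. 0)) (sint A (\<lambda>_. 0))"
    by (rule sint_tendsto[OF sm_approx_zero A])
  then have "AE \<omega> in M. sint A (\<lambda>_. 0) \<omega> = 0"
    by (rule simp_int_limit_unique[OF sm_approx_zero A])
  then show ?case using sm_approx_zero by (auto simp: sm_integrable_def)
next
  case (insert j J)
  have i: "sm_integrable M N \<mu> (\<lambda>x. \<Sum>j\<in>J. c j * g j x)"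
    and e: "AE \<omega> in M. sint A (\<lambda>x. \<Sum>j\<in>J. c j * g j x) \<omega> = (\<Sum>j\<in>J. c j * sint A (g j) \<omega>)"
    using insert by auto
  have j: "sm_integrable M N \<mu> (g j)" using insert.prems by simp
  have "sm_integrable M N \<mu> (\<lambda>x. c j * g j x + 1 * (\<Sum>j\<in>J. c j * g j x))"
    by (rule sm_integrable_linear[OF j i])
  moreover have "AE \<omega> in M. sint A (\<lambda>x. c j * g j x + 1 * (\<Sum>j\<in>J. c j * g j x)) \<omega> =
     c j * sint A (g j) \<omega> + 1 * sint A (\<lambda>x. \<Sum>j\<in>J. c j * g j x) \<omega>"
    by (rule sint_linear[OF j i A])
  ultimately show ?case using e insert.hyps by auto
qed

lemma sm_approx_cong:
  assumes "\<And>x. x \<in> space N \<Longrightarrow> g x = h x"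
  shows "sm_approx M N \<mu> g = sm_approx M N \<mu> h"
  unfolding sm_approx_def[abs_def] using assms by (auto simp: fun_eq_iff)

text \<open>
  Needed because the noise term is an integral over \<open>{0<..t}\<close> of a function that vanishes after time \<open>t\<close>,
  while Fourier coefficients are integrals over the whole interval.
\<close>

lemma sint_support:
  assumes g: "sm_integrable M N \<mu> g" and A: "A \<in> sets N" and 0: "\<And>x. x \<in> space N - A \<Longrightarrow> g x = 0"
  shows "AE \<omega> in M. sint (space N) g \<omega> = sint A g \<omega>"
proof -
  obtain G where G: "sm_approx M N \<mu> g G" using g by (auto simp: sm_integrable_def)
  have Gs: "\<And>n. simple_function N (G n)" using G by (simp add: sm_approx_def)
  let ?H = "\<lambda>n x. G n x * indicator A x"
  have Hs: "simple_function N (?H n)" for n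
    using Gs A by (intro simple_function_mult simple_function_indicator)
  have H: "sm_approx M N \<mu> g ?H"
    unfolding sm_approx_def
  proof (intro conjI allI ballI Hs)
    show "(\<lambda>n. ?H n x) \<longlonglongrightarrow> g x" if x: "x \<in> space N" for x
    proof (cases "x \<in> A")
      case True
      then show ?thesis using G x by (simp add: sm_approx_def)
    next
      case False
      then show ?thesis using 0[of x] x by simp
    qed
    fix D assume D: "D \<in> sets N"
    have AD: "A \<inter> D \<in> sets N" using A D by (rule sets.Int)
    have "\<forall>A\<in>sets N. \<exists>Y. tendsto_in_prob M (\<lambda>n. simp_int A (G n)) Y" using G by (simp add: sm_approx_def)
    from bspec[OF this AD] obtain Y where Y: "tendsto_in_prob M (\<lambda>n. simp_int (A \<inter> D) (G n)) Y" ..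
    have "tendsto_in_prob M (\<lambda>n. simp_int D (?H n)) Y"
    proof (rule tendsto_in_prob_cong[OF Y])
      show "AE \<omega> in M. simp_int (A \<inter> D) (G n) \<omega> = simp_int D (?H n) \<omega>" for n
        using simp_int_indicator[OF Gs A D, of n] by eventually_elim simp
    qed (use Y in \<open>auto simp: tendsto_in_prob_iff intro: simp_int_measurable Hs D\<close>)
    then show "\<exists>Y. tendsto_in_prob M (\<lambda>n. simp_int D (?H n)) Y" by blast
  qed
  have S: "A \<inter> space N = A" using sets.sets_into_space[OF A] by blast
  show ?thesis
  proof (rule tendsto_in_prob_unique[OF sint_tendsto[OF H sets.top] sint_tendsto[OF G A]])
    show "AE \<omega> in M. simp_int (space N) (?H n) \<omega> = simp_int A (G n) \<omega>" for n
      using simp_int_indicator[OF Gs A sets.top, of n] unfolding S .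
  qed
qed

end

section \<open>Fourier series on the unit interval\<close>

abbreviation unit_leb :: "real measure" where
  "unit_leb \<equiv> restrict_space lborel {0<..1}"

lemma space_unit_leb [simp]: "space unit_leb = {0<..1}"
  by (simp add: space_restrict_space)

lemma borel_measurable_unit_leb: "borel_measurable unit_leb = borel_measurable unit_borel"
  by (rule measurable_cong_sets) (simp_all add: sets_restrict_space)

interpretation unit_leb: prob_space unit_leb
proof
  show "emeasure unit_leb (space unit_leb) = 1"
    by (simp add: emeasure_restrict_space space_restrict_space)
qed

lemma set_integral_unit_leb: "(LINT x:{0<..1}|lborel. f x) = (\<integral>x. f x \<partial>unit_leb)"
  for f :: "real \<Rightarrow> real"
  by (simp add: integral_restrict_space set_lebesgue_integral_def)

text \<open>
  Bounded measurable functions on the unit interval. All functions whose Fourier coefficients are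
  taken below are of this kind, and unlike square integrable functions they form an algebra.
\<close>

definition bdd_meas :: "(real \<Rightarrow> real) \<Rightarrow> bool" where
  "bdd_meas h \<longleftrightarrow> h \<in> borel_measurable unit_leb \<and> (\<exists>B. \<forall>x\<in>{0<..1}. \<bar>h x\<bar> \<le> B)"

lemma bdd_measI: "h \<in> borel_measurable unit_leb \<Longrightarrow> (\<And>x. x \<in> {0<..1} \<Longrightarrow> \<bar>h x\<bar> \<le> B) \<Longrightarrow> bdd_meas h"
  unfolding bdd_meas_def by blast

lemma bdd_meas_measurable: "bdd_meas h \<Longrightarrow> h \<in> borel_measurable unit_leb"
  by (simp add: bdd_meas_def)

lemma bdd_meas_integrable: assumes "bdd_meas h" shows "integrable unit_leb h"
proof -
  obtain B where B: "\<forall>x\<in>{0<..1}. \<bar>h x\<bar> \<le> B" using assms unfolding bdd_meas_def by blast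
  show ?thesis
    by (rule unit_leb.integrable_const_bound[where B=B])
       (use B in \<open>auto intro!: AE_I2 bdd_meas_measurable assms\<close>)
qed

lemma bdd_meas_const [intro]: "bdd_meas (\<lambda>_. c)"
  by (rule bdd_measI[where B="\<bar>c\<bar>"]) auto

lemma bdd_meas_add [intro]:
  assumes "bdd_meas f" "bdd_meas g" shows "bdd_meas (\<lambda>x. f x + g x)"
proof -
  obtain A B where A: "\<forall>x\<in>{0<..1}. \<bar>f x\<bar> \<le> A" and B: "\<forall>x\<in>{0<..1}. \<bar>g x\<bar> \<le> B"
    using assms unfolding bdd_meas_def by blast
  show ?thesis
  proof (rule bdd_measI)
    show "\<bar>f x + g x\<bar> \<le> A + B" if "x \<in> {0<..1}" for x
      using bspec[OF A that] bspec[OF B that] by linarith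
  qed (intro borel_measurable_add bdd_meas_measurable assms)
qed

lemma bdd_meas_mult [intro]:
  assumes "bdd_meas f" "bdd_meas g" shows "bdd_meas (\<lambda>x. f x * g x)"
proof -
  obtain A B where A: "\<forall>x\<in>{0<..1}. \<bar>f x\<bar> \<le> A" and B: "\<forall>x\<in>{0<..1}. \<bar>g x\<bar> \<le> B"
    using assms unfolding bdd_meas_def by blast
  show ?thesis
  proof (rule bdd_measI)
    show "\<bar>f x * g x\<bar> \<le> A * B" if "x \<in> {0<..1}" for x
      unfolding abs_mult using bspec[OF A that] bspec[OF B that] by (intro mult_mono) auto
  qed (intro borel_measurable_times bdd_meas_measurable assms)
qed

lemma bdd_meas_diff [intro]:
  assumes "bdd_meas f" "bdd_meas g" shows "bdd_meas (\<lambda>x. f x - g x)"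
proof -
  have "bdd_meas (\<lambda>x. f x + (- 1) * g x)" by (intro bdd_meas_add bdd_meas_mult bdd_meas_const assms)
  then show ?thesis by simp
qed

lemma bdd_meas_sum:
  assumes "\<And>i. i \<in> F \<Longrightarrow> bdd_meas (f i)" shows "bdd_meas (\<lambda>x. \<Sum>i\<in>F. f i x)"
proof (cases "finite F")
  case True
  then show ?thesis using assms by (induction F rule: finite_induct) auto
qed auto

lemma bdd_meas_continuous:
  assumes "continuous_on {0..1} h" shows "bdd_meas h"
proof -
  have "compact (h ` {0..1})" by (intro compact_continuous_image assms compact_Icc)
  then obtain B where B: "\<forall>y\<in>h ` {0..1}. norm y \<le> B" using compact_imp_bounded bounded_iff by blast
  show ?thesis
  proof (rule bdd_measI)
    show "\<bar>h x\<bar> \<le> B" if "x \<in> {0<..1}" for x using B that by auto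
    have "h \<in> borel_measurable (restrict_space borel {0<..1})"
      by (rule borel_measurable_continuous_on_restrict) (rule continuous_on_subset[OF assms], auto)
    then show "h \<in> borel_measurable unit_leb" by (simp add: borel_measurable_unit_leb)
  qed
qed

definition ip :: "(real \<Rightarrow> real) \<Rightarrow> (real \<Rightarrow> real) \<Rightarrow> real" where
  "ip f g = (\<integral>x. f x * g x \<partial>unit_leb)"

lemma ip_commute: "ip f g = ip g f" by (simp add: ip_def mult.commute)

lemma ip_add_left: "bdd_meas f \<Longrightarrow> bdd_meas g \<Longrightarrow> bdd_meas h \<Longrightarrow> ip (\<lambda>x. f x + g x) h = ip f h + ip g h"
  unfolding ip_def distrib_right by (intro Bochner_Integration.integral_add bdd_meas_integrable bdd_meas_mult)

lemma ip_diff_left: "bdd_meas f \<Longrightarrow> bdd_meas g \<Longrightarrow> bdd_meas h \<Longrightarrow> ip (\<lambda>x. f x - g x) h = ip f h - ip g h"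
  unfolding ip_def left_diff_distrib by (intro Bochner_Integration.integral_diff bdd_meas_integrable bdd_meas_mult)

lemma ip_cmult_left: "ip (\<lambda>x. c * f x) h = c * ip f h"
  unfolding ip_def by (simp add: mult.assoc)

lemma ip_sum_left:
  assumes "\<And>i. i \<in> F \<Longrightarrow> bdd_meas (f i)" "bdd_meas h"
  shows "ip (\<lambda>x. \<Sum>i\<in>F. f i x) h = (\<Sum>i\<in>F. ip (f i) h)"
  unfolding ip_def sum_distrib_right using assms
  by (intro Bochner_Integration.integral_sum bdd_meas_integrable bdd_meas_mult)

lemma ip_nonneg: "ip f f \<ge> 0" unfolding ip_def by simp

lemma ip_le_const:
  assumes "bdd_meas f" "\<And>x. x \<in> {0<..1} \<Longrightarrow> \<bar>f x\<bar> \<le> B"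
  shows "ip f f \<le> B\<^sup>2"
proof -
  have "ip f f \<le> (\<integral>x. B\<^sup>2 \<partial>unit_leb)"
    unfolding ip_def
  proof (rule integral_mono)
    fix x assume "x \<in> space unit_leb"
    then have "\<bar>f x\<bar> \<le> \<bar>B\<bar>" using assms(2)[of x] by auto
    then show "f x * f x \<le> B\<^sup>2" by (simp add: abs_le_square_iff power2_eq_square)
  qed (intro bdd_meas_integrable bdd_meas_mult assms bdd_meas_const)+
  then show ?thesis by (simp add: unit_leb.prob_space[simplified])
qed

subsection \<open>The trigonometric system\<close>

text \<open>
  An orthonormal basis of real functions. Cosines have positive and sines negative index, so that
  the sum over \<open>\<bar>k\<bar> \<le> j\<close> is the \<open>j\<close>-th symmetric partial sum of the complex Fourier series.
\<close>

definition ebasis :: "int \<Rightarrow> real \<Rightarrow> real" where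
  "ebasis k t = (if k = 0 then 1 else if k > 0 then sqrt 2 * cos (2 * pi * of_int k * t)
     else sqrt 2 * sin (2 * pi * of_int k * t))"

lemma continuous_ebasis: "continuous_on S (ebasis k)"
  by (cases "k = 0"; cases "k > 0") (simp_all add: ebasis_def[abs_def] continuous_intros)

lemma bdd_meas_ebasis [intro]: "bdd_meas (ebasis k)"
  by (intro bdd_meas_continuous continuous_ebasis)

lemma abs_ebasis_le: "\<bar>ebasis k t\<bar> \<le> 2"
proof -
  have "sqrt 2 \<le> 2" by (rule real_le_lsqrt) auto
  then have "sqrt 2 * \<bar>cos y\<bar> \<le> 2 * 1" "sqrt 2 * \<bar>sin y\<bar> \<le> 2 * 1" for y :: real by (intro mult_mono; simp)+
  then show ?thesis by (simp add: ebasis_def abs_mult)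
qed

lemma integral_unit_leb_FTC:
  assumes "\<And>x. (F has_real_derivative f x) (at x)" "continuous_on UNIV f"
  shows "(\<integral>x. f x \<partial>unit_leb) = F 1 - F 0"
proof -
  have i: "set_integrable lborel {0..1} f"
    by (rule borel_integrable_atLeastAtMost') (rule continuous_on_subset[OF assms(2)], simp)
  have "(\<integral>x. f x \<partial>unit_leb) = (LINT x:{0<..1}|lborel. f x)" by (simp add: set_integral_unit_leb)
  also have "\<dots> = (LINT x:{0..1}|lborel. f x)"
  proof -
    have m: "f \<in> borel_measurable borel" using assms(2) by (rule borel_measurable_continuous_onI)
    have "AE x in lborel. indicator {0<..1} x *\<^sub>R f x = indicator {0..1} x *\<^sub>R f x"
      using AE_lborel_singleton[of 0] by eventually_elim (auto simp: indicator_def)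
    then show ?thesis unfolding set_lebesgue_integral_def
      using m by (intro integral_cong_AE) auto
  qed
  also have "\<dots> = integral {0..1} f" by (rule set_borel_integral_eq_integral(2)[OF i])
  also have "(f has_integral (F 1 - F 0)) {0..1}"
    using assms(1) by (intro fundamental_theorem_of_calculus)
      (auto simp: has_real_derivative_iff_has_vector_derivative[symmetric] intro: has_field_derivative_at_within)
  then have "integral {0..1} f = F 1 - F 0" by (rule integral_unique)
  finally show ?thesis .
qed

lemma integral_cos_unit: "(\<integral>t. cos (2 * pi * of_int m * t) \<partial>unit_leb) = of_bool (m = 0)"
proof (cases "m = 0")
  case True
  then show ?thesis by (simp add: unit_leb.prob_space[simplified])
next
  case False
  let ?c = "2 * pi * of_int m"
  have c: "?c \<noteq> 0" using False by simp
  have "(\<integral>t. cos (?c * t) \<partial>unit_leb) = sin (?c * 1) / ?c - sin (?c * 0) / ?c"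
  proof (rule integral_unit_leb_FTC[where F="\<lambda>t. sin (?c * t) / ?c"])
    fix x
    have "((\<lambda>t. sin (?c * t) / ?c) has_real_derivative cos (?c * x) * ?c / ?c) (at x)"
      by (auto intro!: derivative_eq_intros)
    then show "((\<lambda>t. sin (?c * t) / ?c) has_real_derivative cos (?c * x)) (at x)"
      using c by simp
  qed (auto intro!: continuous_intros)
  also have "sin (?c * 1) = 0" using sin_int_2pin[of m] by (simp add: mult.commute mult.left_commute)
  finally show ?thesis using False by simp
qed

lemma integral_sin_unit: "(\<integral>t. sin (2 * pi * of_int m * t) \<partial>unit_leb) = 0"
proof (cases "m = 0")
  case False
  let ?c = "2 * pi * of_int m"
  have c: "?c \<noteq> 0" using False by simp
  have "(\<integral>t. sin (?c * t) \<partial>unit_leb) = - cos (?c * 1) / ?c - (- cos (?c * 0) / ?c)"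
  proof (rule integral_unit_leb_FTC[where F="\<lambda>t. - cos (?c * t) / ?c"])
    fix x
    have "((\<lambda>t. - cos (?c * t) / ?c) has_real_derivative sin (?c * x) * ?c / ?c) (at x)"
      by (auto intro!: derivative_eq_intros)
    then show "((\<lambda>t. - cos (?c * t) / ?c) has_real_derivative sin (?c * x)) (at x)"
      using c by simp
  qed (auto intro!: continuous_intros)
  also have "cos (?c * 1) = 1" using cos_int_2pin[of m] by (simp add: mult.commute mult.left_commute)
  finally show ?thesis by simp
qed simp

lemma bdd_meas_cos [intro]: "bdd_meas (\<lambda>t. cos (2 * pi * of_int m * t))"
  and bdd_meas_sin [intro]: "bdd_meas (\<lambda>t. sin (2 * pi * of_int m * t))"
  by (auto intro!: bdd_meas_continuous continuous_intros)

lemma ip_cos_cos: "ip (\<lambda>t. cos (2 * pi * of_int k * t)) (\<lambda>t. cos (2 * pi * of_int l * t)) =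
    (of_bool (k = l) + of_bool (k + l = 0)) / 2"
proof -
  have eq: "cos (2 * pi * of_int k * t) * cos (2 * pi * of_int l * t) =
     (cos (2 * pi * of_int (k - l) * t) + cos (2 * pi * of_int (k + l) * t)) / 2" for t :: real
    by (simp add: cos_times_cos algebra_simps)
  show ?thesis
    unfolding ip_def eq
    by (simp add: Bochner_Integration.integral_add[OF bdd_meas_integrable bdd_meas_integrable] bdd_meas_cos integral_cos_unit del: of_int_diff of_int_add)
qed

lemma ip_sin_sin: "ip (\<lambda>t. sin (2 * pi * of_int k * t)) (\<lambda>t. sin (2 * pi * of_int l * t)) =
    (of_bool (k = l) - of_bool (k + l = 0)) / 2"
proof -
  have eq: "sin (2 * pi * of_int k * t) * sin (2 * pi * of_int l * t) =
     (cos (2 * pi * of_int (k - l) * t) - cos (2 * pi * of_int (k + l) * t)) / 2" for t :: real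
    by (simp add: sin_times_sin algebra_simps)
  show ?thesis
    unfolding ip_def eq
    by (simp add: Bochner_Integration.integral_diff[OF bdd_meas_integrable bdd_meas_integrable] bdd_meas_cos integral_cos_unit del: of_int_diff of_int_add)
qed

lemma ip_cos_sin: "ip (\<lambda>t. cos (2 * pi * of_int k * t)) (\<lambda>t. sin (2 * pi * of_int l * t)) = 0"
proof -
  have eq: "cos (2 * pi * of_int k * t) * sin (2 * pi * of_int l * t) =
     (sin (2 * pi * of_int (k + l) * t) - sin (2 * pi * of_int (k - l) * t)) / 2" for t :: real
    by (simp add: cos_times_sin algebra_simps)
  show ?thesis
    unfolding ip_def eq
    by (simp add: Bochner_Integration.integral_diff[OF bdd_meas_integrable bdd_meas_integrable] bdd_meas_sin integral_sin_unit del: of_int_diff of_int_add)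
qed

lemma ebasis_alt:
  "ebasis k = (\<lambda>t. (if k = 0 then 1 else if k > 0 then sqrt 2 else 0) * cos (2 * pi * of_int k * t)
     + (if k < 0 then sqrt 2 else 0) * sin (2 * pi * of_int k * t))"
  by (auto simp: ebasis_def fun_eq_iff)

lemma ip_ebasis: "ip (ebasis k) (ebasis l) = of_bool (k = l)"
proof -
  define p where "p = (\<lambda>k::int. if k = 0 then 1 else if k > 0 then sqrt 2 else (0::real))"
  define r where "r = (\<lambda>k::int. if k < 0 then sqrt 2 else (0::real))"
  let ?c = "\<lambda>(k::int) t. cos (2 * pi * of_int k * t)" and ?s = "\<lambda>(k::int) t. sin (2 * pi * of_int k * t)"
  have e: "ebasis k = (\<lambda>t. p k * ?c k t + r k * ?s k t)" for k unfolding ebasis_alt p_def r_def ..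
  have m: "bdd_meas (\<lambda>t. a * ?c k t)" "bdd_meas (\<lambda>t. a * ?s k t)" for a k
    by (intro bdd_meas_mult bdd_meas_const bdd_meas_cos bdd_meas_sin)+
  have 1: "ip (?c j) (ebasis l) = p l * ip (?c j) (?c l) + r l * ip (?c j) (?s l)" for j
    unfolding e by (subst (1 2 3) ip_commute) (simp add: ip_add_left[OF m bdd_meas_cos] ip_cmult_left)
  have 2: "ip (?s j) (ebasis l) = p l * ip (?s j) (?c l) + r l * ip (?s j) (?s l)" for j
    unfolding e by (subst (1 2 3) ip_commute) (simp add: ip_add_left[OF m bdd_meas_sin] ip_cmult_left)
  have "ip (ebasis k) (ebasis l) = p k * ip (?c k) (ebasis l) + r k * ip (?s k) (ebasis l)"
    by (subst (1) e) (simp add: ip_add_left[OF m bdd_meas_ebasis] ip_cmult_left)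
  also have "\<dots> = p k * p l * ((of_bool (k = l) + of_bool (k + l = 0)) / 2) + r k * r l * ((of_bool (k = l) - of_bool (k + l = 0)) / 2)"
    unfolding 1 2 ip_commute[of "?s k" "?c l"] ip_cos_cos ip_cos_sin ip_sin_sin by (simp add: algebra_simps)
  also have "\<dots> = of_bool (k = l)" by (auto simp: p_def r_def)
  finally show ?thesis .
qed

definition fcoef :: "(real \<Rightarrow> real) \<Rightarrow> int \<Rightarrow> real" where "fcoef h k = ip h (ebasis k)"

definition trig_sum :: "int set \<Rightarrow> (int \<Rightarrow> real) \<Rightarrow> real \<Rightarrow> real" where
  "trig_sum F c t = (\<Sum>k\<in>F. c k * ebasis k t)"

lemma bdd_meas_trig_sum [intro]: "bdd_meas (trig_sum F c)"
  unfolding trig_sum_def[abs_def] by (intro bdd_meas_sum bdd_meas_mult bdd_meas_const bdd_meas_ebasis)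

lemma ip_trig_sum_ebasis: "finite F \<Longrightarrow> ip (trig_sum F c) (ebasis l) = (if l \<in> F then c l else 0)"
  unfolding trig_sum_def[abs_def]
  by (subst ip_sum_left) (auto simp: ip_cmult_left ip_ebasis intro: bdd_meas_mult)

lemma ip_trig_sum_right:
  assumes "finite F" "bdd_meas h" shows "ip h (trig_sum F c) = (\<Sum>k\<in>F. c k * fcoef h k)"
  unfolding trig_sum_def[abs_def]
  by (subst ip_commute, subst ip_sum_left)
     (auto simp: ip_cmult_left fcoef_def ip_commute[of h] intro: bdd_meas_mult assms)

lemma ip_trig_sum_trig_sum: "finite F \<Longrightarrow> ip (trig_sum F c) (trig_sum F c) = (\<Sum>k\<in>F. (c k)\<^sup>2)"
  by (simp add: ip_trig_sum_right bdd_meas_trig_sum fcoef_def ip_trig_sum_ebasis power2_eq_square cong: sum.cong)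

lemma ip_diff_diff:
  assumes "bdd_meas f" "bdd_meas g"
  shows "ip (\<lambda>x. f x - g x) (\<lambda>x. f x - g x) = ip f f - 2 * ip f g + ip g g"
proof -
  have d: "bdd_meas (\<lambda>x. f x - g x)" by (intro bdd_meas_diff assms)
  have "ip (\<lambda>x. f x - g x) (\<lambda>x. f x - g x) = ip f (\<lambda>x. f x - g x) - ip g (\<lambda>x. f x - g x)"
    by (rule ip_diff_left[OF assms d])
  also have "ip f (\<lambda>x. f x - g x) = ip f f - ip g f"
    unfolding ip_commute[of f "\<lambda>x. f x - g x"] by (rule ip_diff_left[OF assms assms(1)])
  also have "ip g (\<lambda>x. f x - g x) = ip f g - ip g g"
    unfolding ip_commute[of g "\<lambda>x. f x - g x"] by (rule ip_diff_left[OF assms assms(2)])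
  finally show ?thesis by (simp add: ip_commute[of g f])
qed

lemma ip_diff_trig_sum:
  assumes F: "finite F" and h: "bdd_meas h"
  shows "ip (\<lambda>x. h x - trig_sum F c x) (\<lambda>x. h x - trig_sum F c x) =
    ip h h - (\<Sum>k\<in>F. (fcoef h k)\<^sup>2) + (\<Sum>k\<in>F. (c k - fcoef h k)\<^sup>2)"
  unfolding ip_diff_diff[OF h bdd_meas_trig_sum] ip_trig_sum_right[OF F h] ip_trig_sum_trig_sum[OF F]
  by (simp add: power2_eq_square algebra_simps sum.distrib sum_subtractf sum_distrib_left)

lemma bessel:
  assumes "finite F" "bdd_meas h"
  shows "(\<Sum>k\<in>F. (fcoef h k)\<^sup>2) \<le> ip h h"
  using ip_diff_trig_sum[OF assms, of "fcoef h"] ip_nonneg[of "\<lambda>x. h x - trig_sum F (fcoef h) x"] by simp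

lemma trig_sum_best_approximation:
  assumes F: "finite F" and h: "bdd_meas h" and "F' \<subseteq> F"
  shows "ip (\<lambda>x. h x - trig_sum F (fcoef h) x) (\<lambda>x. h x - trig_sum F (fcoef h) x) \<le>
     ip (\<lambda>x. h x - trig_sum F' c x) (\<lambda>x. h x - trig_sum F' c x)"
proof -
  have F': "finite F'" using assms finite_subset by blast
  have "(\<Sum>k\<in>F'. (fcoef h k)\<^sup>2) \<le> (\<Sum>k\<in>F. (fcoef h k)\<^sup>2)"
    using assms by (intro sum_mono2) auto
  moreover have "0 \<le> (\<Sum>k\<in>F'. (c k - fcoef h k)\<^sup>2)" by (intro sum_nonneg) simp
  ultimately show ?thesis unfolding ip_diff_trig_sum[OF F h] ip_diff_trig_sum[OF F' h] by simp
qed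

lemma fcoef_add: "bdd_meas f \<Longrightarrow> bdd_meas g \<Longrightarrow> fcoef (\<lambda>x. f x + g x) k = fcoef f k + fcoef g k"
  unfolding fcoef_def by (intro ip_add_left bdd_meas_ebasis)

lemma fcoef_cmult: "fcoef (\<lambda>x. c * f x) k = c * fcoef f k"
  unfolding fcoef_def by (rule ip_cmult_left)

subsection \<open>Density of trigonometric polynomials\<close>

text \<open>
  Linear combinations of sines and cosines without reference to \<open>ebasis\<close>; closure under products is
  easier to prove in this form.
\<close>

inductive trig_poly :: "(real \<Rightarrow> real) \<Rightarrow> bool" where
  trig_cos: "trig_poly (\<lambda>t. cos (2 * pi * of_int m * t))"
| trig_sin: "trig_poly (\<lambda>t. sin (2 * pi * of_int m * t))"
| trig_add: "trig_poly p \<Longrightarrow> trig_poly r \<Longrightarrow> trig_poly (\<lambda>t. p t + r t)"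
| trig_cmult: "trig_poly p \<Longrightarrow> trig_poly (\<lambda>t. c * p t)"

lemma trig_poly_const: "trig_poly (\<lambda>t. c)"
  using trig_cmult[OF trig_cos[of 0], of c] by simp

lemma trig_poly_mult_cos: "trig_poly p \<Longrightarrow> trig_poly (\<lambda>t. p t * cos (2 * pi * of_int m * t))"
proof (induction rule: trig_poly.induct)
  case (trig_cos k)
  have eq: "cos (2 * pi * of_int k * t) * cos (2 * pi * of_int m * t) =
      1 / 2 * (cos (2 * pi * of_int (k - m) * t) + cos (2 * pi * of_int (k + m) * t))" for t :: real
    by (simp add: cos_add cos_diff sin_add sin_diff ring_distribs)
  show ?case unfolding eq by (intro trig_poly.intros)
next
  case (trig_sin k)
  have eq: "sin (2 * pi * of_int k * t) * cos (2 * pi * of_int m * t) =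
      1 / 2 * (sin (2 * pi * of_int (k + m) * t) + sin (2 * pi * of_int (k - m) * t))" for t :: real
    by (simp add: cos_add cos_diff sin_add sin_diff ring_distribs)
  show ?case unfolding eq by (intro trig_poly.intros)
next
  case (trig_add p r)
  from trig_poly.trig_add[OF trig_add.IH] show ?case by (simp add: distrib_right)
next
  case (trig_cmult p c)
  from trig_poly.trig_cmult[OF trig_cmult.IH, of c] show ?case by (simp add: mult.assoc)
qed

lemma trig_poly_mult_sin: "trig_poly p \<Longrightarrow> trig_poly (\<lambda>t. p t * sin (2 * pi * of_int m * t))"
proof (induction rule: trig_poly.induct)
  case (trig_cos k)
  have eq: "cos (2 * pi * of_int k * t) * sin (2 * pi * of_int m * t) =
      1 / 2 * (sin (2 * pi * of_int (k + m) * t) + (- 1) * sin (2 * pi * of_int (k - m) * t))" for t :: real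
    by (simp add: cos_add cos_diff sin_add sin_diff ring_distribs)
  show ?case unfolding eq by (intro trig_poly.intros)
next
  case (trig_sin k)
  have eq: "sin (2 * pi * of_int k * t) * sin (2 * pi * of_int m * t) =
      1 / 2 * (cos (2 * pi * of_int (k - m) * t) + (- 1) * cos (2 * pi * of_int (k + m) * t))" for t :: real
    by (simp add: cos_add cos_diff sin_add sin_diff ring_distribs)
  show ?case unfolding eq by (intro trig_poly.intros)
next
  case (trig_add p r)
  from trig_poly.trig_add[OF trig_add.IH] show ?case by (simp add: distrib_right)
next
  case (trig_cmult p c)
  from trig_poly.trig_cmult[OF trig_cmult.IH, of c] show ?case by (simp add: mult.assoc)
qed

lemma trig_poly_mult:
  assumes p: "trig_poly p" and r: "trig_poly r" shows "trig_poly (\<lambda>t. p t * r t)"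
  using r
proof (induction rule: trig_poly.induct)
  case (trig_add r s)
  from trig_poly.trig_add[OF trig_add.IH] show ?case by (simp add: distrib_left)
next
  case (trig_cmult r c)
  from trig_poly.trig_cmult[OF trig_cmult.IH, of c] show ?case by (simp add: mult.left_commute)
qed (intro trig_poly_mult_cos trig_poly_mult_sin p)+

lemma trig_poly_trig_sum: "trig_poly p \<Longrightarrow> \<exists>F c. finite F \<and> p = trig_sum F c"
proof (induction rule: trig_poly.induct)
  case (trig_cos m)
  show ?case
    by (rule exI[of _ "{\<bar>m\<bar>}"], rule exI[of _ "\<lambda>_. if m = 0 then 1 else 1 / sqrt 2"])
       (auto simp: trig_sum_def ebasis_def fun_eq_iff abs_if)
next
  case (trig_sin m)
  show ?case
    by (rule exI[of _ "{- \<bar>m\<bar>}"], rule exI[of _ "\<lambda>_. if m = 0 then 0 else if m > 0 then - 1 / sqrt 2 else 1 / sqrt 2"])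
       (auto simp: trig_sum_def ebasis_def fun_eq_iff abs_if)
next
  case (trig_add p r)
  then obtain F c F' c' where F: "finite F" "p = trig_sum F c" "finite F'" "r = trig_sum F' c'" by blast
  have "trig_sum F c t = (\<Sum>k\<in>F \<union> F'. (if k \<in> F then c k else 0) * ebasis k t)" for t
    unfolding trig_sum_def using F by (intro sum.mono_neutral_cong_left) auto
  moreover have "trig_sum F' c' t = (\<Sum>k\<in>F \<union> F'. (if k \<in> F' then c' k else 0) * ebasis k t)" for t
    unfolding trig_sum_def using F by (intro sum.mono_neutral_cong_left) auto
  ultimately have "(\<lambda>t. p t + r t) = trig_sum (F \<union> F') (\<lambda>k. (if k \<in> F then c k else 0) + (if k \<in> F' then c' k else 0))"
    unfolding F(2,4) by (simp add: fun_eq_iff trig_sum_def[of "F \<union> F'"] distrib_right sum.distrib)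
  then show ?case using F by blast
next
  case (trig_cmult p d)
  then obtain F c where F: "finite F" "p = trig_sum F c" by blast
  have "(\<lambda>t. d * p t) = trig_sum F (\<lambda>k. d * c k)"
    unfolding F(2) by (simp add: fun_eq_iff trig_sum_def sum_distrib_left mult.assoc)
  then show ?case using F by blast
qed

lemma trig_poly_polynomial_on_circle:
  assumes "real_polynomial_function (g :: complex \<Rightarrow> real)"
  shows "trig_poly (\<lambda>t. g (cis (2 * pi * t)))"
  using assms
proof (induction rule: real_polynomial_function.induct)
  case (linear f)
  then interpret bounded_linear f .
  have "f (cis (2 * pi * t)) = f 1 * cos (2 * pi * of_int 1 * t) + f \<i> * sin (2 * pi * of_int 1 * t)" for t
  proof -
    have "cis (2 * pi * t) = cos (2 * pi * t) *\<^sub>R 1 + sin (2 * pi * t) *\<^sub>R \<i>"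
      by (simp add: complex_eq_iff)
    then have "f (cis (2 * pi * t)) = f (cos (2 * pi * t) *\<^sub>R 1 + sin (2 * pi * t) *\<^sub>R \<i>)" by simp
    also have "\<dots> = cos (2 * pi * t) * f 1 + sin (2 * pi * t) * f \<i>" by (simp only: add scaleR real_scaleR_def)
    finally show ?thesis by (simp add: mult.commute)
  qed
  then show ?case by (simp only:) (intro trig_poly.intros)
qed (intro trig_poly_const trig_poly.trig_add trig_poly_mult; assumption)+

text \<open>
  Stone-Weierstrass theorem on the circle, where polynomials are trigonometric polynomials.
\<close>

lemma trig_sum_dense:
  fixes h :: "real \<Rightarrow> real"
  assumes h: "continuous_on {0..1} h" "h 0 = h 1" and e: "e > 0"
  obtains F c where "finite F" "\<And>t. t \<in> {0..1} \<Longrightarrow> \<bar>h t - trig_sum F c t\<bar> < e"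
proof -
  let ?H = "h \<circ> (\<lambda>z. Arg2pi z / (2 * pi))"
  have "homotopic_loops UNIV h h"
    using h by (simp add: homotopic_loops_refl path_def pathstart_def pathfinish_def)
  from homotopic_loops_imp_homotopic_circlemaps[OF this]
  have cont: "continuous_on (sphere 0 1) ?H"
    by (rule homotopic_with_imp_continuous[THEN conjunct1])
  obtain g where g: "real_polynomial_function g" "\<And>z. z \<in> sphere 0 1 \<Longrightarrow> \<bar>?H z - g z\<bar> < e"
    using Stone_Weierstrass_real_polynomial_function[OF compact_sphere cont e] by blast
  obtain F c where F: "finite F" "(\<lambda>t. g (cis (2 * pi * t))) = trig_sum F c"
    using trig_poly_trig_sum[OF trig_poly_polynomial_on_circle[OF g(1)]] by blast
  have "\<bar>h t - trig_sum F c t\<bar> < e" if t: "t \<in> {0..1}" for t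
  proof -
    have "?H (cis (2 * pi * t)) = h t"
    proof (cases "t = 1")
      case True
      have "Arg2pi 1 = 0" by (rule Arg2pi_unique[where r=1]) auto
      then show ?thesis using h(2) True by simp
    next
      case False
      have "Arg2pi (cis (2 * pi * t)) = 2 * pi * t"
        using t False by (intro Arg2pi_unique[where r=1]) (auto simp: cis_conv_exp)
      then show ?thesis by simp
    qed
    moreover have "trig_sum F c t = g (cis (2 * pi * t))" using fun_cong[OF F(2), of t] by simp
    ultimately show ?thesis using g(2)[of "cis (2 * pi * t)"] by simp
  qed
  then show ?thesis using that F(1) by blast
qed

abbreviation fpart :: "nat \<Rightarrow> (real \<Rightarrow> real) \<Rightarrow> real \<Rightarrow> real" where
  "fpart n h \<equiv> trig_sum {- int n..int n} (fcoef h)"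

text \<open>
  On the circle, \<open>h\<close> may have a jump at \<open>0\<close>. Multiplying by \<open>min 1 (m * x)\<close> makes it continuous and changes \<open>h\<close>
  little in mean square, so \<open>h\<close> is approximated by trigonometric sums, and the Fourier sums are the
  best approximations.
\<close>

lemma fpart_L2_tendsto:
  assumes h: "continuous_on {0..1} h" and h1: "h 1 = 0"
  shows "(\<lambda>n. ip (\<lambda>x. h x - fpart n h x) (\<lambda>x. h x - fpart n h x)) \<longlonglongrightarrow> 0"
proof (rule LIMSEQ_I)
  fix r :: real assume r: "r > 0"
  have bh: "bdd_meas h" by (rule bdd_meas_continuous[OF h])
  have "compact (h ` {0..1})" by (intro compact_continuous_image h compact_Icc)
  then obtain B0 where B0: "\<forall>y\<in>h ` {0..1}. norm y \<le> B0" using compact_imp_bounded bounded_iff by blast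
  define B where "B = max B0 1"
  have B: "B > 0" "\<bar>h x\<bar> \<le> B" if "x \<in> {0..1}" for x
  proof -
    have "norm (h x) \<le> B0" using B0 that by blast
    then show "\<bar>h x\<bar> \<le> B" by (simp add: B_def)
  qed (simp add: B_def)
  have B1: "B > 0" by (simp add: B_def)
  obtain m0 :: nat where m0: "8 * B\<^sup>2 / r < real m0" using reals_Archimedean2 by blast
  define m where "m = Suc m0"
  have m: "2 * (B\<^sup>2 / real m) < r / 2" "real m \<ge> 1"
  proof -
    have "8 * B\<^sup>2 < r * real m" using m0 r by (simp add: m_def field_simps)
    moreover have "0 < B\<^sup>2" using B1 by simp
    ultimately have "4 * B\<^sup>2 < r * real m" by linarith
    then show "2 * (B\<^sup>2 / real m) < r / 2" by (simp add: m_def field_simps)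
  qed (simp add: m_def)
  define g where "g = (\<lambda>x. h x * min 1 (real m * x))"
  have g: "continuous_on {0..1} g" "g 0 = g 1"
    unfolding g_def using h1 by (auto intro!: continuous_intros h)
  have bg: "bdd_meas g" by (rule bdd_meas_continuous[OF g(1)])
  define e where "e = sqrt (r / 8)"
  have e: "e > 0" "e\<^sup>2 = r / 8" using r by (auto simp: e_def)
  obtain F c where F: "finite F" "\<And>t. t \<in> {0..1} \<Longrightarrow> \<bar>g t - trig_sum F c t\<bar> < e"
    using trig_sum_dense[OF g e(1)] by blast
  have cut: "ip (\<lambda>x. h x - g x) (\<lambda>x. h x - g x) \<le> B\<^sup>2 / real m"
  proof -
    have "ip (\<lambda>x. h x - g x) (\<lambda>x. h x - g x) \<le> (\<integral>x. B\<^sup>2 * indicator {0<..1 / real m} x \<partial>unit_leb)"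
      unfolding ip_def
    proof (rule integral_mono)
      have s: "{0<..1 / real m} \<in> sets unit_leb"
      proof -
        have "1 / real m \<le> 1" using m(2) by simp
        then have "{0<..1 / real m} = {0<..1} \<inter> {0<..1 / real m}" by auto
        then show ?thesis unfolding sets_restrict_space by (rule image_eqI) simp
      qed
      show "integrable unit_leb (\<lambda>x. B\<^sup>2 * indicator {0<..1 / real m} x)"
        using s by (intro integrable_mult_right integrable_real_indicator) (auto simp: unit_leb.emeasure_eq_measure)
      fix x assume "x \<in> space unit_leb"
      then have x: "x \<in> {0<..1}" by simp
      show "(h x - g x) * (h x - g x) \<le> B\<^sup>2 * indicator {0<..1 / real m} x"
      proof (cases "x \<le> 1 / real m")
        case True
        then have "real m * x \<le> 1" using m(2) by (simp add: field_simps)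
        then have "h x - g x = h x * (1 - real m * x)" by (simp add: g_def algebra_simps)
        moreover have "\<bar>h x * (1 - real m * x)\<bar> \<le> B * 1"
          unfolding abs_mult using x \<open>real m * x \<le> 1\<close> B(2)[of x] m(2) by (intro mult_mono) auto
        ultimately have "\<bar>h x - g x\<bar> \<le> \<bar>B\<bar>" using B1 by simp
        then have "(h x - g x)\<^sup>2 \<le> B\<^sup>2" by (simp only: abs_le_square_iff)
        then show ?thesis using True x by (simp add: power2_eq_square)
      next
        case False
        then have "real m * x \<ge> 1" using m(2) by (simp add: field_simps)
        then show ?thesis using False by (simp add: g_def)
      qed
    qed (intro bdd_meas_integrable bdd_meas_mult bdd_meas_diff bh bg)
    also have "\<dots> = B\<^sup>2 * measure unit_leb {0<..1 / real m}" using m(2) by simp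
    also have "measure unit_leb {0<..1 / real m} = 1 / real m"
    proof -
      have "1 / real m \<le> 1" using m(2) by simp
      then have "{0<..1 / real m} \<subseteq> {0<..1}" by auto
      then show ?thesis using m(2) by (subst measure_restrict_space) simp_all
    qed
    finally show ?thesis by simp
  qed
  have near: "ip (\<lambda>x. g x - trig_sum F c x) (\<lambda>x. g x - trig_sum F c x) \<le> e\<^sup>2"
    using F(2) by (intro ip_le_const bdd_meas_diff bg bdd_meas_trig_sum) (auto intro: less_imp_le)
  have hP: "ip (\<lambda>x. h x - trig_sum F c x) (\<lambda>x. h x - trig_sum F c x) < r"
  proof -
    let ?f = "\<lambda>x. h x - g x" and ?k = "\<lambda>x. g x - trig_sum F c x"
    have "ip (\<lambda>x. h x - trig_sum F c x) (\<lambda>x. h x - trig_sum F c x) \<le> (\<integral>x. 2 * (?f x * ?f x) + 2 * (?k x * ?k x) \<partial>unit_leb)"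
      unfolding ip_def
    proof (rule integral_mono)
      fix x
      have "0 \<le> (?f x - ?k x) * (?f x - ?k x)" by simp
      then show "(h x - trig_sum F c x) * (h x - trig_sum F c x) \<le> 2 * (?f x * ?f x) + 2 * (?k x * ?k x)"
        by (simp add: algebra_simps)
    qed (intro bdd_meas_integrable bdd_meas_mult bdd_meas_add bdd_meas_const bdd_meas_diff bh bg bdd_meas_trig_sum)+
    also have "\<dots> = (\<integral>x. 2 * (?f x * ?f x) \<partial>unit_leb) + (\<integral>x. 2 * (?k x * ?k x) \<partial>unit_leb)"
      by (intro Bochner_Integration.integral_add bdd_meas_integrable bdd_meas_mult bdd_meas_const bdd_meas_diff bh bg bdd_meas_trig_sum)
    also have "\<dots> = 2 * ip ?f ?f + 2 * ip ?k ?k" by (simp add: ip_def)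
    also have "\<dots> < r" using cut near m(1) e(2) r by linarith
    finally show ?thesis .
  qed
  obtain n0 where n0: "F \<subseteq> {- int n0..int n0}"
  proof
    show "F \<subseteq> {- int (\<Sum>k\<in>F. nat \<bar>k\<bar>)..int (\<Sum>k\<in>F. nat \<bar>k\<bar>)}"
    proof
      fix k assume "k \<in> F"
      then have "nat \<bar>k\<bar> \<le> (\<Sum>k\<in>F. nat \<bar>k\<bar>)" using F(1) by (intro member_le_sum) auto
      then have "\<bar>k\<bar> \<le> int (\<Sum>k\<in>F. nat \<bar>k\<bar>)" by linarith
      then show "k \<in> {- int (\<Sum>k\<in>F. nat \<bar>k\<bar>)..int (\<Sum>k\<in>F. nat \<bar>k\<bar>)}" by auto
    qed
  qed
  show "\<exists>n0. \<forall>n\<ge>n0. norm (ip (\<lambda>x. h x - fpart n h x) (\<lambda>x. h x - fpart n h x) - 0) < r"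
  proof (intro exI allI impI)
    fix n assume n: "n \<ge> n0"
    have "F \<subseteq> {- int n..int n}" using n0 n by (auto dest!: subsetD)
    then have "ip (\<lambda>x. h x - fpart n h x) (\<lambda>x. h x - fpart n h x) \<le> ip (\<lambda>x. h x - trig_sum F c x) (\<lambda>x. h x - trig_sum F c x)"
      by (intro trig_sum_best_approximation bh) auto
    then show "norm (ip (\<lambda>x. h x - fpart n h x) (\<lambda>x. h x - fpart n h x) - 0) < r"
      using hP ip_nonneg[of "\<lambda>x. h x - fpart n h x"] by simp
  qed
qed

subsection \<open>Fourier coefficients of Hoelder functions\<close>

lemma ebasis_shift_int: "ebasis k (t + of_int m) = ebasis k t"
proof -
  have s: "sin (2 * pi * of_int k * of_int m) = 0" and c: "cos (2 * pi * of_int k * of_int m) = 1"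
    using sin_int_2pin[of "k * m"] cos_int_2pin[of "k * m"] by (simp_all add: mult.assoc)
  show ?thesis
    unfolding ebasis_def distrib_left sin_add cos_add s c by simp
qed

lemma ebasis_symmetric_difference:
  "k \<noteq> 0 \<Longrightarrow> ebasis k (t - d) - ebasis k (t + d) = - 2 * sin (2 * pi * of_int k * d) * ebasis (- k) t"
  by (auto simp: ebasis_def cos_add cos_diff sin_add sin_diff algebra_simps)

lemma integrable_continuous_support:
  fixes \<phi> :: "real \<Rightarrow> real"
  assumes "continuous_on UNIV \<phi>" "\<And>t. t \<notin> {a..b} \<Longrightarrow> \<phi> t = 0"
  shows "integrable lborel \<phi>"
proof -
  have "integrable lborel (\<lambda>t. indicator {a..b} t *\<^sub>R \<phi> t)"
    by (rule borel_integrable_compact) (auto intro: continuous_on_subset[OF assms(1)])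
  also have "(\<lambda>t. indicator {a..b} t *\<^sub>R \<phi> t) = \<phi>" using assms(2) by (auto simp: fun_eq_iff indicator_def)
  finally show ?thesis .
qed

text \<open>
  Vanishing at both end points makes the extension by \<open>0\<close> Hoelder continuous on the whole line, and
  translates of it can be used.
\<close>

definition hoelder0 :: "real \<Rightarrow> real \<Rightarrow> (real \<Rightarrow> real) \<Rightarrow> bool" where
  "hoelder0 H \<beta> g \<longleftrightarrow> 0 \<le> H \<and> g 0 = 0 \<and> g 1 = 0 \<and>
     (\<forall>s\<in>{0..1}. \<forall>s'\<in>{0..1}. \<bar>g s - g s'\<bar> \<le> H * \<bar>s - s'\<bar> powr \<beta>)"

lemma hoelder0_clamp:
  assumes "hoelder0 H \<beta> g" "\<beta> > 0"
  shows "\<bar>g (max 0 (min 1 s)) - g (max 0 (min 1 s'))\<bar> \<le> H * \<bar>s - s'\<bar> powr \<beta>"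
proof -
  have "\<bar>g (max 0 (min 1 s)) - g (max 0 (min 1 s'))\<bar> \<le> H * \<bar>max 0 (min 1 s) - max 0 (min 1 s')\<bar> powr \<beta>"
    using assms(1) unfolding hoelder0_def by auto
  also have "\<dots> \<le> H * \<bar>s - s'\<bar> powr \<beta>"
    using assms unfolding hoelder0_def by (intro mult_left_mono powr_mono2) auto
  finally show ?thesis .
qed

lemma hoelder_imp_continuous:
  fixes g :: "real \<Rightarrow> real"
  assumes "\<And>s s'. \<bar>g s - g s'\<bar> \<le> H * \<bar>s - s'\<bar> powr \<beta>" "\<beta> > 0"
  shows "continuous_on UNIV g"
proof -
  have "(g \<longlongrightarrow> g s) (at s)" for s
  proof (rule Lim_null[THEN iffD2], rule Lim_null_comparison)
    show "\<forall>\<^sub>F x in at s. norm (g x - g s) \<le> H * \<bar>x - s\<bar> powr \<beta>"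
      using assms(1) by (intro always_eventually) simp
    have "((\<lambda>x. \<bar>x - s\<bar>) \<longlongrightarrow> 0) (at s)" by (auto intro!: tendsto_eq_intros)
    then have "((\<lambda>x. \<bar>x - s\<bar> powr \<beta>) \<longlongrightarrow> 0) (at s)"
      using assms(2) by (intro tendsto_zero_powrI[OF _ tendsto_const]) auto
    from tendsto_mult_left[OF this, of H] show "((\<lambda>x. H * \<bar>x - s\<bar> powr \<beta>) \<longlongrightarrow> 0) (at s)" by simp
  qed
  then show ?thesis by (simp add: continuous_on_def)
qed

lemma lborel_integral_shift: "(\<integral>t. f (t + c) \<partial>lborel) = (\<integral>t. f t \<partial>lborel)" for f :: "real \<Rightarrow> real"
  using lborel_integral_real_affine[of 1 f c] by (simp add: add.commute)

text \<open>
  Bernstein's argument. The symmetric difference \<open>g (t + d) - g (t - d)\<close> has the Fourier coefficients of \<open>g\<close>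
  multiplied by \<open>2 * sin (2 * pi * k * d)\<close> up to sign and reflection of the index. For \<open>d = 1 / 2 ^ (n + 3)\<close> and \<open>k\<close> in the
  dyadic block, this factor is bounded away from \<open>0\<close>, while the difference is at most \<open>H * (2 * d) powr \<beta>\<close>.
  Bessel's inequality gives the bound.
\<close>

lemma hoelder_coefficients_block:
  assumes g: "hoelder0 H \<beta> g" and \<beta>: "\<beta> > 0" and F: "finite F" "\<And>k. k \<in> F \<Longrightarrow> 2 ^ n \<le> \<bar>k\<bar> \<and> \<bar>k\<bar> < 2 ^ Suc n"
  shows "(\<Sum>k\<in>F. (fcoef g k)\<^sup>2) \<le> 9 / 2 * H\<^sup>2 * (1 / 2 ^ n) powr (2 * \<beta>)"
proof -
  define d where "d = 1 / (2::real) ^ (n + 3)"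
  have d: "0 < d" "d \<le> 1 / 8"
  proof -
    have "(1::real) \<le> 2 ^ n" by simp
    then show "d \<le> 1 / 8" by (simp add: d_def power_add field_simps)
  qed (simp add: d_def)
  define p where "p = (\<lambda>t. g (max 0 (min 1 t)))"
  have p: "\<bar>p s - p s'\<bar> \<le> H * \<bar>s - s'\<bar> powr \<beta>" for s s'
    unfolding p_def by (rule hoelder0_clamp[OF g \<beta>])
  have cp: "continuous_on UNIV p" by (rule hoelder_imp_continuous[OF p \<beta>])
  have cp': "continuous_on S (\<lambda>t. p (t + c))" for S c
    by (rule continuous_on_compose2[OF cp]) (auto intro!: continuous_intros)
  have ce: "continuous_on S (\<lambda>t. ebasis k (t + c))" for S k c
    by (rule continuous_on_compose2[OF continuous_ebasis[of UNIV]]) (auto intro!: continuous_intros)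
  have p0: "p t = 0" if "t \<le> 0 \<or> t \<ge> 1" for t
    using that g by (auto simp: p_def hoelder0_def max_def min_def)
  have H: "H \<ge> 0" using g by (simp add: hoelder0_def)
  have cg: "continuous_on {0..1} g"
  proof -
    have "continuous_on {0..1} p" by (rule continuous_on_subset[OF cp]) simp
    then show ?thesis by (rule continuous_on_eq) (simp add: p_def)
  qed
  have bg: "bdd_meas g" by (rule bdd_meas_continuous[OF cg])
  define q where "q = (\<lambda>t. p (t + d) - p (t + (- d)))"
  have cq: "continuous_on S (\<lambda>t. q (t + c))" for S c
    unfolding q_def add.assoc by (intro continuous_on_diff cp')
  have q_le: "\<bar>q t\<bar> \<le> H * (2 * d) powr \<beta>" for t
    using p[of "t + d" "t + (- d)"] d by (simp add: q_def)
  have q0: "q t = 0" if "t \<le> - 1 \<or> t \<ge> 2" for t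
  proof -
    have "p (t + d) = 0" "p (t + (- d)) = 0" using that d by (intro p0; linarith)+
    then show ?thesis by (simp add: q_def)
  qed
  \<comment> \<open>the difference lives on an interval of length three; its periodization \<open>Q\<close> is a function on the unit interval\<close>
  define Q where "Q = (\<lambda>t. q (t + (- 1)) + q (t + 0) + q (t + 1))"
  have bQ: "bdd_meas Q"
    unfolding Q_def by (intro bdd_meas_add bdd_meas_continuous cq)
  have Q_le: "\<bar>Q t\<bar> \<le> 3 * (H * (2 * d) powr \<beta>)" for t
    unfolding Q_def using q_le[of "t + (- 1)"] q_le[of "t + 0"] q_le[of "t + 1"] by linarith
  have coef: "fcoef Q k = - 2 * sin (2 * pi * of_int k * d) * fcoef g (- k)" if k: "k \<noteq> 0" for k
  proof -
    define \<phi> where "\<phi> = (\<lambda>t. q t * ebasis k t)"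
    have c\<phi>: "continuous_on S \<phi>" for S
      unfolding \<phi>_def using cq[of S 0] by (intro continuous_on_mult continuous_ebasis) simp
    have i\<phi>: "integrable lborel \<phi>"
      by (rule integrable_continuous_support[where a="-1" and b=2, OF c\<phi>]) (auto simp: \<phi>_def q0)
    have sh: "(\<integral>t. indicator {0<..1} (t - of_int m) * \<phi> t \<partial>lborel) = ip (\<lambda>t. q (t + of_int m)) (ebasis k)" for m :: int
    proof -
      have "(\<integral>t. indicator {0<..1} (t - of_int m) * \<phi> t \<partial>lborel) =
          (\<integral>t. indicator {0<..1} (t + of_int m - of_int m) * \<phi> (t + of_int m) \<partial>lborel)"
        by (rule lborel_integral_shift[of "\<lambda>t. indicator {0<..1} (t - of_int m) * \<phi> t", symmetric])
      also have "\<dots> = ip (\<lambda>t. q (t + of_int m)) (ebasis k)"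
        by (simp add: ip_def integral_restrict_space \<phi>_def ebasis_shift_int)
      finally show ?thesis .
    qed
    have im: "integrable lborel (\<lambda>t. indicator {0<..1} (t - of_int m) * \<phi> t)" for m :: int
      by (rule Bochner_Integration.integrable_bound[OF i\<phi>])
         (use borel_measurable_integrable[OF i\<phi>] in \<open>auto simp: indicator_def\<close>)
    have "(\<integral>t. \<phi> t \<partial>lborel) = (\<integral>t. indicator {0<..1} (t - of_int (- 1)) * \<phi> t + indicator {0<..1} (t - of_int 0) * \<phi> t
        + indicator {0<..1} (t - of_int 1) * \<phi> t \<partial>lborel)"
    proof (rule Bochner_Integration.integral_cong)
      fix t
      show "\<phi> t = indicator {0<..1} (t - of_int (- 1)) * \<phi> t + indicator {0<..1} (t - of_int 0) * \<phi> t
        + indicator {0<..1} (t - of_int 1) * \<phi> t"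
      proof -
        consider "t \<le> - 1" | "- 1 < t" "t \<le> 0" | "0 < t" "t \<le> 1" | "1 < t" "t \<le> 2" | "2 < t" by linarith
        then show ?thesis by cases (simp_all add: indicator_def \<phi>_def q0)
      qed
    qed simp
    also have "\<dots> = ip (\<lambda>t. q (t + of_int (- 1))) (ebasis k) + ip (\<lambda>t. q (t + of_int 0)) (ebasis k) + ip (\<lambda>t. q (t + of_int 1)) (ebasis k)"
      unfolding sh[symmetric]
      by (subst Bochner_Integration.integral_add, intro Bochner_Integration.integrable_add im, rule im,
          subst Bochner_Integration.integral_add[OF im im]) (rule refl)
    also have "\<dots> = fcoef Q k"
      unfolding fcoef_def Q_def
      by (simp add: ip_add_left bdd_meas_add bdd_meas_ebasis bdd_meas_continuous cq cq[of _ "-1", simplified] cq[of _ 0, simplified])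
    finally have 1: "fcoef Q k = (\<integral>t. \<phi> t \<partial>lborel)" ..
    have ip1: "integrable lborel (\<lambda>t. p (t + c) * ebasis k t)" for c
      by (rule integrable_continuous_support[where a="-c" and b="1 - c"])
         (auto intro!: continuous_on_mult cp' continuous_ebasis p0)
    have ip2: "integrable lborel (\<lambda>t. p t * ebasis k (t + c))" for c
      by (rule integrable_continuous_support[where a=0 and b=1])
         (auto intro!: continuous_on_mult cp ce p0)
    have mv: "(\<integral>t. p (t + c) * ebasis k t \<partial>lborel) = (\<integral>t. p t * ebasis k (t + (- c)) \<partial>lborel)" for c
      using lborel_integral_shift[of "\<lambda>t. p t * ebasis k (t + (- c))" c] by simp
    have "(\<integral>t. \<phi> t \<partial>lborel) = (\<integral>t. p (t + d) * ebasis k t - p (t + (- d)) * ebasis k t \<partial>lborel)"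
      by (simp add: \<phi>_def q_def left_diff_distrib)
    also have "\<dots> = (\<integral>t. p (t + d) * ebasis k t \<partial>lborel) - (\<integral>t. p (t + (- d)) * ebasis k t \<partial>lborel)"
      by (rule Bochner_Integration.integral_diff[OF ip1 ip1])
    also have "\<dots> = (\<integral>t. p t * ebasis k (t + (- d)) \<partial>lborel) - (\<integral>t. p t * ebasis k (t + d) \<partial>lborel)"
      unfolding mv by simp
    also have "\<dots> = (\<integral>t. p t * ebasis k (t + (- d)) - p t * ebasis k (t + d) \<partial>lborel)"
      by (rule Bochner_Integration.integral_diff[OF ip2 ip2, symmetric])
    also have "\<dots> = (\<integral>t. (- 2 * sin (2 * pi * of_int k * d)) * (indicator {0<..1} t * (g t * ebasis (- k) t)) \<partial>lborel)"
    proof (rule Bochner_Integration.integral_cong[OF refl])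
      fix t
      have "p t * ebasis k (t + (- d)) - p t * ebasis k (t + d) = p t * (ebasis k (t - d) - ebasis k (t + d))"
        by (simp add: right_diff_distrib)
      also have "\<dots> = (- 2 * sin (2 * pi * of_int k * d)) * (p t * ebasis (- k) t)"
        unfolding ebasis_symmetric_difference[OF k] by simp
      also have "p t * ebasis (- k) t = indicator {0<..1} t * (g t * ebasis (- k) t)"
        using p0[of t] by (cases "t \<in> {0<..1}") (auto simp: p_def)
      finally show "p t * ebasis k (t + (- d)) - p t * ebasis k (t + d) =
          (- 2 * sin (2 * pi * of_int k * d)) * (indicator {0<..1} t * (g t * ebasis (- k) t))" .
    qed
    also have "\<dots> = (- 2 * sin (2 * pi * of_int k * d)) * fcoef g (- k)"
      by (simp add: fcoef_def ip_def integral_restrict_space)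
    finally show ?thesis unfolding 1 .
  qed
  \<comment> \<open>here \<open>4 * pi * \<bar>k\<bar> * d\<close> lies between \<open>pi / 2\<close> and \<open>pi\<close>, where the cosine is not positive\<close>
  have sin2: "1 / 2 \<le> (sin (2 * pi * of_int k * d))\<^sup>2" if k: "k \<in> F" for k
  proof -
    define y where "y = 4 * pi * (\<bar>of_int k\<bar> * d)"
    have "real_of_int (2 ^ n) \<le> real_of_int \<bar>k\<bar>" "real_of_int \<bar>k\<bar> \<le> real_of_int (2 ^ Suc n)"
      using F(2)[OF k] by (simp_all only: of_int_le_iff less_imp_le)
    then have "1 / 8 \<le> \<bar>of_int k\<bar> * d" "\<bar>of_int k\<bar> * d \<le> 1 / 4"
      by (simp_all add: d_def power_add field_simps)
    then have "4 * pi * (1 / 8) \<le> y" "y \<le> 4 * pi * (1 / 4)"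
      unfolding y_def by (intro mult_left_mono; simp)+
    then have "0 \<le> sin (y - pi / 2)" by (intro sin_ge_zero) auto
    then have "cos y \<le> 0" by (simp add: sin_diff)
    moreover have "cos (2 * (2 * pi * of_int k * d)) = cos y"
    proof -
      have "\<bar>2 * (2 * pi * of_int k * d)\<bar> = y" using d(1) by (simp add: y_def abs_mult)
      then show ?thesis by (metis cos_abs_real)
    qed
    ultimately show ?thesis using cos_double_sin[of "2 * pi * of_int k * d"] by simp
  qed
  have "2 * (\<Sum>k\<in>F. (fcoef g k)\<^sup>2) = (\<Sum>k\<in>F. 2 * (fcoef g k)\<^sup>2)" by (simp add: sum_distrib_left)
  also have "\<dots> \<le> (\<Sum>k\<in>F. (fcoef Q (- k))\<^sup>2)"
  proof (rule sum_mono)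
    fix k assume k: "k \<in> F"
    have "\<bar>k\<bar> > 0" using F(2)[OF k] by (smt (verit) zero_less_power)
    then have "fcoef Q (- k) = - 2 * sin (2 * pi * of_int (- k) * d) * fcoef g k" using coef[of "- k"] by simp
    then have "(fcoef Q (- k))\<^sup>2 = 4 * (sin (2 * pi * of_int k * d))\<^sup>2 * (fcoef g k)\<^sup>2" by (simp add: power_mult_distrib)
    moreover have "4 * (1 / 2) * (fcoef g k)\<^sup>2 \<le> 4 * (sin (2 * pi * of_int k * d))\<^sup>2 * (fcoef g k)\<^sup>2"
      using sin2[OF k] by (intro mult_right_mono) auto
    ultimately show "2 * (fcoef g k)\<^sup>2 \<le> (fcoef Q (- k))\<^sup>2" by simp
  qed
  also have "\<dots> = (\<Sum>k\<in>uminus ` F. (fcoef Q k)\<^sup>2)" by (simp add: sum.reindex inj_on_def)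
  also have "\<dots> \<le> ip Q Q" using F(1) by (intro bessel bQ) auto
  also have "\<dots> \<le> (3 * (H * (2 * d) powr \<beta>))\<^sup>2" by (intro ip_le_const bQ Q_le)
  also have "\<dots> = 9 * H\<^sup>2 * ((2 * d) powr \<beta>)\<^sup>2" by (simp add: power_mult_distrib)
  also have "((2 * d) powr \<beta>)\<^sup>2 = (2 * d) powr (2 * \<beta>)" by (simp add: power2_eq_square powr_add[symmetric])
  also have "9 * H\<^sup>2 * (2 * d) powr (2 * \<beta>) \<le> 9 * H\<^sup>2 * (1 / 2 ^ n) powr (2 * \<beta>)"
  proof (intro mult_left_mono powr_mono2)
    show "2 * d \<le> 1 / 2 ^ n" by (simp add: d_def power_add field_simps)
  qed (use d \<beta> in auto)
  finally show ?thesis by simp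
qed

lemma sum_UN_le:
  fixes f :: "'b \<Rightarrow> real"
  assumes "\<And>n. finite (B n)" "\<And>x. f x \<ge> 0"
  shows "sum f (\<Union>n<m::nat. B n) \<le> (\<Sum>n<m. sum f (B n))"
proof (induction m)
  case (Suc m)
  have "sum f ((\<Union>n<m. B n) \<union> B m) + sum f ((\<Union>n<m. B n) \<inter> B m) = sum f (\<Union>n<m. B n) + sum f (B m)"
    using assms(1) by (intro sum.union_inter) auto
  moreover have "0 \<le> sum f ((\<Union>n<m. B n) \<inter> B m)" using assms(2) by (intro sum_nonneg)
  moreover have "(\<Union>n<Suc m. B n) = (\<Union>n<m. B n) \<union> B m" by (auto simp: lessThan_Suc)
  ultimately show ?case using Suc by simp
qed simp

text \<open>
  On the block of index \<open>n\<close> the weights are at most \<open>2 powr (r * (n + 1))\<close>, so that the block bounds form a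
  geometric series with ratio \<open>2 powr (r - 2 * \<beta>)\<close>.
\<close>

lemma hoelder_coefficients_weighted:
  assumes \<beta>: "\<beta> > 0" and r: "r < 2 * \<beta>" "r \<ge> 0"
  obtains C where "C \<ge> 0" "\<And>H g F. hoelder0 H \<beta> g \<Longrightarrow> finite F \<Longrightarrow> 0 \<notin> F \<Longrightarrow>
     (\<Sum>k\<in>F. \<bar>of_int k\<bar> powr r * (fcoef g k)\<^sup>2) \<le> C * H\<^sup>2"
proof -
  define z :: real where "z = 2 powr (r - 2 * \<beta>)"
  have z: "0 < z" "z < 1" using r by (auto simp: z_def powr_less_one)
  define C where "C = 9 / 2 * 2 powr r * (1 / (1 - z))"
  have C: "C \<ge> 0" using z by (simp add: C_def)
  show ?thesis
  proof (rule that[OF C])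
    fix H :: real and g and F :: "int set"
    assume g: "hoelder0 H \<beta> g" and F: "finite F" "0 \<notin> F"
    define B where "B = (\<lambda>n. {k\<in>F. 2 ^ n \<le> \<bar>k\<bar> \<and> \<bar>k\<bar> < 2 ^ Suc n})"
    define m where "m = (\<Sum>k\<in>F. nat \<bar>k\<bar>)"
    have cover: "F = (\<Union>n<m. B n)"
    proof
      show "F \<subseteq> (\<Union>n<m. B n)"
      proof
        fix k assume k: "k \<in> F"
        define a where "a = nat \<bar>k\<bar>"
        have a: "a > 0" "int a = \<bar>k\<bar>" using k F(2) by (auto simp: a_def)
        obtain n where n: "2 ^ n \<le> a" "a < 2 ^ (n + 1)" using ex_power_ivl1[of 2 a] a(1) by auto
        have "n < 2 ^ n" by simp
        moreover have "a \<le> m" unfolding m_def a_def using k F(1) by (intro member_le_sum) auto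
        ultimately have "n < m" using n(1) by (meson less_le_trans order_trans)
        moreover have "2 ^ n \<le> \<bar>k\<bar>" "\<bar>k\<bar> < 2 ^ Suc n"
        proof -
          have "int (2 ^ n) \<le> int a" "int a < int (2 ^ Suc n)" using n by (simp_all only: of_nat_le_iff of_nat_less_iff Suc_eq_plus1)
          then show "2 ^ n \<le> \<bar>k\<bar>" "\<bar>k\<bar> < 2 ^ Suc n" using a(2) by (simp_all)
        qed
        ultimately show "k \<in> (\<Union>n<m. B n)" using k by (auto simp: B_def)
      qed
    qed (auto simp: B_def)
    have block: "(\<Sum>k\<in>B n. \<bar>of_int k\<bar> powr r * (fcoef g k)\<^sup>2) \<le> 9 / 2 * H\<^sup>2 * 2 powr r * z ^ n" for n
    proof -
      have "(\<Sum>k\<in>B n. \<bar>of_int k\<bar> powr r * (fcoef g k)\<^sup>2) \<le> (\<Sum>k\<in>B n. (2 ^ Suc n) powr r * (fcoef g k)\<^sup>2)"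
      proof (intro sum_mono mult_right_mono powr_mono2)
        fix k assume "k \<in> B n"
        then have "real_of_int \<bar>k\<bar> \<le> real_of_int (2 ^ Suc n)" unfolding of_int_le_iff by (auto simp: B_def)
        then show "\<bar>real_of_int k\<bar> \<le> 2 ^ Suc n" by simp
      qed (use r in auto)
      also have "\<dots> = (2 ^ Suc n) powr r * (\<Sum>k\<in>B n. (fcoef g k)\<^sup>2)" by (simp add: sum_distrib_left)
      also have "\<dots> \<le> (2 ^ Suc n) powr r * (9 / 2 * H\<^sup>2 * (1 / 2 ^ n) powr (2 * \<beta>))"
        using F(1) by (intro mult_left_mono hoelder_coefficients_block[OF g \<beta>]) (auto simp: B_def)
      also have "\<dots> = 9 / 2 * H\<^sup>2 * ((2 ^ Suc n) powr r * (1 / 2 ^ n) powr (2 * \<beta>))" by simp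
      also have "(2 ^ Suc n) powr r * (1 / 2 ^ n) powr (2 * \<beta>) = (2::real) powr r * z ^ n"
      proof -
        have "((2::real) ^ Suc n) powr r = 2 powr (real (Suc n) * r)"
          by (simp only: powr_realpow[symmetric] powr_powr zero_less_numeral)
        moreover have "(1 / (2::real) ^ n) powr (2 * \<beta>) = 2 powr (- (real n * (2 * \<beta>)))"
          by (simp add: powr_minus_divide powr_divide powr_realpow[symmetric] powr_powr)
        moreover have "z ^ n = 2 powr (real n * (r - 2 * \<beta>))"
          unfolding z_def by (simp add: powr_realpow[symmetric] powr_powr mult.commute)
        ultimately show ?thesis by (simp add: powr_add[symmetric] algebra_simps)
      qed
      finally show ?thesis by (simp add: mult.assoc)
    qed
    have "(\<Sum>k\<in>F. \<bar>of_int k\<bar> powr r * (fcoef g k)\<^sup>2) \<le> (\<Sum>n<m. \<Sum>k\<in>B n. \<bar>of_int k\<bar> powr r * (fcoef g k)\<^sup>2)"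
      by (subst cover, rule sum_UN_le) (use F(1) in \<open>auto simp: B_def\<close>)
    also have "\<dots> \<le> (\<Sum>n<m. 9 / 2 * H\<^sup>2 * 2 powr r * z ^ n)" by (intro sum_mono block)
    also have "\<dots> = 9 / 2 * H\<^sup>2 * 2 powr r * (\<Sum>n<m. z ^ n)" by (simp add: sum_distrib_left)
    also have "\<dots> \<le> 9 / 2 * H\<^sup>2 * 2 powr r * (1 / (1 - z))"
    proof (rule mult_left_mono)
      have "(\<Sum>n<m. z ^ n) \<le> (\<Sum>n. z ^ n)" using z by (intro sum_le_suminf summable_geometric) auto
      then show "(\<Sum>n<m. z ^ n) \<le> 1 / (1 - z)" using z by (simp add: suminf_geometric)
    qed simp
    finally show "(\<Sum>k\<in>F. \<bar>of_int k\<bar> powr r * (fcoef g k)\<^sup>2) \<le> C * H\<^sup>2" by (simp add: C_def algebra_simps)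
  qed
qed

section \<open>Stochastic measures continuous in the square mean\<close>

lemma (in prob_space) prob_norm_tendsto_0_AE:
  assumes [measurable]: "\<And>n. X n \<in> borel_measurable M" "Y \<in> borel_measurable M"
    and lim: "AE \<omega> in M. (\<lambda>n. X n \<omega>) \<longlonglongrightarrow> (Y \<omega> :: real)"
  shows "(\<lambda>n. prob_norm M (\<lambda>\<omega>. X n \<omega> - Y \<omega>)) \<longlonglongrightarrow> 0"
proof -
  have "(\<lambda>n. \<integral>\<omega>. min 1 \<bar>X n \<omega> - Y \<omega>\<bar> \<partial>M) \<longlonglongrightarrow> (\<integral>\<omega>. 0 \<partial>M)"
  proof (rule integral_dominated_convergence[where w="\<lambda>_. 1"])
    show "AE \<omega> in M. (\<lambda>n. min 1 \<bar>X n \<omega> - Y \<omega>\<bar>) \<longlonglongrightarrow> 0"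
      using lim
    proof eventually_elim
      case (elim \<omega>)
      have "(\<lambda>n. min 1 \<bar>X n \<omega> - Y \<omega>\<bar>) \<longlonglongrightarrow> min 1 \<bar>Y \<omega> - Y \<omega>\<bar>"
        by (intro tendsto_intros elim)
      then show ?case by simp
    qed
  qed auto
  then show ?thesis by (simp add: prob_norm_def)
qed

lemma square_integrable_bdd_meas:
  assumes "bdd_meas h" shows "square_integrable_unit h"
proof -
  have "integrable unit_leb (\<lambda>x. h x * h x)" by (intro bdd_meas_integrable bdd_meas_mult assms)
  then have "integrable lborel (\<lambda>x. indicator {0<..1} x *\<^sub>R (h x * h x))"
    by (simp add: integrable_restrict_space)
  then show ?thesis
    using bdd_meas_measurable[OF assms]
    by (simp add: square_integrable_unit_def set_integrable_def power2_eq_square borel_measurable_unit_leb)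
qed

lemma ip_self: "(LINT x:{0<..1}|lborel. \<bar>h x\<bar>\<^sup>2) = ip h h"
  by (simp add: set_integral_unit_leb ip_def power2_eq_square)

text \<open>
  The exponent \<open>r\<close> is the weight in the sums of squares: \<open>\<bar>k\<bar> powr (- r)\<close> is summable since \<open>r > 1\<close>.
\<close>

locale L2_stoch_measure = stoch_measure M unit_borel \<mu> for M :: "'w measure" and \<mu> +
  fixes r :: real
  assumes L2_integrable: "\<And>h. square_integrable_unit h \<Longrightarrow> sm_integrable M unit_borel \<mu> h"
    and L2_continuous: "\<And>h :: nat \<Rightarrow> real \<Rightarrow> real. (\<And>j. square_integrable_unit (h j)) \<Longrightarrow>
      (\<lambda>j. LINT x:{0<..1}|lborel. \<bar>h j x\<bar>\<^sup>2) \<longlonglongrightarrow> 0 \<Longrightarrow>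
      tendsto_in_prob M (\<lambda>j. sm_integral M unit_borel \<mu> {0<..1} (h j)) (\<lambda>\<omega>. 0)"
    and r: "r > 1"
begin

abbreviation sI :: "(real \<Rightarrow> real) \<Rightarrow> 'w \<Rightarrow> real" where "sI \<equiv> sint {0<..1}"

lemma unit_set: "{0<..1} \<in> sets unit_borel"
  unfolding sets_restrict_space by (rule image_eqI[of _ _ "{0<..1}"]) auto

lemma bdd_meas_sm_integrable: "bdd_meas h \<Longrightarrow> sm_integrable M unit_borel \<mu> h"
  by (intro L2_integrable square_integrable_bdd_meas)

lemma sI_measurable: "bdd_meas h \<Longrightarrow> sI h \<in> borel_measurable M"
  by (intro sint_measurable bdd_meas_sm_integrable unit_set)

lemma sI_tendsto_0:
  assumes "\<And>j. bdd_meas (h j)" "(\<lambda>j. ip (h j) (h j)) \<longlonglongrightarrow> 0"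
  shows "(\<lambda>j. prob_norm M (sI (h j))) \<longlonglongrightarrow> 0"
proof -
  have "tendsto_in_prob M (\<lambda>j. sI (h j)) (\<lambda>\<omega>. 0)"
  proof (rule L2_continuous)
    show "(\<lambda>j. LINT x:{0<..1}|lborel. \<bar>h j x\<bar>\<^sup>2) \<longlonglongrightarrow> 0" unfolding ip_self by (rule assms(2))
  qed (intro square_integrable_bdd_meas assms(1))
  then show ?thesis by (simp add: tendsto_in_prob_iff)
qed

text \<open>
  Sequential continuity at \<open>0\<close> in the form with \<open>\<epsilon>\<close> and \<open>\<delta>\<close>.
\<close>

lemma sI_uniform:
  assumes e: "e > 0"
  obtains d where "d > 0" "\<And>h. bdd_meas h \<Longrightarrow> ip h h \<le> d \<Longrightarrow> prob_norm M (sI h) \<le> e"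
proof (rule ccontr)
  assume neg: "\<not> thesis"
  have "\<forall>n::nat. \<exists>h. bdd_meas h \<and> ip h h \<le> 1 / real (Suc n) \<and> e < prob_norm M (sI h)"
  proof (rule allI, rule ccontr)
    fix n :: nat
    assume "\<not> (\<exists>h. bdd_meas h \<and> ip h h \<le> 1 / real (Suc n) \<and> e < prob_norm M (sI h))"
    then have "\<And>h. bdd_meas h \<Longrightarrow> ip h h \<le> 1 / real (Suc n) \<Longrightarrow> prob_norm M (sI h) \<le> e"
      using not_less by blast
    then show False using that[of "1 / real (Suc n)"] neg by simp
  qed
  from choice[OF this] obtain h where hh: "\<forall>n. bdd_meas (h n) \<and> ip (h n) (h n) \<le> 1 / real (Suc n) \<and> e < prob_norm M (sI (h n))" ..
  have h: "bdd_meas (h n)" "ip (h n) (h n) \<le> 1 / real (Suc n)" "e < prob_norm M (sI (h n))" for n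
    using spec[OF hh, of n] by blast+
  have "(\<lambda>n. ip (h n) (h n)) \<longlonglongrightarrow> 0"
  proof (rule tendsto_sandwich[OF _ _ tendsto_const LIMSEQ_inverse_real_of_nat])
    show "\<forall>\<^sub>F n in sequentially. 0 \<le> ip (h n) (h n)" by (intro always_eventually allI ip_nonneg)
    show "\<forall>\<^sub>F n in sequentially. ip (h n) (h n) \<le> inverse (real (Suc n))"
      by (intro always_eventually allI) (use h(2) in \<open>simp add: inverse_eq_divide\<close>)
  qed
  then have "(\<lambda>n. prob_norm M (sI (h n))) \<longlonglongrightarrow> 0" by (intro sI_tendsto_0 h(1))
  moreover have "e \<le> prob_norm M (sI (h n))" for n using h(3)[of n] by simp
  ultimately have "e \<le> 0" by (intro LIMSEQ_le_const) auto
  then show False using e by simp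
qed

subsection \<open>Random Fourier coefficients\<close>

text \<open>
  The integrals may be changed on null sets; \<open>zeta\<close> below is the representative for which the
  weighted sums of squares converge everywhere.
\<close>

definition zeta0 :: "int \<Rightarrow> 'w \<Rightarrow> real" where "zeta0 k = sI (ebasis k)"

lemma zeta0_measurable [measurable]: "zeta0 k \<in> borel_measurable M"
  unfolding zeta0_def by (intro sI_measurable bdd_meas_ebasis)

lemma sI_trig_sum: "finite F \<Longrightarrow> AE \<omega> in M. sI (trig_sum F c) \<omega> = (\<Sum>k\<in>F. c k * zeta0 k \<omega>)"
  unfolding trig_sum_def[abs_def] zeta0_def
  using sint_sum[of F ebasis "{0<..1}" c, OF _ bdd_meas_sm_integrable[OF bdd_meas_ebasis] unit_set] by blast

text \<open>
  Whatever the signs, the signed sum of \<open>sqrt (w k) * zeta0 k\<close> is the integral of a trigonometric sum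
  of mean square at most \<open>W\<close>. Scaled by \<open>c\<close>, such functions have small integrals by continuity in mean square.
  The bound depends on \<open>w\<close> only through \<open>W\<close>.
\<close>

lemma weighted_squares_bounded:
  assumes p: "p > 0" and W: "W > 0"
  obtains L where "\<And>F w. finite F \<Longrightarrow> (\<And>k. k \<in> F \<Longrightarrow> w k \<ge> 0) \<Longrightarrow> (\<Sum>k\<in>F. w k) \<le> W \<Longrightarrow>
    prob {\<omega>\<in>space M. L < (\<Sum>k\<in>F. w k * (zeta0 k \<omega>)\<^sup>2)} \<le> p"
proof -
  obtain d where d: "d > 0" "\<And>h. bdd_meas h \<Longrightarrow> ip h h \<le> d \<Longrightarrow> prob_norm M (sI h) \<le> p / 10"
    by (rule sI_uniform[of "p / 10"]) (use p in auto)
  define c where "c = sqrt (d / W)"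
  have c: "c > 0" "c\<^sup>2 * W = d" using d(1) W by (simp_all add: c_def)
  show ?thesis
  proof (rule that[of "2 * (1 / c)\<^sup>2"])
    fix F and w :: "int \<Rightarrow> real"
    assume F: "finite F" and w: "\<And>k. k \<in> F \<Longrightarrow> w k \<ge> 0" and sw: "(\<Sum>k\<in>F. w k) \<le> W"
    let ?X = "\<lambda>k \<omega>. sqrt (w k) * zeta0 k \<omega>"
    have "prob {\<omega>\<in>space M. 2 * (1 / c)\<^sup>2 < (\<Sum>k\<in>F. (?X k \<omega>)\<^sup>2)} \<le> 10 * (p / 10)"
    proof (rule prob_sum_squares_le[OF F])
      fix T assume T: "T \<subseteq> F"
      let ?s = "\<lambda>k. c * ((if k \<in> T then 1 else - 1) * sqrt (w k))"
      let ?h = "trig_sum F ?s"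
      have "ip ?h ?h = (\<Sum>k\<in>F. c\<^sup>2 * w k)"
        unfolding ip_trig_sum_trig_sum[OF F] using w by (intro sum.cong refl) (auto simp: power_mult_distrib)
      also have "\<dots> \<le> c\<^sup>2 * W" unfolding sum_distrib_left[symmetric] using sw by (intro mult_left_mono) auto
      finally have n: "prob_norm M (sI ?h) \<le> p / 10" using c(2) by (intro d(2) bdd_meas_trig_sum) simp
      have m: "sI ?h \<in> borel_measurable M" by (intro sI_measurable bdd_meas_trig_sum)
      have m2: "(\<lambda>\<omega>. sgn_sum (\<lambda>k. ?X k \<omega>) F T) \<in> borel_measurable M"
        unfolding sgn_sum_def by measurable
      have eq: "AE \<omega> in M. sI ?h \<omega> = c * sgn_sum (\<lambda>k. ?X k \<omega>) F T"
        using sI_trig_sum[OF F, of ?s]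
      proof eventually_elim
        case (elim \<omega>)
        have "sgn_sum (\<lambda>k. ?X k \<omega>) F T = (\<Sum>k\<in>F. (if k \<in> T then 1 else - 1) * ?X k \<omega>)"
        proof -
          have "(\<Sum>k\<in>F. (if k \<in> T then 1 else - 1) * ?X k \<omega>) =
             (\<Sum>k\<in>F - T. (if k \<in> T then 1 else - 1) * ?X k \<omega>) + (\<Sum>k\<in>T. (if k \<in> T then 1 else - 1) * ?X k \<omega>)"
            by (rule sum.subset_diff[OF T F])
          also have "(\<Sum>k\<in>F - T. (if k \<in> T then 1 else - 1) * ?X k \<omega>) = (\<Sum>k\<in>F - T. - ?X k \<omega>)"
            by (intro sum.cong) auto
          also have "(\<Sum>k\<in>T. (if k \<in> T then 1 else - 1) * ?X k \<omega>) = (\<Sum>k\<in>T. ?X k \<omega>)"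
            by (intro sum.cong) auto
          finally show ?thesis by (simp add: sgn_sum_def sum_negf)
        qed
        then show ?case unfolding elim by (simp add: sum_distrib_left mult.assoc)
      qed
      have "prob {\<omega>\<in>space M. 1 / c < \<bar>sgn_sum (\<lambda>k. ?X k \<omega>) F T\<bar>} \<le> prob {\<omega>\<in>space M. 1 < \<bar>sI ?h \<omega>\<bar>}"
      proof (rule finite_measure_mono_AE)
        show "{\<omega>\<in>space M. 1 < \<bar>sI ?h \<omega>\<bar>} \<in> events" using m by measurable
        show "AE \<omega> in M. \<omega> \<in> {\<omega>\<in>space M. 1 / c < \<bar>sgn_sum (\<lambda>k. ?X k \<omega>) F T\<bar>} \<longrightarrow> \<omega> \<in> {\<omega>\<in>space M. 1 < \<bar>sI ?h \<omega>\<bar>}"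
          using eq
        proof eventually_elim
          case (elim \<omega>)
          have "1 / c < \<bar>y\<bar> \<longleftrightarrow> 1 < \<bar>c * y\<bar>" for y using c(1) by (simp add: abs_mult field_simps)
          moreover have "\<bar>sI ?h \<omega>\<bar> = \<bar>c * sgn_sum (\<lambda>k. ?X k \<omega>) F T\<bar>" by (rule arg_cong[OF elim])
          ultimately show ?case by (simp only: mem_Collect_eq) simp
        qed
      qed
      also have "\<dots> \<le> p / 10" using prob_gt_le_prob_norm[OF m, of 1] n by simp
      finally show "prob {\<omega>\<in>space M. 1 / c < \<bar>sgn_sum (\<lambda>k. ?X k \<omega>) F T\<bar>} \<le> p / 10" .
    qed (use c(1) in \<open>simp_all\<close>)
    moreover have "(\<Sum>k\<in>F. (?X k \<omega>)\<^sup>2) = (\<Sum>k\<in>F. w k * (zeta0 k \<omega>)\<^sup>2)" for \<omega>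
      using w by (intro sum.cong) (simp_all add: power_mult_distrib)
    ultimately show "prob {\<omega>\<in>space M. 2 * (1 / c)\<^sup>2 < (\<Sum>k\<in>F. w k * (zeta0 k \<omega>)\<^sup>2)} \<le> p" by simp
  qed
qed

text \<open>
  The term with \<open>k = 0\<close> vanishes, because \<open>0 powr (- r) = 0\<close>. A single coefficient does not matter for
  convergence.
\<close>

definition sqsum0 :: "nat \<Rightarrow> 'w \<Rightarrow> real" where
  "sqsum0 n \<omega> = (\<Sum>k\<in>{- int n..int n}. \<bar>of_int k\<bar> powr (- r) * (zeta0 k \<omega>)\<^sup>2)"

lemma sqsum0_measurable [measurable]: "sqsum0 n \<in> borel_measurable M"
  unfolding sqsum0_def[abs_def] by measurable

text \<open>
  The bound is a natural number so that the set of these \<open>\<omega>\<close> is visibly measurable.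
\<close>

definition coeffs_bounded :: "'w \<Rightarrow> bool" where
  "coeffs_bounded \<omega> \<longleftrightarrow> (\<exists>B::nat. \<forall>n. sqsum0 n \<omega> \<le> real B)"

lemma coeffs_bounded_measurable [measurable]: "Measurable.pred M coeffs_bounded"
  unfolding coeffs_bounded_def[abs_def] by measurable

lemma sum_symmetric_interval:
  fixes f :: "int \<Rightarrow> real"
  shows "(\<Sum>k\<in>{- int n..int n}. f k) = f 0 + (\<Sum>m=1..n. f (int m) + f (- int m))"
proof (induction n)
  case (Suc n)
  have "{- int (Suc n)..int (Suc n)} = insert (int (Suc n)) (insert (- int (Suc n)) {- int n..int n})" by auto
  then show ?case using Suc by simp
qed simp

lemma sum_weights_bounded:
  obtains W where "W > 0" "\<And>n. (\<Sum>k\<in>{- int n..int n}. \<bar>of_int k\<bar> powr (- r)) \<le> W"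
proof -
  have s: "summable (\<lambda>n. real n powr (- r))" using r by (simp add: summable_real_powr_iff)
  define W where "W = 2 * (\<Sum>n. real n powr (- r)) + 1"
  show ?thesis
  proof (rule that[of W])
    show "W > 0" using suminf_nonneg[OF s] by (simp add: W_def)
    fix n
    have "(\<Sum>k\<in>{- int n..int n}. \<bar>of_int k\<bar> powr (- r)) = 2 * (\<Sum>m=1..n. real m powr (- r))"
      by (simp add: sum_symmetric_interval sum_distrib_left)
    also have "(\<Sum>m=1..n. real m powr (- r)) \<le> (\<Sum>n. real n powr (- r))" by (intro sum_le_suminf s) auto
    finally show "(\<Sum>k\<in>{- int n..int n}. \<bar>of_int k\<bar> powr (- r)) \<le> W" by (simp add: W_def)
  qed
qed

lemma sqsum0_mono: "m \<le> n \<Longrightarrow> sqsum0 m \<omega> \<le> sqsum0 n \<omega>"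
  unfolding sqsum0_def by (intro sum_mono2) auto

lemma AE_coeffs_bounded: "AE \<omega> in M. coeffs_bounded \<omega>"
proof -
  obtain W where W: "W > 0" "\<And>n. (\<Sum>k\<in>{- int n..int n}. \<bar>of_int k\<bar> powr (- r)) \<le> W"
    by (rule sum_weights_bounded) blast
  have "prob {\<omega>\<in>space M. \<not> coeffs_bounded \<omega>} \<le> 0 + p" if p: "p > 0" for p
  proof -
    obtain L where L: "\<And>F w. finite F \<Longrightarrow> (\<And>k. k \<in> F \<Longrightarrow> w k \<ge> 0) \<Longrightarrow> (\<Sum>k\<in>F. w k) \<le> W \<Longrightarrow>
        prob {\<omega>\<in>space M. L < (\<Sum>k\<in>F. w k * (zeta0 k \<omega>)\<^sup>2)} \<le> p"
      by (rule weighted_squares_bounded[OF p W(1)]) blast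
    have le: "prob {\<omega>\<in>space M. L < sqsum0 n \<omega>} \<le> p" for n
      unfolding sqsum0_def by (rule L) (auto simp: W(2))
    have "(\<lambda>n. prob {\<omega>\<in>space M. L < sqsum0 n \<omega>}) \<longlonglongrightarrow> prob (\<Union>n. {\<omega>\<in>space M. L < sqsum0 n \<omega>})"
    proof (rule finite_Lim_measure_incseq)
      show "incseq (\<lambda>n. {\<omega>\<in>space M. L < sqsum0 n \<omega>})"
        unfolding incseq_def using sqsum0_mono less_le_trans by blast
    qed auto
    then have "prob (\<Union>n. {\<omega>\<in>space M. L < sqsum0 n \<omega>}) \<le> p"
      by (rule LIMSEQ_le_const2) (use le in blast)
    moreover have "prob {\<omega>\<in>space M. \<not> coeffs_bounded \<omega>} \<le> prob (\<Union>n. {\<omega>\<in>space M. L < sqsum0 n \<omega>})"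
    proof (rule finite_measure_mono)
      show "{\<omega>\<in>space M. \<not> coeffs_bounded \<omega>} \<subseteq> (\<Union>n. {\<omega>\<in>space M. L < sqsum0 n \<omega>})"
      proof
        fix \<omega> assume w: "\<omega> \<in> {\<omega>\<in>space M. \<not> coeffs_bounded \<omega>}"
        obtain B :: nat where "L \<le> real B" using real_arch_simple by blast
        moreover have "\<exists>n. real B < sqsum0 n \<omega>" using w by (auto simp: coeffs_bounded_def not_le)
        ultimately show "\<omega> \<in> (\<Union>n. {\<omega>\<in>space M. L < sqsum0 n \<omega>})" using w by (auto intro: le_less_trans)
      qed
    qed auto
    ultimately show ?thesis by simp
  qed
  then have "prob {\<omega>\<in>space M. \<not> coeffs_bounded \<omega>} \<le> 0" by (rule field_le_epsilon)
  then have "prob {\<omega>\<in>space M. \<not> coeffs_bounded \<omega>} = 0" by (simp add: measure_le_0_iff)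
  then show ?thesis
    by (intro AE_I[of _ _ "{\<omega>\<in>space M. \<not> coeffs_bounded \<omega>}"]) (auto simp: emeasure_eq_measure)
qed

definition zeta :: "int \<Rightarrow> 'w \<Rightarrow> real" where "zeta k \<omega> = (if coeffs_bounded \<omega> then zeta0 k \<omega> else 0)"

lemma zeta_measurable [measurable]: "zeta k \<in> borel_measurable M"
  unfolding zeta_def[abs_def] by measurable

lemma AE_zeta: "AE \<omega> in M. \<forall>k. zeta k \<omega> = zeta0 k \<omega>"
  using AE_coeffs_bounded by eventually_elim (simp add: zeta_def)

definition sqsum :: "nat \<Rightarrow> 'w \<Rightarrow> real" where
  "sqsum n \<omega> = (\<Sum>k\<in>{- int n..int n}. \<bar>of_int k\<bar> powr (- r) * (zeta k \<omega>)\<^sup>2)"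

lemma sqsum_measurable [measurable]: "sqsum n \<in> borel_measurable M"
  unfolding sqsum_def[abs_def] by measurable

lemma sqsum_mono: "incseq (\<lambda>n. sqsum n \<omega>)"
  unfolding incseq_def sqsum_def by (intro allI impI sum_mono2) auto

definition sqsum_lim :: "'w \<Rightarrow> real" where "sqsum_lim \<omega> = lim (\<lambda>n. sqsum n \<omega>)"

lemma sqsum_tendsto: "(\<lambda>n. sqsum n \<omega>) \<longlonglongrightarrow> sqsum_lim \<omega>"
proof -
  have "\<exists>B. \<forall>n. sqsum n \<omega> \<le> B"
  proof (cases "coeffs_bounded \<omega>")
    case True
    then show ?thesis by (auto simp: coeffs_bounded_def sqsum_def sqsum0_def zeta_def)
  next
    case False
    then show ?thesis by (auto simp: sqsum_def zeta_def)
  qed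
  then obtain B where "\<And>n. sqsum n \<omega> \<le> B" by blast
  then obtain L where "(\<lambda>n. sqsum n \<omega>) \<longlonglongrightarrow> L"
    using incseq_convergent[OF sqsum_mono, of \<omega> B] by blast
  then have "convergent (\<lambda>n. sqsum n \<omega>)" by (rule convergentI)
  then show ?thesis by (simp add: sqsum_lim_def convergent_LIMSEQ_iff)
qed

lemma sqsum_le_lim: "sqsum n \<omega> \<le> sqsum_lim \<omega>"
  by (rule incseq_le[OF sqsum_mono sqsum_tendsto])

lemma sqsum_lim_measurable [measurable]: "sqsum_lim \<in> borel_measurable M"
  by (rule borel_measurable_LIMSEQ_real[OF sqsum_tendsto]) simp

definition tail :: "nat \<Rightarrow> 'w \<Rightarrow> real" where "tail n \<omega> = sqrt (sqsum_lim \<omega> - sqsum n \<omega>)"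

lemma tail_measurable [measurable]: "tail n \<in> borel_measurable M"
  unfolding tail_def[abs_def] by measurable

lemma tail_tendsto: "(\<lambda>n. tail n \<omega>) \<longlonglongrightarrow> 0"
proof -
  have "(\<lambda>n. tail n \<omega>) \<longlonglongrightarrow> sqrt (sqsum_lim \<omega> - sqsum_lim \<omega>)"
    unfolding tail_def by (intro tendsto_intros sqsum_tendsto)
  then show ?thesis by simp
qed

definition pseries :: "nat \<Rightarrow> (int \<Rightarrow> real) \<Rightarrow> 'w \<Rightarrow> real" where
  "pseries n c \<omega> = (\<Sum>k\<in>{- int n..int n}. c k * zeta k \<omega>)"

definition series :: "(int \<Rightarrow> real) \<Rightarrow> 'w \<Rightarrow> real" where
  "series c \<omega> = lim (\<lambda>n. pseries n c \<omega>)"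

lemma pseries_measurable [measurable]: "pseries n c \<in> borel_measurable M"
  unfolding pseries_def[abs_def] by measurable

text \<open>
  Cauchy-Schwarz inequality with the weights \<open>\<bar>k\<bar> powr (r / 2)\<close> and \<open>\<bar>k\<bar> powr (- r / 2)\<close>. The random factor does not depend
  on the coefficients \<open>c\<close>, which makes the convergence uniform in \<open>(t,x)\<close> later.
\<close>

lemma pseries_diff_le:
  assumes c: "\<And>F. finite F \<Longrightarrow> 0 \<notin> F \<Longrightarrow> (\<Sum>k\<in>F. \<bar>of_int k\<bar> powr r * (c k)\<^sup>2) \<le> K\<^sup>2" and K: "K \<ge> 0"
    and "m \<le> n"
  shows "\<bar>pseries n c \<omega> - pseries m c \<omega>\<bar> \<le> K * tail m \<omega>"
proof -
  let ?A = "{- int m..int m}" and ?B = "{- int n..int n}"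
  let ?F = "?B - ?A"
  have sub: "?A \<subseteq> ?B" using assms(3) by auto
  have d: "sum f ?B - sum f ?A = sum f ?F" for f :: "int \<Rightarrow> real"
    using sum.subset_diff[OF sub, of f] by simp
  have F0: "0 \<notin> ?F" by auto
  have "\<bar>pseries n c \<omega> - pseries m c \<omega>\<bar> = \<bar>\<Sum>k\<in>?F. c k * zeta k \<omega>\<bar>"
    unfolding pseries_def d ..
  also have "\<dots> \<le> (\<Sum>k\<in>?F. \<bar>\<bar>of_int k\<bar> powr (r / 2) * c k\<bar> * \<bar>\<bar>of_int k\<bar> powr (- r / 2) * zeta k \<omega>\<bar>)"
  proof (rule order_trans[OF sum_abs], rule sum_mono)
    fix k assume "k \<in> ?F"
    then have "\<bar>real_of_int k\<bar> > 0" by auto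
    then have "\<bar>real_of_int k\<bar> powr (r / 2) * \<bar>real_of_int k\<bar> powr (- r / 2) = 1"
      by (simp add: powr_add[symmetric])
    then have "\<bar>\<bar>of_int k\<bar> powr (r / 2) * c k\<bar> * \<bar>\<bar>of_int k\<bar> powr (- r / 2) * zeta k \<omega>\<bar> = \<bar>c k * zeta k \<omega>\<bar>"
      unfolding abs_mult by (simp add: mult.assoc mult.left_commute)
    then show "\<bar>c k * zeta k \<omega>\<bar> \<le> \<bar>\<bar>of_int k\<bar> powr (r / 2) * c k\<bar> * \<bar>\<bar>of_int k\<bar> powr (- r / 2) * zeta k \<omega>\<bar>" by simp
  qed
  also have "\<dots> \<le> L2_set (\<lambda>k. \<bar>of_int k\<bar> powr (r / 2) * c k) ?F * L2_set (\<lambda>k. \<bar>of_int k\<bar> powr (- r / 2) * zeta k \<omega>) ?F"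
    by (rule L2_set_mult_ineq)
  also have "\<dots> \<le> K * tail m \<omega>"
  proof (rule mult_mono)
    have p: "(\<bar>real_of_int k\<bar> powr y)\<^sup>2 = \<bar>real_of_int k\<bar> powr (2 * y)" for k y
      by (simp add: power2_eq_square powr_add[symmetric])
    have "(\<Sum>k\<in>?F. (\<bar>of_int k\<bar> powr (r / 2) * c k)\<^sup>2) = (\<Sum>k\<in>?F. \<bar>of_int k\<bar> powr r * (c k)\<^sup>2)"
      unfolding power_mult_distrib p by simp
    also have "\<dots> \<le> K\<^sup>2" by (rule c[OF _ F0]) simp
    finally show "L2_set (\<lambda>k. \<bar>of_int k\<bar> powr (r / 2) * c k) ?F \<le> K"
      unfolding L2_set_def by (rule real_le_lsqrt[OF K])
    have "(\<Sum>k\<in>?F. (\<bar>of_int k\<bar> powr (- r / 2) * zeta k \<omega>)\<^sup>2) = sqsum n \<omega> - sqsum m \<omega>"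
      unfolding power_mult_distrib p sqsum_def d by simp
    also have "\<dots> \<le> sqsum_lim \<omega> - sqsum m \<omega>" using sqsum_le_lim by simp
    finally show "L2_set (\<lambda>k. \<bar>of_int k\<bar> powr (- r / 2) * zeta k \<omega>) ?F \<le> tail m \<omega>"
      unfolding L2_set_def tail_def by (rule real_sqrt_le_mono)
  qed (use K in \<open>auto simp: L2_set_nonneg\<close>)
  finally show ?thesis .
qed

lemma pseries_tendsto:
  assumes c: "\<And>F. finite F \<Longrightarrow> 0 \<notin> F \<Longrightarrow> (\<Sum>k\<in>F. \<bar>of_int k\<bar> powr r * (c k)\<^sup>2) \<le> K\<^sup>2" and K: "K \<ge> 0"
  shows "(\<lambda>n. pseries n c \<omega>) \<longlonglongrightarrow> series c \<omega>" "\<bar>series c \<omega> - pseries m c \<omega>\<bar> \<le> K * tail m \<omega>"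
proof -
  have "Cauchy (\<lambda>n. pseries n c \<omega>)"
  proof (rule metric_CauchyI)
    fix e :: real assume e: "e > 0"
    have "(\<lambda>n. 2 * (K * tail n \<omega>)) \<longlonglongrightarrow> 2 * (K * 0)" by (intro tendsto_mult_left tail_tendsto)
    from LIMSEQ_D[OF this e] obtain m where "norm (2 * (K * tail m \<omega>) - 2 * (K * 0)) < e" by blast
    then have m: "2 * (K * tail m \<omega>) < e" by simp
    show "\<exists>M. \<forall>k\<ge>M. \<forall>n\<ge>M. dist (pseries k c \<omega>) (pseries n c \<omega>) < e"
    proof (intro exI allI impI)
      fix k n assume "k \<ge> m" "n \<ge> m"
      then show "dist (pseries k c \<omega>) (pseries n c \<omega>) < e"
        using pseries_diff_le[OF c K, of m k \<omega>] pseries_diff_le[OF c K, of m n \<omega>] m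
        by (simp add: dist_real_def)
    qed
  qed
  then have "convergent (\<lambda>n. pseries n c \<omega>)" by (rule Cauchy_convergent)
  then show l: "(\<lambda>n. pseries n c \<omega>) \<longlonglongrightarrow> series c \<omega>"
    by (simp add: series_def convergent_LIMSEQ_iff)
  have "(\<lambda>n. \<bar>pseries n c \<omega> - pseries m c \<omega>\<bar>) \<longlonglongrightarrow> \<bar>series c \<omega> - pseries m c \<omega>\<bar>"
    by (intro tendsto_intros l)
  then show "\<bar>series c \<omega> - pseries m c \<omega>\<bar> \<le> K * tail m \<omega>"
    by (rule LIMSEQ_le_const2) (use pseries_diff_le[OF c K] in blast)
qed

lemma sI_fpart_tendsto:
  assumes h: "continuous_on {0..1} h" "h 1 = 0"
  shows "(\<lambda>n. prob_norm M (\<lambda>\<omega>. pseries n (fcoef h) \<omega> - sI h \<omega>)) \<longlonglongrightarrow> 0"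
proof -
  have bh: "bdd_meas h" by (rule bdd_meas_continuous[OF h(1)])
  have b: "bdd_meas (\<lambda>x. h x - fpart n h x)" for n by (intro bdd_meas_diff bh bdd_meas_trig_sum)
  have "prob_norm M (sI (\<lambda>x. h x - fpart n h x)) = prob_norm M (\<lambda>\<omega>. pseries n (fcoef h) \<omega> - sI h \<omega>)" for n
  proof -
    have "AE \<omega> in M. sI (\<lambda>x. 1 * h x + (- 1) * fpart n h x) \<omega> = 1 * sI h \<omega> + (- 1) * sI (fpart n h) \<omega>"
      by (intro sint_linear bdd_meas_sm_integrable bh bdd_meas_trig_sum unit_set)
    then have "AE \<omega> in M. sI (\<lambda>x. h x - fpart n h x) \<omega> = - (pseries n (fcoef h) \<omega> - sI h \<omega>)"
      using AE_zeta sI_trig_sum[of "{- int n..int n}" "fcoef h", OF finite_atLeastAtMost_int]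
      by eventually_elim (simp add: pseries_def)
    then have "prob_norm M (sI (\<lambda>x. h x - fpart n h x)) = prob_norm M (\<lambda>\<omega>. - (pseries n (fcoef h) \<omega> - sI h \<omega>))"
      using sI_measurable[OF bh] sI_measurable[OF b] by (intro prob_norm_cong_AE) auto
    then show ?thesis by (simp only: prob_norm_minus)
  qed
  then show ?thesis using sI_tendsto_0[of "\<lambda>n x. h x - fpart n h x", OF b fpart_L2_tendsto[OF h]] by simp
qed

text \<open>
  The partial sums converge to the integral in probability, because the Fourier sums converge in
  mean square, and to the series pointwise.
\<close>

lemma sI_eq_series:
  assumes h: "continuous_on {0..1} h" "h 1 = 0"
    and c: "\<And>F. finite F \<Longrightarrow> 0 \<notin> F \<Longrightarrow> (\<Sum>k\<in>F. \<bar>of_int k\<bar> powr r * (fcoef h k)\<^sup>2) \<le> K\<^sup>2" and K: "K \<ge> 0"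
  shows "AE \<omega> in M. sI h \<omega> = series (fcoef h) \<omega>"
proof -
  have lim: "(\<lambda>n. pseries n (fcoef h) \<omega>) \<longlonglongrightarrow> series (fcoef h) \<omega>" for \<omega>
    by (rule pseries_tendsto(1)[OF c K])
  have m: "series (fcoef h) \<in> borel_measurable M"
    by (rule borel_measurable_LIMSEQ_real[OF lim]) simp
  have mI: "sI h \<in> borel_measurable M" by (intro sI_measurable bdd_meas_continuous h)
  have "tendsto_in_prob M (\<lambda>n. pseries n (fcoef h)) (sI h)"
    using sI_fpart_tendsto[OF h] mI by (simp add: tendsto_in_prob_iff)
  moreover have "tendsto_in_prob M (\<lambda>n. pseries n (fcoef h)) (series (fcoef h))"
    using prob_norm_tendsto_0_AE[OF pseries_measurable m] lim m by (simp add: tendsto_in_prob_iff)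
  ultimately show ?thesis by (rule tendsto_in_prob_unique) simp
qed

text \<open>
  The real part of the term with index \<open>k\<close> is the cosine integral times the cosine plus the sine
  integral times the sine. The terms for \<open>k\<close> and \<open>- k\<close> agree, and their sum is the contribution of the
  two basis functions with these indices; each of them carries a factor \<open>sqrt 2\<close> twice.
\<close>

lemma fourier_partial_sum_eq:
  "AE \<omega> in M. \<forall>s. Re (fourier_partial_sum M \<mu> j s \<omega>) = (\<Sum>k\<in>{- int j..int j}. zeta k \<omega> * ebasis k s)"
proof -
  let ?c = "\<lambda>(k::int) t. cos (2 * pi * of_int k * t)" and ?s = "\<lambda>(k::int) t. sin (2 * pi * of_int k * t)"
  have neg: "AE \<omega> in M. \<forall>k. sI (?s (- k)) \<omega> = - sI (?s k) \<omega>"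
  proof (rule AE_all_countable[THEN iffD2], rule allI)
    fix k
    have "AE \<omega> in M. sI (\<lambda>t. 0 * ?s k t + (- 1) * ?s k t) \<omega> = 0 * sI (?s k) \<omega> + (- 1) * sI (?s k) \<omega>"
      by (intro sint_linear bdd_meas_sm_integrable bdd_meas_sin unit_set)
    then show "AE \<omega> in M. sI (?s (- k)) \<omega> = - sI (?s k) \<omega>" by simp
  qed
  have z: "AE \<omega> in M. \<forall>k. zeta0 k \<omega> = (if k = 0 then sI (?c 0) \<omega> else if k > 0 then sqrt 2 * sI (?c k) \<omega> else sqrt 2 * sI (?s k) \<omega>)"
  proof (rule AE_all_countable[THEN iffD2], rule allI)
    fix k :: int
    have 1: "AE \<omega> in M. sI (\<lambda>t. sqrt 2 * ?c k t + 0 * ?s k t) \<omega> = sqrt 2 * sI (?c k) \<omega> + 0 * sI (?s k) \<omega>"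
     and 2: "AE \<omega> in M. sI (\<lambda>t. 0 * ?c k t + sqrt 2 * ?s k t) \<omega> = 0 * sI (?c k) \<omega> + sqrt 2 * sI (?s k) \<omega>"
      by (intro sint_linear bdd_meas_sm_integrable bdd_meas_sin bdd_meas_cos unit_set)+
    show "AE \<omega> in M. zeta0 k \<omega> = (if k = 0 then sI (?c 0) \<omega> else if k > 0 then sqrt 2 * sI (?c k) \<omega> else sqrt 2 * sI (?s k) \<omega>)"
    proof (cases "k = 0")
      case True
      then show ?thesis by (simp add: zeta0_def ebasis_def[abs_def])
    next
      case False
      then show ?thesis using 1 2 by (cases "k > 0") (simp_all add: zeta0_def ebasis_def[abs_def])
    qed
  qed
  show ?thesis
    using neg z AE_zeta
  proof eventually_elim
    case (elim \<omega>)
    show ?case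
    proof
      fix s
      have R: "Re (fourier_coeff M \<mu> k \<omega> * exp (2 * complex_of_real pi * \<i> * of_int k * complex_of_real s)) =
          sI (?c k) \<omega> * ?c k s + sI (?s k) \<omega> * ?s k s" for k
      proof -
        have "exp (2 * complex_of_real pi * \<i> * of_int k * complex_of_real s) = cis (2 * pi * of_int k * s)"
          by (simp add: cis_conv_exp algebra_simps)
        then show ?thesis by (simp add: fourier_coeff_def algebra_simps)
      qed
      have "Re (fourier_partial_sum M \<mu> j s \<omega>) = (\<Sum>k\<in>{- int j..int j}. sI (?c k) \<omega> * ?c k s + sI (?s k) \<omega> * ?s k s)"
        unfolding fourier_partial_sum_def Re_sum R ..
      also have "\<dots> = (\<Sum>k\<in>{- int j..int j}. zeta k \<omega> * ebasis k s)"
        unfolding sum_symmetric_interval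
      proof (rule arg_cong2[where f="(+)"], goal_cases zero pairs)
        case zero
        show "sI (?c 0) \<omega> * ?c 0 s + sI (?s 0) \<omega> * ?s 0 s = zeta 0 \<omega> * ebasis 0 s"
          using elim by (simp add: ebasis_def)
      next
        case pairs
        show ?case
        proof (rule sum.cong[OF refl])
          fix m assume m: "m \<in> {1..j}"
        have c: "sI (?c (- int m)) = sI (?c (int m))" by simp
        have "sI (?s (- int m)) \<omega> = - sI (?s (int m)) \<omega>" using elim(1) by blast
        then have sn: "sI (?s (int m)) \<omega> = - sI (?s (- int m)) \<omega>" by simp
        have z1: "zeta (int m) \<omega> = sqrt 2 * sI (?c (int m)) \<omega>" and z2: "zeta (- int m) \<omega> = sqrt 2 * sI (?s (- int m)) \<omega>"
          using elim(2,3) m by auto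
        have e1: "ebasis (int m) s = sqrt 2 * ?c (int m) s" and e2: "ebasis (- int m) s = sqrt 2 * ?s (- int m) s"
          using m by (auto simp: ebasis_def)
        have q: "sqrt 2 * x * (sqrt 2 * y) = 2 * (x * y)" for x y :: real
          by (simp add: algebra_simps)
        have cn: "?c (- int m) s = ?c (int m) s" and snn: "?s (int m) s = - ?s (- int m) s" by simp_all
        show "sI (?c (int m)) \<omega> * ?c (int m) s + sI (?s (int m)) \<omega> * ?s (int m) s
            + (sI (?c (- int m)) \<omega> * ?c (- int m) s + sI (?s (- int m)) \<omega> * ?s (- int m) s) =
          zeta (int m) \<omega> * ebasis (int m) s + zeta (- int m) \<omega> * ebasis (- int m) s"
          unfolding c cn sn snn z1 z2 e1 e2 q by (simp only: mult_minus_left mult_minus_right minus_minus mult_2 add_ac)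
        qed
      qed
      finally show "Re (fourier_partial_sum M \<mu> j s \<omega>) = (\<Sum>k\<in>{- int j..int j}. zeta k \<omega> * ebasis k s)" .
    qed
  qed
qed

end

section \<open>Integrals over the light cone\<close>

text \<open>
  For negative radius the interval is empty and the integral is \<open>0\<close>. Thus the integrals over the
  light cone can be extended from \<open>s \<le> t\<close> to all \<open>s\<close> in the unit interval.
\<close>

definition ball_int :: "real \<Rightarrow> real \<Rightarrow> (real \<Rightarrow> real) \<Rightarrow> real" where
  "ball_int x \<rho> \<phi> = (LINT y:{x - \<rho>..x + \<rho>}|lborel. \<phi> y)"

lemma set_integrable_Icc:
  fixes \<phi> :: "real \<Rightarrow> real"
  assumes "\<phi> \<in> borel_measurable borel" "AE y in lborel. \<bar>\<phi> y\<bar> \<le> B"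
  shows "set_integrable lborel {p..q} \<phi>"
  unfolding set_integrable_def
proof (rule integrableI_bounded_set_indicator)
  show "AE x in lborel. x \<in> {p..q} \<longrightarrow> norm (\<phi> x) \<le> B"
    using assms(2) by eventually_elim simp
qed (use assms(1) in \<open>auto simp: emeasure_lborel_Icc_eq\<close>)

lemma set_integral_Icc_diff:
  fixes \<phi> :: "real \<Rightarrow> real"
  assumes \<phi>: "\<phi> \<in> borel_measurable borel" "AE y in lborel. \<bar>\<phi> y\<bar> \<le> B" and B: "B \<ge> 0"
    and pq: "p \<le> q" "p' \<le> q'"
  shows "\<bar>(LINT y:{p..q}|lborel. \<phi> y) - (LINT y:{p'..q'}|lborel. \<phi> y)\<bar> \<le> B * (\<bar>p - p'\<bar> + \<bar>q - q'\<bar>)"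
proof -
  have i: "integrable lborel (\<lambda>y. indicator {c..d} y * \<phi> y)" for c d
    using set_integrable_Icc[OF \<phi>, of c d] by (simp add: set_integrable_def)
  let ?P = "{min p p'..max p p'}" and ?Q = "{min q q'..max q q'}"
  have j: "integrable lborel (indicator {c..d} :: real \<Rightarrow> real)" for c d :: real
    by (rule integrable_real_indicator) (auto simp: emeasure_lborel_Icc_eq)
  have "\<bar>(LINT y:{p..q}|lborel. \<phi> y) - (LINT y:{p'..q'}|lborel. \<phi> y)\<bar> =
      \<bar>\<integral>y. indicator {p..q} y * \<phi> y - indicator {p'..q'} y * \<phi> y \<partial>lborel\<bar>"
    unfolding set_lebesgue_integral_def real_scaleR_def
    by (subst Bochner_Integration.integral_diff[OF i i]) simp
  also have "\<dots> \<le> (\<integral>y. \<bar>indicator {p..q} y * \<phi> y - indicator {p'..q'} y * \<phi> y\<bar> \<partial>lborel)"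
    by (rule integral_abs_bound)
  also have "\<dots> \<le> (\<integral>y. B * (indicator ?P y + indicator ?Q y) \<partial>lborel)"
  proof (rule integral_mono_AE)
    show "AE y in lborel. \<bar>indicator {p..q} y * \<phi> y - indicator {p'..q'} y * \<phi> y\<bar> \<le> B * (indicator ?P y + indicator ?Q y)"
      using \<phi>(2)
    proof eventually_elim
      case (elim y)
      have "\<bar>indicator {p..q} y - indicator {p'..q'} y :: real\<bar> \<le> indicator ?P y + indicator ?Q y"
        using pq by (auto simp: indicator_def)
      then have "\<bar>indicator {p..q} y - indicator {p'..q'} y\<bar> * \<bar>\<phi> y\<bar> \<le> (indicator ?P y + indicator ?Q y) * B"
        using elim by (intro mult_mono) auto
      then show ?case by (simp add: abs_mult[symmetric] left_diff_distrib mult.commute[of B])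
    qed
    show "integrable lborel (\<lambda>y. \<bar>indicator {p..q} y * \<phi> y - indicator {p'..q'} y * \<phi> y\<bar>)"
      by (intro integrable_abs Bochner_Integration.integrable_diff i)
    show "integrable lborel (\<lambda>y. B * (indicator ?P y + indicator ?Q y))"
      by (intro integrable_mult_right Bochner_Integration.integrable_add j)
  qed
  also have "\<dots> = B * (\<bar>p - p'\<bar> + \<bar>q - q'\<bar>)"
  proof -
    have "measure lborel {min c d..max c d} = \<bar>c - d\<bar>" for c d :: real
      by (subst measure_lborel_Icc) (auto simp: max_def min_def)
    then show ?thesis by (simp add: Bochner_Integration.integral_add[OF j j])
  qed
  finally show ?thesis .
qed

lemma ball_int_max: "ball_int x \<rho> \<phi> = ball_int x (max 0 \<rho>) \<phi>"
proof (cases "\<rho> \<ge> 0")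
  case False
  have "ball_int x 0 \<phi> = 0"
    unfolding ball_int_def set_lebesgue_integral_def
  proof (rule integral_eq_zero_AE)
    show "AE y in lborel. indicator {x - 0..x + 0} y *\<^sub>R \<phi> y = 0"
      using AE_lborel_singleton[of x] by eventually_elim (simp add: indicator_def)
  qed
  moreover have "ball_int x \<rho> \<phi> = 0" using False by (simp add: ball_int_def set_lebesgue_integral_def)
  ultimately show ?thesis using False by simp
qed (simp add: max_def)

lemma ball_int_nonpos: "\<rho> \<le> 0 \<Longrightarrow> ball_int x \<rho> \<phi> = 0"
  using ball_int_max[of x \<rho> \<phi>] ball_int_max[of x "-1" \<phi>]
  by (simp add: max_def ball_int_def set_lebesgue_integral_def split: if_splits)

lemma ball_int_diff:
  assumes "\<phi> \<in> borel_measurable borel" "AE y in lborel. \<bar>\<phi> y\<bar> \<le> B" "B \<ge> 0"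
  shows "\<bar>ball_int x \<rho> \<phi> - ball_int x' \<rho>' \<phi>\<bar> \<le> 2 * B * (\<bar>x - x'\<bar> + \<bar>\<rho> - \<rho>'\<bar>)"
proof -
  let ?r = "max 0 \<rho>" and ?r' = "max 0 \<rho>'"
  have "\<bar>ball_int x \<rho> \<phi> - ball_int x' \<rho>' \<phi>\<bar> \<le> B * (\<bar>(x - ?r) - (x' - ?r')\<bar> + \<bar>(x + ?r) - (x' + ?r')\<bar>)"
    unfolding ball_int_max[of x \<rho>] ball_int_max[of x' \<rho>'] unfolding ball_int_def
    by (rule set_integral_Icc_diff[OF assms]) auto
  also have "\<dots> \<le> B * (2 * (\<bar>x - x'\<bar> + \<bar>\<rho> - \<rho>'\<bar>))"
  proof (rule mult_left_mono[OF _ assms(3)])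
    have "\<bar>?r - ?r'\<bar> \<le> \<bar>\<rho> - \<rho>'\<bar>" by (auto simp: max_def)
    moreover have "\<bar>(x - ?r) - (x' - ?r')\<bar> \<le> \<bar>x - x'\<bar> + \<bar>?r - ?r'\<bar>"
      using abs_triangle_ineq4[of "x - x'" "?r - ?r'"] by (simp only: diff_diff_eq2 diff_diff_eq) (simp add: algebra_simps)
    moreover have "\<bar>(x + ?r) - (x' + ?r')\<bar> \<le> \<bar>x - x'\<bar> + \<bar>?r - ?r'\<bar>"
      using abs_triangle_ineq[of "x - x'" "?r - ?r'"] by (simp only: diff_add_eq add_diff_eq) (simp add: algebra_simps)
    ultimately have "\<bar>(x - ?r) - (x' - ?r')\<bar> \<le> \<bar>x - x'\<bar> + \<bar>\<rho> - \<rho>'\<bar>" "\<bar>(x + ?r) - (x' + ?r')\<bar> \<le> \<bar>x - x'\<bar> + \<bar>\<rho> - \<rho>'\<bar>"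
      by (meson add_left_mono order_trans)+
    from add_mono[OF this] show "\<bar>(x - ?r) - (x' - ?r')\<bar> + \<bar>(x + ?r) - (x' + ?r')\<bar> \<le> 2 * (\<bar>x - x'\<bar> + \<bar>\<rho> - \<rho>'\<bar>)"
      by (simp only: mult_2)
  qed
  finally show ?thesis by (simp only: mult.assoc mult.left_commute[of B 2])
qed

lemma ball_int_bound:
  assumes "\<phi> \<in> borel_measurable borel" "AE y in lborel. \<bar>\<phi> y\<bar> \<le> B" "B \<ge> 0" "\<rho> \<le> R" "R \<ge> 0"
  shows "\<bar>ball_int x \<rho> \<phi>\<bar> \<le> 2 * R * B"
proof -
  have "\<bar>ball_int x (max 0 \<rho>) \<phi> - ball_int x 0 \<phi>\<bar> \<le> 2 * B * (\<bar>x - x\<bar> + \<bar>max 0 \<rho> - 0\<bar>)"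
    by (rule ball_int_diff[OF assms(1-3)])
  also have "\<dots> \<le> 2 * B * R" using assms(3-5) by (intro mult_left_mono) auto
  finally show ?thesis using ball_int_nonpos[of 0 x \<phi>] by (simp add: ball_int_max[of x \<rho>, symmetric] mult_ac)
qed

lemma ball_int_diff_fun:
  assumes "\<phi> \<in> borel_measurable borel" "AE y in lborel. \<bar>\<phi> y\<bar> \<le> B"
    "\<psi> \<in> borel_measurable borel" "AE y in lborel. \<bar>\<psi> y\<bar> \<le> B"
    and D: "AE y in lborel. \<bar>\<phi> y - \<psi> y\<bar> \<le> D" "D \<ge> 0" and "\<rho> \<le> R" "R \<ge> 0"
  shows "\<bar>ball_int x \<rho> \<phi> - ball_int x \<rho> \<psi>\<bar> \<le> 2 * R * D"
proof -
  have "ball_int x \<rho> \<phi> - ball_int x \<rho> \<psi> = ball_int x \<rho> (\<lambda>y. \<phi> y - \<psi> y)"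
    unfolding ball_int_def
    by (rule set_integral_diff(2)[symmetric])
       (rule set_integrable_Icc[OF assms(1,2)] set_integrable_Icc[OF assms(3,4)])+
  then show ?thesis using assms by (simp add: ball_int_bound)
qed

lemma abs_le_powr:
  assumes "\<bar>z::real\<bar> \<le> 1" "0 < \<beta>" "\<beta> \<le> 1" shows "\<bar>z\<bar> \<le> \<bar>z\<bar> powr \<beta>"
proof (cases "z = 0")
  case False
  have "\<bar>z\<bar> powr 1 \<le> \<bar>z\<bar> powr \<beta>" using assms False by (intro powr_mono') auto
  then show ?thesis using False by simp
qed simp

lemma ip_ebasis_bound:
  assumes "bdd_meas f" "\<And>x. x \<in> {0<..1} \<Longrightarrow> \<bar>f x\<bar> \<le> D" "D \<ge> 0"
  shows "\<bar>fcoef f k\<bar> \<le> 2 * D"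
proof -
  have "\<bar>fcoef f k\<bar> \<le> (\<integral>x. \<bar>f x * ebasis k x\<bar> \<partial>unit_leb)"
    unfolding fcoef_def ip_def by (rule integral_abs_bound)
  also have "\<dots> \<le> (\<integral>x. D * 2 \<partial>unit_leb)"
  proof (rule integral_mono)
    show "integrable unit_leb (\<lambda>x. \<bar>f x * ebasis k x\<bar>)"
      by (intro integrable_abs bdd_meas_integrable bdd_meas_mult assms bdd_meas_ebasis)
    show "\<bar>f x * ebasis k x\<bar> \<le> D * 2" if "x \<in> space unit_leb" for x
      unfolding abs_mult using assms(2)[of x] that assms(3) by (intro mult_mono abs_ebasis_le) auto
  qed simp
  finally show ?thesis by (simp add: unit_leb.prob_space[simplified])
qed

locale wave_kernel =
  fixes a :: real and \<sigma> :: "real \<Rightarrow> real \<Rightarrow> real" and B L \<beta> :: real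
  assumes a: "a > 0" and \<beta>: "1 / 2 < \<beta>" "\<beta> \<le> 1" and B: "B \<ge> 0" and L: "L \<ge> 0"
    and \<sigma>_bound: "\<And>s y. s \<in> {0..1} \<Longrightarrow> \<bar>\<sigma> s y\<bar> \<le> B"
    and \<sigma>_hoelder: "\<And>s s' y y'. s \<in> {0..1} \<Longrightarrow> s' \<in> {0..1} \<Longrightarrow>
      \<bar>\<sigma> s y - \<sigma> s' y'\<bar> \<le> L * (\<bar>s - s'\<bar> powr \<beta> + \<bar>y - y'\<bar> powr \<beta>)"
begin

definition kern :: "real \<Rightarrow> real \<Rightarrow> real \<Rightarrow> real" where
  "kern t x s = ball_int x (a * (t - s)) (\<sigma> s)"

lemma \<sigma>_measurable: assumes "s \<in> {0..1}" shows "\<sigma> s \<in> borel_measurable borel"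
proof (rule borel_measurable_continuous_onI, rule hoelder_imp_continuous)
  show "\<bar>\<sigma> s y - \<sigma> s y'\<bar> \<le> L * \<bar>y - y'\<bar> powr \<beta>" for y y'
    using \<sigma>_hoelder[OF assms assms, of y y'] by simp
qed (use \<beta> in simp)

lemma \<sigma>_AE: "s \<in> {0..1} \<Longrightarrow> AE y in lborel. \<bar>\<sigma> s y\<bar> \<le> B"
  using \<sigma>_bound by (intro AE_I2)

lemma kern_zero: "t \<le> s \<Longrightarrow> kern t x s = 0"
  unfolding kern_def using a by (intro ball_int_nonpos) (simp add: mult_nonneg_nonpos)

lemma kern_bound: assumes "s \<in> {0..1}" "t \<in> {0..1}" shows "\<bar>kern t x s\<bar> \<le> 2 * a * B"
proof -
  have "a * (t - s) \<le> a * 1" using assms a by (intro mult_left_mono) auto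
  then show ?thesis unfolding kern_def
    using a by (intro ball_int_bound \<sigma>_measurable \<sigma>_AE assms B) auto
qed

lemma kern_diff_tx: assumes "s \<in> {0..1}"
  shows "\<bar>kern t x s - kern t' x' s\<bar> \<le> 2 * B * (\<bar>x - x'\<bar> + a * \<bar>t - t'\<bar>)"
proof -
  have "a * (t - s) - a * (t' - s) = a * (t - t')" by (simp add: algebra_simps)
  then have "\<bar>a * (t - s) - a * (t' - s)\<bar> = a * \<bar>t - t'\<bar>" using a by (simp add: abs_mult)
  then show ?thesis unfolding kern_def
    using ball_int_diff[OF \<sigma>_measurable[OF assms] \<sigma>_AE[OF assms] B, of x "a * (t - s)" x' "a * (t' - s)"] by simp
qed

text \<open>
  Moving \<open>s\<close> moves the interval of integration, at a cost that is linear in \<open>\<bar>s - s'\<bar>\<close>, and the integrand,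
  which is Hoelder continuous.
\<close>

lemma kern_diff_s:
  assumes s: "s \<in> {0..1}" and s': "s' \<in> {0..1}" and t: "t \<in> {0..1}"
  shows "\<bar>kern t x s - kern t x s'\<bar> \<le> (2 * a * B + 2 * a * L) * \<bar>s - s'\<bar> powr \<beta>"
proof -
  have le1: "\<bar>s - s'\<bar> \<le> \<bar>s - s'\<bar> powr \<beta>" using s s' \<beta> by (intro abs_le_powr) auto
  have "a * (t - s) - a * (t - s') = a * (s' - s)" by (simp add: algebra_simps)
  then have e: "\<bar>a * (t - s) - a * (t - s')\<bar> = a * \<bar>s - s'\<bar>" using a by (simp add: abs_mult abs_minus_commute)
  have "\<bar>ball_int x (a * (t - s)) (\<sigma> s) - ball_int x (a * (t - s')) (\<sigma> s)\<bar> \<le> 2 * B * (\<bar>x - x\<bar> + \<bar>a * (t - s) - a * (t - s')\<bar>)"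
    by (intro ball_int_diff \<sigma>_measurable \<sigma>_AE s B)
  also have "\<dots> = 2 * a * B * \<bar>s - s'\<bar>" unfolding e by simp
  also have "\<dots> \<le> 2 * a * B * \<bar>s - s'\<bar> powr \<beta>" using le1 a B by (intro mult_left_mono) auto
  finally have 1: "\<bar>ball_int x (a * (t - s)) (\<sigma> s) - ball_int x (a * (t - s')) (\<sigma> s)\<bar> \<le> 2 * a * B * \<bar>s - s'\<bar> powr \<beta>" .
  have 2: "\<bar>ball_int x (a * (t - s')) (\<sigma> s) - ball_int x (a * (t - s')) (\<sigma> s')\<bar> \<le> 2 * a * (L * \<bar>s - s'\<bar> powr \<beta>)"
  proof (rule ball_int_diff_fun[OF \<sigma>_measurable[OF s] \<sigma>_AE[OF s] \<sigma>_measurable[OF s'] \<sigma>_AE[OF s']])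
    show "AE y in lborel. \<bar>\<sigma> s y - \<sigma> s' y\<bar> \<le> L * \<bar>s - s'\<bar> powr \<beta>"
      using \<sigma>_hoelder[OF s s', of y y for y] by (intro AE_I2) simp
    have "a * (t - s') \<le> a * 1" using s' t a by (intro mult_left_mono) auto
    then show "a * (t - s') \<le> a" by simp
  qed (use a L in auto)
  show ?thesis unfolding kern_def using 1 2 by (simp add: algebra_simps)
qed

lemma kern_continuous: assumes t: "t \<in> {0..1}" shows "continuous_on {0..1} (kern t x)"
proof -
  define k where "k = (\<lambda>s. kern t x (max 0 (min 1 s)))"
  have "continuous_on UNIV k"
  proof (rule hoelder_imp_continuous)
    fix s s' :: real
    have "\<bar>k s - k s'\<bar> \<le> (2 * a * B + 2 * a * L) * \<bar>max 0 (min 1 s) - max 0 (min 1 s')\<bar> powr \<beta>"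
      unfolding k_def by (rule kern_diff_s[OF _ _ t]) auto
    also have "\<dots> \<le> (2 * a * B + 2 * a * L) * \<bar>s - s'\<bar> powr \<beta>"
      using a B L \<beta> by (intro mult_left_mono powr_mono2) auto
    finally show "\<bar>k s - k s'\<bar> \<le> (2 * a * B + 2 * a * L) * \<bar>s - s'\<bar> powr \<beta>" .
  qed (use \<beta> in simp)
  then have "continuous_on {0..1} k" by (rule continuous_on_subset) simp
  then show ?thesis by (rule continuous_on_eq) (simp add: k_def)
qed

lemma bdd_meas_kern: "t \<in> {0..1} \<Longrightarrow> bdd_meas (kern t x)"
  by (intro bdd_meas_continuous kern_continuous)

text \<open>
  The kernel vanishes at \<open>1\<close> but in general not at \<open>0\<close>. As a function on the circle it has a jump, which
  a multiple of this function removes. The multiple depends on \<open>(t,x)\<close>, the function does not.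
\<close>

definition ramp :: "real \<Rightarrow> real" where "ramp s = 1 - s"

lemma ramp_continuous: "continuous_on S ramp" unfolding ramp_def[abs_def] by (intro continuous_intros)

lemma bdd_meas_ramp: "bdd_meas ramp" by (intro bdd_meas_continuous ramp_continuous)

definition hkern :: "real \<Rightarrow> real \<Rightarrow> real \<Rightarrow> real" where
  "hkern t x s = kern t x s - kern t x 0 * ramp s"

lemma kern_decomp: "kern t x = (\<lambda>s. kern t x 0 * ramp s + 1 * hkern t x s)"
  by (simp add: hkern_def)

lemma hkern_continuous: "t \<in> {0..1} \<Longrightarrow> continuous_on {0..1} (hkern t x)"
  unfolding hkern_def[abs_def] by (intro continuous_intros kern_continuous ramp_continuous)

lemma bdd_meas_hkern: "t \<in> {0..1} \<Longrightarrow> bdd_meas (hkern t x)"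
  by (intro bdd_meas_continuous hkern_continuous)

lemma hkern_hoelder:
  assumes t: "t \<in> {0..1}" shows "hoelder0 (4 * a * B + 2 * a * L) \<beta> (hkern t x)"
  unfolding hoelder0_def
proof (intro conjI ballI)
  show "0 \<le> 4 * a * B + 2 * a * L" using a B L by simp
  show "hkern t x 0 = 0" by (simp add: hkern_def ramp_def)
  show "hkern t x 1 = 0" using kern_zero[of t 1 x] t by (simp add: hkern_def ramp_def)
  fix s s' :: real assume s: "s \<in> {0..1}" and s': "s' \<in> {0..1}"
  have "\<bar>hkern t x s - hkern t x s'\<bar> \<le> \<bar>kern t x s - kern t x s'\<bar> + \<bar>kern t x 0 * (s - s')\<bar>"
    by (simp add: hkern_def ramp_def algebra_simps)
  also have "\<bar>kern t x 0 * (s - s')\<bar> \<le> 2 * a * B * \<bar>s - s'\<bar> powr \<beta>"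
    unfolding abs_mult using a B s s' \<beta> by (intro mult_mono kern_bound abs_le_powr t) auto
  finally show "\<bar>hkern t x s - hkern t x s'\<bar> \<le> (4 * a * B + 2 * a * L) * \<bar>s - s'\<bar> powr \<beta>"
    using kern_diff_s[OF s s' t, of x] by (simp add: algebra_simps)
qed

lemma fcoef_kern: "t \<in> {0..1} \<Longrightarrow> fcoef (kern t x) k = kern t x 0 * fcoef ramp k + fcoef (hkern t x) k"
proof -
  assume t: "t \<in> {0..1}"
  have "fcoef (\<lambda>s. kern t x 0 * ramp s + 1 * hkern t x s) k = fcoef (\<lambda>s. kern t x 0 * ramp s) k + fcoef (\<lambda>s. 1 * hkern t x s) k"
    by (intro fcoef_add bdd_meas_mult bdd_meas_const bdd_meas_ramp bdd_meas_hkern t)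
  then show ?thesis unfolding kern_decomp[symmetric] by (simp add: fcoef_cmult)
qed

lemma lipschitz_imp_continuous:
  fixes g :: "real \<Rightarrow> real \<Rightarrow> real"
  assumes "\<And>t x t' x'. t \<in> {0..1} \<Longrightarrow> t' \<in> {0..1} \<Longrightarrow> \<bar>g t x - g t' x'\<bar> \<le> C * (\<bar>x - x'\<bar> + a * \<bar>t - t'\<bar>)"
  shows "continuous_on ({0..1} \<times> UNIV) (\<lambda>(t, x). g t x)"
proof -
  have "((\<lambda>(t, x). g t x) \<longlongrightarrow> (\<lambda>(t, x). g t x) p) (at p within {0..1} \<times> UNIV)" if p: "p \<in> {0..1} \<times> UNIV" for p
  proof (rule Lim_null[THEN iffD2], rule Lim_null_comparison)
    show "\<forall>\<^sub>F q in at p within {0..1} \<times> UNIV. norm ((\<lambda>(t, x). g t x) q - (\<lambda>(t, x). g t x) p) \<le>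
       C * (\<bar>snd q - snd p\<bar> + a * \<bar>fst q - fst p\<bar>)"
      unfolding eventually_at_filter using assms p by (intro always_eventually) (auto simp: case_prod_beta')
    have "((\<lambda>q. C * (\<bar>snd q - snd p\<bar> + a * \<bar>fst q - fst p\<bar>)) \<longlongrightarrow> C * (\<bar>snd p - snd p\<bar> + a * \<bar>fst p - fst p\<bar>)) (at p within {0..1} \<times> UNIV)"
      by (intro tendsto_intros)
    then show "((\<lambda>q. C * (\<bar>snd q - snd p\<bar> + a * \<bar>fst q - fst p\<bar>)) \<longlongrightarrow> 0) (at p within {0..1} \<times> UNIV)" by simp
  qed
  then show ?thesis by (simp add: continuous_on_def)
qed

lemma kern_continuous_tx: "s \<in> {0..1} \<Longrightarrow> continuous_on ({0..1} \<times> UNIV) (\<lambda>(t, x). kern t x s)"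
  by (rule lipschitz_imp_continuous) (rule kern_diff_tx)

lemma fcoef_hkern_continuous: "continuous_on ({0..1} \<times> UNIV) (\<lambda>(t, x). fcoef (hkern t x) k)"
proof (rule lipschitz_imp_continuous)
  fix t x t' x' :: real assume t: "t \<in> {0..1}" and t': "t' \<in> {0..1}"
  let ?D = "2 * (2 * B * (\<bar>x - x'\<bar> + a * \<bar>t - t'\<bar>))"
  have "fcoef (hkern t x) k - fcoef (hkern t' x') k = fcoef (\<lambda>s. hkern t x s - hkern t' x' s) k"
    unfolding fcoef_def by (intro ip_diff_left[symmetric] bdd_meas_hkern t t' bdd_meas_ebasis)
  moreover have "\<bar>fcoef (\<lambda>s. hkern t x s - hkern t' x' s) k\<bar> \<le> 2 * ?D"
  proof (rule ip_ebasis_bound)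
    fix s :: real assume s: "s \<in> {0<..1}"
    have "\<bar>(kern t x 0 - kern t' x' 0) * ramp s\<bar> \<le> 2 * B * (\<bar>x - x'\<bar> + a * \<bar>t - t'\<bar>) * 1"
      unfolding abs_mult using s B a by (intro mult_mono kern_diff_tx) (auto simp: ramp_def)
    moreover have "\<bar>kern t x s - kern t' x' s\<bar> \<le> 2 * B * (\<bar>x - x'\<bar> + a * \<bar>t - t'\<bar>)"
      using s by (intro kern_diff_tx) auto
    moreover have "hkern t x s - hkern t' x' s = (kern t x s - kern t' x' s) - (kern t x 0 - kern t' x' 0) * ramp s"
      by (simp add: hkern_def algebra_simps)
    ultimately show "\<bar>hkern t x s - hkern t' x' s\<bar> \<le> ?D" by linarith
  qed (use a B in \<open>auto intro: bdd_meas_hkern t t'\<close>)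
  ultimately show "\<bar>fcoef (hkern t x) k - fcoef (hkern t' x') k\<bar> \<le> 8 * B * (\<bar>x - x'\<bar> + a * \<bar>t - t'\<bar>)"
    by simp
qed

end

section \<open>The error of the noise term\<close>

locale wave_noise = L2_stoch_measure M \<mu> r + wave_kernel a \<sigma> B L \<beta>
  for M :: "'w measure" and \<mu> r a \<sigma> B L \<beta> +
  assumes r_less: "r < 2 * \<beta>"
begin

lemma hkern_weighted:
  obtains K where "K \<ge> 0" "\<And>t x F. t \<in> {0..1} \<Longrightarrow> finite F \<Longrightarrow> 0 \<notin> F \<Longrightarrow>
    (\<Sum>k\<in>F. \<bar>of_int k\<bar> powr r * (fcoef (hkern t x) k)\<^sup>2) \<le> K\<^sup>2"
proof -
  have "\<beta> > 0" "r \<ge> 0" using \<beta> r by auto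
  then obtain C where C: "C \<ge> 0" "\<And>H g F. hoelder0 H \<beta> g \<Longrightarrow> finite F \<Longrightarrow> 0 \<notin> F \<Longrightarrow>
     (\<Sum>k\<in>F. \<bar>of_int k\<bar> powr r * (fcoef g k)\<^sup>2) \<le> C * H\<^sup>2"
    using hoelder_coefficients_weighted[of \<beta> r] r_less by blast
  define H where "H = 4 * a * B + 2 * a * L"
  show ?thesis
  proof (rule that[of "sqrt (C * H\<^sup>2)"])
    show "(\<Sum>k\<in>F. \<bar>of_int k\<bar> powr r * (fcoef (hkern t x) k)\<^sup>2) \<le> (sqrt (C * H\<^sup>2))\<^sup>2"
      if "t \<in> {0..1}" "finite F" "0 \<notin> F" for t x F
      using C(2)[OF hkern_hoelder[OF that(1)] that(2,3), of x] C(1) by (simp add: H_def)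
  qed (use C(1) in simp)
qed

definition ramp_error :: "nat \<Rightarrow> 'w \<Rightarrow> real" where
  "ramp_error j \<omega> = pseries j (fcoef ramp) \<omega> - sI ramp \<omega>"

text \<open>
  The error of the noise term, with representatives chosen simultaneously for all \<open>(t,x)\<close>.
\<close>

definition noise_error :: "nat \<Rightarrow> real \<Rightarrow> real \<Rightarrow> 'w \<Rightarrow> real" where
  "noise_error j t x \<omega> = kern t x 0 * ramp_error j \<omega> +
     (pseries j (fcoef (hkern t x)) \<omega> - series (fcoef (hkern t x)) \<omega>)"

lemma ramp_error_measurable [measurable]: "ramp_error j \<in> borel_measurable M"
  unfolding ramp_error_def[abs_def] using sI_measurable[OF bdd_meas_ramp] by measurable

lemma ramp_error_tendsto: "(\<lambda>j. prob_norm M (ramp_error j)) \<longlonglongrightarrow> 0"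
  unfolding ramp_error_def[abs_def] by (rule sI_fpart_tendsto[OF ramp_continuous]) (simp add: ramp_def)

lemma noise_error_eq:
  assumes t: "t \<in> {0..1}"
  shows "AE \<omega> in M. fourier_noise_term M a \<mu> \<sigma> j t x \<omega> - noise_term M a \<mu> \<sigma> t x \<omega> = noise_error j t x \<omega>"
proof -
  have bk: "bdd_meas (kern t x)" and bh: "bdd_meas (hkern t x)" using t by (auto intro: bdd_meas_kern bdd_meas_hkern)
  have A: "{0<..t} \<in> sets unit_borel"
  proof -
    have "{0<..t} = {0<..1} \<inter> {0<..t}" using t by auto
    then show ?thesis unfolding sets_restrict_space by (rule image_eqI) simp
  qed
  have "AE \<omega> in M. sint (space unit_borel) (kern t x) \<omega> = sint {0<..t} (kern t x) \<omega>"
    by (rule sint_support[OF bdd_meas_sm_integrable[OF bk] A]) (auto simp: space_restrict_space intro: kern_zero)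
  then have 1: "AE \<omega> in M. sI (kern t x) \<omega> = noise_term M a \<mu> \<sigma> t x \<omega>"
    by (simp add: space_restrict_space noise_term_def kern_def[abs_def] ball_int_def)
  have 2: "AE \<omega> in M. sI (kern t x) \<omega> = kern t x 0 * sI ramp \<omega> + 1 * sI (hkern t x) \<omega>"
    by (subst kern_decomp) (intro sint_linear bdd_meas_sm_integrable bdd_meas_ramp bh unit_set)
  obtain K where K: "K \<ge> 0" "\<And>t x F. t \<in> {0..1} \<Longrightarrow> finite F \<Longrightarrow> 0 \<notin> F \<Longrightarrow>
    (\<Sum>k\<in>F. \<bar>of_int k\<bar> powr r * (fcoef (hkern t x) k)\<^sup>2) \<le> K\<^sup>2" by (rule hkern_weighted) blast
  have 3: "AE \<omega> in M. sI (hkern t x) \<omega> = series (fcoef (hkern t x)) \<omega>"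
    by (rule sI_eq_series[OF hkern_continuous[OF t] _ K(2)[OF t] K(1)])
       (use hkern_hoelder[OF t, of x] in \<open>auto simp: hoelder0_def\<close>)
  have 4: "AE \<omega> in M. fourier_noise_term M a \<mu> \<sigma> j t x \<omega> = pseries j (fcoef (kern t x)) \<omega>"
    using fourier_partial_sum_eq[of j]
  proof eventually_elim
    case (elim \<omega>)
    let ?S = "trig_sum {- int j..int j} (\<lambda>k. zeta k \<omega>)"
    have S: "Re (fourier_partial_sum M \<mu> j s \<omega>) = ?S s" for s
      using elim by (simp add: trig_sum_def)
    have "fourier_noise_term M a \<mu> \<sigma> j t x \<omega> = (LINT s:{0<..t}|lborel. ?S s * kern t x s)"
      unfolding fourier_noise_term_def S kern_def ball_int_def ..
    also have "\<dots> = (LINT s:{0<..1}|lborel. ?S s * kern t x s)"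
      unfolding set_lebesgue_integral_def
    proof (rule Bochner_Integration.integral_cong[OF refl])
      fix s :: real
      show "indicator {0<..t} s *\<^sub>R (?S s * kern t x s) = indicator {0<..1} s *\<^sub>R (?S s * kern t x s)"
        using t kern_zero[of t s x] by (cases "s \<le> t") (auto simp: indicator_def)
    qed
    also have "\<dots> = ip (kern t x) ?S" by (simp add: set_integral_unit_leb ip_def mult.commute)
    also have "\<dots> = pseries j (fcoef (kern t x)) \<omega>"
      by (simp add: ip_trig_sum_right[OF _ bk] pseries_def mult.commute)
    finally show ?case .
  qed
  show ?thesis using 1 2 3 4
  proof eventually_elim
    case (elim \<omega>)
    have "pseries j (fcoef (kern t x)) \<omega> = kern t x 0 * pseries j (fcoef ramp) \<omega> + pseries j (fcoef (hkern t x)) \<omega>"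
      unfolding pseries_def by (simp add: fcoef_kern[OF t] distrib_right sum.distrib sum_distrib_left mult.assoc)
    then show ?case using elim by (simp add: noise_error_def ramp_error_def algebra_simps)
  qed
qed

text \<open>
  The kernels have Fourier coefficients with a common bound for the weighted sums of squares, so the
  error of the series is at most a constant times \<open>tail j\<close>; the error for \<open>ramp\<close> is a single random
  variable.
\<close>

lemma noise_error_bound:
  obtains \<eta> where "\<And>j. \<eta> j \<in> borel_measurable M" "(\<lambda>j. prob_norm M (\<eta> j)) \<longlonglongrightarrow> 0"
    "\<And>j t x \<omega>. t \<in> {0..1} \<Longrightarrow> \<bar>noise_error j t x \<omega>\<bar> \<le> \<eta> j \<omega>"
proof -
  obtain K where K: "K \<ge> 0" "\<And>t x F. t \<in> {0..1} \<Longrightarrow> finite F \<Longrightarrow> 0 \<notin> F \<Longrightarrow>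
    (\<Sum>k\<in>F. \<bar>of_int k\<bar> powr r * (fcoef (hkern t x) k)\<^sup>2) \<le> K\<^sup>2" by (rule hkern_weighted) blast
  define \<eta> where "\<eta> = (\<lambda>j \<omega>. (2 * a * B) * \<bar>ramp_error j \<omega>\<bar> + K * tail j \<omega>)"
  show ?thesis
  proof (rule that[of \<eta>])
    show "\<eta> j \<in> borel_measurable M" for j unfolding \<eta>_def by measurable
    have "(\<lambda>j. prob_norm M (\<lambda>\<omega>. tail j \<omega> - 0)) \<longlonglongrightarrow> 0"
      by (rule prob_norm_tendsto_0_AE) (use tail_tendsto in auto)
    then have t0: "tendsto_in_prob M tail (\<lambda>_. 0)" by (simp add: tendsto_in_prob_iff)
    have "prob_norm M (\<lambda>\<omega>. \<bar>ramp_error j \<omega>\<bar>) = prob_norm M (ramp_error j)" for j by (simp add: prob_norm_def)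
    then have r0: "tendsto_in_prob M (\<lambda>j \<omega>. \<bar>ramp_error j \<omega>\<bar>) (\<lambda>_. 0)"
      using ramp_error_tendsto by (simp add: tendsto_in_prob_iff)
    have "tendsto_in_prob M \<eta> (\<lambda>\<omega>. (2 * a * B) * 0 + K * 0)"
      unfolding \<eta>_def by (intro tendsto_in_prob_add tendsto_in_prob_cmult t0 r0)
    then show "(\<lambda>j. prob_norm M (\<eta> j)) \<longlonglongrightarrow> 0" by (simp add: tendsto_in_prob_iff)
    fix j t x \<omega> assume t: "t \<in> {0..1::real}"
    have "\<bar>kern t x 0 * ramp_error j \<omega>\<bar> \<le> (2 * a * B) * \<bar>ramp_error j \<omega>\<bar>"
      unfolding abs_mult by (intro mult_right_mono kern_bound t) auto
    moreover have "\<bar>series (fcoef (hkern t x)) \<omega> - pseries j (fcoef (hkern t x)) \<omega>\<bar> \<le> K * tail j \<omega>"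
      by (rule pseries_tendsto(2)[OF K(2)[OF t] K(1)])
    ultimately show "\<bar>noise_error j t x \<omega>\<bar> \<le> \<eta> j \<omega>" unfolding noise_error_def \<eta>_def by linarith
  qed
qed

lemma pseries_hkern_continuous: "continuous_on ({0..1} \<times> UNIV) (\<lambda>(t, x). pseries j (fcoef (hkern t x)) \<omega>)"
  unfolding pseries_def case_prod_beta'
  by (intro continuous_on_sum continuous_on_mult continuous_on_const fcoef_hkern_continuous[unfolded case_prod_beta'])

lemma series_hkern_uniform:
  "uniform_limit ({0..1} \<times> UNIV) (\<lambda>j (t, x). pseries j (fcoef (hkern t x)) \<omega>) (\<lambda>(t, x). series (fcoef (hkern t x)) \<omega>) sequentially"
proof (rule uniform_limitI)
  fix e :: real assume e: "e > 0"
  obtain K where K: "K \<ge> 0" "\<And>t x F. t \<in> {0..1} \<Longrightarrow> finite F \<Longrightarrow> 0 \<notin> F \<Longrightarrow>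
    (\<Sum>k\<in>F. \<bar>of_int k\<bar> powr r * (fcoef (hkern t x) k)\<^sup>2) \<le> K\<^sup>2" by (rule hkern_weighted) blast
  have "(\<lambda>j. K * tail j \<omega>) \<longlonglongrightarrow> K * 0" by (intro tendsto_mult_left tail_tendsto)
  then have "\<forall>\<^sub>F j in sequentially. K * tail j \<omega> < e" using e by (intro order_tendstoD(2)) auto
  then show "\<forall>\<^sub>F j in sequentially. \<forall>p\<in>{0..1} \<times> UNIV.
     dist ((\<lambda>(t, x). pseries j (fcoef (hkern t x)) \<omega>) p) ((\<lambda>(t, x). series (fcoef (hkern t x)) \<omega>) p) < e"
  proof eventually_elim
    case (elim j)
    show ?case
    proof (rule ballI, clarify)
      fix t x :: real assume t: "t \<in> {0..1}"
      have "\<bar>series (fcoef (hkern t x)) \<omega> - pseries j (fcoef (hkern t x)) \<omega>\<bar> \<le> K * tail j \<omega>"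
        by (rule pseries_tendsto(2)[OF K(2)[OF t] K(1)])
      then show "dist (pseries j (fcoef (hkern t x)) \<omega>) (series (fcoef (hkern t x)) \<omega>) < e"
        using elim by (simp add: dist_real_def abs_minus_commute)
    qed
  qed
qed

lemma noise_error_continuous: "continuous_on ({0..1} \<times> UNIV) (\<lambda>(t, x). noise_error j t x \<omega>)"
proof -
  have s: "continuous_on ({0..1} \<times> UNIV) (\<lambda>(t, x). series (fcoef (hkern t x)) \<omega>)"
    by (rule uniform_limit_theorem[OF _ series_hkern_uniform]) (simp_all add: pseries_hkern_continuous)
  have k: "continuous_on ({0..1} \<times> UNIV) (\<lambda>(t, x). kern t x 0)" by (rule kern_continuous_tx) simp
  show ?thesis
    unfolding noise_error_def case_prod_beta'
    by (intro continuous_on_add continuous_on_diff continuous_on_mult continuous_on_const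
        k[unfolded case_prod_beta'] s[unfolded case_prod_beta'] pseries_hkern_continuous[unfolded case_prod_beta'])
qed

lemma noise_error_measurable:
  "(\<lambda>((t, x), \<omega>). noise_error j t x \<omega>) \<in> borel_measurable (restrict_space borel ({0..1} \<times> UNIV) \<Otimes>\<^sub>M M)"
proof -
  let ?N = "restrict_space borel ({0..1::real} \<times> (UNIV :: real set))"
  have c: "(\<lambda>p. g (fst p)) \<in> borel_measurable (?N \<Otimes>\<^sub>M M)" if "continuous_on ({0..1} \<times> UNIV) g" for g :: "real \<times> real \<Rightarrow> real"
    by (rule measurable_compose[OF measurable_fst]) (rule borel_measurable_continuous_on_restrict[OF that])
  have z: "(\<lambda>p. Z (snd p)) \<in> borel_measurable (?N \<Otimes>\<^sub>M M)" if "Z \<in> borel_measurable M" for Z :: "'w \<Rightarrow> real"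
    by (rule measurable_compose[OF measurable_snd that])
  have ps: "(\<lambda>p. pseries n (fcoef (hkern (fst (fst p)) (snd (fst p)))) (snd p)) \<in> borel_measurable (?N \<Otimes>\<^sub>M M)" for n
    unfolding pseries_def
    by (intro borel_measurable_sum borel_measurable_times z[OF zeta_measurable]
        c[OF fcoef_hkern_continuous[unfolded case_prod_beta']])
  have se: "(\<lambda>p. series (fcoef (hkern (fst (fst p)) (snd (fst p)))) (snd p)) \<in> borel_measurable (?N \<Otimes>\<^sub>M M)"
  proof (rule borel_measurable_LIMSEQ_metric[OF ps])
    fix p assume "p \<in> space (?N \<Otimes>\<^sub>M M)"
    then have t: "fst (fst p) \<in> {0..1}" by (auto simp: space_pair_measure space_restrict_space)
    obtain K where K: "K \<ge> 0" "\<And>t x F. t \<in> {0..1} \<Longrightarrow> finite F \<Longrightarrow> 0 \<notin> F \<Longrightarrow>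
      (\<Sum>k\<in>F. \<bar>of_int k\<bar> powr r * (fcoef (hkern t x) k)\<^sup>2) \<le> K\<^sup>2" by (rule hkern_weighted) blast
    show "(\<lambda>n. pseries n (fcoef (hkern (fst (fst p)) (snd (fst p)))) (snd p)) \<longlonglongrightarrow>
       series (fcoef (hkern (fst (fst p)) (snd (fst p)))) (snd p)"
      by (rule pseries_tendsto(1)[OF K(2)[OF t] K(1)])
  qed
  have k: "continuous_on ({0..1} \<times> UNIV) (\<lambda>(t, x). kern t x 0)" by (rule kern_continuous_tx) simp
  show ?thesis
    unfolding noise_error_def case_prod_beta'
    by (intro borel_measurable_add borel_measurable_diff borel_measurable_times ps se
        c[OF k[unfolded case_prod_beta']] z[OF ramp_error_measurable])
qed

end

section \<open>The wave equation with a Lipschitz source\<close>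

text \<open>
  Functions given for times in the unit interval are extended constantly to the real line, so that
  they can be treated as measurable functions on all of the plane.
\<close>

definition unit_clamp :: "real \<Rightarrow> real" where "unit_clamp s = max 0 (min 1 s)"

lemma unit_clamp_in [simp]: "0 \<le> unit_clamp s" "unit_clamp s \<le> 1" by (simp_all add: unit_clamp_def)

lemma unit_clamp_ident: "s \<in> {0..1} \<Longrightarrow> unit_clamp s = s" by (simp add: unit_clamp_def)

lemma unit_clamp_measurable [measurable]: "unit_clamp \<in> borel_measurable borel"
  unfolding unit_clamp_def[abs_def] by measurable

lemma set_integral_diff_bound:
  fixes g h D :: "real \<Rightarrow> real"
  assumes "set_integrable lborel S g" "set_integrable lborel S h" "set_integrable lborel S D"
    and le: "AE s in lborel. s \<in> S \<longrightarrow> \<bar>g s - h s\<bar> \<le> D s"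
  shows "\<bar>(LINT s:S|lborel. g s) - (LINT s:S|lborel. h s)\<bar> \<le> (LINT s:S|lborel. D s)"
proof -
  have i: "set_integrable lborel S (\<lambda>s. g s - h s)" by (rule set_integral_diff(1)[OF assms(1,2)])
  have "\<bar>(LINT s:S|lborel. g s) - (LINT s:S|lborel. h s)\<bar> = \<bar>LINT s:S|lborel. g s - h s\<bar>"
    by (simp add: set_integral_diff(2)[OF assms(1,2)])
  also have "\<dots> \<le> (\<integral>s. \<bar>indicator S s *\<^sub>R (g s - h s)\<bar> \<partial>lborel)"
    unfolding set_lebesgue_integral_def by (rule integral_abs_bound)
  also have "\<dots> \<le> (LINT s:S|lborel. D s)"
    unfolding set_lebesgue_integral_def
  proof (rule integral_mono_AE)
    show "AE s in lborel. \<bar>indicator S s *\<^sub>R (g s - h s)\<bar> \<le> indicator S s *\<^sub>R D s"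
      using le by eventually_elim (simp add: indicator_def)
  qed (use i assms(3) in \<open>auto simp: set_integrable_def\<close>)
  finally show ?thesis .
qed

locale wave_source =
  fixes a :: real and f :: "real \<Rightarrow> real \<Rightarrow> real \<Rightarrow> real" and C \<Lambda> :: real
  assumes a: "a > 0" and C: "C \<ge> 0" and \<Lambda>: "\<Lambda> \<ge> 1"
    and f_bound: "\<And>s y v. s \<in> {0..1} \<Longrightarrow> \<bar>f s y v\<bar> \<le> C"
    and f_lipschitz: "\<And>s y v v'. s \<in> {0..1} \<Longrightarrow> \<bar>f s y v - f s y v'\<bar> \<le> \<Lambda> * \<bar>v - v'\<bar>"
begin

definition source :: "(real \<Rightarrow> real \<Rightarrow> real) \<Rightarrow> real \<Rightarrow> real \<Rightarrow> real" where
  "source u s y = f (unit_clamp s) y (u (unit_clamp s) y)"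

text \<open>
  The measurability that the integrals of \<open>f s y (u s y)\<close> require of \<open>u\<close>.
\<close>

definition admissible :: "(real \<Rightarrow> real \<Rightarrow> real) \<Rightarrow> bool" where
  "admissible u \<longleftrightarrow> (\<lambda>p. source u (fst p) (snd p)) \<in> borel_measurable borel"

definition cone_int :: "real \<Rightarrow> real \<Rightarrow> (real \<Rightarrow> real \<Rightarrow> real) \<Rightarrow> real" where
  "cone_int t x u = (LINT s:{0..t}|lborel. ball_int x (a * (t - s)) (\<lambda>y. f s y (u s y)))"

lemma source_bound: "\<bar>source u s y\<bar> \<le> C"
  unfolding source_def by (rule f_bound) simp

lemma source_AE: "AE y in lborel. \<bar>source u s y\<bar> \<le> C" by (intro AE_I2 source_bound)

lemma source_measurable: assumes "admissible u" shows "source u s \<in> borel_measurable borel"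
proof -
  have "(\<lambda>y::real. (s, y)) \<in> borel_measurable borel" by measurable
  from measurable_compose[OF this assms[unfolded admissible_def]] show ?thesis by simp
qed

lemma cone_int_source: "t \<in> {0..1} \<Longrightarrow> cone_int t x u = (LINT s:{0..t}|lborel. ball_int x (a * (t - s)) (source u s))"
  unfolding cone_int_def set_lebesgue_integral_def
  by (intro Bochner_Integration.integral_cong refl) (auto simp: indicator_def source_def[abs_def] unit_clamp_ident)

lemma cone_int_source_unit:
  assumes "t \<in> {0..1}"
  shows "cone_int t x u = (LINT s:{0..1}|lborel. ball_int x (a * (t - s)) (source u s))"
  unfolding cone_int_source[OF assms] set_lebesgue_integral_def
proof (rule Bochner_Integration.integral_cong[OF refl])
  fix s :: real
  have "ball_int x (a * (t - s)) (source u s) = 0" if "t \<le> s"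
    using that a by (intro ball_int_nonpos) (simp add: mult_nonneg_nonpos)
  then show "indicator {0..t} s *\<^sub>R ball_int x (a * (t - s)) (source u s) =
     indicator {0..1} s *\<^sub>R ball_int x (a * (t - s)) (source u s)"
    using assms by (cases "t \<le> s") (auto simp: indicator_def)
qed

lemma ball_int_source_measurable:
  assumes "admissible u"
  shows "(\<lambda>s. ball_int x (a * (t - s)) (source u s)) \<in> borel_measurable borel"
proof -
  have "(\<lambda>p. source u (fst p) (snd p)) \<in> borel_measurable (borel \<Otimes>\<^sub>M borel)"
    using assms by (simp add: admissible_def borel_prod)
  then have [measurable]: "(\<lambda>p. source u (fst p) (snd p)) \<in> borel_measurable (borel \<Otimes>\<^sub>M lborel)"
    by (subst measurable_cong_sets[OF sets_pair_measure_cong refl]) auto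
  have "(\<lambda>p. of_bool (x - a * (t - fst p) \<le> snd p \<and> snd p \<le> x + a * (t - fst p)) * source u (fst p) (snd p))
      \<in> borel_measurable (borel \<Otimes>\<^sub>M lborel)"
    by measurable
  then have "(\<lambda>s. \<integral>y. of_bool (x - a * (t - s) \<le> y \<and> y \<le> x + a * (t - s)) * source u s y \<partial>lborel) \<in> borel_measurable borel"
    by (intro lborel.borel_measurable_lebesgue_integral) (simp add: case_prod_beta')
  moreover have "(\<integral>y. of_bool (x - a * (t - s) \<le> y \<and> y \<le> x + a * (t - s)) * source u s y \<partial>lborel) =
      ball_int x (a * (t - s)) (source u s)" for s
    unfolding ball_int_def set_lebesgue_integral_def
    by (intro Bochner_Integration.integral_cong refl) (auto simp: indicator_def)
  ultimately show ?thesis by simp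
qed

lemma ball_int_source_bound:
  assumes "admissible u" "t \<in> {0..1}" "s \<in> {0..1}"
  shows "\<bar>ball_int x (a * (t - s)) (source u s)\<bar> \<le> 2 * a * C"
proof -
  have "a * (t - s) \<le> a * 1" using assms a by (intro mult_left_mono) auto
  then show ?thesis
    using a by (intro ball_int_bound source_measurable source_AE assms C) auto
qed

lemma set_integrable_ball_int_source:
  assumes u: "admissible u" and t: "t \<in> {0..1}" "t' \<in> {0..1}"
  shows "set_integrable lborel {0..t'} (\<lambda>s. ball_int x (a * (t - s)) (source u s))"
  unfolding set_integrable_def
proof (rule integrableI_bounded_set_indicator)
  show "AE s in lborel. s \<in> {0..t'} \<longrightarrow> norm (ball_int x (a * (t - s)) (source u s)) \<le> 2 * a * C"
    using ball_int_source_bound[OF u t(1)] t(2) by (intro AE_I2) auto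
qed (use ball_int_source_measurable[OF u] in \<open>auto simp: emeasure_lborel_Icc_eq\<close>)

lemma set_integrable_const_Icc: "set_integrable lborel {p..q} (\<lambda>_. c :: real)" for p q :: real
  by (rule set_integrable_Icc[where B="\<bar>c\<bar>"]) auto

lemma LINT_const_unit: "(LINT s:{0..1::real}|lborel. c :: real) = c"
  by (simp add: set_lebesgue_integral_def)

text \<open>
  Only the domain of integration depends on \<open>(t,x)\<close>, and the integrand is bounded.
\<close>

lemma cone_int_lipschitz:
  assumes u: "admissible u" and t: "t \<in> {0..1}" "t' \<in> {0..1}"
  shows "\<bar>cone_int t x u - cone_int t' x' u\<bar> \<le> 2 * C * (\<bar>x - x'\<bar> + a * \<bar>t - t'\<bar>)"
proof -
  have "\<bar>cone_int t x u - cone_int t' x' u\<bar> \<le> (LINT s:{0..1::real}|lborel. 2 * C * (\<bar>x - x'\<bar> + a * \<bar>t - t'\<bar>))"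
    unfolding cone_int_source_unit[OF t(1)] cone_int_source_unit[OF t(2)]
  proof (rule set_integral_diff_bound)
    show "AE s in lborel. s \<in> {0..1} \<longrightarrow> \<bar>ball_int x (a * (t - s)) (source u s) - ball_int x' (a * (t' - s)) (source u s)\<bar>
        \<le> 2 * C * (\<bar>x - x'\<bar> + a * \<bar>t - t'\<bar>)"
    proof (intro AE_I2 impI)
      fix s :: real
      have "a * (t - s) - a * (t' - s) = a * (t - t')" by (simp add: algebra_simps)
      then have "\<bar>a * (t - s) - a * (t' - s)\<bar> = a * \<bar>t - t'\<bar>" using a by (simp add: abs_mult)
      then show "\<bar>ball_int x (a * (t - s)) (source u s) - ball_int x' (a * (t' - s)) (source u s)\<bar>
          \<le> 2 * C * (\<bar>x - x'\<bar> + a * \<bar>t - t'\<bar>)"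
        using ball_int_diff[OF source_measurable[OF u] source_AE C, of x "a * (t - s)" s x' "a * (t' - s)"] by simp
    qed
  qed (intro set_integrable_ball_int_source set_integrable_const_Icc u t; simp)+
  then show ?thesis by (simp only: LINT_const_unit)
qed

lemma cone_int_bound:
  assumes u: "admissible u" and t: "t \<in> {0..1}"
  shows "\<bar>cone_int t x u\<bar> \<le> 2 * a * C"
proof -
  have "cone_int 0 x u = 0"
  proof -
    have "AE s in lborel. indicator {0..0::real} s *\<^sub>R ball_int x (a * (0 - s)) (\<lambda>y. f s y (u s y)) = 0"
      using AE_lborel_singleton[of 0] by eventually_elim (simp add: indicator_def)
    then show ?thesis unfolding cone_int_def set_lebesgue_integral_def by (rule integral_eq_zero_AE)
  qed
  then have "\<bar>cone_int t x u\<bar> \<le> 2 * C * (\<bar>x - x\<bar> + a * \<bar>t - 0\<bar>)"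
    using cone_int_lipschitz[OF u t, of 0 x x] by simp
  also have "\<dots> \<le> 2 * C * (a * 1)" using t a C by (intro mult_left_mono) auto
  finally show ?thesis by (simp add: mult_ac)
qed

lemma LINT_exp_le:
  fixes l t :: real
  assumes "l > 0" "t \<ge> 0"
  shows "(LINT s:{0..t}|lborel. exp (l * s)) \<le> exp (l * t) / l"
proof -
  have "(\<integral>s. exp (l * s) * indicator {0..t} s \<partial>lborel) = exp (l * t) / l - exp (l * 0) / l"
  proof (rule integral_FTC_Icc_real[where F="\<lambda>s. exp (l * s) / l"])
    show "((\<lambda>s. exp (l * s) / l) has_real_derivative exp (l * x)) (at x)" for x
      using assms(1) by (auto intro!: derivative_eq_intros)
  qed (use assms in \<open>auto intro!: continuous_intros\<close>)
  then show ?thesis using assms by (simp add: set_lebesgue_integral_def mult.commute)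
qed

text \<open>
  Gronwall's argument in the weighted norm \<open>K\<close>, the supremum of \<open>exp (- l * s) * \<bar>d s y\<bar>\<close>. The equation for
  \<open>d\<close> is a contraction with factor \<open>1/2\<close> in this norm if \<open>l = 2 * \<Lambda>\<close>. The equality \<open>v - u = d\<close> is used
  under an integral, so almost everywhere is enough.
\<close>

lemma perturbation_bound:
  assumes u: "admissible u" and v: "admissible v"
    and d: "\<And>t x. t \<in> {0..1} \<Longrightarrow> d t x = 1 / (2 * a) * (cone_int t x v - cone_int t x u + e t x)"
    and e: "\<And>t x. t \<in> {0..1} \<Longrightarrow> \<bar>e t x\<bar> \<le> \<eta>"
    and vu: "AE p in lborel. fst p \<in> {0..1} \<longrightarrow> v (fst p) (snd p) - u (fst p) (snd p) = d (fst p) (snd p)"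
    and t: "t \<in> {0..1}"
  shows "\<bar>d t x\<bar> \<le> exp (2 * \<Lambda>) * \<eta> / a"
proof -
  define l where "l = 2 * \<Lambda>"
  have l: "l > 0" using \<Lambda> by (simp add: l_def)
  define h where "h = (\<lambda>p. exp (- l * fst p) * \<bar>d (fst p) (snd p)\<bar>)"
  let ?S = "{0..1::real} \<times> (UNIV :: real set)"
  define b where "b = 1 / (2 * a) * (4 * a * C + \<eta>)"
  have db: "\<bar>d t x\<bar> \<le> b" if t: "t \<in> {0..1}" for t x
  proof -
    have "\<bar>cone_int t x v - cone_int t x u + e t x\<bar> \<le> 4 * a * C + \<eta>"
      using cone_int_bound[OF u t, of x] cone_int_bound[OF v t, of x] e[OF t, of x] by linarith
    then show ?thesis unfolding d[OF t] abs_mult b_def using a by (simp add: divide_right_mono)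
  qed
  have hb: "h p \<le> b" if "p \<in> ?S" for p
  proof -
    have "h p \<le> 1 * \<bar>d (fst p) (snd p)\<bar>" unfolding h_def using that l by (intro mult_right_mono) (auto simp: mult_nonneg_nonneg)
    then show ?thesis using db[of "fst p" "snd p"] that by auto
  qed
  have bdd: "bdd_above (h ` ?S)" using hb by (intro bdd_aboveI[of _ b]) auto
  define K where "K = (SUP p\<in>?S. h p)"
  have hK: "h p \<le> K" if "p \<in> ?S" for p unfolding K_def by (rule cSUP_upper[OF that bdd])
  have K0: "K \<ge> 0"
  proof -
    have "0 \<le> h (0, 0)" by (simp add: h_def)
    also have "\<dots> \<le> K" by (rule hK) simp
    finally show ?thesis .
  qed
  have dK: "\<bar>d s y\<bar> \<le> K * exp (l * s)" if "s \<in> {0..1}" for s y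
  proof -
    have "\<bar>d s y\<bar> = h (s, y) * exp (l * s)" by (simp add: h_def exp_minus)
    also have "\<dots> \<le> K * exp (l * s)" using that by (intro mult_right_mono hK) auto
    finally show ?thesis .
  qed
  have ae: "AE s in lborel. AE y in lborel. s \<in> {0..1} \<longrightarrow> v s y - u s y = d s y"
  proof -
    have "AE p in lborel \<Otimes>\<^sub>M lborel. fst p \<in> {0..1} \<longrightarrow> v (fst p) (snd p) - u (fst p) (snd p) = d (fst p) (snd p)"
      unfolding lborel_prod by (rule vu)
    from lborel_pair.AE_pair[OF this] show ?thesis by simp
  qed
  have main: "\<bar>d t x\<bar> \<le> K * exp (l * t) / 2 + \<eta> / (2 * a)" if t: "t \<in> {0..1}" for t x
  proof -
    have "\<bar>cone_int t x v - cone_int t x u\<bar> \<le> (LINT s:{0..t}|lborel. (2 * a * \<Lambda> * K) * exp (l * s))"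
      unfolding cone_int_source[OF t]
    proof (rule set_integral_diff_bound)
      show "set_integrable lborel {0..t} (\<lambda>s. (2 * a * \<Lambda> * K) * exp (l * s))"
        by (intro borel_integrable_atLeastAtMost' continuous_intros)
      show "AE s in lborel. s \<in> {0..t} \<longrightarrow>
         \<bar>ball_int x (a * (t - s)) (source v s) - ball_int x (a * (t - s)) (source u s)\<bar> \<le> 2 * a * \<Lambda> * K * exp (l * s)"
        using ae
      proof eventually_elim
        case (elim s)
        show ?case
        proof
          assume "s \<in> {0..t}"
          then have s: "s \<in> {0..1}" using t by auto
          have "\<bar>ball_int x (a * (t - s)) (source v s) - ball_int x (a * (t - s)) (source u s)\<bar> \<le> 2 * a * (\<Lambda> * (K * exp (l * s)))"
          proof (rule ball_int_diff_fun[OF source_measurable[OF v] source_AE source_measurable[OF u] source_AE])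
            show "AE y in lborel. \<bar>source v s y - source u s y\<bar> \<le> \<Lambda> * (K * exp (l * s))"
              using elim
            proof eventually_elim
              case (elim y)
              have "\<bar>source v s y - source u s y\<bar> \<le> \<Lambda> * \<bar>v s y - u s y\<bar>"
                unfolding source_def unit_clamp_ident[OF s] by (rule f_lipschitz[OF s])
              also have "\<dots> \<le> \<Lambda> * (K * exp (l * s))"
                using elim s dK[OF s, of y] \<Lambda> by (intro mult_left_mono) auto
              finally show ?case .
            qed
            have "a * (t - s) \<le> a * 1" using s t a by (intro mult_left_mono) auto
            then show "a * (t - s) \<le> a" by simp
          qed (use a \<Lambda> K0 in auto)
          then show "\<bar>ball_int x (a * (t - s)) (source v s) - ball_int x (a * (t - s)) (source u s)\<bar> \<le> 2 * a * \<Lambda> * K * exp (l * s)"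
            by (simp add: mult.assoc)
        qed
      qed
    qed (intro set_integrable_ball_int_source u v t)+
    also have "\<dots> = (2 * a * \<Lambda> * K) * (LINT s:{0..t}|lborel. exp (l * s))" by simp
    also have "\<dots> \<le> (2 * a * \<Lambda> * K) * (exp (l * t) / l)"
      using t a \<Lambda> K0 l by (intro mult_left_mono LINT_exp_le) auto
    also have "\<dots> = a * K * exp (l * t)" using \<Lambda> by (simp add: l_def)
    finally have c: "\<bar>cone_int t x v - cone_int t x u\<bar> \<le> a * K * exp (l * t)" .
    have "\<bar>d t x\<bar> = 1 / (2 * a) * \<bar>cone_int t x v - cone_int t x u + e t x\<bar>"
      unfolding d[OF t] abs_mult using a by simp
    also have "\<dots> \<le> 1 / (2 * a) * (a * K * exp (l * t) + \<eta>)"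
      using c e[OF t, of x] a by (intro mult_left_mono) auto
    also have "\<dots> = K * exp (l * t) / 2 + \<eta> / (2 * a)" using a by (simp add: field_simps)
    finally show ?thesis .
  qed
  have \<eta>: "\<eta> \<ge> 0" using e[of 0 0] by simp
  have "K \<le> K / 2 + \<eta> / (2 * a)"
    unfolding K_def
  proof (rule cSUP_least)
    fix p assume p: "p \<in> ?S"
    then have p1: "fst p \<in> {0..1}" by auto
    have e1: "exp (- l * fst p) * exp (l * fst p) = 1" by (simp add: exp_minus)
    have e2: "exp (- l * fst p) \<le> 1" using p1 l by (simp add: mult_nonneg_nonneg)
    have "h p \<le> exp (- l * fst p) * (K * exp (l * fst p) / 2 + \<eta> / (2 * a))"
      unfolding h_def by (intro mult_left_mono main p1) simp
    also have "\<dots> = (exp (- l * fst p) * exp (l * fst p)) * (K / 2) + exp (- l * fst p) * (\<eta> / (2 * a))"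
      by (simp add: algebra_simps)
    also have "\<dots> \<le> K / 2 + 1 * (\<eta> / (2 * a))"
      unfolding e1 using e2 \<eta> a by (intro add_mono mult_right_mono) auto
    finally show "h p \<le> (SUP p\<in>?S. h p) / 2 + \<eta> / (2 * a)" unfolding K_def by simp
  qed auto
  then have Kle: "K \<le> \<eta> / a" by (simp add: field_simps)
  have "\<bar>d t x\<bar> \<le> K * exp (l * t)" by (rule dK[OF t])
  also have "\<dots> \<le> \<eta> / a * exp (2 * \<Lambda>)"
    using Kle K0 t l \<Lambda> \<eta> a by (intro mult_mono) (auto simp: l_def mult_left_le)
  finally show ?thesis by (simp add: mult.commute)
qed

end

subsection \<open>Measurability\<close>

abbreviation (input) strip :: "(real \<times> real) measure" where
  "strip \<equiv> restrict_space borel ({0..1} \<times> UNIV)"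

lemma clamp_strip_measurable:
  "(\<lambda>q. ((unit_clamp (fst (fst q)), snd (fst q)), snd q)) \<in> (borel :: (real \<times> real) measure) \<Otimes>\<^sub>M M \<rightarrow>\<^sub>M strip \<Otimes>\<^sub>M M"
proof (rule measurable_Pair)
  have "(\<lambda>q. (unit_clamp (fst (fst q)), snd (fst q))) \<in> borel_measurable ((borel :: (real \<times> real) measure) \<Otimes>\<^sub>M M)"
    by (rule borel_measurable_Pair; unfold borel_prod[symmetric]; measurable)
  then show "(\<lambda>q. (unit_clamp (fst (fst q)), snd (fst q))) \<in> (borel :: (real \<times> real) measure) \<Otimes>\<^sub>M M \<rightarrow>\<^sub>M strip"
    by (rule measurable_restrict_space2[rotated]) auto
qed measurable

lemma strip_to_borel_measurable: "(\<lambda>q. q) \<in> strip \<Otimes>\<^sub>M M \<rightarrow>\<^sub>M borel \<Otimes>\<^sub>M M"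
proof -
  have "(\<lambda>q. (fst q, snd q)) \<in> strip \<Otimes>\<^sub>M M \<rightarrow>\<^sub>M borel \<Otimes>\<^sub>M M"
    by (intro measurable_Pair measurable_snd measurable_compose[OF measurable_fst] measurable_restrict_space1) auto
  then show ?thesis by simp
qed

lemma source_joint_measurable:
  fixes f :: "real \<Rightarrow> real \<Rightarrow> real \<Rightarrow> real" and u :: "real \<Rightarrow> real \<Rightarrow> 'w \<Rightarrow> real"
  assumes f: "(\<lambda>(s, y, v). f s y v) \<in> borel_measurable (restrict_space borel ({0..1} \<times> UNIV \<times> UNIV))"
    and u: "(\<lambda>((t, x), \<omega>). u t x \<omega>) \<in> borel_measurable (strip \<Otimes>\<^sub>M M)"
  shows "(\<lambda>q. f (unit_clamp (fst (fst q))) (snd (fst q)) (u (unit_clamp (fst (fst q))) (snd (fst q)) (snd q)))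
     \<in> borel_measurable (borel \<Otimes>\<^sub>M M)"
proof -
  have u': "(\<lambda>q. u (unit_clamp (fst (fst q))) (snd (fst q)) (snd q)) \<in> borel_measurable (borel \<Otimes>\<^sub>M M)"
    using measurable_compose[OF clamp_strip_measurable u] by (simp add: case_prod_beta')
  have c: "(\<lambda>q. unit_clamp (fst (fst q))) \<in> borel_measurable ((borel :: (real \<times> real) measure) \<Otimes>\<^sub>M M)"
    "(\<lambda>q. snd (fst q)) \<in> borel_measurable ((borel :: (real \<times> real) measure) \<Otimes>\<^sub>M M)"
    by (unfold borel_prod[symmetric]; measurable)+
  have "(\<lambda>q. (unit_clamp (fst (fst q)), snd (fst q), u (unit_clamp (fst (fst q))) (snd (fst q)) (snd q)))
      \<in> borel_measurable (borel \<Otimes>\<^sub>M M)"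
    by (intro borel_measurable_Pair c u')
  then have "(\<lambda>q. (unit_clamp (fst (fst q)), snd (fst q), u (unit_clamp (fst (fst q))) (snd (fst q)) (snd q)))
      \<in> borel \<Otimes>\<^sub>M M \<rightarrow>\<^sub>M restrict_space borel ({0..1} \<times> UNIV \<times> UNIV)"
    by (rule measurable_restrict_space2[rotated]) auto
  from measurable_compose[OF this f] show ?thesis by simp
qed

text \<open>
  By continuity, a countable dense subset gives the same supremum.
\<close>

lemma SUP_continuous_measurable:
  fixes g :: "'p :: {metric_space, second_countable_topology} \<Rightarrow> 'w \<Rightarrow> real"
  assumes m: "\<And>p. p \<in> S \<Longrightarrow> g p \<in> borel_measurable M"
    and c: "\<And>\<omega>. \<omega> \<in> space M \<Longrightarrow> continuous_on S (\<lambda>p. g p \<omega>)"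
  shows "(\<lambda>\<omega>. SUP p\<in>S. ennreal \<bar>g p \<omega>\<bar>) \<in> borel_measurable M"
proof -
  obtain T where T: "countable T" "T \<subseteq> S" "S \<subseteq> closure T" by (rule separable)
  have "(SUP p\<in>S. ennreal \<bar>g p \<omega>\<bar>) = (SUP p\<in>T. ennreal \<bar>g p \<omega>\<bar>)" if w: "\<omega> \<in> space M" for \<omega>
  proof (rule antisym)
    show "(SUP p\<in>T. ennreal \<bar>g p \<omega>\<bar>) \<le> (SUP p\<in>S. ennreal \<bar>g p \<omega>\<bar>)"
      using T(2) by (intro SUP_subset_mono) auto
    show "(SUP p\<in>S. ennreal \<bar>g p \<omega>\<bar>) \<le> (SUP p\<in>T. ennreal \<bar>g p \<omega>\<bar>)"
    proof (rule SUP_least)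
      fix p assume p: "p \<in> S"
      then obtain s where s: "\<And>n. s n \<in> T" "s \<longlonglongrightarrow> p" using T(3) closure_sequential by blast
      have "(\<lambda>n. g (s n) \<omega>) \<longlonglongrightarrow> g p \<omega>"
        by (rule continuous_on_tendsto_compose[OF c[OF w] s(2) p]) (use s(1) T(2) in \<open>auto intro!: always_eventually\<close>)
      then have "(\<lambda>n. ennreal \<bar>g (s n) \<omega>\<bar>) \<longlonglongrightarrow> ennreal \<bar>g p \<omega>\<bar>" by (intro tendsto_ennrealI tendsto_rabs)
      then show "ennreal \<bar>g p \<omega>\<bar> \<le> (SUP p\<in>T. ennreal \<bar>g p \<omega>\<bar>)"
        by (rule LIMSEQ_le_const2) (use s(1) in \<open>auto intro!: SUP_upper\<close>)
    qed
  qed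
  then have "(\<lambda>\<omega>. SUP p\<in>S. ennreal \<bar>g p \<omega>\<bar>) \<in> borel_measurable M \<longleftrightarrow>
      (\<lambda>\<omega>. SUP p\<in>T. ennreal \<bar>g p \<omega>\<bar>) \<in> borel_measurable M" by (intro measurable_cong)
  moreover have "(\<lambda>\<omega>. SUP p\<in>T. ennreal \<bar>g p \<omega>\<bar>) \<in> borel_measurable M"
  proof (rule borel_measurable_SUP[OF T(1)])
    fix p assume "p \<in> T"
    then have [measurable]: "g p \<in> borel_measurable M" using T(2) m by blast
    show "(\<lambda>\<omega>. ennreal \<bar>g p \<omega>\<bar>) \<in> borel_measurable M" by measurable
  qed
  ultimately show ?thesis by simp
qed

lemma (in wave_source) admissible_section:
  assumes "(\<lambda>(s, y, v). f s y v) \<in> borel_measurable (restrict_space borel ({0..1} \<times> UNIV \<times> UNIV))"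
    and "(\<lambda>((t, x), \<omega>). u t x \<omega>) \<in> borel_measurable (strip \<Otimes>\<^sub>M M)" and w: "\<omega> \<in> space M"
  shows "admissible (\<lambda>t x. u t x \<omega>)"
  using measurable_compose[OF measurable_Pair2'[OF w] source_joint_measurable[OF assms(1,2)]]
  unfolding admissible_def source_def by simp

lemma (in wave_source) cone_indicator_measurable:
  fixes t x s y h :: "'k \<Rightarrow> real"
  assumes [measurable]: "t \<in> borel_measurable K" "x \<in> borel_measurable K" "s \<in> borel_measurable K"
    "y \<in> borel_measurable K" "h \<in> borel_measurable K"
  shows "(\<lambda>w. of_bool (x w - a * (t w - s w) \<le> y w \<and> y w \<le> x w + a * (t w - s w)) * h w) \<in> borel_measurable K"
  by measurable

lemma (in wave_source) cone_int_measurable: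
  fixes u :: "real \<Rightarrow> real \<Rightarrow> 'w \<Rightarrow> real"
  assumes f: "(\<lambda>(s, y, v). f s y v) \<in> borel_measurable (restrict_space borel ({0..1} \<times> UNIV \<times> UNIV))"
    and u: "(\<lambda>((t, x), \<omega>). u t x \<omega>) \<in> borel_measurable (strip \<Otimes>\<^sub>M M)"
  shows "(\<lambda>((t, x), \<omega>). cone_int t x (\<lambda>s y. u s y \<omega>)) \<in> borel_measurable (strip \<Otimes>\<^sub>M M)"
proof -
  let ?X = "(borel :: (real \<times> real) measure) \<Otimes>\<^sub>M M"
  let ?Y = "?X \<Otimes>\<^sub>M (lborel :: real measure)"
  let ?Z = "?Y \<Otimes>\<^sub>M (lborel :: real measure)"
  let ?h = "\<lambda>q. f (unit_clamp (fst (fst q))) (snd (fst q)) (u (unit_clamp (fst (fst q))) (snd (fst q)) (snd q))"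
  let ?t = "\<lambda>z. fst (fst z)" and ?x = "\<lambda>z. snd (fst z)"
  have tx: "?t \<in> borel_measurable ?X" "?x \<in> borel_measurable ?X"
    by (unfold borel_prod[symmetric]; measurable)+
  have sy: "(\<lambda>z. snd (fst z)) \<in> borel_measurable (?Z)" "(\<lambda>z. snd z) \<in> borel_measurable (?Z)"
  proof -
    have "(\<lambda>z. snd (fst z)) \<in> ?Z \<rightarrow>\<^sub>M lborel"
      by (rule measurable_compose[OF measurable_fst measurable_snd])
    then show "(\<lambda>z. snd (fst z)) \<in> borel_measurable (?Z)" by simp
    have "(\<lambda>z. snd z) \<in> ?Z \<rightarrow>\<^sub>M lborel" by (rule measurable_snd)
    then show "(\<lambda>z. snd z) \<in> borel_measurable (?Z)" by simp
  qed
  have pr: "(\<lambda>z. (snd (fst z), snd z)) \<in> borel_measurable (?Z)"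
    by (rule borel_measurable_Pair[OF sy])
  have mp: "(\<lambda>z. ((snd (fst z), snd z), snd (fst (fst z)))) \<in> ?Z \<rightarrow>\<^sub>M ?X"
  proof (rule measurable_Pair)
    show "(\<lambda>z. (snd (fst z), snd z)) \<in> ?Z \<rightarrow>\<^sub>M borel"
      by (rule pr)
    show "(\<lambda>z. snd (fst (fst z))) \<in> ?Z \<rightarrow>\<^sub>M M"
      by (rule measurable_compose[OF measurable_compose[OF measurable_fst measurable_fst] measurable_snd])
  qed
  have hm: "(\<lambda>z. ?h ((snd (fst z), snd z), snd (fst (fst z)))) \<in> borel_measurable (?Z)"
    by (rule measurable_compose[OF mp source_joint_measurable[OF f u]])
  let ?g = "\<lambda>z s y. of_bool (?x z - a * (?t z - s) \<le> y \<and> y \<le> ?x z + a * (?t z - s)) * ?h ((s, y), snd z)"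
  have c2: "(\<lambda>w. fst (fst w)) \<in> ?Z \<rightarrow>\<^sub>M ?X"
    by (rule measurable_compose[OF measurable_fst measurable_fst])
  have "(\<lambda>w. ?g (fst (fst w)) (snd (fst w)) (snd w)) \<in> borel_measurable (?Z)"
    using cone_indicator_measurable[OF measurable_compose[OF c2 tx(1)] measurable_compose[OF c2 tx(2)] sy hm] by simp
  then have 1: "(\<lambda>w. \<integral>y. ?g (fst w) (snd w) y \<partial>lborel) \<in> borel_measurable (?Y)"
    by (intro lborel.borel_measurable_lebesgue_integral) (simp add: case_prod_beta')
  have s1: "(\<lambda>w. indicator {0..1} (snd w) :: real) \<in> borel_measurable (?Y)"
    by (rule measurable_compose[OF measurable_snd]) simp
  have "(\<lambda>w. indicator {0..1} (snd w) * (\<integral>y. ?g (fst w) (snd w) y \<partial>lborel)) \<in> borel_measurable (?Y)"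
    by (rule borel_measurable_times[OF s1 1])
  then have 2: "(\<lambda>z. \<integral>s. indicator {0..1} s * (\<integral>y. ?g z s y \<partial>lborel) \<partial>lborel) \<in> borel_measurable ?X"
    by (intro lborel.borel_measurable_lebesgue_integral) (simp add: case_prod_beta')
  have eq: "(\<integral>s. indicator {0..1} s * (\<integral>y. ?g z s y \<partial>lborel) \<partial>lborel) = cone_int (?t z) (?x z) (\<lambda>s y. u s y (snd z))"
    if "?t z \<in> {0..1}" for z
  proof -
    have "(\<integral>y. ?g z s y \<partial>lborel) = ball_int (?x z) (a * (?t z - s)) (source (\<lambda>s y. u s y (snd z)) s)" for s
      unfolding ball_int_def set_lebesgue_integral_def source_def
      by (intro Bochner_Integration.integral_cong refl) (auto simp: indicator_def)
    then show ?thesis unfolding cone_int_source_unit[OF that] set_lebesgue_integral_def by simp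
  qed
  have "(\<lambda>z. \<integral>s. indicator {0..1} s * (\<integral>y. ?g z s y \<partial>lborel) \<partial>lborel) \<in> borel_measurable (strip \<Otimes>\<^sub>M M)"
    by (rule measurable_compose[OF strip_to_borel_measurable 2])
  also have "?this \<longleftrightarrow> (\<lambda>z. cone_int (?t z) (?x z) (\<lambda>s y. u s y (snd z))) \<in> borel_measurable (strip \<Otimes>\<^sub>M M)"
    by (rule measurable_cong, rule eq) (auto simp: space_pair_measure space_restrict_space)
  finally show ?thesis by (simp add: case_prod_beta')
qed

section \<open>Versions of the solutions and their uniform distance\<close>

text \<open>
  The initial data have cancelled: only the difference of the two equations enters.
\<close>

locale wave_approximation = wave_source a f C \<Lambda> + wave_noise M \<mu> r a \<sigma> B L \<beta>
  for f C \<Lambda> and M :: "'w measure" and \<mu> r a \<sigma> B L \<beta> +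
  fixes u :: "real \<Rightarrow> real \<Rightarrow> 'w \<Rightarrow> real" and uj :: "nat \<Rightarrow> real \<Rightarrow> real \<Rightarrow> 'w \<Rightarrow> real"
  assumes f_measurable: "(\<lambda>(s, y, v). f s y v) \<in> borel_measurable (restrict_space borel ({0..1} \<times> UNIV \<times> UNIV))"
    and u_measurable: "(\<lambda>((t, x), \<omega>). u t x \<omega>) \<in> borel_measurable (strip \<Otimes>\<^sub>M M)"
    and uj_measurable: "\<And>j. (\<lambda>((t, x), \<omega>). uj j t x \<omega>) \<in> borel_measurable (strip \<Otimes>\<^sub>M M)"
    and difference: "\<And>j t x. t \<in> {0..1} \<Longrightarrow> AE \<omega> in M. uj j t x \<omega> - u t x \<omega> =
      1 / (2 * a) * (cone_int t x (\<lambda>s y. uj j s y \<omega>) - cone_int t x (\<lambda>s y. u s y \<omega>) + noise_error j t x \<omega>)"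
begin

text \<open>
  The difference of the right-hand sides. It is a version of \<open>uj j - u\<close>, continuous in \<open>(t,x)\<close>.
\<close>

definition gap :: "nat \<Rightarrow> real \<Rightarrow> real \<Rightarrow> 'w \<Rightarrow> real" where
  "gap j t x \<omega> =
     1 / (2 * a) * (cone_int t x (\<lambda>s y. uj j s y \<omega>) - cone_int t x (\<lambda>s y. u s y \<omega>) + noise_error j t x \<omega>)"

lemma gap_measurable: "(\<lambda>((t, x), \<omega>). gap j t x \<omega>) \<in> borel_measurable (strip \<Otimes>\<^sub>M M)"
proof -
  note [measurable] = cone_int_measurable[OF f_measurable u_measurable, unfolded case_prod_beta']
    cone_int_measurable[OF f_measurable uj_measurable, unfolded case_prod_beta']
    noise_error_measurable[unfolded case_prod_beta']
  have "(\<lambda>q. gap j (fst (fst q)) (snd (fst q)) (snd q)) \<in> borel_measurable (strip \<Otimes>\<^sub>M M)"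
    unfolding gap_def
    by (intro borel_measurable_times borel_measurable_add borel_measurable_diff borel_measurable_const
      cone_int_measurable[OF f_measurable u_measurable, unfolded case_prod_beta']
      cone_int_measurable[OF f_measurable uj_measurable, unfolded case_prod_beta']
      noise_error_measurable[unfolded case_prod_beta'])
  then show ?thesis by (simp add: case_prod_beta')
qed

lemma strip_section_measurable:
  fixes g :: "real \<Rightarrow> real \<Rightarrow> 'w \<Rightarrow> real"
  assumes g: "(\<lambda>((t, x), \<omega>). g t x \<omega>) \<in> borel_measurable (strip \<Otimes>\<^sub>M M)" and t: "t \<in> {0..1}"
  shows "g t x \<in> borel_measurable M"
proof -
  have "(t, x) \<in> space strip" using t by (auto simp: space_restrict_space)
  from measurable_compose[OF measurable_Pair1'[OF this] g] show ?thesis by simp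
qed

text \<open>
  The exceptional null set of \<open>\<omega>\<close> may depend on \<open>(t,x)\<close>. By Fubini's theorem, almost every \<open>\<omega>\<close> is exceptional
  for almost no \<open>(t,x)\<close>.
\<close>

lemma gap_ae:
  "AE \<omega> in M. AE p in lborel. fst p \<in> {0..1} \<longrightarrow>
     uj j (fst p) (snd p) \<omega> - u (fst p) (snd p) \<omega> = gap j (fst p) (snd p) \<omega>"
proof -
  interpret pair_sigma_finite "lborel :: (real \<times> real) measure" M ..
  define D where "D = (\<lambda>t x \<omega>. uj j t x \<omega> - u t x \<omega> - gap j t x \<omega>)"
  have "(\<lambda>q. D (fst (fst q)) (snd (fst q)) (snd q)) \<in> borel_measurable (strip \<Otimes>\<^sub>M M)"
    unfolding D_def
    by (intro borel_measurable_diff uj_measurable[unfolded case_prod_beta']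
      u_measurable[unfolded case_prod_beta'] gap_measurable[unfolded case_prod_beta'])
  from measurable_compose[OF clamp_strip_measurable this]
  have Dm: "(\<lambda>q. D (unit_clamp (fst (fst q))) (snd (fst q)) (snd q)) \<in>
      borel_measurable ((borel :: (real \<times> real) measure) \<Otimes>\<^sub>M M)" unfolding fst_conv snd_conv .
  have "sets ((lborel :: (real \<times> real) measure) \<Otimes>\<^sub>M M) = sets ((borel :: (real \<times> real) measure) \<Otimes>\<^sub>M M)"
    by (rule sets_pair_measure_cong[OF sets_lborel refl])
  with Dm have [measurable]: "(\<lambda>q. D (unit_clamp (fst (fst q))) (snd (fst q)) (snd q)) \<in>
      borel_measurable ((lborel :: (real \<times> real) measure) \<Otimes>\<^sub>M M)"
    by (subst measurable_cong_sets[OF _ refl])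
  have "AE p in (lborel :: (real \<times> real) measure). AE \<omega> in M. D (unit_clamp (fst p)) (snd p) \<omega> = 0"
  proof (rule AE_I2)
    fix p :: "real \<times> real"
    show "AE \<omega> in M. D (unit_clamp (fst p)) (snd p) \<omega> = 0"
      using difference[of "unit_clamp (fst p)" j "snd p"] unfolding D_def gap_def by simp
  qed
  then have "AE \<omega> in M. AE p in (lborel :: (real \<times> real) measure). D (unit_clamp (fst p)) (snd p) \<omega> = 0"
    by (subst (asm) AE_commute) measurable
  then show ?thesis
  proof eventually_elim
    case (elim \<omega>)
    then show ?case
    proof eventually_elim
      case (elim p)
      then show ?case by (auto simp: D_def unit_clamp_ident)
    qed
  qed
qed

lemma gap_continuous:
  assumes "\<omega> \<in> space M"
  shows "continuous_on ({0..1} \<times> UNIV) (\<lambda>(t, x). gap j t x \<omega>)"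
proof -
  have *: "continuous_on ({0..1} \<times> UNIV) (\<lambda>(t, x). cone_int t x (\<lambda>s y. v s y \<omega>))"
    if "(\<lambda>((t, x), \<omega>). v t x \<omega>) \<in> borel_measurable (strip \<Otimes>\<^sub>M M)" for v
    by (rule lipschitz_imp_continuous, rule cone_int_lipschitz[OF admissible_section[OF f_measurable that assms]])
  show ?thesis
    using *[OF u_measurable] *[OF uj_measurable] noise_error_continuous
    unfolding gap_def case_prod_beta' by (intro continuous_intros)
qed

lemma gap_bound:
  assumes \<eta>: "\<And>t x. t \<in> {0..1} \<Longrightarrow> \<bar>noise_error j t x \<omega>\<bar> \<le> \<eta>" and w: "\<omega> \<in> space M"
    and ae: "AE p in lborel. fst p \<in> {0..1} \<longrightarrow>
     uj j (fst p) (snd p) \<omega> - u (fst p) (snd p) \<omega> = gap j (fst p) (snd p) \<omega>"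
    and t: "t \<in> {0..1}"
  shows "\<bar>gap j t x \<omega>\<bar> \<le> exp (2 * \<Lambda>) * \<eta> / a"
proof (rule perturbation_bound[where d="\<lambda>t x. gap j t x \<omega>" and e="\<lambda>t x. noise_error j t x \<omega>"])
  show "admissible (\<lambda>s y. u s y \<omega>)" by (rule admissible_section[OF f_measurable u_measurable w])
  show "admissible (\<lambda>s y. uj j s y \<omega>)" by (rule admissible_section[OF f_measurable uj_measurable w])
qed (use \<eta> ae t in \<open>simp_all add: gap_def\<close>)

text \<open>
  The supremum is at most a constant multiple of the random bound for the noise error.
\<close>

lemma null_in_prob_gap:
  assumes T: "T \<subseteq> {0..1}"
  shows "null_in_prob M (\<lambda>j \<omega>. SUP (t, x)\<in>T \<times> UNIV. ennreal \<bar>gap j t x \<omega>\<bar>)"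
proof -
  obtain \<eta> where \<eta>: "\<And>j. \<eta> j \<in> borel_measurable M" "(\<lambda>j. prob_norm M (\<eta> j)) \<longlonglongrightarrow> 0"
    "\<And>j t x \<omega>. t \<in> {0..1} \<Longrightarrow> \<bar>noise_error j t x \<omega>\<bar> \<le> \<eta> j \<omega>" by (rule noise_error_bound) blast
  note [measurable] = \<eta>(1)
  define c where "c = exp (2 * \<Lambda>) / a"
  have c: "c > 0" using wave_source_axioms by (simp add: c_def wave_source_def)
  define X where "X = (\<lambda>j \<omega>. SUP (t, x)\<in>T \<times> UNIV. ennreal \<bar>gap j t x \<omega>\<bar>)"
  have X_le: "AE \<omega> in M. X j \<omega> \<le> ennreal (c * \<eta> j \<omega>)" for j
  proof -
    have "AE \<omega> in M. \<omega> \<in> space M" by simp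
    with gap_ae[of j] show ?thesis
    proof eventually_elim
      case (elim \<omega>)
      have "\<bar>gap j t x \<omega>\<bar> \<le> c * \<eta> j \<omega>" if "t \<in> T" for t x
        using gap_bound[OF \<eta>(3) elim(2) elim(1), of t x] that T by (auto simp: c_def)
      then show ?case unfolding X_def by (intro SUP_least) (auto intro: ennreal_leI)
    qed
  qed
  have Xm: "X j \<in> borel_measurable M" for j
  proof -
    have "(\<lambda>\<omega>. SUP p\<in>T \<times> UNIV. ennreal \<bar>(\<lambda>(t, x). gap j t x \<omega>) p\<bar>) \<in> borel_measurable M"
    proof (rule SUP_continuous_measurable[where g="\<lambda>p \<omega>. case p of (t, x) \<Rightarrow> gap j t x \<omega>"])
      fix p assume "p \<in> T \<times> (UNIV :: real set)"
      then have "fst p \<in> {0..1}" using T by auto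
      from strip_section_measurable[OF gap_measurable this]
      show "(\<lambda>\<omega>. case p of (t, x) \<Rightarrow> gap j t x \<omega>) \<in> borel_measurable M" by (simp add: case_prod_beta')
    next
      fix \<omega> assume "\<omega> \<in> space M"
      then show "continuous_on (T \<times> UNIV) (\<lambda>p. case p of (t, x) \<Rightarrow> gap j t x \<omega>)"
        using T by (intro continuous_on_subset[OF gap_continuous]) auto
    qed
    then show ?thesis by (simp add: X_def[abs_def] case_prod_beta')
  qed
  have "(\<lambda>j. prob {\<omega>\<in>space M. ennreal \<epsilon> < X j \<omega>}) \<longlonglongrightarrow> 0" if \<epsilon>: "\<epsilon> > 0" for \<epsilon> :: real
  proof (rule tendsto_sandwich[OF _ _ tendsto_const])
    show "(\<lambda>j. prob {\<omega>\<in>space M. \<epsilon> / c < \<bar>\<eta> j \<omega>\<bar>}) \<longlonglongrightarrow> 0"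
      by (rule prob_gt_tendsto_0_iff[THEN iffD2, rule_format, OF \<eta>(1,2)]) (simp add: \<epsilon> c)
    show "\<forall>\<^sub>F j in sequentially. prob {\<omega>\<in>space M. ennreal \<epsilon> < X j \<omega>} \<le> prob {\<omega>\<in>space M. \<epsilon> / c < \<bar>\<eta> j \<omega>\<bar>}"
    proof (rule always_eventually, rule allI, rule finite_measure_mono_AE)
      fix j
      show "AE \<omega> in M. \<omega> \<in> {\<omega>\<in>space M. ennreal \<epsilon> < X j \<omega>} \<longrightarrow> \<omega> \<in> {\<omega>\<in>space M. \<epsilon> / c < \<bar>\<eta> j \<omega>\<bar>}"
        using X_le[of j]
      proof eventually_elim
        case (elim \<omega>)
        show ?case
        proof (intro impI)
          assume "\<omega> \<in> {\<omega>\<in>space M. ennreal \<epsilon> < X j \<omega>}"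
          then have w: "\<omega> \<in> space M" and "ennreal \<epsilon> < X j \<omega>" by auto
          then have "ennreal \<epsilon> < ennreal (c * \<eta> j \<omega>)" using elim by (meson less_le_trans)
          then have "\<epsilon> < c * \<eta> j \<omega>" using \<epsilon> by (simp add: ennreal_less_iff)
          then have "\<epsilon> / c < \<eta> j \<omega>" using c by (simp add: pos_divide_less_eq mult.commute)
          then show "\<omega> \<in> {\<omega>\<in>space M. \<epsilon> / c < \<bar>\<eta> j \<omega>\<bar>}" using w by auto
        qed
      qed
    qed measurable
  qed simp
  then have "null_in_prob M X" unfolding null_in_prob_def using Xm by blast
  then show ?thesis by (simp add: X_def)
qed

lemma versions_converge:
  "\<exists>w wj. is_version M w u \<and> (\<forall>j. is_version M (wj j) (uj j)) \<and>
    (\<forall>\<delta>. 0 < \<delta> \<and> \<delta> < 1 \<longrightarrow>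
      null_in_prob M (\<lambda>j \<omega>. SUP (t, x)\<in>{0..1 - \<delta>} \<times> UNIV. ennreal \<bar>wj j t x \<omega> - w t x \<omega>\<bar>))"
proof (intro exI[of _ u] exI[of _ "\<lambda>j t x \<omega>. u t x \<omega> + gap j t x \<omega>"] conjI allI impI)
  show "is_version M u u"
    unfolding is_version_def by (auto intro: strip_section_measurable[OF u_measurable])
  show "is_version M (\<lambda>t x \<omega>. u t x \<omega> + gap j t x \<omega>) (uj j)" for j
    unfolding is_version_def
  proof (intro ballI allI conjI)
    fix t x :: real assume t: "t \<in> {0..1}"
    show "(\<lambda>\<omega>. u t x \<omega> + gap j t x \<omega>) \<in> borel_measurable M"
      by (intro borel_measurable_add strip_section_measurable[OF u_measurable t]
        strip_section_measurable[OF gap_measurable t])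
    show "AE \<omega> in M. u t x \<omega> + gap j t x \<omega> = uj j t x \<omega>"
      using difference[OF t, of j x] by eventually_elim (simp add: gap_def)
  qed
  fix \<delta> :: real assume "0 < \<delta> \<and> \<delta> < 1"
  then show "null_in_prob M (\<lambda>j \<omega>. SUP (t, x)\<in>{0..1 - \<delta>} \<times> UNIV. ennreal \<bar>u t x \<omega> + gap j t x \<omega> - u t x \<omega>\<bar>)"
    using null_in_prob_gap[of "{0..1 - \<delta>}"] by simp
qed

end

theorem theorem1:
  fixes M :: "'w measure"
    and \<mu> :: "real set \<Rightarrow> 'w \<Rightarrow> real"
    and a :: real
    and u0 v0 :: "real \<Rightarrow> 'w \<Rightarrow> real"
    and f :: "real \<Rightarrow> real \<Rightarrow> real \<Rightarrow> real"
    and \<sigma> :: "real \<Rightarrow> real \<Rightarrow> real"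
    and u :: "real \<Rightarrow> real \<Rightarrow> 'w \<Rightarrow> real"
    and uj :: "nat \<Rightarrow> real \<Rightarrow> real \<Rightarrow> 'w \<Rightarrow> real"
  assumes "prob_space M" and "complete_measure M"
    and "stochastic_measure M unit_borel \<mu>"
    and "a > 0"
    and A1_u0: "(\<lambda>(y, \<omega>). u0 y \<omega>) \<in> borel_measurable (borel \<Otimes>\<^sub>M M)"
      "\<forall>\<omega>\<in>space M. bounded (range (\<lambda>y. u0 y \<omega>))"
    and A1_v0: "(\<lambda>(y, \<omega>). v0 y \<omega>) \<in> borel_measurable (borel \<Otimes>\<^sub>M M)"
      "\<forall>\<omega>\<in>space M. bounded (range (\<lambda>y. v0 y \<omega>))"
    and A2: "(\<lambda>(s, y, v). f s y v) \<in> borel_measurable (restrict_space borel ({0..1} \<times> UNIV \<times> UNIV))"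
      "bounded ((\<lambda>(s, y, v). f s y v) ` ({0..1} \<times> UNIV \<times> UNIV))"
    and A3: "\<exists>Lf. \<forall>s\<in>{0..1}. \<forall>y1 y2 v1 v2.
      \<bar>f s y1 v1 - f s y2 v2\<bar> \<le> Lf * (\<bar>y1 - y2\<bar> + \<bar>v1 - v2\<bar>)"
    and A4: "(\<lambda>(s, y). \<sigma> s y) \<in> borel_measurable (restrict_space borel ({0..1} \<times> UNIV))"
      "bounded ((\<lambda>(s, y). \<sigma> s y) ` ({0..1} \<times> UNIV))"
    and A5: "\<exists>L\<sigma> \<beta>. 1 / 2 < \<beta> \<and> \<beta> \<le> 1 \<and>
      (\<forall>s1\<in>{0..1}. \<forall>s2\<in>{0..1}. \<forall>y1 y2.
        \<bar>\<sigma> s1 y1 - \<sigma> s2 y2\<bar> \<le> L\<sigma> * (\<bar>s1 - s2\<bar> powr \<beta> + \<bar>y1 - y2\<bar> powr \<beta>))"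
    and A6: "\<exists>m C. (\<forall>t\<in>{0<..1}. m t \<in> borel_measurable M \<and> (AE \<omega> in M. m t \<omega> = \<mu> {0<..t} \<omega>)) \<and>
      C \<in> borel_measurable M \<and>
      (\<forall>\<omega>\<in>space M. \<forall>t\<in>{0<..1}. \<bar>m t \<omega> :: real\<bar> \<le> C \<omega>)"
    and L2_integrable: "\<forall>h. square_integrable_unit h \<longrightarrow> sm_integrable M unit_borel \<mu> h"
    and L2_continuous: "\<forall>h :: nat \<Rightarrow> real \<Rightarrow> real.
      (\<forall>j. square_integrable_unit (h j)) \<longrightarrow>
      (\<lambda>j. LINT x:{0<..1}|lborel. \<bar>h j x\<bar>\<^sup>2) \<longlonglongrightarrow> 0 \<longrightarrow>
      tendsto_in_prob M (\<lambda>j. sm_integral M unit_borel \<mu> {0<..1} (h j)) (\<lambda>\<omega>. 0)"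
    and u: "mild_solution M a u0 v0 f (noise_term M a \<mu> \<sigma>) u"
    and uj: "\<forall>j. mild_solution M a u0 v0 f (fourier_noise_term M a \<mu> \<sigma> j) (uj j)"
  shows "\<exists>w wj. is_version M w u \<and> (\<forall>j. is_version M (wj j) (uj j)) \<and>
    (\<forall>\<delta>. 0 < \<delta> \<and> \<delta> < 1 \<longrightarrow>
      null_in_prob M (\<lambda>j \<omega>. SUP (t, x)\<in>{0..1 - \<delta>} \<times> UNIV. ennreal \<bar>wj j t x \<omega> - w t x \<omega>\<bar>))"
proof -
  obtain C0 where C0: "\<forall>z\<in>(\<lambda>(s, y, v). f s y v) ` ({0..1} \<times> UNIV \<times> UNIV). norm z \<le> C0"
    using A2(2) unfolding bounded_iff by blast
  have f_bound: "\<bar>f s y v\<bar> \<le> \<bar>C0\<bar>" if "s \<in> {0..1}" for s y v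
  proof -
    have "norm ((\<lambda>(s, y, v). f s y v) (s, y, v)) \<le> C0" using that by (intro C0[rule_format] imageI) auto
    then show ?thesis by simp
  qed
  obtain Lf where Lf: "\<forall>s\<in>{0..1}. \<forall>y1 y2 v1 v2.
      \<bar>f s y1 v1 - f s y2 v2\<bar> \<le> Lf * (\<bar>y1 - y2\<bar> + \<bar>v1 - v2\<bar>)" using A3 by blast
  have f_lipschitz: "\<bar>f s y v - f s y v'\<bar> \<le> max 1 Lf * \<bar>v - v'\<bar>" if "s \<in> {0..1}" for s y v v'
  proof -
    have "\<bar>f s y v - f s y v'\<bar> \<le> Lf * (\<bar>y - y\<bar> + \<bar>v - v'\<bar>)" using Lf that by blast
    also have "\<dots> \<le> max 1 Lf * (\<bar>y - y\<bar> + \<bar>v - v'\<bar>)" by (intro mult_right_mono) auto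
    finally show ?thesis by simp
  qed
  obtain B0 where B0: "\<forall>z\<in>(\<lambda>(s, y). \<sigma> s y) ` ({0..1} \<times> UNIV). norm z \<le> B0"
    using A4(2) unfolding bounded_iff by blast
  have \<sigma>_bound: "\<bar>\<sigma> s y\<bar> \<le> \<bar>B0\<bar>" if "s \<in> {0..1}" for s y
  proof -
    have "norm ((\<lambda>(s, y). \<sigma> s y) (s, y)) \<le> B0" using that by (intro B0[rule_format] imageI) auto
    then show ?thesis by simp
  qed
  obtain L\<sigma> \<beta> where \<beta>: "1 / 2 < \<beta>" "\<beta> \<le> 1" and L\<sigma>: "\<forall>s1\<in>{0..1}. \<forall>s2\<in>{0..1}. \<forall>y1 y2.
      \<bar>\<sigma> s1 y1 - \<sigma> s2 y2\<bar> \<le> L\<sigma> * (\<bar>s1 - s2\<bar> powr \<beta> + \<bar>y1 - y2\<bar> powr \<beta>)" using A5 by blast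
  have \<sigma>_hoelder: "\<bar>\<sigma> s y - \<sigma> s' y'\<bar> \<le> \<bar>L\<sigma>\<bar> * (\<bar>s - s'\<bar> powr \<beta> + \<bar>y - y'\<bar> powr \<beta>)"
    if "s \<in> {0..1}" "s' \<in> {0..1}" for s s' y y'
  proof -
    have "\<bar>\<sigma> s y - \<sigma> s' y'\<bar> \<le> L\<sigma> * (\<bar>s - s'\<bar> powr \<beta> + \<bar>y - y'\<bar> powr \<beta>)" using L\<sigma> that by blast
    also have "\<dots> \<le> \<bar>L\<sigma>\<bar> * (\<bar>s - s'\<bar> powr \<beta> + \<bar>y - y'\<bar> powr \<beta>)" by (intro mult_right_mono) auto
    finally show ?thesis .
  qed
  interpret prob_space M by fact
  interpret S: wave_source a f "\<bar>C0\<bar>" "max 1 Lf"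
  proof
    show "a > 0" "\<bar>C0\<bar> \<ge> 0" "max 1 Lf \<ge> 1" using \<open>a > 0\<close> by simp_all
  qed (fact f_bound f_lipschitz)+
  interpret W: wave_noise M \<mu> "\<beta> + 1 / 2" a \<sigma> "\<bar>B0\<bar>" "\<bar>L\<sigma>\<bar>" \<beta>
  proof
    show "a > 0" by fact
    show "stochastic_measure M unit_borel \<mu>" by fact
    show "1 / 2 < \<beta>" "\<beta> \<le> 1" by (fact \<beta>)+
    show "\<beta> + 1 / 2 > 1" "\<beta> + 1 / 2 < 2 * \<beta>" using \<beta> by simp_all
    show "\<bar>B0\<bar> \<ge> 0" "\<bar>L\<sigma>\<bar> \<ge> 0" by simp_all
    show "sm_integrable M unit_borel \<mu> h" if "square_integrable_unit h" for h
      using L2_integrable that by blast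
    show "tendsto_in_prob M (\<lambda>j. sm_integral M unit_borel \<mu> {0<..1} (h j)) (\<lambda>\<omega>. 0)"
      if "\<And>j. square_integrable_unit (h j)" "(\<lambda>j. LINT x:{0<..1}|lborel. \<bar>h j x\<bar>\<^sup>2) \<longlonglongrightarrow> 0" for h
      by (rule L2_continuous[rule_format, OF that])
  qed (fact \<sigma>_bound \<sigma>_hoelder)+
  have difference: "AE \<omega> in M. uj j t x \<omega> - u t x \<omega> = 1 / (2 * a) *
      (S.cone_int t x (\<lambda>s y. uj j s y \<omega>) - S.cone_int t x (\<lambda>s y. u s y \<omega>) + W.noise_error j t x \<omega>)"
    if t: "t \<in> {0..1}" for j t x
  proof -
    have 1: "AE \<omega> in M. u t x \<omega> = 1 / 2 * (u0 (x + a * t) \<omega> + u0 (x - a * t) \<omega>)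
       + 1 / (2 * a) * (LINT y:{x - a * t..x + a * t}|lborel. v0 y \<omega>)
       + 1 / (2 * a) * S.cone_int t x (\<lambda>s y. u s y \<omega>) + 1 / (2 * a) * noise_term M a \<mu> \<sigma> t x \<omega>"
      using u t unfolding mild_solution_def S.cone_int_def ball_int_def by blast
    have 2: "AE \<omega> in M. uj j t x \<omega> = 1 / 2 * (u0 (x + a * t) \<omega> + u0 (x - a * t) \<omega>)
       + 1 / (2 * a) * (LINT y:{x - a * t..x + a * t}|lborel. v0 y \<omega>)
       + 1 / (2 * a) * S.cone_int t x (\<lambda>s y. uj j s y \<omega>)
       + 1 / (2 * a) * fourier_noise_term M a \<mu> \<sigma> j t x \<omega>"
      using uj[rule_format, of j] t unfolding mild_solution_def S.cone_int_def ball_int_def by blast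
    from 1 2 W.noise_error_eq[OF t, of j x] show ?thesis
      by eventually_elim (simp add: algebra_simps add_divide_distrib diff_divide_distrib)
  qed
  interpret A: wave_approximation f "\<bar>C0\<bar>" "max 1 Lf" M \<mu> "\<beta> + 1 / 2" a \<sigma> "\<bar>B0\<bar>" "\<bar>L\<sigma>\<bar>" \<beta> u uj
  proof
    show "(\<lambda>((t, x), \<omega>). u t x \<omega>) \<in> borel_measurable (strip \<Otimes>\<^sub>M M)"
      using u unfolding mild_solution_def by blast
    show "(\<lambda>((t, x), \<omega>). uj j t x \<omega>) \<in> borel_measurable (strip \<Otimes>\<^sub>M M)" for j
      using uj unfolding mild_solution_def by blast
  qed (fact A2(1) difference)+
  show ?thesis by (rule A.versions_converge)
qed

end
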